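(* Let $\mathcal{M}=(M,\mathcal{A}_M)$ be a $\mathbb{Z}_2^n$-supermanifold and let $\mathcal{V}^{u|\mathbf{v}}=(V,C^\infty_V[[\eta^1,\dots,\eta^v]])$ be a $\mathbb{Z}_2^n$-superdomain, where $V\subset\mathbb{R}^u$ is open with coordinates $y=(y^1,\dots,y^u)$ and $\eta^b$ has degree $\tau_b\in\mathbb{Z}_2^n\setminus\{0\}$ for $b=1,\dots,v$. Let $(s^1,\dots,s^u,\zeta^1,\dots,\zeta^v)$ be a $(u+v)$-tuple of elements of $\mathcal{A}_M(M)$ such that $$s^j\in\mathcal{A}_M^{0}(M),\qquad \zeta^b\in\mathcal{A}_M^{\tau_b}(M)\qquad(1\le j\le u,\ 1\le b\le v)$$ and $$(\varepsilon s^1,\dots,\varepsilon s^u)(M)\subset V .$$ Then there exists a unique morphism of $\mathbb{Z}_2^n$-supermanifolds $\Psi=(\psi,\psi^* ):\mathcal{M}\to\mathcal{V}^{u|\mathbf{v}}$ such that $s^j=\psi_V^*y^j$ for all $j$ and $\zeta^b=\psi_V^*\eta^b$ for all $b$.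
   Context: Fix $n\in\mathbb{N}$. $\mathbb{Z}_2=\{0,1\}$, and $\langle i,j\rangle=\sum_k i_kj_k$ for $i,j\in\mathbb{Z}_2^n$. A $\mathbb{Z}_2^n$-commutative associative unital $\mathbb{R}$-algebra is a $\mathbb{Z}_2^n$-graded associative unital $\mathbb{R}$-algebra $A=\bigoplus_{i\in\mathbb{Z}_2^n}A^i$ with $ab=(-1)^{\langle i,j\rangle}ba$ for $a\in A^i$, $b\in A^j$. Superdomains. Order $\mathbb{Z}_2^n\setminus\{0\}$ lexicographically. Let $p\in\mathbb{N}$, $\mathbf{q}=(q_1,\dots,q_{2^n-1})\in\mathbb{N}^{2^n-1}$, $q=\sum_kq_k$, and let $\xi^1,\dots,\xi^q$ be formal variables with degrees in $\mathbb{Z}_2^n\setminus\{0\}$, exactly $q_k$ of them having as degree the $k$-th element of $\mathbb{Z}_2^n\setminus\{0\}$. For $U\subset\mathbb{R}^p$ open, $C^\infty_U[[\xi^1,\dots,\xi^q]]$ denotes the sheaf $V\mapsto C^\infty(V)[[\xi^1,\dots,\xi^q]]$ of formal power series $\sum_\mu f_\mu(x)\xi^\mu$ with $f_\mu\in C^\infty(V)$, where $\xi^\mu=(\xi^1)^{\mu_1}\cdots(\xi^q)^{\mu_q}$, functions of $x$ have degree $0$ and are central, and $\xi^a\xi^b=(-1)^{\langle\deg\xi^a,\deg\xi^b\rangle}\xi^b\xi^a$ (variables with odd $\langle\deg\xi^a,\deg\xi^a\rangle$ thus occur with exponent at most 1). The pair $(U,C^\infty_U[[\xi^1,\dots,\xi^q]])$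 is a $\mathbb{Z}_2^n$-superdomain of dimension $p|\mathbf{q}$. Supermanifolds. A locally $\mathbb{Z}_2^n$-ringed space is a pair $(M,\mathcal{A}_M)$ of a Hausdorff second-countable topological space $M$ and a sheaf $\mathcal{A}_M$ of $\mathbb{Z}_2^n$-commutative associative unital $\mathbb{R}$-algebras whose stalks $\mathcal{A}_m$ are local, i.e. have a unique maximal homogeneous ideal $\mathfrak{m}_m$. A morphism $(\varphi,\varphi^* ):(M,\mathcal{A}_M)\to(N,\mathcal{B}_N)$ consists of a continuous map $\varphi:M\to N$ and graded unital $\mathbb{R}$-algebra morphisms $\varphi_V^*:\mathcal{B}_N(V)\to\mathcal{A}_M(\varphi^{-1}(V))$, $V\subset N$ open, commuting with restrictions and such that the induced stalk maps $\varphi_m^*:\mathcal{B}_{\varphi(m)}\to\mathcal{A}_m$ satisfy $\varphi_m^*(\mathfrak{m}_{\varphi(m)})\subset\mathfrak{m}_m$. A $\mathbb{Z}_2^n$-supermanifold of dimension $p|\mathbf{q}$ is a locally $\mathbb{Z}_2^n$-ringed space locally isomorphic to a $\mathbb{Z}_2^n$-superdomain of dimension $p|\mathbf{q}$; a morphism of $\mathbb{Z}_2^n$-supermanifolds is a morphism of locally $\mathbb{Z}_2^n$-ringed spaces. $\mathcal{A}_M^i(U)$ denotes the degree $i$ part of $\mathcal{A}_M(U)$. Base projection $\varepsilon$. For $U\subset M$ open, $f\in\mathcal{A}_M(U)$ and $m\in U$, $\varepsilon(f)(m)$ is the unique $k\in\mathbb{R}$ such that $f-k$ is not invertible in any neighborhood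 of $m$. (In a superdomain, $\varepsilon(\sum_\mu f_\mu\xi^\mu)=f_0$.) *)

theory Defs
  imports
    "HOL-Analysis.Analysis"
    "HOL-Algebra.Module"
    "HOL-Algebra.Ideal"
    "HOL-Library.Z2"
begin

section \<open>The grading group\<close>

text \<open>
  Elements of \<open>\<int>\<^sub>2\<^sup>n\<close> are functions \<^typ>\<open>nat \<Rightarrow> bit\<close> supported in \<open>{0..<n}\<close>. Numbers \<open>n\<close>, \<open>p\<close> are
  allowed to be 0. All indices are 0-based.
\<close>

type_synonym degree = "nat \<Rightarrow> bit"

definition Z2n :: "nat \<Rightarrow> degree set" where
  "Z2n n = {i. \<forall>k\<ge>n. i k = 0}"

definition deg_zero :: degree where
  "deg_zero = (\<lambda>_. 0)"

definition deg_plus :: "degree \<Rightarrow> degree \<Rightarrow> degree" where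
  "deg_plus i j = (\<lambda>k. i k + j k)"

text \<open>Only the parity of \<open>\<langle>i,j\<rangle>\<close> matters, so the sum is taken in \<open>\<int>\<^sub>2\<close>.\<close>

definition pairing :: "nat \<Rightarrow> degree \<Rightarrow> degree \<Rightarrow> bit" where
  "pairing n i j = (\<Sum>k<n. i k * j k)"

definition comm_sign :: "nat \<Rightarrow> degree \<Rightarrow> degree \<Rightarrow> real" where
  "comm_sign n i j = (if pairing n i j = 1 then - 1 else 1)"

definition deg_lex :: "degree \<Rightarrow> degree \<Rightarrow> bool" where
  "deg_lex i j \<longleftrightarrow> (\<exists>k. (\<forall>l<k. i l = j l) \<and> i k = 0 \<and> j k = 1)"


section \<open>Graded-commutative algebras\<close>

definition real_ring :: "real ring" where
  "real_ring = \<lparr>carrier = UNIV, mult = (*), one = 1, zero = 0, add = (+)\<rparr>"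

text \<open>The field \<open>grade A i\<close> is only meaningful for \<^prop>\<open>i \<in> Z2n n\<close>.\<close>

record 'a graded_algebra = "(real, 'a) module" +
  grade :: "degree \<Rightarrow> 'a set"

definition real_algebra :: "('a, 'b) graded_algebra_scheme \<Rightarrow> bool" where
  "real_algebra A \<longleftrightarrow>
     ring A \<and> Module.module real_ring A \<and>
     (\<forall>r. \<forall>a\<in>carrier A. \<forall>b\<in>carrier A.
        (r \<odot>\<^bsub>A\<^esub> a) \<otimes>\<^bsub>A\<^esub> b = r \<odot>\<^bsub>A\<^esub> (a \<otimes>\<^bsub>A\<^esub> b) \<and>
        a \<otimes>\<^bsub>A\<^esub> (r \<odot>\<^bsub>A\<^esub> b) = r \<odot>\<^bsub>A\<^esub> (a \<otimes>\<^bsub>A\<^esub> b))"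

definition z2n_graded :: "nat \<Rightarrow> ('a, 'b) graded_algebra_scheme \<Rightarrow> bool" where
  "z2n_graded n A \<longleftrightarrow>
     (\<forall>i\<in>Z2n n. submodule (grade A i) real_ring A) \<and>
     (\<forall>x\<in>carrier A. \<exists>!c. c \<in> (\<Pi>\<^sub>E i\<in>Z2n n. grade A i) \<and> x = finsum A c (Z2n n)) \<and>
     (\<forall>i\<in>Z2n n. \<forall>j\<in>Z2n n. \<forall>a\<in>grade A i. \<forall>b\<in>grade A j.
        a \<otimes>\<^bsub>A\<^esub> b \<in> grade A (deg_plus i j))"

definition z2n_comm_algebra :: "nat \<Rightarrow> ('a, 'b) graded_algebra_scheme \<Rightarrow> bool" where
  "z2n_comm_algebra n A \<longleftrightarrow>
     real_algebra A \<and> z2n_graded n A \<and>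
     (\<forall>i\<in>Z2n n. \<forall>j\<in>Z2n n. \<forall>a\<in>grade A i. \<forall>b\<in>grade A j.
        a \<otimes>\<^bsub>A\<^esub> b = comm_sign n i j \<odot>\<^bsub>A\<^esub> (b \<otimes>\<^bsub>A\<^esub> a))"

definition graded_alg_hom ::
  "nat \<Rightarrow> ('a, 'c) graded_algebra_scheme \<Rightarrow> ('b, 'd) graded_algebra_scheme \<Rightarrow> ('a \<Rightarrow> 'b) set" where
  "graded_alg_hom n A B =
     {h \<in> ring_hom A B.
        (\<forall>r. \<forall>a\<in>carrier A. h (r \<odot>\<^bsub>A\<^esub> a) = r \<odot>\<^bsub>B\<^esub> h a) \<and>
        (\<forall>i\<in>Z2n n. h ` grade A i \<subseteq> grade B i)}"

definition homogeneous_ideal :: "nat \<Rightarrow> ('a, 'b) graded_algebra_scheme \<Rightarrow> 'a set \<Rightarrow> bool" where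
  "homogeneous_ideal n A I \<longleftrightarrow>
     ideal I A \<and>
     (\<forall>x\<in>I. \<exists>c. (\<forall>i\<in>Z2n n. c i \<in> I \<inter> grade A i) \<and> x = finsum A c (Z2n n))"

definition maximal_homogeneous_ideal ::
  "nat \<Rightarrow> ('a, 'b) graded_algebra_scheme \<Rightarrow> 'a set \<Rightarrow> bool" where
  "maximal_homogeneous_ideal n A I \<longleftrightarrow>
     homogeneous_ideal n A I \<and> I \<noteq> carrier A \<and>
     (\<forall>J. homogeneous_ideal n A J \<and> I \<subseteq> J \<longrightarrow> J = I \<or> J = carrier A)"

definition graded_local :: "nat \<Rightarrow> ('a, 'b) graded_algebra_scheme \<Rightarrow> bool" where
  "graded_local n A \<longleftrightarrow> (\<exists>!I. maximal_homogeneous_ideal n A I)"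

definition the_max_ideal :: "nat \<Rightarrow> ('a, 'b) graded_algebra_scheme \<Rightarrow> 'a set" where
  "the_max_ideal n A = (THE I. maximal_homogeneous_ideal n A I)"


section \<open>Locally ringed spaces\<close>

text \<open>
  The algebras \<^term>\<open>sections M U\<close> and the restriction maps \<^term>\<open>rstr M U W\<close> are only meaningful for
  open \<open>U\<close> and \<open>W \<subseteq> U\<close>. All sections live in one type, without loss of generality.
\<close>

record ('m, 'a) ringed_space =
  base :: "'m topology"
  sections :: "'m set \<Rightarrow> 'a graded_algebra"
  rstr :: "'m set \<Rightarrow> 'm set \<Rightarrow> 'a \<Rightarrow> 'a"

definition z2n_presheaf :: "nat \<Rightarrow> ('m, 'a) ringed_space \<Rightarrow> bool" where
  "z2n_presheaf n M \<longleftrightarrow>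
     (\<forall>U. openin (base M) U \<longrightarrow> z2n_comm_algebra n (sections M U)) \<and>
     (\<forall>U W. openin (base M) U \<and> openin (base M) W \<and> W \<subseteq> U \<longrightarrow>
        rstr M U W \<in> graded_alg_hom n (sections M U) (sections M W)) \<and>
     (\<forall>U. openin (base M) U \<longrightarrow> (\<forall>s\<in>carrier (sections M U). rstr M U U s = s)) \<and>
     (\<forall>U W N. openin (base M) U \<and> openin (base M) W \<and> openin (base M) N \<and> N \<subseteq> W \<and> W \<subseteq> U \<longrightarrow>
        (\<forall>s\<in>carrier (sections M U). rstr M W N (rstr M U W s) = rstr M U N s))"

definition z2n_sheaf :: "nat \<Rightarrow> ('m, 'a) ringed_space \<Rightarrow> bool" where
  "z2n_sheaf n M \<longleftrightarrow>
     z2n_presheaf n M \<and>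
     (\<forall>\<U>. (\<forall>U\<in>\<U>. openin (base M) U) \<longrightarrow>
        (\<forall>s\<in>carrier (sections M (\<Union>\<U>)). \<forall>t\<in>carrier (sections M (\<Union>\<U>)).
           (\<forall>U\<in>\<U>. rstr M (\<Union>\<U>) U s = rstr M (\<Union>\<U>) U t) \<longrightarrow> s = t) \<and>
        (\<forall>f. (\<forall>U\<in>\<U>. f U \<in> carrier (sections M U)) \<and>
             (\<forall>U\<in>\<U>. \<forall>W\<in>\<U>. rstr M U (U \<inter> W) (f U) = rstr M W (U \<inter> W) (f W)) \<longrightarrow>
           (\<exists>s\<in>carrier (sections M (\<Union>\<U>)). \<forall>U\<in>\<U>. rstr M (\<Union>\<U>) U s = f U)))"

text \<open>The germ at \<open>m\<close> of a section \<open>s\<close> over \<open>U\<close>, as an equivalence class of pairs.\<close>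

definition germ :: "('m, 'a) ringed_space \<Rightarrow> 'm \<Rightarrow> 'm set \<Rightarrow> 'a \<Rightarrow> ('m set \<times> 'a) set" where
  "germ M m U s =
     {(W, t). openin (base M) W \<and> m \<in> W \<and> t \<in> carrier (sections M W) \<and>
        (\<exists>N. openin (base M) N \<and> m \<in> N \<and> N \<subseteq> U \<inter> W \<and> rstr M U N s = rstr M W N t)}"

text \<open>
  Sums and products of germs are computed on representatives over a common neighbourhood, which is
  what the description operator selects.
\<close>

definition stalk :: "('m, 'a) ringed_space \<Rightarrow> 'm \<Rightarrow> ('m set \<times> 'a) set graded_algebra" where
  "stalk M m =
     \<lparr>carrier = {germ M m U s | U s. openin (base M) U \<and> m \<in> U \<and> s \<in> carrier (sections M U)},
      mult = (\<lambda>x y. THE z. \<exists>U s t. openin (base M) U \<and> m \<in> U \<and>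
                s \<in> carrier (sections M U) \<and> t \<in> carrier (sections M U) \<and>
                x = germ M m U s \<and> y = germ M m U t \<and> z = germ M m U (s \<otimes>\<^bsub>sections M U\<^esub> t)),
      one = germ M m (topspace (base M)) \<one>\<^bsub>sections M (topspace (base M))\<^esub>,
      zero = germ M m (topspace (base M)) \<zero>\<^bsub>sections M (topspace (base M))\<^esub>,
      add = (\<lambda>x y. THE z. \<exists>U s t. openin (base M) U \<and> m \<in> U \<and>
                s \<in> carrier (sections M U) \<and> t \<in> carrier (sections M U) \<and>
                x = germ M m U s \<and> y = germ M m U t \<and> z = germ M m U (s \<oplus>\<^bsub>sections M U\<^esub> t)),
      smult = (\<lambda>r x. THE z. \<exists>U s. openin (base M) U \<and> m \<in> U \<and> s \<in> carrier (sections M U) \<and>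
                x = germ M m U s \<and> z = germ M m U (r \<odot>\<^bsub>sections M U\<^esub> s)),
      grade = (\<lambda>i. {germ M m U s | U s. openin (base M) U \<and> m \<in> U \<and> s \<in> grade (sections M U) i})\<rparr>"

definition locally_z2n_ringed_space :: "nat \<Rightarrow> ('m, 'a) ringed_space \<Rightarrow> bool" where
  "locally_z2n_ringed_space n M \<longleftrightarrow>
     Hausdorff_space (base M) \<and> second_countable (base M) \<and> z2n_sheaf n M \<and>
     (\<forall>m\<in>topspace (base M). graded_local n (stalk M m))"

definition preimage :: "('m, 'a) ringed_space \<Rightarrow> ('m \<Rightarrow> 'k) \<Rightarrow> 'k set \<Rightarrow> 'm set" where
  "preimage M \<phi> V = {m \<in> topspace (base M). \<phi> m \<in> V}"

text \<open>A morphism is a pair of a map of base spaces and a family of pullback maps of sections.\<close>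

type_synonym ('m, 'a, 'k, 'b) space_map = "('m \<Rightarrow> 'k) \<times> ('k set \<Rightarrow> 'b \<Rightarrow> 'a)"

definition stalk_map ::
  "('m, 'a) ringed_space \<Rightarrow> ('k, 'b) ringed_space \<Rightarrow> ('m, 'a, 'k, 'b) space_map \<Rightarrow> 'm \<Rightarrow>
     ('k set \<times> 'b) set \<Rightarrow> ('m set \<times> 'a) set" where
  "stalk_map M N \<Phi> m x =
     (THE y. \<exists>V s. openin (base N) V \<and> fst \<Phi> m \<in> V \<and> s \<in> carrier (sections N V) \<and>
        x = germ N (fst \<Phi> m) V s \<and> y = germ M m (preimage M (fst \<Phi>) V) (snd \<Phi> V s))"

text \<open>
  Maps on a set are represented by extensional functions, so that equality of morphisms is equality
  of the representing pairs.
\<close>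

definition z2n_morphism ::
  "nat \<Rightarrow> ('m, 'a) ringed_space \<Rightarrow> ('k, 'b) ringed_space \<Rightarrow> ('m, 'a, 'k, 'b) space_map \<Rightarrow> bool" where
  "z2n_morphism n M N \<Phi> \<longleftrightarrow>
     fst \<Phi> \<in> extensional (topspace (base M)) \<and>
     snd \<Phi> \<in> extensional {V. openin (base N) V} \<and>
     (\<forall>V. openin (base N) V \<longrightarrow> snd \<Phi> V \<in> extensional (carrier (sections N V))) \<and>
     continuous_map (base M) (base N) (fst \<Phi>) \<and>
     (\<forall>V. openin (base N) V \<longrightarrow>
        snd \<Phi> V \<in> graded_alg_hom n (sections N V) (sections M (preimage M (fst \<Phi>) V))) \<and>
     (\<forall>V W. openin (base N) V \<and> openin (base N) W \<and> W \<subseteq> V \<longrightarrow>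
        (\<forall>s\<in>carrier (sections N V).
           snd \<Phi> W (rstr N V W s) =
           rstr M (preimage M (fst \<Phi>) V) (preimage M (fst \<Phi>) W) (snd \<Phi> V s))) \<and>
     (\<forall>m\<in>topspace (base M).
        stalk_map M N \<Phi> m ` the_max_ideal n (stalk N (fst \<Phi> m)) \<subseteq> the_max_ideal n (stalk M m))"

definition id_map :: "('m, 'a) ringed_space \<Rightarrow> ('m, 'a, 'm, 'a) space_map" where
  "id_map M = (\<lambda>m\<in>topspace (base M). m, \<lambda>V\<in>{V. openin (base M) V}. \<lambda>s\<in>carrier (sections M V). s)"

definition comp_map ::
  "('l, 'c) ringed_space \<Rightarrow> ('m, 'a) ringed_space \<Rightarrow> ('k, 'b) ringed_space \<Rightarrow>
     ('m, 'a, 'k, 'b) space_map \<Rightarrow> ('l, 'c, 'm, 'a) space_map \<Rightarrow> ('l, 'c, 'k, 'b) space_map" where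
  "comp_map L M N \<Psi> \<Phi> =
     (\<lambda>m\<in>topspace (base L). fst \<Psi> (fst \<Phi> m),
      \<lambda>V\<in>{V. openin (base N) V}. \<lambda>s\<in>carrier (sections N V).
         snd \<Phi> (preimage M (fst \<Psi>) V) (snd \<Psi> V s))"

definition z2n_isomorphic :: "nat \<Rightarrow> ('m, 'a) ringed_space \<Rightarrow> ('k, 'b) ringed_space \<Rightarrow> bool" where
  "z2n_isomorphic n M N \<longleftrightarrow>
     (\<exists>\<Phi> \<Psi>. z2n_morphism n M N \<Phi> \<and> z2n_morphism n N M \<Psi> \<and>
        comp_map M N M \<Psi> \<Phi> = id_map M \<and> comp_map N M N \<Phi> \<Psi> = id_map N)"

definition open_subspace :: "('m, 'a) ringed_space \<Rightarrow> 'm set \<Rightarrow> ('m, 'a) ringed_space" where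
  "open_subspace M W = M\<lparr>base := subtopology (base M) W\<rparr>"

text \<open>The base projection, evaluated at a section \<open>f\<close> over \<open>U\<close> and a point \<open>m\<close> of \<open>U\<close>.\<close>

definition base_proj :: "('m, 'a) ringed_space \<Rightarrow> 'm set \<Rightarrow> 'a \<Rightarrow> 'm \<Rightarrow> real" where
  "base_proj M U f m =
     (THE k. \<forall>W. openin (base M) W \<and> m \<in> W \<and> W \<subseteq> U \<longrightarrow>
        rstr M U W (f \<ominus>\<^bsub>sections M U\<^esub> k \<odot>\<^bsub>sections M U\<^esub> \<one>\<^bsub>sections M U\<^esub>) \<notin> Units (sections M W))"


section \<open>Superdomains\<close>

text \<open>
  \<open>\<real>\<^sup>p\<close> is \<^term>\<open>Euclidean_space p\<close>, whose points are sequences vanishing from index \<open>p\<close> on.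
\<close>

definition partial_deriv :: "nat \<Rightarrow> ((nat \<Rightarrow> real) \<Rightarrow> real) \<Rightarrow> (nat \<Rightarrow> real) \<Rightarrow> real" where
  "partial_deriv i f x = deriv (\<lambda>t. f (x(i := t))) (x i)"

primrec iter_partial_deriv :: "nat list \<Rightarrow> ((nat \<Rightarrow> real) \<Rightarrow> real) \<Rightarrow> (nat \<Rightarrow> real) \<Rightarrow> real" where
  "iter_partial_deriv [] f = f"
| "iter_partial_deriv (i # is) f = partial_deriv i (iter_partial_deriv is f)"

text \<open>Functions on an open set \<open>V\<close> are extended by 0, to have unique representatives.\<close>

definition C_infinity :: "nat \<Rightarrow> (nat \<Rightarrow> real) set \<Rightarrow> ((nat \<Rightarrow> real) \<Rightarrow> real) set" where
  "C_infinity p V =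
     {f. (\<forall>x. x \<notin> V \<longrightarrow> f x = 0) \<and>
         (\<forall>is. set is \<subseteq> {..<p} \<longrightarrow>
            continuous_map (subtopology (Euclidean_space p) V) euclideanreal (iter_partial_deriv is f) \<and>
            (\<forall>i<p. \<forall>x\<in>V. (\<lambda>t. iter_partial_deriv is f (x(i := t))) differentiable (at (x i))))}"

text \<open>
  A formal power series \<open>\<Sum>\<^sub>\<mu> f\<^sub>\<mu> \<xi>\<^sup>\<mu>\<close> is the function \<open>\<mu> \<mapsto> f\<^sub>\<mu>\<close>. In what follows \<open>q\<close> is the number of
  formal variables and \<open>\<tau> a\<close> the degree of the variable with index \<open>a < q\<close>.
\<close>

type_synonym power_series = "(nat \<Rightarrow> nat) \<Rightarrow> (nat \<Rightarrow> real) \<Rightarrow> real"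

definition multi_index :: "nat \<Rightarrow> nat \<Rightarrow> (nat \<Rightarrow> degree) \<Rightarrow> (nat \<Rightarrow> nat) set" where
  "multi_index n q \<tau> =
     {\<mu>. (\<forall>a\<ge>q. \<mu> a = 0) \<and> (\<forall>a<q. pairing n (\<tau> a) (\<tau> a) = 1 \<longrightarrow> \<mu> a \<le> 1)}"

definition monomial_degree :: "nat \<Rightarrow> (nat \<Rightarrow> degree) \<Rightarrow> (nat \<Rightarrow> nat) \<Rightarrow> degree" where
  "monomial_degree q \<tau> \<mu> = (\<lambda>k. \<Sum>a<q. of_nat (\<mu> a) * \<tau> a k)"

text \<open>
  Sorting the product \<open>\<xi>\<^sup>\<mu> \<xi>\<^sup>\<nu>\<close> into normal form moves, for all \<open>a < b\<close>, the \<open>\<mu>\<^sub>b\<close> factors \<open>\<xi>\<^sup>b\<close>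
  past the \<open>\<nu>\<^sub>a\<close> factors \<open>\<xi>\<^sup>a\<close>. The result is \<open>\<xi>\<^sup>\<mu>\<^sup>+\<^sup>\<nu>\<close> times the following sign,
  or 0 if \<open>\<mu> + \<nu>\<close> is not an admissible multi-index.
\<close>

definition monomial_sign ::
  "nat \<Rightarrow> nat \<Rightarrow> (nat \<Rightarrow> degree) \<Rightarrow> (nat \<Rightarrow> nat) \<Rightarrow> (nat \<Rightarrow> nat) \<Rightarrow> real" where
  "monomial_sign n q \<tau> \<mu> \<nu> = (\<Prod>b<q. \<Prod>a<b. comm_sign n (\<tau> b) (\<tau> a) ^ (\<mu> b * \<nu> a))"

definition series_mult ::
  "nat \<Rightarrow> nat \<Rightarrow> (nat \<Rightarrow> degree) \<Rightarrow> power_series \<Rightarrow> power_series \<Rightarrow> power_series" where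
  "series_mult n q \<tau> F G = (\<lambda>\<nu> x.
     if \<nu> \<in> multi_index n q \<tau>
     then \<Sum>\<mu> | \<forall>a. \<mu> a \<le> \<nu> a.
            monomial_sign n q \<tau> \<mu> (\<lambda>a. \<nu> a - \<mu> a) * F \<mu> x * G (\<lambda>a. \<nu> a - \<mu> a) x
     else 0)"

text \<open>The series consisting of the single term \<open>f \<xi>\<^sup>\<mu>\<close>, with \<open>f\<close> cut off outside \<open>V\<close>.\<close>

definition series_term ::
  "(nat \<Rightarrow> real) set \<Rightarrow> ((nat \<Rightarrow> real) \<Rightarrow> real) \<Rightarrow> (nat \<Rightarrow> nat) \<Rightarrow> power_series" where
  "series_term V f \<mu> = (\<lambda>\<nu> x. if \<nu> = \<mu> \<and> x \<in> V then f x else 0)"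

definition series_carrier ::
  "nat \<Rightarrow> nat \<Rightarrow> nat \<Rightarrow> (nat \<Rightarrow> degree) \<Rightarrow> (nat \<Rightarrow> real) set \<Rightarrow> power_series set" where
  "series_carrier n p q \<tau> V =
     {F. (\<forall>\<mu>. F \<mu> \<in> C_infinity p V) \<and> (\<forall>\<mu>. \<mu> \<notin> multi_index n q \<tau> \<longrightarrow> F \<mu> = (\<lambda>_. 0))}"

definition series_algebra ::
  "nat \<Rightarrow> nat \<Rightarrow> nat \<Rightarrow> (nat \<Rightarrow> degree) \<Rightarrow> (nat \<Rightarrow> real) set \<Rightarrow> power_series graded_algebra" where
  "series_algebra n p q \<tau> V =
     \<lparr>carrier = series_carrier n p q \<tau> V,
      mult = series_mult n q \<tau>,
      one = series_term V (\<lambda>_. 1) (\<lambda>_. 0),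
      zero = (\<lambda>\<mu> x. 0),
      add = (\<lambda>F G \<mu> x. F \<mu> x + G \<mu> x),
      smult = (\<lambda>r F \<mu> x. r * F \<mu> x),
      grade = (\<lambda>i. {F \<in> series_carrier n p q \<tau> V.
                 \<forall>\<mu>. F \<mu> \<noteq> (\<lambda>_. 0) \<longrightarrow> monomial_degree q \<tau> \<mu> = i})\<rparr>"

definition superdomain ::
  "nat \<Rightarrow> nat \<Rightarrow> nat \<Rightarrow> (nat \<Rightarrow> degree) \<Rightarrow> (nat \<Rightarrow> real) set \<Rightarrow> (nat \<Rightarrow> real, power_series) ringed_space" where
  "superdomain n p q \<tau> U =
     \<lparr>base = subtopology (Euclidean_space p) U,
      sections = series_algebra n p q \<tau>,
      rstr = (\<lambda>V W F \<mu> x. if x \<in> W then F \<mu> x else 0)\<rparr>"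

definition coord_fun :: "(nat \<Rightarrow> real) set \<Rightarrow> nat \<Rightarrow> power_series" where
  "coord_fun V j = series_term V (\<lambda>x. x j) (\<lambda>_. 0)"

definition formal_var :: "(nat \<Rightarrow> real) set \<Rightarrow> nat \<Rightarrow> power_series" where
  "formal_var V b = series_term V (\<lambda>_. 1) (\<lambda>a. if a = b then 1 else 0)"

text \<open>
  The data \<open>(U, \<tau>)\<close> of a superdomain of dimension \<open>p|q\<close>. The entry of the list \<open>q\<close> belonging to a
  degree \<open>d\<close> is found at the position of \<open>d\<close> in the lexicographic enumeration of the nonzero degrees.
\<close>

definition superdomain_data ::
  "nat \<Rightarrow> nat \<Rightarrow> nat list \<Rightarrow> (nat \<Rightarrow> real) set \<Rightarrow> (nat \<Rightarrow> degree) \<Rightarrow> bool" where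
  "superdomain_data n p q U \<tau> \<longleftrightarrow>
     openin (Euclidean_space p) U \<and>
     length q = 2 ^ n - 1 \<and>
     (\<forall>a<sum_list q. \<tau> a \<in> Z2n n - {deg_zero}) \<and>
     (\<forall>d\<in>Z2n n - {deg_zero}.
        card {a. a < sum_list q \<and> \<tau> a = d} = q ! card {e \<in> Z2n n - {deg_zero}. deg_lex e d})"

definition z2n_supermanifold :: "nat \<Rightarrow> nat \<Rightarrow> nat list \<Rightarrow> ('m, 'a) ringed_space \<Rightarrow> bool" where
  "z2n_supermanifold n p q M \<longleftrightarrow>
     locally_z2n_ringed_space n M \<and>
     (\<forall>m\<in>topspace (base M). \<exists>W U \<tau>.
        openin (base M) W \<and> m \<in> W \<and> superdomain_data n p q U \<tau> \<and>
        z2n_isomorphic n (open_subspace M W) (superdomain n p (sum_list q) \<tau> U))"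

end

theory Submission
  imports Defs "HOL-Library.Function_Algebras"
begin

text \<open>
  Over a chart, the morphism is forced and given by a formal Taylor expansion. Write \<open>s\<^sup>j = \<psi>\<^sup>j + h\<^sup>j\<close> with \<open>\<psi>\<^sup>j\<close> the
  body of \<open>s\<^sup>j\<close>; then \<open>y\<^sup>j\<close> must go to \<open>\<psi>\<^sup>j + h\<^sup>j\<close>, and \<open>\<Sum>\<^sub>\<nu> g\<^sub>\<nu> \<eta>\<^sup>\<nu>\<close> goes to \<open>\<Sum>\<^sub>\<nu> (exp D g\<^sub>\<nu>)(\<psi>) \<zeta>\<^sup>\<nu>\<close> for the
  derivation \<open>D = \<Sum>\<^sub>j h\<^sup>j \<partial>\<^sub>j\<close>. Since \<open>h\<^sup>j\<close> and \<open>\<zeta>\<^sup>b\<close> have no body, only finitely many terms contribute to a given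
  coefficient.

  For uniqueness, Hadamard's lemma writes a series near a point as a constant plus terms in the ideal generated by
  \<open>y\<^sup>j - c\<^sup>j\<close> and \<open>\<eta>\<^sup>b\<close>. By iteration, two pullbacks that agree on the coordinates agree modulo every power of the
  maximal ideal at every point, hence coincide. Uniqueness makes the local pullbacks compatible, and the sheaf property
  glues them. That the underlying continuous map is \<open>(\<epsilon> s\<^sup>1, \<dots>, \<epsilon> s\<^sup>u)\<close> follows from locality on stalks.
\<close>

section \<open>Smooth functions\<close>

text \<open>Variables whose degree has even self-pairing are not nilpotent, so series and
  substituted sections need not be polynomial in them; the algebra is only complete for the
  filtration by total degree. Identities about substitution are therefore proved for finite
  truncations, modulo total degree above \<open>N\<close>, for every \<open>N\<close>. They are
  verified over one point at a time, where sections become families of real coefficients; smooth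
  dependence on the point is a separate matter.

  For uniqueness, a morphism of algebras is not assumed continuous, so agreement on polynomials
  cannot be passed to limits. The Hadamard expansion is a finite sum of products, which every
  morphism respects. Its quotients exist only on a smaller neighbourhood, so the induction on the
  power of the ideal runs over all open sets and all series at once. Flat functions lie in every
  power of the ideal at a point; hence only the values of the coefficients at that point are
  concluded, and the point then varies.\<close>

lemma Euclidean_space_eq_top_of_set:
  "Euclidean_space p = top_of_set {x. \<forall>i\<ge>p. x i = 0}"
  by (simp add: Euclidean_space_def euclidean_product_topology)

text \<open>A basic open set of the product topology constrains finitely many coordinates, and
  coordinates from \<open>p\<close> on vanish on the whole space, so a cube in the first
  \<open>p\<close> coordinates fits inside. Cubes are convenient because smoothness is tested along
  coordinate lines.\<close>

lemma openin_Euclidean_space_iff: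
  "openin (Euclidean_space p) V \<longleftrightarrow>
     V \<subseteq> topspace (Euclidean_space p) \<and>
     (\<forall>x\<in>V. \<exists>e>0. \<forall>y\<in>topspace (Euclidean_space p). (\<forall>i<p. \<bar>y i - x i\<bar> < e) \<longrightarrow> y \<in> V)"
proof
  assume V: "openin (Euclidean_space p) V"
  then obtain T where T: "openin (powertop_real UNIV) T" "V = T \<inter> {x. \<forall>i\<ge>p. x i = 0}"
    by (auto simp: Euclidean_space_def openin_subtopology)
  have "\<exists>e>0. \<forall>y\<in>topspace (Euclidean_space p). (\<forall>i<p. \<bar>y i - x i\<bar> < e) \<longrightarrow> y \<in> V" if "x \<in> V" for x
  proof -
    have "x \<in> T" using that T by auto
    from product_topology_open_contains_basis[OF T(1) this]
    obtain X where X: "x \<in> Pi\<^sub>E UNIV X" "\<And>i. open (X i)" "finite {i. X i \<noteq> UNIV}" "Pi\<^sub>E UNIV X \<subseteq> T"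
      by (auto simp: simp del: PiE_UNIV_domain)
    have "\<exists>e>0. ball (x i) e \<subseteq> X i" for i
    proof -
      have "x i \<in> X i" using X(1) by auto
      then show ?thesis using X(2)[of i] unfolding open_contains_ball by blast
    qed
    then obtain e where e: "\<And>i. e i > 0" "\<And>i. ball (x i) (e i) \<subseteq> X i"
      by metis
    \<comment> \<open>The extra 1 keeps the set nonempty when the basic set constrains no
      coordinate.\<close>
    define E where "E = Min (insert 1 (e ` {i. X i \<noteq> UNIV}))"
    have fin: "finite (insert 1 (e ` {i. X i \<noteq> UNIV}))" using X(3) by simp
    have "E > 0" unfolding E_def using fin e(1) by (subst Min_gr_iff) auto
    moreover have "y \<in> V" if y: "y \<in> topspace (Euclidean_space p)" "\<forall>i<p. \<bar>y i - x i\<bar> < E" for y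
    proof -
      have "y i \<in> X i" for i
      proof (cases "X i = UNIV")
        case False
        then have "E \<le> e i" unfolding E_def using fin by (intro Min_le) auto
        moreover have "\<bar>y i - x i\<bar> < E"
        proof (cases "i < p")
          case False
          then have "y i = 0" "x i = 0" using y \<open>x \<in> V\<close> T by (auto simp: topspace_Euclidean_space)
          then show ?thesis using \<open>E > 0\<close> by simp
        qed (use y in auto)
        ultimately have "y i \<in> ball (x i) (e i)" by (simp add: dist_real_def)
        then show ?thesis using e(2) by blast
      qed auto
      then have "y \<in> T" using X(4) by blast
      then show ?thesis using T y by (simp add: topspace_Euclidean_space)
    qed
    ultimately show ?thesis by blast
  qed
  then show "V \<subseteq> topspace (Euclidean_space p) \<and>
     (\<forall>x\<in>V. \<exists>e>0. \<forall>y\<in>topspace (Euclidean_space p). (\<forall>i<p. \<bar>y i - x i\<bar> < e) \<longrightarrow> y \<in> V)"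
    using openin_subset[OF V] by blast
next
  assume V: "V \<subseteq> topspace (Euclidean_space p) \<and>
     (\<forall>x\<in>V. \<exists>e>0. \<forall>y\<in>topspace (Euclidean_space p). (\<forall>i<p. \<bar>y i - x i\<bar> < e) \<longrightarrow> y \<in> V)"
  have "\<exists>T. openin (Euclidean_space p) T \<and> x \<in> T \<and> T \<subseteq> V" if x: "x \<in> V" for x
  proof -
    obtain e where e: "e > 0" "\<forall>y\<in>topspace (Euclidean_space p). (\<forall>i<p. \<bar>y i - x i\<bar> < e) \<longrightarrow> y \<in> V"
      using V x by blast
    have "open (\<Inter>i<p. {y::nat \<Rightarrow> real. \<bar>y i - x i\<bar> < e})"
      by (intro open_INT ballI open_Collect_less continuous_intros
          continuous_on_product_then_coordinatewise[OF continuous_on_id]) auto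
    then have "openin (Euclidean_space p) ({x. \<forall>i\<ge>p. x i = 0} \<inter> (\<Inter>i<p. {y. \<bar>y i - x i\<bar> < e}))"
      unfolding Euclidean_space_eq_top_of_set by (rule openin_open_Int)
    moreover have "x \<in> {x. \<forall>i\<ge>p. x i = 0} \<inter> (\<Inter>i<p. {y. \<bar>y i - x i\<bar> < e})"
      using V x e(1) by (auto simp: topspace_Euclidean_space)
    moreover have "{x. \<forall>i\<ge>p. x i = 0} \<inter> (\<Inter>i<p. {y. \<bar>y i - x i\<bar> < e}) \<subseteq> V"
    proof
      fix y assume "y \<in> {x. \<forall>i\<ge>p. x i = 0} \<inter> (\<Inter>i<p. {y. \<bar>y i - x i\<bar> < e})"
      then have "y \<in> topspace (Euclidean_space p)" "\<forall>i<p. \<bar>y i - x i\<bar> < e"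
        by (simp_all add: topspace_Euclidean_space)
      then show "y \<in> V" using e(2) by simp
    qed
    ultimately show ?thesis by blast
  qed
  then show "openin (Euclidean_space p) V" by (subst openin_subopen) blast
qed

lemma openin_Euclidean_space_box:
  "openin (Euclidean_space p) {y \<in> topspace (Euclidean_space p). \<forall>i<p. \<bar>y i - x i\<bar> < e}"
proof -
  have "\<exists>d>0. \<forall>y\<in>topspace (Euclidean_space p). (\<forall>i<p. \<bar>y i - z i\<bar> < d) \<longrightarrow> (\<forall>i<p. \<bar>y i - x i\<bar> < e)"
    if z: "\<forall>i<p. \<bar>z i - x i\<bar> < e" for z
  proof -
    define d where "d = Min (insert 1 ((\<lambda>i. e - \<bar>z i - x i\<bar>) ` {..<p}))"
    have "d > 0" unfolding d_def using z by (subst Min_gr_iff) auto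
    moreover have "d \<le> e - \<bar>z i - x i\<bar>" if "i < p" for i
      unfolding d_def using that by (intro Min_le) auto
    ultimately have *: "\<bar>y i - x i\<bar> < e" if "i < p" "\<forall>i<p. \<bar>y i - z i\<bar> < d" for y i
      using that(2)[rule_format, OF that(1)] \<open>\<And>i. i < p \<Longrightarrow> d \<le> e - \<bar>z i - x i\<bar>\<close>[OF that(1)] by linarith
    show ?thesis using \<open>d > 0\<close> * by blast
  qed
  then show ?thesis unfolding openin_Euclidean_space_iff by fastforce
qed

lemma continuous_map_Euclidean_subspace_iff:
  assumes "V \<subseteq> topspace (Euclidean_space p)"
  shows "continuous_map (subtopology (Euclidean_space p) V) euclideanreal f \<longleftrightarrow> continuous_on V f"
proof -
  have "subtopology (Euclidean_space p) V = top_of_set V"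
    using assms by (simp add: Euclidean_space_eq_top_of_set subtopology_subtopology
        topspace_Euclidean_space inf.absorb2)
  then show ?thesis by (simp add: continuous_map_iff_continuous)
qed

lemma openin_Euclidean_fun_upd:
  assumes "openin (Euclidean_space p) V" "x \<in> V" "i < p"
  shows "\<exists>e>0. \<forall>t. \<bar>t - x i\<bar> < e \<longrightarrow> x(i := t) \<in> V"
proof -
  obtain e where "e > 0" "\<forall>y\<in>topspace (Euclidean_space p). (\<forall>i<p. \<bar>y i - x i\<bar> < e) \<longrightarrow> y \<in> V"
    using assms by (meson openin_Euclidean_space_iff)
  moreover have "x \<in> topspace (Euclidean_space p)"
    using assms openin_subset by blast
  ultimately show ?thesis using assms(3) by (intro exI[of _ e]) (auto simp: topspace_Euclidean_space)
qed

lemma eventually_fun_upd_in: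
  assumes "openin (Euclidean_space p) V" "x \<in> V" "i < p"
  shows "eventually (\<lambda>t. x(i := t) \<in> V) (nhds (x i))"
  using openin_Euclidean_fun_upd[OF assms] unfolding eventually_nhds_metric
  by (auto simp: dist_real_def)

lemma continuous_on_Euclidean_box:
  assumes V: "openin (Euclidean_space p) V" and f: "continuous_on V f" and "z \<in> V" "(e::real) > 0"
  shows "\<exists>d>0. \<forall>y\<in>topspace (Euclidean_space p). (\<forall>i<p. \<bar>y i - z i\<bar> < d) \<longrightarrow> y \<in> V \<and> \<bar>f y - f z\<bar> < e"
proof -
  have sub: "V \<subseteq> topspace (Euclidean_space p)" using V openin_subset by blast
  have "openin (subtopology (Euclidean_space p) V)
          {y \<in> topspace (subtopology (Euclidean_space p) V). f y \<in> ball (f z) e}"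
    using f by (intro openin_continuous_map_preimage[where Y = euclideanreal])
      (auto simp: continuous_map_Euclidean_subspace_iff[OF sub])
  then have "openin (Euclidean_space p) {y \<in> V. f y \<in> ball (f z) e}"
    using V sub by (simp add: openin_trans_full inf.absorb2)
  then have "\<exists>d>0. \<forall>y\<in>topspace (Euclidean_space p). (\<forall>i<p. \<bar>y i - z i\<bar> < d) \<longrightarrow>
      y \<in> {y \<in> V. f y \<in> ball (f z) e}"
    using assms(3,4) unfolding openin_Euclidean_space_iff by (metis (mono_tags, lifting) centre_in_ball mem_Collect_eq)
  then show ?thesis by (auto simp: dist_real_def abs_minus_commute)
qed

section \<open>Partial derivatives and differentiability to finite order\<close>

abbreviation has_partial :: "nat \<Rightarrow> ((nat \<Rightarrow> real) \<Rightarrow> real) \<Rightarrow> real \<Rightarrow> (nat \<Rightarrow> real) \<Rightarrow> bool" where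
  "has_partial i f D x \<equiv> ((\<lambda>t. f (x(i := t))) has_field_derivative D) (at (x i))"

lemma has_partial_imp_eq: "has_partial i f D x \<Longrightarrow> partial_deriv i f x = D"
  unfolding partial_deriv_def by (rule DERIV_imp_deriv)

lemma differentiable_imp_has_partial:
  "(\<lambda>t. f (x(i := t))) differentiable at (x i) \<Longrightarrow> has_partial i f (partial_deriv i f x) x"
  unfolding partial_deriv_def by (simp add: DERIV_deriv_iff_real_differentiable)

lemma partial_deriv_cong:
  assumes "openin (Euclidean_space p) V" "x \<in> V" "i < p" "\<And>y. y \<in> V \<Longrightarrow> f y = g y"
  shows "partial_deriv i f x = partial_deriv i g x"
  unfolding partial_deriv_def using eventually_fun_upd_in[OF assms(1-3)]
  by (intro deriv_cong_ev) (auto elim!: eventually_mono simp: assms(4))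

lemma has_partial_cong:
  assumes "openin (Euclidean_space p) V" "x \<in> V" "i < p" "\<And>y. y \<in> V \<Longrightarrow> f y = g y"
  shows "has_partial i f D x \<longleftrightarrow> has_partial i g D x"
  using eventually_fun_upd_in[OF assms(1-3)]
  by (intro DERIV_cong_ev) (auto elim!: eventually_mono simp: assms(4))

text \<open>The recursion strips off the derivative that is applied first, whereas
  \<open>iter_partial_deriv\<close> strips off the one applied last. In this form the first
  derivatives of a product, an inverse or a composition, given by formulas of lower order, feed
  directly into an induction on \<open>k\<close>.\<close>

primrec smooth_upto :: "nat \<Rightarrow> (nat \<Rightarrow> real) set \<Rightarrow> nat \<Rightarrow> ((nat \<Rightarrow> real) \<Rightarrow> real) \<Rightarrow> bool" where
  "smooth_upto p V 0 f \<longleftrightarrow> continuous_on V f"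
| "smooth_upto p V (Suc k) f \<longleftrightarrow> continuous_on V f \<and>
     (\<forall>i<p. (\<forall>x\<in>V. (\<lambda>t. f (x(i := t))) differentiable at (x i)) \<and> smooth_upto p V k (partial_deriv i f))"

definition smooth :: "nat \<Rightarrow> (nat \<Rightarrow> real) set \<Rightarrow> ((nat \<Rightarrow> real) \<Rightarrow> real) \<Rightarrow> bool" where
  "smooth p V f \<longleftrightarrow> (\<forall>k. smooth_upto p V k f)"

lemma smooth_upto_continuous: "smooth_upto p V k f \<Longrightarrow> continuous_on V f"
  by (cases k) auto

lemma smooth_upto_Suc_has_partial:
  "smooth_upto p V (Suc k) f \<Longrightarrow> i < p \<Longrightarrow> x \<in> V \<Longrightarrow> has_partial i f (partial_deriv i f x) x"
  by (simp add: differentiable_imp_has_partial)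

lemma smooth_upto_cong:
  assumes "openin (Euclidean_space p) V" "\<And>y. y \<in> V \<Longrightarrow> f y = g y"
  shows "smooth_upto p V k f \<longleftrightarrow> smooth_upto p V k g"
  using assms(2)
proof (induction k arbitrary: f g)
  case 0
  then show ?case by (simp cong: continuous_on_cong)
next
  case (Suc k)
  have "smooth_upto p V k (partial_deriv i f) \<longleftrightarrow> smooth_upto p V k (partial_deriv i g)" if "i < p" for i
    using Suc.IH partial_deriv_cong[OF assms(1) _ that, of _ f g] Suc.prems by blast
  moreover have "(\<lambda>t. f (x(i := t))) differentiable at (x i) \<longleftrightarrow>
      (\<lambda>t. g (x(i := t))) differentiable at (x i)" if "i < p" "x \<in> V" for i x
    unfolding real_differentiable_def
    using has_partial_cong[OF assms(1) that(2,1), of f g] Suc.prems by simp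
  moreover have "continuous_on V f \<longleftrightarrow> continuous_on V g" using Suc.prems by (simp cong: continuous_on_cong)
  ultimately show ?case by auto
qed

lemma smooth_cong:
  assumes "openin (Euclidean_space p) V" "\<And>y. y \<in> V \<Longrightarrow> f y = g y"
  shows "smooth p V f \<longleftrightarrow> smooth p V g"
  unfolding smooth_def using smooth_upto_cong[OF assms] by simp

lemma smooth_upto_subset: "smooth_upto p V k f \<Longrightarrow> W \<subseteq> V \<Longrightarrow> smooth_upto p W k f"
  by (induction k arbitrary: f) (auto intro: continuous_on_subset)

lemma smooth_subset: "smooth p V f \<Longrightarrow> W \<subseteq> V \<Longrightarrow> smooth p W f"
  unfolding smooth_def using smooth_upto_subset by blast

lemma smooth_upto_SucD: "smooth_upto p V (Suc k) f \<Longrightarrow> smooth_upto p V k f"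
  by (induction k arbitrary: f) auto

text \<open>Formulas for derivatives are available on \<open>V\<close> only, so the candidates
  \<open>g\<close> are compared with \<open>partial_deriv\<close> there and the order is transferred
  by \<open>smooth_upto_cong\<close>.\<close>

lemma smooth_upto_SucI:
  assumes V: "openin (Euclidean_space p) V" and "continuous_on V f"
    and g: "\<And>i x. i < p \<Longrightarrow> x \<in> V \<Longrightarrow> has_partial i f (g i x) x"
    and "\<And>i. i < p \<Longrightarrow> smooth_upto p V k (g i)"
  shows "smooth_upto p V (Suc k) f"
proof -
  have "smooth_upto p V k (partial_deriv i f)" if "i < p" for i
  proof -
    have "partial_deriv i f x = g i x" if "x \<in> V" for x
      by (rule has_partial_imp_eq[OF g[OF \<open>i < p\<close> that]])
    then show ?thesis using smooth_upto_cong[OF V, of "partial_deriv i f" "g i" k] assms(4)[OF that] by blast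
  qed
  then show ?thesis using assms by (auto simp: real_differentiable_def)
qed

lemma smooth_imp_smooth_upto: "smooth p V f \<Longrightarrow> smooth_upto p V k f"
  by (simp add: smooth_def)

lemma smooth_partial_deriv: "smooth p V f \<Longrightarrow> i < p \<Longrightarrow> smooth p V (partial_deriv i f)"
  unfolding smooth_def by (meson smooth_upto.simps(2))

lemma smooth_has_partial: "smooth p V f \<Longrightarrow> i < p \<Longrightarrow> x \<in> V \<Longrightarrow> has_partial i f (partial_deriv i f x) x"
  using smooth_upto_Suc_has_partial[OF smooth_imp_smooth_upto] .

lemma smooth_upto_iff_iter:
  "smooth_upto p V k f \<longleftrightarrow> (\<forall>is. set is \<subseteq> {..<p} \<and> length is \<le> k \<longrightarrow>
     continuous_on V (iter_partial_deriv is f) \<and>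
     (length is < k \<longrightarrow> (\<forall>i<p. \<forall>x\<in>V. (\<lambda>t. iter_partial_deriv is f (x(i := t))) differentiable at (x i))))"
proof (induction k arbitrary: f)
  case 0
  then show ?case by auto
next
  case (Suc k)
  have snoc: "iter_partial_deriv (is @ [i]) f = iter_partial_deriv is (partial_deriv i f)" for "is" i f
    by (induction "is") auto
  show ?case (is "?L \<longleftrightarrow> ?R")
  proof
    assume L: ?L
    show ?R
    proof (intro allI impI)
      fix "is" assume A: "set is \<subseteq> {..<p} \<and> length is \<le> Suc k"
      show "continuous_on V (iter_partial_deriv is f) \<and>
        (length is < Suc k \<longrightarrow> (\<forall>i<p. \<forall>x\<in>V. (\<lambda>t. iter_partial_deriv is f (x(i := t))) differentiable at (x i)))"
      proof (cases "is" rule: rev_cases)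
        case Nil
        then show ?thesis using L by auto
      next
        \<comment> \<open>The last list entry is the derivative taken first, the one that
          \<open>smooth_upto\<close> removes.\<close>
        case (snoc js j)
        then have "smooth_upto p V k (partial_deriv j f)" using L A by auto
        then show ?thesis unfolding Suc.IH using A snoc \<open>\<And>is i f. iter_partial_deriv (is @ [i]) f = _\<close> by auto
      qed
    qed
  next
    assume R: ?R
    have "smooth_upto p V k (partial_deriv i f)" if "i < p" for i
      unfolding Suc.IH
    proof (intro allI impI)
      fix "is" assume "set is \<subseteq> {..<p} \<and> length is \<le> k"
      then show "continuous_on V (iter_partial_deriv is (partial_deriv i f)) \<and>
        (length is < k \<longrightarrow> (\<forall>ia<p. \<forall>x\<in>V. (\<lambda>t. iter_partial_deriv is (partial_deriv i f) (x(ia := t))) differentiable at (x ia)))"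
        using R[rule_format, of "is @ [i]"] that by (auto simp: snoc)
    qed
    then show ?L using R[rule_format, of "[]"] by auto
  qed
qed

lemma C_infinity_iff:
  assumes "openin (Euclidean_space p) V"
  shows "f \<in> C_infinity p V \<longleftrightarrow> (\<forall>x. x \<notin> V \<longrightarrow> f x = 0) \<and> smooth p V f"
proof -
  have "V \<subseteq> topspace (Euclidean_space p)" using assms openin_subset by blast
  note c = continuous_map_Euclidean_subspace_iff[OF this]
  have "smooth p V f \<longleftrightarrow> (\<forall>is. set is \<subseteq> {..<p} \<longrightarrow>
     continuous_on V (iter_partial_deriv is f) \<and>
     (\<forall>i<p. \<forall>x\<in>V. (\<lambda>t. iter_partial_deriv is f (x(i := t))) differentiable at (x i)))"
    unfolding smooth_def smooth_upto_iff_iter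
    by (metis dual_order.refl lessI less_imp_le)
  then show ?thesis unfolding C_infinity_def c by auto
qed

section \<open>Closure properties of smooth functions\<close>

lemma smooth_upto_const: "openin (Euclidean_space p) V \<Longrightarrow> smooth_upto p V k (\<lambda>_. c)"
proof (induction k arbitrary: c)
  case (Suc k)
  show ?case by (rule smooth_upto_SucI[where g = "\<lambda>_ _. 0"]) (use Suc in auto)
qed auto

lemma smooth_const: "openin (Euclidean_space p) V \<Longrightarrow> smooth p V (\<lambda>_. c)"
  by (simp add: smooth_def smooth_upto_const)

lemma smooth_coord:
  assumes "openin (Euclidean_space p) V"
  shows "smooth p V (\<lambda>x. x j)"
  unfolding smooth_def
proof
  fix k
  have c: "continuous_on V (\<lambda>x. x j)" by (rule continuous_on_product_then_coordinatewise[OF continuous_on_id])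
  show "smooth_upto p V k (\<lambda>x. x j)"
  proof (cases k)
    case (Suc l)
    show ?thesis unfolding Suc
    proof (rule smooth_upto_SucI[OF assms c, where g = "\<lambda>i _. if i = j then 1 else 0"])
      show "has_partial i (\<lambda>x. x j) (if i = j then 1 else 0) x" for i x by auto
    qed (auto intro: smooth_upto_const assms)
  qed (use c in auto)
qed

lemma smooth_upto_add:
  "openin (Euclidean_space p) V \<Longrightarrow> smooth_upto p V k f \<Longrightarrow> smooth_upto p V k g \<Longrightarrow>
     smooth_upto p V k (\<lambda>x. f x + g x)"
proof (induction k arbitrary: f g)
  case (Suc k)
  show ?case
  proof (rule smooth_upto_SucI[where g = "\<lambda>i x. partial_deriv i f x + partial_deriv i g x"])
    show "has_partial i (\<lambda>x. f x + g x) (partial_deriv i f x + partial_deriv i g x) x" if "i < p" "x \<in> V" for i x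
      by (intro derivative_intros smooth_upto_Suc_has_partial[OF Suc.prems(2) that]
          smooth_upto_Suc_has_partial[OF Suc.prems(3) that])
  qed (use Suc in \<open>auto intro: continuous_intros\<close>)
qed (auto intro: continuous_intros)

lemma smooth_add:
  "openin (Euclidean_space p) V \<Longrightarrow> smooth p V f \<Longrightarrow> smooth p V g \<Longrightarrow> smooth p V (\<lambda>x. f x + g x)"
  by (simp add: smooth_def smooth_upto_add)

lemma smooth_upto_mult:
  "openin (Euclidean_space p) V \<Longrightarrow> smooth_upto p V k f \<Longrightarrow> smooth_upto p V k g \<Longrightarrow>
     smooth_upto p V k (\<lambda>x. f x * g x)"
proof (induction k arbitrary: f g)
  case (Suc k)
  show ?case
  proof (rule smooth_upto_SucI[where g = "\<lambda>i x. partial_deriv i f x * g x + f x * partial_deriv i g x"])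
    show "has_partial i (\<lambda>x. f x * g x) (partial_deriv i f x * g x + f x * partial_deriv i g x) x"
      if "i < p" "x \<in> V" for i x
      by (rule DERIV_cong[OF DERIV_mult[OF smooth_upto_Suc_has_partial[OF Suc.prems(2) that]
          smooth_upto_Suc_has_partial[OF Suc.prems(3) that]]]) simp
    show "smooth_upto p V k (\<lambda>x. partial_deriv i f x * g x + f x * partial_deriv i g x)" if "i < p" for i
      using Suc.prems that by (intro smooth_upto_add Suc.IH) (auto dest: smooth_upto_SucD simp del: smooth_upto.simps, auto)
  qed (use Suc.prems in \<open>auto intro: continuous_intros\<close>)
qed (auto intro: continuous_intros)

lemma smooth_mult:
  "openin (Euclidean_space p) V \<Longrightarrow> smooth p V f \<Longrightarrow> smooth p V g \<Longrightarrow> smooth p V (\<lambda>x. f x * g x)"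
  by (simp add: smooth_def smooth_upto_mult)

lemma smooth_upto_sum:
  "openin (Euclidean_space p) V \<Longrightarrow> (\<And>a. a \<in> A \<Longrightarrow> smooth_upto p V k (f a)) \<Longrightarrow>
     smooth_upto p V k (\<lambda>x. \<Sum>a\<in>A. f a x)"
  by (induction A rule: infinite_finite_induct) (auto intro: smooth_upto_const smooth_upto_add)

lemma smooth_sum:
  "openin (Euclidean_space p) V \<Longrightarrow> (\<And>a. a \<in> A \<Longrightarrow> smooth p V (f a)) \<Longrightarrow> smooth p V (\<lambda>x. \<Sum>a\<in>A. f a x)"
  by (simp add: smooth_def smooth_upto_sum)

text \<open>The derivative of 1/f is - f' (1/f)^2, which contains 1/f only to the order already
  reached; so the order climbs by one at each step.\<close>

lemma smooth_inverse:
  assumes V: "openin (Euclidean_space p) V" and f: "smooth p V f" "\<And>x. x \<in> V \<Longrightarrow> f x \<noteq> 0"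
  shows "smooth p V (\<lambda>x. inverse (f x))"
proof -
  have cont: "continuous_on V (\<lambda>x. inverse (f x))"
    using f smooth_upto_continuous[OF smooth_imp_smooth_upto[OF f(1)]] by (intro continuous_intros) auto
  have "smooth_upto p V k (\<lambda>x. inverse (f x))" for k
  proof (induction k)
    case (Suc k)
    show ?case
    proof (rule smooth_upto_SucI[OF V cont, where g = "\<lambda>i x. (-1) * (partial_deriv i f x * (inverse (f x) * inverse (f x)))"])
      show "has_partial i (\<lambda>x. inverse (f x)) ((-1) * (partial_deriv i f x * (inverse (f x) * inverse (f x)))) x"
        if "i < p" "x \<in> V" for i x
        using DERIV_inverse_fun[OF smooth_has_partial[OF f(1) that]] f(2)[OF that(2)]
        by (simp add: algebra_simps)
      show "smooth_upto p V k (\<lambda>x. (-1) * (partial_deriv i f x * (inverse (f x) * inverse (f x))))" if "i < p" for i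
        by (intro smooth_upto_mult smooth_upto_const V Suc smooth_imp_smooth_upto smooth_partial_deriv f that)
    qed
  qed (use cont in simp)
  then show ?thesis by (simp add: smooth_def)
qed

text \<open>
  The increment of \<open>g\<close> is telescoped along the path that changes one coordinate at a time;
  the mean value theorem controls each step.
\<close>

lemma has_derivative_along_curve:
  assumes V: "openin (Euclidean_space u) V"
    and g: "\<And>j y. j < u \<Longrightarrow> y \<in> V \<Longrightarrow> has_partial j g (g' j y) y"
    and cont: "\<And>j. j < u \<Longrightarrow> continuous_on V (g' j)"
    and in_V: "\<gamma> t0 \<in> V" "eventually (\<lambda>t. \<gamma> t \<in> V) (at t0)"
    and \<gamma>: "\<And>j. j < u \<Longrightarrow> ((\<lambda>t. \<gamma> t j) has_field_derivative d j) (at t0)"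
  shows "((\<lambda>t. g (\<gamma> t)) has_field_derivative (\<Sum>j<u. g' j (\<gamma> t0) * d j)) (at t0)"
proof -
  define z where "z = \<gamma> t0"
  \<comment> \<open>\<open>w y j\<close> is the vertex reached after \<open>j\<close> steps of the
    path from \<open>z\<close> to \<open>y\<close>, and \<open>c y j\<close> is the slope of the
    next step. At a zero increment the limit value is inserted, so that \<open>incr\<close> holds in
    all cases and \<open>c\<close> still tends to \<open>g' j z\<close>.\<close>
  define w where "w = (\<lambda>y j i. if i < j then y i else z i :: real)"
  define c where "c = (\<lambda>y j. if y j = z j then g' j z else (g (w y (Suc j)) - g (w y j)) / (y j - z j))"
  have sub: "V \<subseteq> topspace (Euclidean_space u)" using V openin_subset by blast
  have zV: "z \<in> V" using in_V z_def by simp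
  have w_Suc: "w y (Suc j) = (w y j)(j := y j)" for y j
    by (auto simp: w_def fun_eq_iff less_Suc_eq)
  have incr: "g y - g z = (\<Sum>j<u. c y j * (y j - z j))" if "y \<in> V" for y
  proof -
    have "y \<in> topspace (Euclidean_space u)" "z \<in> topspace (Euclidean_space u)" using that zV sub by auto
    then have "w y u = y" "w y 0 = z"
      by (auto simp: w_def fun_eq_iff topspace_Euclidean_space)
    then have "g y - g z = (\<Sum>j<u. g (w y (Suc j)) - g (w y j))"
      using sum_lessThan_telescope[of "\<lambda>j. g (w y j)" u] by simp
    also have "\<dots> = (\<Sum>j<u. c y j * (y j - z j))"
    proof (rule sum.cong)
      fix j assume "j \<in> {..<u}"
      have "w y (Suc j) = w y j" if "y j = z j"
        using that by (auto simp: w_def fun_eq_iff less_Suc_eq)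
      then show "g (w y (Suc j)) - g (w y j) = c y j * (y j - z j)" by (auto simp: c_def)
    qed auto
    finally show ?thesis .
  qed
  have c_lim: "((\<lambda>t. c (\<gamma> t) j) \<longlongrightarrow> g' j z) (at t0)" if j: "j < u" for j
  proof (rule tendstoI)
    fix e :: real assume e: "e > 0"
    obtain r where r: "r > 0"
      "\<And>y. y \<in> topspace (Euclidean_space u) \<Longrightarrow> \<forall>i<u. \<bar>y i - z i\<bar> < r \<Longrightarrow> y \<in> V \<and> \<bar>g' j y - g' j z\<bar> < e"
      using continuous_on_Euclidean_box[OF V cont[OF j] zV e] by blast
    have near: "dist (c y j) (g' j z) < e" if y: "y \<in> V" "\<forall>i<u. \<bar>y i - z i\<bar> < r" for y
    proof (cases "y j = z j")
      case True
      then show ?thesis using e by (simp add: c_def)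
    next
      case False
      define h where "h = (\<lambda>t. g ((w y j)(j := t)))"
      have box: "(w y j)(j := t) \<in> V \<and> \<bar>g' j ((w y j)(j := t)) - g' j z\<bar> < e" if t: "\<bar>t - z j\<bar> < r" for t
      proof (rule r(2))
        show "(w y j)(j := t) \<in> topspace (Euclidean_space u)"
          using y(1) zV sub j by (auto simp: w_def topspace_Euclidean_space subset_iff)
        show "\<forall>i<u. \<bar>((w y j)(j := t)) i - z i\<bar> < r"
          using y(2) t r(1) by (auto simp: w_def)
      qed
      have h': "(h has_field_derivative g' j ((w y j)(j := t))) (at t)" if "\<bar>t - z j\<bar> < r" for t
        using g[OF j, of "(w y j)(j := t)"] box[OF that] by (simp add: h_def)
      have cyj: "c y j = (h (y j) - h (z j)) / (y j - z j)"
      proof -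
        have "(w y j)(j := z j) = w y j" by (auto simp: w_def)
        then show ?thesis using False by (simp add: c_def h_def w_Suc)
      qed
      have "\<exists>t. \<bar>t - z j\<bar> < r \<and> c y j = g' j ((w y j)(j := t))"
      proof (cases "z j < y j")
        case True
        obtain t where t: "t > z j" "t < y j" "h (y j) - h (z j) = (y j - z j) * g' j ((w y j)(j := t))"
          using MVT2[OF True, of h "\<lambda>t. g' j ((w y j)(j := t))"] h' y(2) j by force
        then show ?thesis using True y(2) j by (intro exI[of _ t]) (auto simp: cyj)
      next
        case F: False
        then have lt: "y j < z j" using False by simp
        obtain t where t: "t > y j" "t < z j" "h (z j) - h (y j) = (z j - y j) * g' j ((w y j)(j := t))"
          using MVT2[OF lt, of h "\<lambda>t. g' j ((w y j)(j := t))"] h' y(2) j by force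
        then have "c y j = g' j ((w y j)(j := t))" using lt by (simp add: cyj field_simps)
        then show ?thesis using t y(2) j by (intro exI[of _ t]) auto
      qed
      then show ?thesis using box by (auto simp: dist_real_def)
    qed
    have "eventually (\<lambda>t. \<bar>\<gamma> t i - z i\<bar> < r) (at t0)" if "i < u" for i
    proof -
      have "((\<lambda>t. \<gamma> t i) \<longlongrightarrow> z i) (at t0)"
        using DERIV_isCont[OF \<gamma>[OF that]] by (simp add: isCont_def z_def)
      from tendstoD[OF this r(1)] show ?thesis by (simp add: dist_real_def)
    qed
    then have "eventually (\<lambda>t. \<forall>i\<in>{..<u}. \<bar>\<gamma> t i - z i\<bar> < r) (at t0)"
      by (intro eventually_ball_finite) auto
    then show "eventually (\<lambda>t. dist (c (\<gamma> t) j) (g' j z) < e) (at t0)"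
      using in_V(2) by eventually_elim (use near in auto)
  qed
  have "((\<lambda>t. \<Sum>j<u. c (\<gamma> t) j * ((\<gamma> t j - \<gamma> t0 j) / (t - t0))) \<longlongrightarrow> (\<Sum>j<u. g' j z * d j)) (at t0)"
    using \<gamma> by (intro tendsto_sum tendsto_mult c_lim) (auto simp: has_field_derivative_iff)
  moreover have "eventually (\<lambda>t. (\<Sum>j<u. c (\<gamma> t) j * ((\<gamma> t j - \<gamma> t0 j) / (t - t0))) =
      (g (\<gamma> t) - g (\<gamma> t0)) / (t - t0)) (at t0)"
    using in_V(2)
    by eventually_elim (simp add: incr[unfolded z_def] sum_divide_distrib)
  ultimately show ?thesis
    unfolding has_field_derivative_iff z_def using tendsto_cong by fast
qed

text \<open>By the chain rule a first derivative is a sum of products of some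
  \<open>partial_deriv j g\<close> composed with \<open>\<psi>\<close> and a derivative of a
  coordinate of \<open>\<psi>\<close>. The induction hypothesis applies to the first kind of factor
  because \<open>g\<close> is kept arbitrary.\<close>

lemma smooth_upto_compose:
  assumes V: "openin (Euclidean_space u) V" and U: "openin (Euclidean_space p) U"
    and \<psi>: "\<And>x. x \<in> U \<Longrightarrow> \<psi> x \<in> V"
  shows "(\<And>j. j < u \<Longrightarrow> smooth_upto p U k (\<lambda>x. \<psi> x j)) \<Longrightarrow> smooth_upto u V k g \<Longrightarrow>
           smooth_upto p U k (\<lambda>x. g (\<psi> x))"
proof (induction k arbitrary: g)
  case 0
  have "continuous_on U (\<lambda>x. \<psi> x j)" for j
  proof (cases "j < u")
    case True
    then show ?thesis using 0 by simp
  next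
    case False
    then have "\<psi> x j = 0" if "x \<in> U" for x
      using \<psi>[OF that] openin_subset[OF V] by (auto simp: topspace_Euclidean_space)
    then show ?thesis by (subst continuous_on_cong[OF refl, of _ _ "\<lambda>_. 0"]) auto
  qed
  then have "continuous_on U \<psi>" by (intro continuous_on_coordinatewise_then_product)
  then show ?case using 0 \<psi> continuous_on_compose2[of V g U \<psi>] by auto
next
  case (Suc k)
  note \<psi>k = smooth_upto_SucD[OF Suc.prems(1)] and gk = smooth_upto_SucD[OF Suc.prems(2)]
  note pg = smooth_upto_Suc_has_partial[OF Suc.prems(2)]
  have pgk: "smooth_upto u V k (partial_deriv j g)" if "j < u" for j
    using Suc.prems(2) that by simp
  show ?case
  proof (rule smooth_upto_SucI[where g = "\<lambda>i x. \<Sum>j<u. partial_deriv j g (\<psi> x) * partial_deriv i (\<lambda>x. \<psi> x j) x", OF U])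
    show "continuous_on U (\<lambda>x. g (\<psi> x))"
      using smooth_upto_continuous[OF Suc.IH[OF \<psi>k gk]] by blast
    show "has_partial i (\<lambda>x. g (\<psi> x)) (\<Sum>j<u. partial_deriv j g (\<psi> x) * partial_deriv i (\<lambda>x. \<psi> x j) x) x"
      if "i < p" "x \<in> U" for i x
    proof -
      have "((\<lambda>t. g ((\<lambda>t. \<psi> (x(i := t))) t)) has_field_derivative
         (\<Sum>j<u. partial_deriv j g (\<psi> (x(i := x i))) * partial_deriv i (\<lambda>x. \<psi> x j) x)) (at (x i))"
      proof (rule has_derivative_along_curve[OF V])
        show "eventually (\<lambda>t. \<psi> (x(i := t)) \<in> V) (at (x i))"
          using eventually_fun_upd_in[OF U that(2,1)] \<psi>
          by (auto simp: eventually_at_filter elim!: eventually_mono)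
        show "((\<lambda>t. \<psi> (x(i := t)) j) has_field_derivative partial_deriv i (\<lambda>x. \<psi> x j) x) (at (x i))" if "j < u" for j
          by (rule smooth_upto_Suc_has_partial[OF Suc.prems(1)[OF that] \<open>i < p\<close> \<open>x \<in> U\<close>])
      qed (use pg smooth_upto_continuous[OF pgk] \<psi> that in auto)
      then show ?thesis by simp
    qed
    show "smooth_upto p U k (\<lambda>x. \<Sum>j<u. partial_deriv j g (\<psi> x) * partial_deriv i (\<lambda>x. \<psi> x j) x)" if "i < p" for i
    proof (intro smooth_upto_sum smooth_upto_mult U)
      fix j assume "j \<in> {..<u}"
      then have j: "j < u" by simp
      show "smooth_upto p U k (\<lambda>x. partial_deriv j g (\<psi> x))" by (rule Suc.IH[OF \<psi>k pgk[OF j]])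
      show "smooth_upto p U k (partial_deriv i (\<lambda>x. \<psi> x j))" using Suc.prems(1)[OF j] that by simp
    qed
  qed
qed

lemma smooth_compose:
  assumes "openin (Euclidean_space u) V" "openin (Euclidean_space p) U" "\<And>x. x \<in> U \<Longrightarrow> \<psi> x \<in> V"
    and "\<And>j. j < u \<Longrightarrow> smooth p U (\<lambda>x. \<psi> x j)" "smooth u V g"
  shows "smooth p U (\<lambda>x. g (\<psi> x))"
  using smooth_upto_compose[OF assms(1,2), of \<psi>] assms(3-5) by (simp add: smooth_def)

lemma partial_deriv_coord: "partial_deriv i (\<lambda>x. x j) = (\<lambda>_. if i = j then 1 else 0)"
proof
  fix x :: "nat \<Rightarrow> real"
  have "has_partial i (\<lambda>x. x j) (if i = j then 1 else 0) x" by auto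
  then show "partial_deriv i (\<lambda>x. x j) x = (if i = j then 1 else 0)" by (rule has_partial_imp_eq)
qed

lemma partial_deriv_const: "partial_deriv i (\<lambda>_. c) = (\<lambda>_. 0)"
  by (simp add: partial_deriv_def fun_eq_iff)

section \<open>Hadamard's lemma by integration along coordinate segments\<close>

text \<open>With \<open>m = 0\<close> and \<open>f\<close> a derivative in direction
  \<open>j\<close> this is the Hadamard quotient. The weight \<open>t ^ m\<close> is present because
  differentiating in direction \<open>j\<close> produces a factor \<open>t\<close>, so only the
  whole family is closed under partial derivatives.\<close>

definition segment_moment :: "nat \<Rightarrow> real \<Rightarrow> nat \<Rightarrow> ((nat \<Rightarrow> real) \<Rightarrow> real) \<Rightarrow> (nat \<Rightarrow> real) \<Rightarrow> real" where
  "segment_moment m c j f y = integral (cbox 0 1) (\<lambda>t. t ^ m * f (y(j := c + t * (y j - c))))"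

lemma continuous_on_segment:
  assumes f: "continuous_on B f" and seg: "\<And>y t. y \<in> B \<Longrightarrow> t \<in> {0..1} \<Longrightarrow> y(j := c + t * (y j - c)) \<in> B"
  shows "continuous_on (B \<times> cbox 0 (1::real)) (\<lambda>(y, t). t ^ m * f (y(j := c + t * (y j - c))))"
proof -
  have "continuous_on (B \<times> cbox 0 (1::real)) (\<lambda>z. (fst z)(j := c + snd z * (fst z j - c)))"
  proof (intro continuous_on_coordinatewise_then_product)
    fix i
    have "continuous_on (B \<times> cbox 0 (1::real)) (\<lambda>z. fst z i)" for i
      by (rule continuous_on_product_then_coordinatewise[OF continuous_on_fst[OF continuous_on_id]])
    then show "continuous_on (B \<times> cbox 0 (1::real)) (\<lambda>z. ((fst z)(j := c + snd z * (fst z j - c))) i)"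
      by (cases "i = j") (auto intro!: continuous_intros)
  qed
  then have "continuous_on (B \<times> cbox 0 (1::real)) (\<lambda>z. f ((fst z)(j := c + snd z * (fst z j - c))))"
    using seg by (intro continuous_on_compose2[OF f]) auto
  then show ?thesis unfolding split_beta by (intro continuous_intros)
qed

text \<open>Differentiation under the integral sign. In direction \<open>j\<close> the point on the
  segment moves with speed \<open>t\<close>, which raises the weight by one; in any other direction
  it moves with speed 1.\<close>

lemma has_partial_segment_moment:
  assumes B: "openin (Euclidean_space u) B"
    and seg: "\<And>y t. y \<in> B \<Longrightarrow> t \<in> {0..1} \<Longrightarrow> y(j := c + t * (y j - c)) \<in> B"
    and f: "smooth_upto u B (Suc 0) f" and "i < u" "x \<in> B"
  shows "has_partial i (segment_moment m c j f)
           (segment_moment (if i = j then Suc m else m) c j (partial_deriv i f) x) x"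
proof -
  obtain e where e: "e > 0" "\<And>t. \<bar>t - x i\<bar> < e \<Longrightarrow> x(i := t) \<in> B"
    using openin_Euclidean_fun_upd[OF B \<open>x \<in> B\<close> \<open>i < u\<close>] by blast
  define m' where "m' = (if i = j then Suc m else m)"
  define \<sigma> where "\<sigma> = (\<lambda>s (t::real). (x(i := s))(j := c + t * ((x(i := s)) j - c)))"
  have in_B: "\<sigma> s t \<in> B" if "s \<in> ball (x i) e" "t \<in> cbox 0 1" for s t
    unfolding \<sigma>_def using that seg[OF e(2), of s t] by (auto simp: dist_real_def abs_minus_commute)
  have cont_f: "continuous_on B f" and cont_df: "continuous_on B (partial_deriv i f)"
    using f \<open>i < u\<close> by auto
  have df: "has_partial i f (partial_deriv i f z) z" if "z \<in> B" for z
    using f \<open>i < u\<close> that by (simp add: differentiable_imp_has_partial)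
  have upd: "continuous_on (ball (x i) e \<times> cbox 0 1) (\<lambda>z::real \<times> real. (x(i := fst z), snd z))"
  proof (intro continuous_on_Pair continuous_on_coordinatewise_then_product)
    fix k show "continuous_on (ball (x i) e \<times> cbox 0 1) (\<lambda>z::real \<times> real. (x(i := fst z)) k)"
      by (cases "k = i") (auto intro!: continuous_intros)
  qed (intro continuous_intros)
  have "((\<lambda>s. integral (cbox 0 1) (\<lambda>t. t ^ m * f (\<sigma> s t))) has_field_derivative
      integral (cbox 0 1) (\<lambda>t. t ^ m' * partial_deriv i f (\<sigma> (x i) t))) (at (x i) within ball (x i) e)"
  proof (rule leibniz_rule_field_derivative)
    fix s t :: real assume st: "s \<in> ball (x i) e" "t \<in> cbox 0 1"
    have "((\<lambda>s. f (\<sigma> s t)) has_field_derivative (if i = j then t else 1) * partial_deriv i f (\<sigma> s t)) (at s)"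
    proof (cases "i = j")
      case True
      have "((\<lambda>r. f ((\<sigma> s t)(i := r))) has_field_derivative partial_deriv i f (\<sigma> s t)) (at (c + t * (s - c)))"
        using df[OF in_B[OF st]] True by (simp add: \<sigma>_def)
      moreover have "((\<lambda>s. c + t * (s - c)) has_field_derivative t) (at s)"
        by (auto intro!: derivative_eq_intros)
      ultimately have "((\<lambda>r. f ((\<sigma> s t)(i := c + t * (r - c)))) has_field_derivative partial_deriv i f (\<sigma> s t) * t) (at s)"
        by (rule DERIV_chain2)
      moreover have "(\<sigma> s t)(i := c + t * (r - c)) = \<sigma> r t" for r
        using True by (auto simp: \<sigma>_def fun_eq_iff)
      ultimately show ?thesis using True by (simp add: mult.commute)
    next
      case False
      have "((\<lambda>r. f ((\<sigma> s t)(i := r))) has_field_derivative partial_deriv i f (\<sigma> s t)) (at s)"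
        using df[OF in_B[OF st]] False by (simp add: \<sigma>_def)
      moreover have "(\<sigma> s t)(i := r) = \<sigma> r t" for r
        using False by (auto simp: \<sigma>_def fun_eq_iff)
      ultimately show ?thesis using False by simp
    qed
    then have "((\<lambda>s. t ^ m * f (\<sigma> s t)) has_field_derivative t ^ m * ((if i = j then t else 1) * partial_deriv i f (\<sigma> s t))) (at s)"
      by (rule DERIV_cmult)
    then have "((\<lambda>s. t ^ m * f (\<sigma> s t)) has_field_derivative t ^ m' * partial_deriv i f (\<sigma> s t)) (at s)"
      by (rule DERIV_cong) (simp add: m'_def)
    then show "((\<lambda>s. t ^ m * f (\<sigma> s t)) has_field_derivative t ^ m' * partial_deriv i f (\<sigma> s t)) (at s within ball (x i) e)"
      by (rule has_field_derivative_at_within)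
  next
    fix s assume s: "s \<in> ball (x i) e"
    have "x(i := s) \<in> B" using e(2)[of s] s by (auto simp: dist_real_def abs_minus_commute)
    then have "continuous_on (cbox 0 1) (\<lambda>t. (\<lambda>(y, t). t ^ m * f (y(j := c + t * (y j - c)))) (x(i := s), t))"
      by (intro continuous_on_compose2[OF continuous_on_segment[OF cont_f seg]] continuous_intros) auto
    then show "(\<lambda>t. t ^ m * f (\<sigma> s t)) integrable_on cbox 0 1"
      unfolding \<sigma>_def split_conv by (rule integrable_continuous)
  next
    have "continuous_on (ball (x i) e \<times> cbox 0 1)
        (\<lambda>z. (\<lambda>(y, t). t ^ m' * partial_deriv i f (y(j := c + t * (y j - c)))) ((\<lambda>z. (x(i := fst z), snd z)) z))"
      using e(2) by (intro continuous_on_compose2[OF continuous_on_segment[OF cont_df seg] upd])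
        (auto simp: dist_real_def abs_minus_commute)
    then show "continuous_on (ball (x i) e \<times> cbox 0 1) (\<lambda>(s, t). t ^ m' * partial_deriv i f (\<sigma> s t))"
      unfolding \<sigma>_def split_beta by simp
  qed (use e(1) in auto)
  then have "((\<lambda>s. integral (cbox 0 1) (\<lambda>t. t ^ m * f (\<sigma> s t))) has_field_derivative
      integral (cbox 0 1) (\<lambda>t. t ^ m' * partial_deriv i f (\<sigma> (x i) t))) (at (x i))"
    using e(1) by (simp add: at_within_open[OF _ open_ball])
  then show ?thesis by (simp only: segment_moment_def \<sigma>_def m'_def fun_upd_triv)
qed

lemma smooth_upto_segment_moment:
  assumes B: "openin (Euclidean_space u) B"
    and seg: "\<And>y t. y \<in> B \<Longrightarrow> t \<in> {0..1} \<Longrightarrow> y(j := c + t * (y j - c)) \<in> B"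
  shows "smooth_upto u B k f \<Longrightarrow> smooth_upto u B k (segment_moment m c j f)"
proof -
  have cont: "continuous_on B (segment_moment m c j f)" if "continuous_on B f" for f m
    unfolding segment_moment_def[abs_def]
    by (rule integral_continuous_on_param, rule continuous_on_segment[OF that seg])
  show "smooth_upto u B k f \<Longrightarrow> smooth_upto u B k (segment_moment m c j f)"
  proof (induction k arbitrary: f m)
    case 0
    then show ?case using cont by simp
  next
    case (Suc k)
    have f1: "smooth_upto u B (Suc 0) f" using Suc.prems by (auto dest: smooth_upto_continuous)
    show ?case
    proof (rule smooth_upto_SucI[OF B])
      show "continuous_on B (segment_moment m c j f)" using Suc.prems cont by simp
      show "has_partial i (segment_moment m c j f)
          (segment_moment (if i = j then Suc m else m) c j (partial_deriv i f) x) x" if "i < u" "x \<in> B" for i x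
        using has_partial_segment_moment[OF B seg f1 that] .
      show "smooth_upto u B k (segment_moment (if i = j then Suc m else m) c j (partial_deriv i f))" if "i < u" for i
        using Suc.IH Suc.prems that by simp
    qed
qed
qed

text \<open>The fundamental theorem of calculus along the segment parallel to axis \<open>j\<close>,
  with the constant speed \<open>y j - c\<close> taken out of the integral.\<close>

lemma segment_increment:
  assumes B: "openin (Euclidean_space u) B"
    and seg: "\<And>y t. y \<in> B \<Longrightarrow> t \<in> {0..1} \<Longrightarrow> y(j := c + t * (y j - c)) \<in> B"
    and f: "smooth_upto u B (Suc 0) f" and "j < u" "y \<in> B"
  shows "f y - f (y(j := c)) = (y j - c) * segment_moment 0 c j (partial_deriv j f) y"
proof -
  define \<phi> where "\<phi> = (\<lambda>t. f (y(j := c + t * (y j - c))))"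
  have d: "(\<phi> has_field_derivative partial_deriv j f (y(j := c + t * (y j - c))) * (y j - c)) (at t)"
    if t: "t \<in> {0..1}" for t
  proof -
    let ?z = "y(j := c + t * (y j - c))"
    have "((\<lambda>r. f (?z(j := r))) has_field_derivative partial_deriv j f ?z) (at (c + t * (y j - c)))"
      using smooth_upto_Suc_has_partial[OF f \<open>j < u\<close> seg[OF \<open>y \<in> B\<close> t]] by simp
    moreover have "((\<lambda>t. c + t * (y j - c)) has_field_derivative (y j - c)) (at t)"
      by (auto intro!: derivative_eq_intros)
    ultimately have "((\<lambda>t. f (?z(j := c + t * (y j - c)))) has_field_derivative partial_deriv j f ?z * (y j - c)) (at t)"
      by (rule DERIV_chain2)
    then show ?thesis by (simp add: \<phi>_def)
  qed
  have "((\<lambda>t. partial_deriv j f (y(j := c + t * (y j - c))) * (y j - c)) has_integral \<phi> 1 - \<phi> 0) {0..1}"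
    using d by (intro fundamental_theorem_of_calculus)
      (auto simp flip: has_real_derivative_iff_has_vector_derivative intro: has_field_derivative_at_within)
  then have "\<phi> 1 - \<phi> 0 = integral {0..1} (\<lambda>t. partial_deriv j f (y(j := c + t * (y j - c))) * (y j - c))"
    by (rule integral_unique[symmetric])
  then show ?thesis by (simp add: \<phi>_def segment_moment_def)
qed

text \<open>The path from \<open>c\<close> to \<open>y\<close> changes one coordinate at a time, and
  each step is divided by its increment through \<open>segment_increment\<close>. Thus only
  integrals over axis-parallel segments occur.\<close>

lemma Hadamard:
  assumes V: "openin (Euclidean_space u) V" and g: "smooth u V g" and "c \<in> V"
  shows "\<exists>B h. openin (Euclidean_space u) B \<and> c \<in> B \<and> B \<subseteq> V \<and> (\<forall>j<u. smooth u B (h j)) \<and>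
           (\<forall>y\<in>B. g y = g c + (\<Sum>j<u. (y j - c j) * h j y))"
proof -
  obtain e where e: "e > 0"
    "\<And>y. y \<in> topspace (Euclidean_space u) \<Longrightarrow> \<forall>i<u. \<bar>y i - c i\<bar> < e \<Longrightarrow> y \<in> V"
    using V \<open>c \<in> V\<close> by (meson openin_Euclidean_space_iff)
  \<comment> \<open>A cube around \<open>c\<close> contains, with each point, the segment that moves
    one coordinate to its value in \<open>c\<close>, and also all the mixed points
    \<open>w j y\<close>.\<close>
  define B where "B = {y \<in> topspace (Euclidean_space u). \<forall>i<u. \<bar>y i - c i\<bar> < e}"
  have c0: "c \<in> topspace (Euclidean_space u)" using \<open>c \<in> V\<close> openin_subset[OF V] by blast
  have B: "openin (Euclidean_space u) B" "c \<in> B" "B \<subseteq> V"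
    using e c0 by (auto simp: B_def openin_Euclidean_space_box)
  have gB: "smooth u B g" using smooth_subset[OF g B(3)] .
  have seg: "y(j := c j + t * (y j - c j)) \<in> B" if "y \<in> B" "t \<in> {0..1}" for y j t
  proof -
    have "\<bar>t * (y j - c j)\<bar> \<le> \<bar>y j - c j\<bar>"
      using that(2) by (simp add: abs_mult mult_left_le_one_le)
    then show ?thesis using that c0 by (auto simp: B_def topspace_Euclidean_space)
  qed
  define w where "w = (\<lambda>(j::nat) y i. if i < j then y i else c i :: real)"
  have wB: "w j y \<in> B" if "y \<in> B" for j y
    using that c0 e(1) by (auto simp: B_def w_def topspace_Euclidean_space)
  have w_smooth: "smooth u B (\<lambda>y. w j y i)" for i j
    by (cases "i < j") (simp_all add: w_def smooth_coord smooth_const B)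
  \<comment> \<open>The segment of step \<open>j\<close> ends at \<open>w (Suc j) y\<close>, so the
    quotient is composed with this smooth map.\<close>
  define h where "h = (\<lambda>j y. segment_moment 0 (c j) j (partial_deriv j g) (w (Suc j) y))"
  have "smooth u B (h j)" if "j < u" for j
  proof -
    have "smooth u B (segment_moment 0 (c j) j (partial_deriv j g))"
      using smooth_partial_deriv[OF gB that] unfolding smooth_def
      by (blast intro: smooth_upto_segment_moment[OF B(1) seg])
    from smooth_compose[OF B(1) B(1) _ _ this, where \<psi> = "w (Suc j)"] show ?thesis unfolding h_def
      using wB w_smooth by blast
  qed
  moreover have "g y = g c + (\<Sum>j<u. (y j - c j) * h j y)" if y: "y \<in> B" for y
  proof -
    have "w u y = y" "w 0 y = c"
      using y c0 by (auto simp: B_def w_def fun_eq_iff topspace_Euclidean_space)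
    then have "g y - g c = (\<Sum>j<u. g (w (Suc j) y) - g (w j y))"
      using sum_lessThan_telescope[of "\<lambda>j. g (w j y)" u] by simp
    also have "\<dots> = (\<Sum>j<u. (y j - c j) * h j y)"
    proof (rule sum.cong)
      fix j assume "j \<in> {..<u}"
      have "w j y = (w (Suc j) y)(j := c j)" "w (Suc j) y j = y j"
        by (auto simp: w_def fun_eq_iff less_Suc_eq)
      then show "g (w (Suc j) y) - g (w j y) = (y j - c j) * h j y"
        using segment_increment[OF B(1) seg smooth_imp_smooth_upto[OF gB] _ wB[OF y, of "Suc j"], of j] \<open>j \<in> _\<close>
        by (simp add: h_def)
    qed auto
    finally show ?thesis by simp
  qed
  ultimately show ?thesis using B by blast
qed

section \<open>The coefficient algebra of a superdomain\<close>

subsection \<open>Signs\<close>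

declare add_bit_eq_xor [simp del] mult_bit_eq_and [simp del]

text \<open>The nontrivial character of the two-element group: signs multiply as exponents add, so
  sign identities become identities between sums of bits.\<close>

definition bit_sign :: "bit \<Rightarrow> real" where
  "bit_sign b = (if b = 1 then - 1 else 1)"

lemma bit_sign_add: "bit_sign (a + b) = bit_sign a * bit_sign b"
  by (cases a; cases b) (auto simp: bit_sign_def)

lemma bit_sign_0 [simp]: "bit_sign 0 = 1"
  by (simp add: bit_sign_def)

lemma bit_sign_sum: "bit_sign (\<Sum>a\<in>A. f a) = (\<Prod>a\<in>A. bit_sign (f a))"
  by (induction A rule: infinite_finite_induct) (auto simp: bit_sign_add)

lemma bit_sign_power: "bit_sign b ^ k = bit_sign (of_nat k * b)"
  by (induction k) (auto simp: bit_sign_add distrib_right)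

lemma bit_sign_square [simp]: "bit_sign b * bit_sign b = 1"
  by (simp add: bit_sign_def)

lemma comm_sign_eq: "comm_sign n i j = bit_sign (pairing n i j)"
  by (simp add: comm_sign_def bit_sign_def)

lemma pairing_commute: "pairing n i j = pairing n j i"
  by (simp add: pairing_def mult.commute)

lemma pairing_sum_left: "pairing n (\<lambda>k. \<Sum>a\<in>A. c a * f a k) j = (\<Sum>a\<in>A. c a * pairing n (f a) j)"
proof -
  have "pairing n (\<lambda>k. \<Sum>a\<in>A. c a * f a k) j = (\<Sum>k<n. \<Sum>a\<in>A. c a * (f a k * j k))"
    by (simp add: pairing_def sum_distrib_right mult.assoc)
  also have "\<dots> = (\<Sum>a\<in>A. c a * pairing n (f a) j)"
    by (subst sum.swap) (simp add: pairing_def sum_distrib_left)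
  finally show ?thesis .
qed

lemma pairing_sum_right: "pairing n i (\<lambda>k. \<Sum>a\<in>A. c a * f a k) = (\<Sum>a\<in>A. c a * pairing n i (f a))"
  using pairing_sum_left[of n c f A i] by (simp add: pairing_commute)

lemma pairing_scale_left: "pairing n (\<lambda>k. c * i k) j = c * pairing n i j"
  by (simp add: pairing_def sum_distrib_left mult.assoc)

lemma comm_sign_deg_zero [simp]: "comm_sign n deg_zero j = 1" "comm_sign n i deg_zero = 1"
  by (simp_all add: comm_sign_def pairing_def deg_zero_def)

lemma monomial_sign_eq:
  "monomial_sign n q \<tau> \<mu> \<nu> =
     bit_sign (\<Sum>b<q. \<Sum>a<b. of_nat (\<mu> b) * of_nat (\<nu> a) * pairing n (\<tau> b) (\<tau> a))"
  by (simp add: monomial_sign_def comm_sign_eq bit_sign_power bit_sign_sum)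

lemma monomial_sign_add_left:
  "monomial_sign n q \<tau> (\<mu> + \<kappa>) \<nu> = monomial_sign n q \<tau> \<mu> \<nu> * monomial_sign n q \<tau> \<kappa> \<nu>"
  by (simp add: monomial_sign_def add_mult_distrib power_add prod.distrib)

lemma monomial_sign_add_right:
  "monomial_sign n q \<tau> \<mu> (\<nu> + \<kappa>) = monomial_sign n q \<tau> \<mu> \<nu> * monomial_sign n q \<tau> \<mu> \<kappa>"
  by (simp add: monomial_sign_def add_mult_distrib2 power_add prod.distrib)

lemma monomial_sign_zero [simp]:
  "monomial_sign n q \<tau> 0 \<nu> = 1" "monomial_sign n q \<tau> \<mu> 0 = 1"
  by (simp_all add: monomial_sign_def)

lemma monomial_degree_add:
  "monomial_degree q \<tau> (\<mu> + \<nu>) = deg_plus (monomial_degree q \<tau> \<mu>) (monomial_degree q \<tau> \<nu>)"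
  by (auto simp: monomial_degree_def deg_plus_def fun_eq_iff distrib_right sum.distrib)

lemma monomial_degree_zero [simp]: "monomial_degree q \<tau> 0 = deg_zero"
  by (simp add: monomial_degree_def deg_zero_def)

lemma sum_square_split:
  fixes P :: "nat \<Rightarrow> nat \<Rightarrow> 'a::comm_monoid_add"
  shows "(\<Sum>b<q. \<Sum>a<q. P b a) = (\<Sum>b<q. \<Sum>a<b. P b a) + (\<Sum>b<q. P b b) + (\<Sum>b<q. \<Sum>a<b. P a b)"
proof (induction q)
  case (Suc q)
  have "(\<Sum>b<Suc q. \<Sum>a<Suc q. P b a) = (\<Sum>b<q. \<Sum>a<q. P b a) + (\<Sum>b<q. P b q) + ((\<Sum>a<q. P q a) + P q q)"
    by (simp add: sum.distrib ac_simps)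
  then show ?case unfolding Suc.IH by (simp add: ac_simps)
qed simp

text \<open>The pairing of the two monomial degrees is a sum over all pairs of variables. Pairs
  below the diagonal give the sign of sorting \<mu> before \<kappa>, pairs above it the sign for the
  opposite order. The diagonal vanishes, since admissibility of the sum forbids a variable of odd
  self-pairing to occur in both factors.\<close>

lemma monomial_sign_commute:
  assumes "\<mu> + \<kappa> \<in> multi_index n q \<tau>"
  shows "monomial_sign n q \<tau> \<mu> \<kappa> =
    comm_sign n (monomial_degree q \<tau> \<mu>) (monomial_degree q \<tau> \<kappa>) * monomial_sign n q \<tau> \<kappa> \<mu>"
proof -
  define P where "P = (\<lambda>b a. of_nat (\<mu> b) * of_nat (\<kappa> a) * pairing n (\<tau> b) (\<tau> a) :: bit)"
  have "P b b = 0" if "b < q" for b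
  proof (cases "pairing n (\<tau> b) (\<tau> b) = 1")
    case True
    then have "\<mu> b + \<kappa> b \<le> 1" using assms that by (auto simp: multi_index_def)
    then have "\<mu> b = 0 \<or> \<kappa> b = 0" by linarith
    then show ?thesis by (auto simp: P_def)
  next
    case False
    then have "pairing n (\<tau> b) (\<tau> b) = 0" by (cases "pairing n (\<tau> b) (\<tau> b)") auto
    then show ?thesis by (simp add: P_def)
  qed
  then have diag: "(\<Sum>b<q. P b b) = 0" by simp
  have "comm_sign n (monomial_degree q \<tau> \<mu>) (monomial_degree q \<tau> \<kappa>) = bit_sign (\<Sum>b<q. \<Sum>a<q. P b a)"
    by (simp add: comm_sign_eq monomial_degree_def pairing_sum_left pairing_sum_right P_def
        sum_distrib_left mult.assoc)
  also have "\<dots> = bit_sign (\<Sum>b<q. \<Sum>a<b. P b a) * bit_sign (\<Sum>b<q. \<Sum>a<b. P a b)"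
    unfolding sum_square_split diag by (simp add: bit_sign_add)
  also have "bit_sign (\<Sum>b<q. \<Sum>a<b. P b a) = monomial_sign n q \<tau> \<mu> \<kappa>"
    by (simp add: monomial_sign_eq P_def)
  also have "bit_sign (\<Sum>b<q. \<Sum>a<b. P a b) = monomial_sign n q \<tau> \<kappa> \<mu>"
    by (simp add: monomial_sign_eq P_def pairing_commute mult.commute)
  finally show ?thesis by (simp add: monomial_sign_eq mult.assoc)
qed

subsection \<open>The product of coefficient families\<close>

type_synonym coeffs = "(nat \<Rightarrow> nat) \<Rightarrow> real"

text \<open>The product of two series over one fixed point. \<open>series_mult\<close> combines only
  coefficient values at the same point, so the algebra laws can be checked on families of reals,
  apart from any smoothness.\<close>

definition cmul :: "nat \<Rightarrow> nat \<Rightarrow> (nat \<Rightarrow> degree) \<Rightarrow> coeffs \<Rightarrow> coeffs \<Rightarrow> coeffs" where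
  "cmul n q \<tau> a b = (\<lambda>\<nu>. if \<nu> \<in> multi_index n q \<tau>
     then \<Sum>\<mu> | \<mu> \<le> \<nu>. monomial_sign n q \<tau> \<mu> (\<nu> - \<mu>) * a \<mu> * b (\<nu> - \<mu>) else 0)"

definition cscale :: "real \<Rightarrow> coeffs \<Rightarrow> coeffs" where
  "cscale r a = (\<lambda>\<mu>. r * a \<mu>)"

definition cconst :: "real \<Rightarrow> coeffs" where
  "cconst r = (\<lambda>\<mu>. if \<mu> = 0 then r else 0)"

definition admissible :: "nat \<Rightarrow> nat \<Rightarrow> (nat \<Rightarrow> degree) \<Rightarrow> coeffs \<Rightarrow> bool" where
  "admissible n q \<tau> a \<longleftrightarrow> (\<forall>\<mu>. \<mu> \<notin> multi_index n q \<tau> \<longrightarrow> a \<mu> = 0)"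

definition cgrade :: "nat \<Rightarrow> (nat \<Rightarrow> degree) \<Rightarrow> degree \<Rightarrow> coeffs set" where
  "cgrade q \<tau> i = {a. \<forall>\<mu>. a \<mu> \<noteq> 0 \<longrightarrow> monomial_degree q \<tau> \<mu> = i}"

definition total_degree :: "nat \<Rightarrow> (nat \<Rightarrow> nat) \<Rightarrow> nat" where
  "total_degree q \<mu> = (\<Sum>a<q. \<mu> a)"

text \<open>The filtration by order. Sums that are infinite because of non-nilpotent variables are
  controlled by it: two families are equal as soon as they agree modulo every member of the
  filtration.\<close>

definition corder :: "nat \<Rightarrow> nat \<Rightarrow> coeffs set" where
  "corder q k = {a. \<forall>\<mu>. total_degree q \<mu> < k \<longrightarrow> a \<mu> = 0}"

lemma finite_multi_index_le:
  assumes "\<nu> \<in> multi_index n q \<tau>"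
  shows "finite {\<mu>. \<mu> \<le> \<nu>}"
proof (rule finite_subset)
  show "{\<mu>. \<mu> \<le> \<nu>} \<subseteq> {\<mu>. \<forall>a. (a \<in> {..<q} \<longrightarrow> \<mu> a \<in> {..sum \<nu> {..<q}}) \<and> (a \<notin> {..<q} \<longrightarrow> \<mu> a = 0)}"
  proof (clarify, intro conjI impI)
    fix \<mu> a assume le: "\<mu> \<le> \<nu>"
    { assume "a \<in> {..<q}"
      then have "\<nu> a \<le> sum \<nu> {..<q}" by (intro member_le_sum) auto
      then show "\<mu> a \<in> {..sum \<nu> {..<q}}" using le le_trans by (fastforce simp: le_fun_def) }
    assume "a \<notin> {..<q}"
    then have "\<nu> a = 0" using assms by (simp add: multi_index_def)
    then show "\<mu> a = 0" using le le_zero_eq by (metis le_funD)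
  qed
qed (rule finite_set_of_finite_funs; simp)

lemma multi_index_le:
  assumes "\<nu> \<in> multi_index n q \<tau>" "\<mu> \<le> \<nu>"
  shows "\<mu> \<in> multi_index n q \<tau>"
proof -
  have "\<mu> a \<le> \<nu> a" for a using assms(2) by (simp add: le_fun_def)
  then show ?thesis using assms(1) unfolding multi_index_def
    by simp (metis le_zero_eq order_trans)
qed

lemma diff_le_multi: "(\<nu>::nat \<Rightarrow> nat) - \<mu> \<le> \<nu>"
  by (simp add: le_fun_def)

lemma multi_add_diff: "(\<mu>::nat \<Rightarrow> nat) \<le> \<nu> \<Longrightarrow> \<mu> + (\<nu> - \<mu>) = \<nu>"
  by (auto simp: le_fun_def fun_eq_iff)

lemma zero_multi_index [simp]: "0 \<in> multi_index n q \<tau>"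
  by (simp add: multi_index_def)

lemma total_degree_add: "total_degree q (\<mu> + \<nu>) = total_degree q \<mu> + total_degree q \<nu>"
  by (simp add: total_degree_def sum.distrib)

lemma total_degree_zero_iff: "\<mu> \<in> multi_index n q \<tau> \<Longrightarrow> total_degree q \<mu> = 0 \<longleftrightarrow> \<mu> = 0"
  by (auto simp: total_degree_def multi_index_def fun_eq_iff) (metis lessThan_iff not_le)

lemma series_mult_eq: "series_mult n q \<tau> F G \<nu> x = cmul n q \<tau> (\<lambda>\<mu>. F \<mu> x) (\<lambda>\<mu>. G \<mu> x) \<nu>"
  by (simp add: series_mult_def cmul_def le_fun_def fun_diff_def)

lemma cmul_at_zero: "cmul n q \<tau> a b 0 = a 0 * b 0"
proof -
  have "{\<mu>::nat \<Rightarrow> nat. \<mu> \<le> 0} = {0}" by (auto simp: le_fun_def fun_eq_iff)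
  moreover have "(0::nat \<Rightarrow> nat) - 0 = 0" by (simp add: fun_eq_iff)
  ultimately show ?thesis by (simp add: cmul_def)
qed

text \<open>Both sides are sums over the splittings \<nu> = \<mu> + \<kappa> + \<rho>. As
  \<open>monomial_sign\<close> is multiplicative in each argument, either bracketing yields the
  product of the signs of the pairs (\<mu>, \<kappa>), (\<mu>, \<rho>) and (\<kappa>,
  \<rho>).\<close>

lemma cmul_assoc: "cmul n q \<tau> (cmul n q \<tau> a b) c = cmul n q \<tau> a (cmul n q \<tau> b c)"
proof
  fix \<nu>
  let ?s = "monomial_sign n q \<tau>"
  show "cmul n q \<tau> (cmul n q \<tau> a b) c \<nu> = cmul n q \<tau> a (cmul n q \<tau> b c) \<nu>"
  proof (cases "\<nu> \<in> multi_index n q \<tau>")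
    case True
    note fin = finite_multi_index_le[OF multi_index_le[OF True]]
    have "cmul n q \<tau> (cmul n q \<tau> a b) c \<nu> =
        (\<Sum>\<pi> | \<pi> \<le> \<nu>. \<Sum>\<mu> | \<mu> \<le> \<pi>. ?s \<pi> (\<nu> - \<pi>) * ?s \<mu> (\<pi> - \<mu>) * a \<mu> * b (\<pi> - \<mu>) * c (\<nu> - \<pi>))"
      using True multi_index_le[OF True]
      by (simp add: cmul_def sum_distrib_left sum_distrib_right mult_ac)
    also have "\<dots> = (\<Sum>(\<pi>, \<mu>) \<in> (SIGMA \<pi>:{\<pi>. \<pi> \<le> \<nu>}. {\<mu>. \<mu> \<le> \<pi>}).
        ?s \<pi> (\<nu> - \<pi>) * ?s \<mu> (\<pi> - \<mu>) * a \<mu> * b (\<pi> - \<mu>) * c (\<nu> - \<pi>))"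
      using fin by (subst sum.Sigma) auto
    also have "\<dots> = (\<Sum>(\<mu>, \<kappa>) \<in> (SIGMA \<mu>:{\<mu>. \<mu> \<le> \<nu>}. {\<kappa>. \<kappa> \<le> \<nu> - \<mu>}).
        ?s \<mu> (\<nu> - \<mu>) * ?s \<kappa> (\<nu> - \<mu> - \<kappa>) * a \<mu> * b \<kappa> * c (\<nu> - \<mu> - \<kappa>))"
    proof (rule sum.reindex_bij_witness[where i = "\<lambda>(\<mu>, \<kappa>). (\<mu> + \<kappa>, \<mu>)" and j = "\<lambda>(\<pi>, \<mu>). (\<mu>, \<pi> - \<mu>)"], goal_cases)
      case (5 x)
      obtain \<pi> \<mu> where x: "x = (\<pi>, \<mu>)" by (cases x)
      define \<kappa> where "\<kappa> = \<pi> - \<mu>"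
      define \<rho> where "\<rho> = \<nu> - \<pi>"
      have \<pi>: "\<pi> = \<mu> + \<kappa>" and \<nu>: "\<nu> = \<mu> + \<kappa> + \<rho>"
        using 5 x by (auto simp: \<kappa>_def \<rho>_def le_fun_def fun_eq_iff)
      have d: "\<nu> - \<pi> = \<rho>" "\<pi> - \<mu> = \<kappa>" "\<nu> - \<mu> = \<kappa> + \<rho>" "\<nu> - \<mu> - \<kappa> = \<rho>"
        by (auto simp: \<pi> \<nu> fun_eq_iff)
      show ?case unfolding x split_conv d
        by (simp add: \<pi> monomial_sign_add_left monomial_sign_add_right mult_ac)
    next
      case (2 x)
      then show ?case by (auto simp: le_fun_def) (meson order_trans diff_le_mono)+
    next
      case (3 y)
      then show ?case by (auto simp: fun_eq_iff)
    next
      case (4 y)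
      then show ?case
        by (auto simp: le_fun_def) (metis add.commute le_diff_conv2)
    qed (auto simp: le_fun_def fun_eq_iff)
    also have "\<dots> = (\<Sum>\<mu> | \<mu> \<le> \<nu>. \<Sum>\<kappa> | \<kappa> \<le> \<nu> - \<mu>.
        ?s \<mu> (\<nu> - \<mu>) * ?s \<kappa> (\<nu> - \<mu> - \<kappa>) * a \<mu> * b \<kappa> * c (\<nu> - \<mu> - \<kappa>))"
      using fin diff_le_multi by (subst sum.Sigma) auto
    also have "\<dots> = cmul n q \<tau> a (cmul n q \<tau> b c) \<nu>"
      using True multi_index_le[OF True diff_le_multi]
      by (simp add: cmul_def sum_distrib_left mult_ac)
    finally show ?thesis .
  qed (simp add: cmul_def)
qed

lemma cmul_add_left: "cmul n q \<tau> (a + b) c = cmul n q \<tau> a c + cmul n q \<tau> b c"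
  by (auto simp: cmul_def fun_eq_iff algebra_simps sum.distrib)

lemma cmul_add_right: "cmul n q \<tau> a (b + c) = cmul n q \<tau> a b + cmul n q \<tau> a c"
  by (auto simp: cmul_def fun_eq_iff algebra_simps sum.distrib)

lemma cmul_zero [simp]: "cmul n q \<tau> 0 c = 0" "cmul n q \<tau> c 0 = 0"
  by (auto simp: cmul_def fun_eq_iff)

lemma cmul_diff_left: "cmul n q \<tau> (a - b) c = cmul n q \<tau> a c - cmul n q \<tau> b c"
  using cmul_add_left[of n q \<tau> "a - b" b c] by (simp add: algebra_simps)

lemma cmul_diff_right: "cmul n q \<tau> a (b - c) = cmul n q \<tau> a b - cmul n q \<tau> a c"
  using cmul_add_right[of n q \<tau> a "b - c" c] by (simp add: algebra_simps)

lemma cmul_sum_left: "cmul n q \<tau> (\<Sum>i\<in>I. a i) c = (\<Sum>i\<in>I. cmul n q \<tau> (a i) c)"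
  using sum_comp_morphism[of "\<lambda>a. cmul n q \<tau> a c" a I] by (simp add: cmul_add_left comp_def)

lemma cmul_sum_right: "cmul n q \<tau> c (\<Sum>i\<in>I. a i) = (\<Sum>i\<in>I. cmul n q \<tau> c (a i))"
  using sum_comp_morphism[of "cmul n q \<tau> c" a I] by (simp add: cmul_add_right comp_def)

lemma cmul_scale_left: "cmul n q \<tau> (cscale r a) c = cscale r (cmul n q \<tau> a c)"
  by (auto simp: cmul_def cscale_def fun_eq_iff sum_distrib_left mult_ac)

lemma cmul_scale_right: "cmul n q \<tau> a (cscale r c) = cscale r (cmul n q \<tau> a c)"
  by (auto simp: cmul_def cscale_def fun_eq_iff sum_distrib_left mult_ac)

lemma cscale_simps [simp]:
  "cscale 1 a = a" "cscale 0 a = 0" "cscale r 0 = 0" "cscale r (cscale s a) = cscale (r * s) a"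
  by (auto simp: cscale_def fun_eq_iff)

lemma cscale_add: "cscale r (a + b) = cscale r a + cscale r b"
  by (auto simp: cscale_def fun_eq_iff algebra_simps)

lemma cscale_diff: "cscale r (a - b) = cscale r a - cscale r b"
  by (auto simp: cscale_def fun_eq_iff algebra_simps)

lemma cscale_add_left: "cscale (r + s) a = cscale r a + cscale s a"
  by (auto simp: cscale_def fun_eq_iff algebra_simps)

lemma cscale_sum: "cscale r (\<Sum>i\<in>I. a i) = (\<Sum>i\<in>I. cscale r (a i))"
  using sum_comp_morphism[of "cscale r" a I] by (simp add: cscale_add comp_def)

lemma sum_coeffs_apply: "(\<Sum>i\<in>I. a i) \<mu> = (\<Sum>i\<in>I. a i \<mu>)" for a :: "'i \<Rightarrow> 'b \<Rightarrow> 'c::comm_monoid_add"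
  by (induction I rule: infinite_finite_induct) auto

lemma cmul_const_left:
  assumes "admissible n q \<tau> a"
  shows "cmul n q \<tau> (cconst r) a = cscale r a"
proof
  fix \<nu>
  show "cmul n q \<tau> (cconst r) a \<nu> = cscale r a \<nu>"
  proof (cases "\<nu> \<in> multi_index n q \<tau>")
    case True
    then have "cmul n q \<tau> (cconst r) a \<nu> =
        (\<Sum>\<mu> | \<mu> \<le> \<nu>. if \<mu> = 0 then monomial_sign n q \<tau> \<mu> (\<nu> - \<mu>) * r * a (\<nu> - \<mu>) else 0)"
      by (auto simp: cmul_def cconst_def intro!: sum.cong)
    also have "\<dots> = r * a (\<nu> - 0)"
      using finite_multi_index_le[OF True] by (subst sum.delta) auto
    also have "\<nu> - 0 = \<nu>" by (simp add: fun_eq_iff)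
    finally show ?thesis by (simp add: cscale_def)
  qed (use assms in \<open>auto simp: cmul_def cscale_def admissible_def\<close>)
qed

lemma cmul_const_right:
  assumes "admissible n q \<tau> a"
  shows "cmul n q \<tau> a (cconst r) = cscale r a"
proof
  fix \<nu>
  show "cmul n q \<tau> a (cconst r) \<nu> = cscale r a \<nu>"
  proof (cases "\<nu> \<in> multi_index n q \<tau>")
    case True
    have "\<nu> - \<mu> = 0 \<longleftrightarrow> \<mu> = \<nu>" if "\<mu> \<le> \<nu>" for \<mu>
      using that by (auto simp: fun_eq_iff le_fun_def) (meson diff_is_0_eq le_antisym)
    then have "cmul n q \<tau> a (cconst r) \<nu> =
        (\<Sum>\<mu> | \<mu> \<le> \<nu>. if \<mu> = \<nu> then monomial_sign n q \<tau> \<mu> (\<nu> - \<mu>) * a \<mu> * r else 0)"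
      using True by (auto simp: cmul_def cconst_def intro!: sum.cong)
    also have "\<dots> = r * a \<nu>"
    proof -
      have "\<nu> - \<nu> = 0" by (simp add: fun_eq_iff)
      then show ?thesis using finite_multi_index_le[OF True] by (subst sum.delta) auto
    qed
    finally show ?thesis by (simp add: cscale_def)
  qed (use assms in \<open>auto simp: cmul_def cscale_def admissible_def\<close>)
qed

lemma cmul_one [simp]:
  assumes "admissible n q \<tau> a"
  shows "cmul n q \<tau> (cconst 1) a = a" "cmul n q \<tau> a (cconst 1) = a"
  using assms by (simp_all add: cmul_const_left cmul_const_right)

lemma admissible_simps [simp]:
  "admissible n q \<tau> 0" "admissible n q \<tau> (cconst r)"
  "admissible n q \<tau> a \<Longrightarrow> admissible n q \<tau> (cscale r a)"
  "admissible n q \<tau> a \<Longrightarrow> admissible n q \<tau> b \<Longrightarrow> admissible n q \<tau> (a + b)"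
  "admissible n q \<tau> a \<Longrightarrow> admissible n q \<tau> b \<Longrightarrow> admissible n q \<tau> (a - b)"
  "admissible n q \<tau> (cmul n q \<tau> c d)"
  by (auto simp: admissible_def cconst_def cscale_def cmul_def)

lemma admissible_sum: "(\<And>i. i \<in> I \<Longrightarrow> admissible n q \<tau> (a i)) \<Longrightarrow> admissible n q \<tau> (\<Sum>i\<in>I. a i)"
  by (induction I rule: infinite_finite_induct) auto

section \<open>Degree, commutation and order of products\<close>

lemma cgrade_cmul:
  assumes "a \<in> cgrade q \<tau> i" "b \<in> cgrade q \<tau> j"
  shows "cmul n q \<tau> a b \<in> cgrade q \<tau> (deg_plus i j)"
  unfolding cgrade_def
proof (intro CollectI allI impI)
  fix \<nu> assume "cmul n q \<tau> a b \<nu> \<noteq> 0"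
  then have "(\<Sum>\<mu> | \<mu> \<le> \<nu>. monomial_sign n q \<tau> \<mu> (\<nu> - \<mu>) * a \<mu> * b (\<nu> - \<mu>)) \<noteq> 0"
    by (auto simp: cmul_def split: if_splits)
  then obtain \<mu> where "\<mu> \<le> \<nu>" "a \<mu> \<noteq> 0" "b (\<nu> - \<mu>) \<noteq> 0"
    by (auto elim!: sum.not_neutral_contains_not_neutral)
  then show "monomial_degree q \<tau> \<nu> = deg_plus i j"
    using assms monomial_degree_add[of q \<tau> \<mu> "\<nu> - \<mu>"] by (simp add: multi_add_diff cgrade_def)
qed

lemma cgrade_simps [simp]:
  "0 \<in> cgrade q \<tau> i" "cconst r \<in> cgrade q \<tau> deg_zero"
  "a \<in> cgrade q \<tau> i \<Longrightarrow> cscale r a \<in> cgrade q \<tau> i"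
  by (auto simp: cgrade_def cconst_def cscale_def)

lemma cgrade_add: "a \<in> cgrade q \<tau> i \<Longrightarrow> b \<in> cgrade q \<tau> i \<Longrightarrow> a + b \<in> cgrade q \<tau> i"
  unfolding cgrade_def by simp (metis add.right_neutral add.left_neutral)

lemma cgrade_diff: "a \<in> cgrade q \<tau> i \<Longrightarrow> b \<in> cgrade q \<tau> i \<Longrightarrow> a - b \<in> cgrade q \<tau> i"
  unfolding cgrade_def by simp (metis diff_self)

lemma cgrade_sum: "(\<And>k. k \<in> I \<Longrightarrow> a k \<in> cgrade q \<tau> i) \<Longrightarrow> (\<Sum>k\<in>I. a k) \<in> cgrade q \<tau> i"
  by (induction I rule: infinite_finite_induct) (auto intro: cgrade_add)

text \<open>Reversing every splitting \<nu> = \<mu> + \<kappa> exchanges the factors at the price of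
  one common sign. Constraining only monomials that actually occur gives graded commutativity and
  the centrality of degree zero elements from the same statement.\<close>

lemma cmul_commute_sign:
  assumes "\<And>\<mu> \<kappa>. a \<mu> \<noteq> 0 \<Longrightarrow> b \<kappa> \<noteq> 0 \<Longrightarrow>
      comm_sign n (monomial_degree q \<tau> \<mu>) (monomial_degree q \<tau> \<kappa>) = s"
  shows "cmul n q \<tau> a b = cscale s (cmul n q \<tau> b a)"
proof
  fix \<nu>
  show "cmul n q \<tau> a b \<nu> = cscale s (cmul n q \<tau> b a) \<nu>"
  proof (cases "\<nu> \<in> multi_index n q \<tau>")
    case True
    have "(\<Sum>\<mu> | \<mu> \<le> \<nu>. monomial_sign n q \<tau> \<mu> (\<nu> - \<mu>) * a \<mu> * b (\<nu> - \<mu>)) =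
        (\<Sum>\<kappa> | \<kappa> \<le> \<nu>. s * (monomial_sign n q \<tau> \<kappa> (\<nu> - \<kappa>) * b \<kappa> * a (\<nu> - \<kappa>)))"
    proof (rule sum.reindex_bij_witness[where i = "\<lambda>\<kappa>. \<nu> - \<kappa>" and j = "\<lambda>\<kappa>. \<nu> - \<kappa>"], goal_cases)
      case (5 \<mu>)
      then have \<mu>: "\<mu> + (\<nu> - \<mu>) = \<nu>" "\<nu> - (\<nu> - \<mu>) = \<mu>"
        by (auto simp: le_fun_def fun_eq_iff)
      show ?case
      proof (cases "a \<mu> = 0 \<or> b (\<nu> - \<mu>) = 0")
        case False
        then show ?thesis using monomial_sign_commute[of \<mu> "\<nu> - \<mu>" n q \<tau>] True assms[of \<mu> "\<nu> - \<mu>"]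
          by (simp add: \<mu>)
      qed (auto simp: \<mu>)
    qed (auto simp: le_fun_def fun_eq_iff)
    then show ?thesis using True by (simp add: cmul_def cscale_def sum_distrib_left)
  qed (simp add: cmul_def cscale_def)
qed

lemma cmul_graded_commute:
  assumes "a \<in> cgrade q \<tau> i" "b \<in> cgrade q \<tau> j"
  shows "cmul n q \<tau> a b = cscale (comm_sign n i j) (cmul n q \<tau> b a)"
  using assms by (intro cmul_commute_sign) (auto simp: cgrade_def)

lemma cmul_central:
  assumes "a \<in> cgrade q \<tau> deg_zero"
  shows "cmul n q \<tau> a b = cmul n q \<tau> b a"
  using assms cmul_commute_sign[of a b n q \<tau> 1] by (auto simp: cgrade_def)

lemma corder_cmul:
  assumes "a \<in> corder q k" "b \<in> corder q l"
  shows "cmul n q \<tau> a b \<in> corder q (k + l)"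
  unfolding corder_def
proof (intro CollectI allI impI)
  fix \<nu> assume \<nu>: "total_degree q \<nu> < k + l"
  have "a \<mu> = 0 \<or> b (\<nu> - \<mu>) = 0" if "\<mu> \<le> \<nu>" for \<mu>
  proof -
    have "total_degree q \<mu> < k \<or> total_degree q (\<nu> - \<mu>) < l"
      using \<nu> total_degree_add[of q \<mu> "\<nu> - \<mu>"] unfolding multi_add_diff[OF that] by linarith
    then show ?thesis using assms by (auto simp: corder_def)
  qed
  then show "cmul n q \<tau> a b \<nu> = 0" unfolding cmul_def by (auto intro!: sum.neutral)
qed

lemma corder_0 [simp]: "a \<in> corder q 0" "0 \<in> corder q k"
  by (auto simp: corder_def)

lemma corder_cmul_right: "b \<in> corder q l \<Longrightarrow> cmul n q \<tau> a b \<in> corder q l"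
  using corder_cmul[OF corder_0(1)] by fastforce

lemma corder_mono: "a \<in> corder q k \<Longrightarrow> l \<le> k \<Longrightarrow> a \<in> corder q l"
  by (auto simp: corder_def)

lemma corder_add: "a \<in> corder q k \<Longrightarrow> b \<in> corder q k \<Longrightarrow> a + b \<in> corder q k"
  by (auto simp: corder_def)

lemma corder_diff: "a \<in> corder q k \<Longrightarrow> b \<in> corder q k \<Longrightarrow> a - b \<in> corder q k"
  by (auto simp: corder_def)

lemma corder_scale: "a \<in> corder q k \<Longrightarrow> cscale r a \<in> corder q k"
  by (auto simp: corder_def cscale_def)

lemma corder_sum: "(\<And>i. i \<in> I \<Longrightarrow> a i \<in> corder q k) \<Longrightarrow> (\<Sum>i\<in>I. a i) \<in> corder q k"
  by (induction I rule: infinite_finite_induct) (auto intro: corder_add)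

lemma corder_one_iff:
  assumes "admissible n q \<tau> a"
  shows "a \<in> corder q 1 \<longleftrightarrow> a 0 = 0"
proof
  show "a \<in> corder q 1 \<Longrightarrow> a 0 = 0" by (simp add: corder_def total_degree_def)
  show "a \<in> corder q 1" if "a 0 = 0"
    unfolding corder_def using that assms total_degree_zero_iff[of _ n q \<tau>]
    by (auto simp: admissible_def)
qed

text \<open>Multiplication is continuous for the order filtration: the difference splits as (a - a')
  b + a' (b - b'). This allows factors to be replaced by truncations.\<close>

lemma cmul_cong_corder:
  assumes "a - a' \<in> corder q k" "b - b' \<in> corder q k"
  shows "cmul n q \<tau> a b - cmul n q \<tau> a' b' \<in> corder q k"
proof -
  have "cmul n q \<tau> a b - cmul n q \<tau> a' b' = cmul n q \<tau> (a - a') b + cmul n q \<tau> a' (b - b')"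
    by (simp add: cmul_diff_left cmul_diff_right)
  then show ?thesis
    using corder_cmul[OF assms(1) corder_0(1)] corder_cmul[OF corder_0(1) assms(2)]
    by (simp add: corder_add)
qed

subsection \<open>Monomials in a tuple of coefficient families\<close>

primrec cpow :: "nat \<Rightarrow> nat \<Rightarrow> (nat \<Rightarrow> degree) \<Rightarrow> coeffs \<Rightarrow> nat \<Rightarrow> coeffs" where
  "cpow n q \<tau> z 0 = cconst 1"
| "cpow n q \<tau> z (Suc k) = cmul n q \<tau> z (cpow n q \<tau> z k)"

text \<open>The factors stand in increasing index order, the normal form to which
  \<open>monomial_sign\<close> refers.\<close>

primrec cmonomial :: "nat \<Rightarrow> nat \<Rightarrow> (nat \<Rightarrow> degree) \<Rightarrow> nat \<Rightarrow> (nat \<Rightarrow> coeffs) \<Rightarrow> (nat \<Rightarrow> nat) \<Rightarrow> coeffs" where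
  "cmonomial n q \<tau> 0 z \<nu> = cconst 1"
| "cmonomial n q \<tau> (Suc v) z \<nu> = cmul n q \<tau> (cmonomial n q \<tau> v z \<nu>) (cpow n q \<tau> (z v) (\<nu> v))"

lemma admissible_cpow [simp]: "admissible n q \<tau> (cpow n q \<tau> z k)"
  by (cases k) auto

lemma cpow_add: "cpow n q \<tau> z (k + l) = cmul n q \<tau> (cpow n q \<tau> z k) (cpow n q \<tau> z l)"
  by (induction k) (auto simp: cmul_assoc)

lemma cgrade_cpow: "z \<in> cgrade q \<tau> i \<Longrightarrow> cpow n q \<tau> z k \<in> cgrade q \<tau> (\<lambda>l. of_nat k * i l)"
proof (induction k)
  case 0
  then show ?case using cgrade_simps(2)[of 1 q \<tau>] by (simp add: deg_zero_def)
next
  case (Suc k)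
  then show ?case using cgrade_cmul[of z q \<tau> i "cpow n q \<tau> z k" "\<lambda>l. of_nat k * i l" n]
    by (simp add: deg_plus_def distrib_right)
qed

lemma cgrade_cmonomial:
  "(\<And>b. b < v \<Longrightarrow> z b \<in> cgrade q \<tau> (\<sigma> b)) \<Longrightarrow> cmonomial n q \<tau> v z \<nu> \<in> cgrade q \<tau> (monomial_degree v \<sigma> \<nu>)"
proof (induction v)
  case 0
  then show ?case using cgrade_simps(2)[of 1 q \<tau>] by (simp add: deg_zero_def monomial_degree_def)
next
  case (Suc v)
  have "monomial_degree (Suc v) \<sigma> \<nu> = deg_plus (monomial_degree v \<sigma> \<nu>) (\<lambda>l. of_nat (\<nu> v) * \<sigma> v l)"
    by (simp add: monomial_degree_def deg_plus_def fun_eq_iff)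
  then show ?case using Suc by (auto intro!: cgrade_cmul cgrade_cpow)
qed

lemma corder_cpow: "z \<in> corder q 1 \<Longrightarrow> cpow n q \<tau> z k \<in> corder q k"
  using corder_cmul[of z q 1] by (induction k) auto

lemma corder_cmonomial:
  "(\<And>b. b < v \<Longrightarrow> z b \<in> corder q 1) \<Longrightarrow> cmonomial n q \<tau> v z \<nu> \<in> corder q (total_degree v \<nu>)"
proof (induction v)
  case (Suc v)
  have "total_degree (Suc v) \<nu> = total_degree v \<nu> + \<nu> v" by (simp add: total_degree_def)
  then show ?case using Suc by (auto intro!: corder_cmul corder_cpow)
qed (simp add: total_degree_def)

text \<open>When variable \<open>v\<close> is added, only its power in the first monomial has to
  pass the lower variables of the second one. The resulting sign is exactly the outer factor for
  index \<open>v\<close> in \<open>monomial_sign\<close>.\<close>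

lemma cmonomial_mult:
  assumes "\<And>b. b < v \<Longrightarrow> z b \<in> cgrade q \<tau> (\<sigma> b)" and \<nu>: "\<nu> = \<mu> + \<kappa>"
  shows "cmul n q \<tau> (cmonomial n q \<tau> v z \<mu>) (cmonomial n q \<tau> v z \<kappa>) =
           cscale (monomial_sign n v \<sigma> \<mu> \<kappa>) (cmonomial n q \<tau> v z \<nu>)"
  using assms(1)
proof (induction v)
  case 0
  then show ?case by (simp add: monomial_sign_def)
next
  case (Suc v)
  let ?m = "\<lambda>\<nu>. cmonomial n q \<tau> v z \<nu>" and ?p = "cpow n q \<tau> (z v)" and ?c = "cmul n q \<tau>"
  define s where "s = comm_sign n (\<lambda>l. of_nat (\<mu> v) * \<sigma> v l) (monomial_degree v \<sigma> \<kappa>)"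
  have s: "s = (\<Prod>a<v. comm_sign n (\<sigma> v) (\<sigma> a) ^ (\<mu> v * \<kappa> a))"
    by (simp add: s_def comm_sign_eq monomial_degree_def pairing_sum_right pairing_scale_left
        sum_distrib_left bit_sign_sum bit_sign_power mult_ac)
  have swap: "?c (?p (\<mu> v)) (?m \<kappa>) = cscale s (?c (?m \<kappa>) (?p (\<mu> v)))"
    unfolding s_def using Suc.prems by (intro cmul_graded_commute cgrade_cpow cgrade_cmonomial) auto
  have "?c (?c (?m \<mu>) (?p (\<mu> v))) (?c (?m \<kappa>) (?p (\<kappa> v))) =
      ?c (?c (?m \<mu>) (?c (?p (\<mu> v)) (?m \<kappa>))) (?p (\<kappa> v))"
    by (simp add: cmul_assoc)
  also have "\<dots> = cscale s (?c (?c (?m \<mu>) (?m \<kappa>)) (?c (?p (\<mu> v)) (?p (\<kappa> v))))"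
    unfolding swap by (simp add: cmul_assoc cmul_scale_left cmul_scale_right)
  also have "\<dots> = cscale (s * monomial_sign n v \<sigma> \<mu> \<kappa>) (?c (?m \<nu>) (?p (\<nu> v)))"
  proof -
    have "?p (\<nu> v) = ?c (?p (\<mu> v)) (?p (\<kappa> v))" by (simp add: \<nu> cpow_add)
    then show ?thesis using Suc by (simp add: cmul_scale_left)
  qed
  also have "s * monomial_sign n v \<sigma> \<mu> \<kappa> = monomial_sign n (Suc v) \<sigma> \<mu> \<kappa>"
    by (simp add: s monomial_sign_def)
  finally show ?case by simp
qed

text \<open>An element of odd self-pairing anticommutes with itself, so its square is zero. This
  matches the convention of \<open>series_mult\<close> that products with inadmissible index are
  0.\<close>

lemma cmonomial_eq_0:
  assumes z: "\<And>b. b < v \<Longrightarrow> z b \<in> cgrade q \<tau> (\<sigma> b)"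
    and "\<nu> \<notin> multi_index n v \<sigma>" "\<forall>a\<ge>v. \<nu> a = 0"
  shows "cmonomial n q \<tau> v z \<nu> = 0"
proof -
  obtain a where a: "a < v" "pairing n (\<sigma> a) (\<sigma> a) = 1" "\<nu> a \<ge> 2"
    using assms(2,3) by (auto simp: multi_index_def)
  have "cmul n q \<tau> (z a) (z a) = cscale (- 1) (cmul n q \<tau> (z a) (z a))"
    using cmul_graded_commute[OF z[OF a(1)] z[OF a(1)], of n] a(2) by (simp add: comm_sign_def)
  then have sq: "cmul n q \<tau> (z a) (z a) = 0" by (simp add: fun_eq_iff cscale_def)
  have "cpow n q \<tau> (z a) (Suc (Suc k)) = 0" for k
    using sq by (simp flip: cmul_assoc)
  then have p0: "cpow n q \<tau> (z a) (\<nu> a) = 0"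
    using a(3) by (metis Suc_le_D numeral_2_eq_2 Suc_le_mono)
  have "a < w \<Longrightarrow> cmonomial n q \<tau> w z \<nu> = 0" for w
    by (induction w) (auto simp: p0 less_Suc_eq)
  then show ?thesis using a(1) by simp
qed

section \<open>Taylor expansion along nilpotent increments\<close>

text \<open>
  \<open>taylor h k g y\<close> is the \<open>k\<close>-th term of the expansion of \<open>g (y + h)\<close>, that is \<open>D\<^sup>k g / k!\<close> for the
  derivation \<open>D = \<Sum>\<^sub>j h\<^sub>j \<partial>\<^sub>j\<close>. Iterating a derivation avoids multi-index Taylor coefficients.
\<close>

primrec taylor ::
  "nat \<Rightarrow> nat \<Rightarrow> (nat \<Rightarrow> degree) \<Rightarrow> nat \<Rightarrow> (nat \<Rightarrow> coeffs) \<Rightarrow> nat \<Rightarrow> ((nat \<Rightarrow> real) \<Rightarrow> real) \<Rightarrow> (nat \<Rightarrow> real) \<Rightarrow> coeffs" where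
  "taylor n q \<tau> u h 0 g y = cconst (g y)"
| "taylor n q \<tau> u h (Suc k) g y =
     cscale (1 / real (Suc k)) (\<Sum>j<u. cmul n q \<tau> (h j) (taylor n q \<tau> u h k (partial_deriv j g) y))"

definition taylor_sum ::
  "nat \<Rightarrow> nat \<Rightarrow> (nat \<Rightarrow> degree) \<Rightarrow> nat \<Rightarrow> (nat \<Rightarrow> coeffs) \<Rightarrow> nat \<Rightarrow> ((nat \<Rightarrow> real) \<Rightarrow> real) \<Rightarrow> (nat \<Rightarrow> real) \<Rightarrow> coeffs" where
  "taylor_sum n q \<tau> u h N g y = (\<Sum>k\<le>N. taylor n q \<tau> u h k g y)"

lemma admissible_taylor [simp]: "admissible n q \<tau> (taylor n q \<tau> u h k g y)"
  by (cases k) (auto intro!: admissible_sum admissible_simps(3))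

lemma admissible_taylor_sum [simp]: "admissible n q \<tau> (taylor_sum n q \<tau> u h N g y)"
  by (simp add: taylor_sum_def admissible_sum)

lemma deg_plus_zero [simp]: "deg_plus deg_zero i = i" "deg_plus i deg_zero = i"
  by (simp_all add: deg_plus_def deg_zero_def)

lemma cgrade_taylor:
  "(\<And>j. j < u \<Longrightarrow> h j \<in> cgrade q \<tau> deg_zero) \<Longrightarrow> taylor n q \<tau> u h k g y \<in> cgrade q \<tau> deg_zero"
proof (induction k arbitrary: g)
  case (Suc k)
  have "cmul n q \<tau> (h j) (taylor n q \<tau> u h k (partial_deriv j g) y) \<in> cgrade q \<tau> (deg_plus deg_zero deg_zero)"
    if "j < u" for j
    using Suc that by (intro cgrade_cmul) auto
  then show ?case by (auto intro!: cgrade_sum cgrade_simps(3))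
qed simp

lemma cgrade_taylor_sum:
  "(\<And>j. j < u \<Longrightarrow> h j \<in> cgrade q \<tau> deg_zero) \<Longrightarrow> taylor_sum n q \<tau> u h N g y \<in> cgrade q \<tau> deg_zero"
  unfolding taylor_sum_def by (intro cgrade_sum cgrade_taylor) auto

lemma corder_taylor:
  "(\<And>j. j < u \<Longrightarrow> h j \<in> corder q 1) \<Longrightarrow> taylor n q \<tau> u h k g y \<in> corder q k"
proof (induction k arbitrary: g)
  case (Suc k)
  have "cmul n q \<tau> (h j) (taylor n q \<tau> u h k (partial_deriv j g) y) \<in> corder q (1 + k)" if "j < u" for j
    using Suc that by (intro corder_cmul) auto
  then show ?case by (auto intro!: corder_sum corder_scale)
qed simp

lemma taylor_cong:
  assumes V: "openin (Euclidean_space u) V" "y \<in> V"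
  shows "(\<And>z. z \<in> V \<Longrightarrow> f z = g z) \<Longrightarrow> taylor n q \<tau> u h k f y = taylor n q \<tau> u h k g y"
proof (induction k arbitrary: f g)
  case (Suc k)
  have "taylor n q \<tau> u h k (partial_deriv j f) y = taylor n q \<tau> u h k (partial_deriv j g) y" if "j < u" for j
    using Suc.IH[of "partial_deriv j f" "partial_deriv j g"] partial_deriv_cong[OF V(1) _ that, of _ f g] Suc.prems
    by blast
  then show ?case by simp
qed (use V in simp)

lemma taylor_add:
  assumes V: "openin (Euclidean_space u) V" "y \<in> V"
  shows "smooth u V f \<Longrightarrow> smooth u V g \<Longrightarrow>
    taylor n q \<tau> u h k (\<lambda>y. f y + g y) y = taylor n q \<tau> u h k f y + taylor n q \<tau> u h k g y"
proof (induction k arbitrary: f g)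
  case 0
  then show ?case by (simp add: cconst_def fun_eq_iff)
next
  case (Suc k)
  have "taylor n q \<tau> u h k (partial_deriv j (\<lambda>y. f y + g y)) y =
      taylor n q \<tau> u h k (partial_deriv j f) y + taylor n q \<tau> u h k (partial_deriv j g) y" if j: "j < u" for j
  proof -
    have "partial_deriv j (\<lambda>y. f y + g y) z = partial_deriv j f z + partial_deriv j g z" if "z \<in> V" for z
      by (rule has_partial_imp_eq, rule DERIV_add) (rule smooth_has_partial[OF _ j that], fact Suc.prems)+
    then have "taylor n q \<tau> u h k (partial_deriv j (\<lambda>y. f y + g y)) y =
        taylor n q \<tau> u h k (\<lambda>z. partial_deriv j f z + partial_deriv j g z) y"
      by (rule taylor_cong[OF V])
    then show ?thesis using Suc.IH[of "partial_deriv j f" "partial_deriv j g"] Suc.prems j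
      by (simp add: smooth_partial_deriv plus_fun_def)
  qed
  then show ?case by (simp add: cmul_add_right sum.distrib cscale_add)
qed

lemma taylor_scale:
  assumes V: "openin (Euclidean_space u) V" "y \<in> V"
  shows "smooth u V f \<Longrightarrow> taylor n q \<tau> u h k (\<lambda>y. c * f y) y = cscale c (taylor n q \<tau> u h k f y)"
proof (induction k arbitrary: f)
  case 0
  then show ?case by (simp add: cconst_def cscale_def fun_eq_iff)
next
  case (Suc k)
  have "taylor n q \<tau> u h k (partial_deriv j (\<lambda>y. c * f y)) y = cscale c (taylor n q \<tau> u h k (partial_deriv j f) y)"
    if j: "j < u" for j
  proof -
    have "partial_deriv j (\<lambda>y. c * f y) z = c * partial_deriv j f z" if "z \<in> V" for z
      by (rule has_partial_imp_eq, rule DERIV_cmult) (rule smooth_has_partial[OF _ j that], fact Suc.prems)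
    then have "taylor n q \<tau> u h k (partial_deriv j (\<lambda>y. c * f y)) y =
        taylor n q \<tau> u h k (\<lambda>z. c * partial_deriv j f z) y"
      by (rule taylor_cong[OF V])
    then show ?thesis using Suc.IH[of "partial_deriv j f"] Suc.prems j by (simp add: smooth_partial_deriv)
  qed
  then show ?case by (simp add: cmul_scale_right flip: cscale_sum)
qed

lemma taylor_zero: "taylor n q \<tau> u h k (\<lambda>_. 0) y = 0"
proof (induction k)
  case 0
  show ?case by (simp add: cconst_def fun_eq_iff)
next
  case (Suc k)
  have "taylor n q \<tau> u h k (\<lambda>_. 0) y = 0" by (rule Suc.IH)
  then show ?case by (simp add: partial_deriv_const)
qed

lemma taylor_const_Suc: "taylor n q \<tau> u h (Suc k) (\<lambda>_. c) y = 0"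
  by (simp add: partial_deriv_const taylor_zero)

text \<open>The Leibniz rule for the divided powers of a derivation. After multiplication by
  \<open>Suc k\<close> one derivative is applied and the induction hypothesis used on both resulting
  products; the weights \<open>i\<close> and \<open>Suc k - i\<close> then add up to
  \<open>Suc k\<close>. Degree zero makes each \<open>h j\<close> central, so it can be moved to the
  factor that is differentiated.\<close>

lemma taylor_mult:
  assumes V: "openin (Euclidean_space u) V" "y \<in> V" and h: "\<And>j. j < u \<Longrightarrow> h j \<in> cgrade q \<tau> deg_zero"
  shows "smooth u V f \<Longrightarrow> smooth u V g \<Longrightarrow>
    taylor n q \<tau> u h k (\<lambda>y. f y * g y) y =
      (\<Sum>i\<le>k. cmul n q \<tau> (taylor n q \<tau> u h i f y) (taylor n q \<tau> u h (k - i) g y))"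
proof (induction k arbitrary: f g)
  case 0
  show ?case by (simp add: cmul_const_left) (simp add: cconst_def cscale_def fun_eq_iff)
next
  case (Suc k)
  let ?t = "taylor n q \<tau> u h" and ?c = "cmul n q \<tau>"
  have step: "cscale (real (Suc l)) (?t (Suc l) f y) = (\<Sum>j<u. ?c (h j) (?t l (partial_deriv j f) y))" for l f
    by simp
  have central: "?c (h j) (?c (?t i f y) b) = ?c (?t i f y) (?c (h j) b)" if "j < u" for i j f b
    using cmul_central[OF h[OF that], of n "?t i f y"] by (simp flip: cmul_assoc)
  have "cscale (real (Suc k)) (?t (Suc k) (\<lambda>y. f y * g y) y) =
      (\<Sum>j<u. ?c (h j) (?t k (partial_deriv j (\<lambda>y. f y * g y)) y))"
    by (rule step)
  also have "\<dots> = (\<Sum>j<u. ?c (h j) (\<Sum>i\<le>k. ?c (?t i (partial_deriv j f) y) (?t (k - i) g y)) +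
      ?c (h j) (\<Sum>i\<le>k. ?c (?t i f y) (?t (k - i) (partial_deriv j g) y)))"
  proof (rule sum.cong[OF refl])
    fix j assume "j \<in> {..<u}"
    then have j: "j < u" by simp
    have "partial_deriv j (\<lambda>y. f y * g y) z = partial_deriv j f z * g z + f z * partial_deriv j g z" if "z \<in> V" for z
      by (rule has_partial_imp_eq, rule DERIV_cong[OF DERIV_mult])
        (rule smooth_has_partial[OF _ j that], fact Suc.prems, rule smooth_has_partial[OF _ j that], fact Suc.prems, simp)
    then have "?t k (partial_deriv j (\<lambda>y. f y * g y)) y =
        ?t k (\<lambda>z. partial_deriv j f z * g z + f z * partial_deriv j g z) y"
      by (rule taylor_cong[OF V])
    also have "\<dots> = ?t k (\<lambda>z. partial_deriv j f z * g z) y + ?t k (\<lambda>z. f z * partial_deriv j g z) y"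
      using Suc.prems j by (intro taylor_add[OF V] smooth_mult[OF V(1)] smooth_partial_deriv)
    also have "?t k (\<lambda>z. partial_deriv j f z * g z) y = (\<Sum>i\<le>k. ?c (?t i (partial_deriv j f) y) (?t (k - i) g y))"
      using Suc.prems j by (intro Suc.IH smooth_partial_deriv)
    also have "?t k (\<lambda>z. f z * partial_deriv j g z) y = (\<Sum>i\<le>k. ?c (?t i f y) (?t (k - i) (partial_deriv j g) y))"
      using Suc.prems j by (intro Suc.IH smooth_partial_deriv)
    finally show "?c (h j) (?t k (partial_deriv j (\<lambda>y. f y * g y)) y) =
      ?c (h j) (\<Sum>i\<le>k. ?c (?t i (partial_deriv j f) y) (?t (k - i) g y)) +
      ?c (h j) (\<Sum>i\<le>k. ?c (?t i f y) (?t (k - i) (partial_deriv j g) y))"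
      by (simp only: cmul_add_right)
  qed
  also have "\<dots> = (\<Sum>j<u. \<Sum>i\<le>k. ?c (?c (h j) (?t i (partial_deriv j f) y)) (?t (k - i) g y)) +
      (\<Sum>j<u. \<Sum>i\<le>k. ?c (?t i f y) (?c (h j) (?t (k - i) (partial_deriv j g) y)))"
    unfolding sum.distrib cmul_sum_right by (simp add: cmul_assoc central)
  also have "(\<Sum>j<u. \<Sum>i\<le>k. ?c (?c (h j) (?t i (partial_deriv j f) y)) (?t (k - i) g y)) =
      (\<Sum>i\<le>k. ?c (cscale (real (Suc i)) (?t (Suc i) f y)) (?t (k - i) g y))"
    unfolding step cmul_sum_left by (rule sum.swap)
  also have "(\<Sum>j<u. \<Sum>i\<le>k. ?c (?t i f y) (?c (h j) (?t (k - i) (partial_deriv j g) y))) =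
      (\<Sum>i\<le>k. ?c (?t i f y) (cscale (real (Suc (k - i))) (?t (Suc (k - i)) g y)))"
    unfolding step cmul_sum_right by (rule sum.swap)
  \<comment> \<open>The shifted sum acquires the term \<open>i = 0\<close>, whose weight is 0; the
    other sum below likewise acquires the term \<open>i = Suc k\<close> with weight 0.\<close>
  also have "(\<Sum>i\<le>k. ?c (cscale (real (Suc i)) (?t (Suc i) f y)) (?t (k - i) g y)) =
      (\<Sum>i\<le>Suc k. cscale (real i) (?c (?t i f y) (?t (Suc k - i) g y)))"
    unfolding sum.atMost_Suc_shift cmul_scale_left by (simp del: taylor.simps)
  also have "(\<Sum>i\<le>k. ?c (?t i f y) (cscale (real (Suc (k - i))) (?t (Suc (k - i)) g y))) =
      (\<Sum>i\<le>Suc k. cscale (real (Suc k - i)) (?c (?t i f y) (?t (Suc k - i) g y)))"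
    unfolding sum.atMost_Suc cmul_scale_right
    by (auto simp: Suc_diff_le simp del: taylor.simps of_nat_Suc intro!: sum.cong)
  also have "(\<Sum>i\<le>Suc k. cscale (real i) (?c (?t i f y) (?t (Suc k - i) g y))) +
      (\<Sum>i\<le>Suc k. cscale (real (Suc k - i)) (?c (?t i f y) (?t (Suc k - i) g y))) =
      cscale (real (Suc k)) (\<Sum>i\<le>Suc k. ?c (?t i f y) (?t (Suc k - i) g y))"
    unfolding sum.distrib[symmetric] cscale_sum cscale_add_left[symmetric]
    by (intro sum.cong refl) (simp add: of_nat_diff del: taylor.simps)
  finally have "cscale (1 / real (Suc k)) (cscale (real (Suc k)) (?t (Suc k) (\<lambda>y. f y * g y) y)) =
      cscale (1 / real (Suc k)) (cscale (real (Suc k)) (\<Sum>i\<le>Suc k. ?c (?t i f y) (?t (Suc k - i) g y)))"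
    by (rule arg_cong)
  then show ?case by (simp del: taylor.simps of_nat_Suc)
qed

text \<open>The truncated product rule produces the triangle of index pairs with sum at most
  \<open>N\<close>, the product of truncations the full square. The remaining corner consists of
  terms of order at least \<open>Suc N\<close>.\<close>

lemma taylor_sum_mult:
  assumes V: "openin (Euclidean_space u) V" "y \<in> V"
    and h: "\<And>j. j < u \<Longrightarrow> h j \<in> cgrade q \<tau> deg_zero" "\<And>j. j < u \<Longrightarrow> h j \<in> corder q 1"
    and fg: "smooth u V f" "smooth u V g"
  shows "taylor_sum n q \<tau> u h N (\<lambda>y. f y * g y) y -
    cmul n q \<tau> (taylor_sum n q \<tau> u h N f y) (taylor_sum n q \<tau> u h N g y) \<in> corder q (Suc N)"
proof -
  define F where "F = (\<lambda>(i, j). cmul n q \<tau> (taylor n q \<tau> u h i f y) (taylor n q \<tau> u h j g y))"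
  define T where "T = {(i, j). i + j \<le> N}"
  have sub: "T \<subseteq> {..N} \<times> {..N}" by (auto simp: T_def)
  have "taylor_sum n q \<tau> u h N (\<lambda>y. f y * g y) y = (\<Sum>k\<le>N. \<Sum>i\<le>k. F (i, k - i))"
    by (simp add: taylor_sum_def taylor_mult[OF V h(1) fg] F_def)
  also have "\<dots> = sum F T"
    unfolding T_def using sum.triangle_reindex_eq[of "\<lambda>i j. F (i, j)" N] by simp
  finally have 1: "taylor_sum n q \<tau> u h N (\<lambda>y. f y * g y) y = sum F T" .
  have "cmul n q \<tau> (taylor_sum n q \<tau> u h N f y) (taylor_sum n q \<tau> u h N g y) = sum F ({..N} \<times> {..N})"
    by (simp add: taylor_sum_def cmul_sum_left) (simp add: cmul_sum_right sum.cartesian_product F_def)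
  also have "\<dots> = sum F ({..N} \<times> {..N} - T) + sum F T"
    by (rule sum.subset_diff[OF sub]) simp
  finally have 2: "cmul n q \<tau> (taylor_sum n q \<tau> u h N f y) (taylor_sum n q \<tau> u h N g y) =
      sum F ({..N} \<times> {..N} - T) + sum F T" .
  have "F x \<in> corder q (Suc N)" if x: "x \<in> {..N} \<times> {..N} - T" for x
  proof -
    obtain i j where "x = (i, j)" "Suc N \<le> i + j" using x by (cases x) (auto simp: T_def)
    then show ?thesis unfolding F_def
      by (simp, intro corder_mono[OF corder_cmul[OF corder_taylor corder_taylor]]) (use h(2) in auto)
  qed
  then have "sum F ({..N} \<times> {..N} - T) \<in> corder q (Suc N)" by (rule corder_sum)
  then show ?thesis unfolding 1 2 using corder_diff[OF corder_0(2)] by fastforce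
qed

lemma taylor_sum_mono:
  assumes "\<And>j. j < u \<Longrightarrow> h j \<in> corder q 1" "N \<le> N'"
  shows "taylor_sum n q \<tau> u h N' g y - taylor_sum n q \<tau> u h N g y \<in> corder q (Suc N)"
proof -
  have "taylor_sum n q \<tau> u h N' g y = (\<Sum>k\<in>{..N'} - {..N}. taylor n q \<tau> u h k g y) + taylor_sum n q \<tau> u h N g y"
    unfolding taylor_sum_def using assms(2) by (intro sum.subset_diff) auto
  moreover have "(\<Sum>k\<in>{..N'} - {..N}. taylor n q \<tau> u h k g y) \<in> corder q (Suc N)"
    by (intro corder_sum corder_mono[OF corder_taylor[OF assms(1)]]) auto
  ultimately show ?thesis by simp
qed

section \<open>Substitution of sections into a formal power series\<close>

definition multi_upto :: "nat \<Rightarrow> nat \<Rightarrow> (nat \<Rightarrow> degree) \<Rightarrow> nat \<Rightarrow> (nat \<Rightarrow> nat) set" where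
  "multi_upto n v \<sigma> N = {\<nu> \<in> multi_index n v \<sigma>. total_degree v \<nu> \<le> N}"

lemma finite_multi_upto [simp]: "finite (multi_upto n v \<sigma> N)"
proof (rule finite_subset)
  show "multi_upto n v \<sigma> N \<subseteq> {\<mu>. \<forall>a. (a \<in> {..<v} \<longrightarrow> \<mu> a \<in> {..N}) \<and> (a \<notin> {..<v} \<longrightarrow> \<mu> a = 0)}"
  proof (clarify, intro conjI impI)
    fix \<mu> a assume \<mu>: "\<mu> \<in> multi_upto n v \<sigma> N"
    { assume "a \<in> {..<v}"
      then have "\<mu> a \<le> total_degree v \<mu>" unfolding total_degree_def by (intro member_le_sum) auto
      then show "\<mu> a \<in> {..N}" using \<mu> by (simp add: multi_upto_def) }
    assume "a \<notin> {..<v}"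
    then show "\<mu> a = 0" using \<mu> by (simp add: multi_upto_def multi_index_def)
  qed
qed (rule finite_set_of_finite_funs; simp)

text \<open>
  \<open>z\<close> is substituted for the formal variables and \<open>y + h\<close> for the coordinates. The terms beyond
  order \<open>N\<close> do not affect the coefficients of total degree at most \<open>N\<close>.
\<close>

definition subst_upto ::
  "nat \<Rightarrow> nat \<Rightarrow> (nat \<Rightarrow> degree) \<Rightarrow> nat \<Rightarrow> nat \<Rightarrow> (nat \<Rightarrow> degree) \<Rightarrow> (nat \<Rightarrow> coeffs) \<Rightarrow> (nat \<Rightarrow> coeffs) \<Rightarrow>
     nat \<Rightarrow> power_series \<Rightarrow> (nat \<Rightarrow> real) \<Rightarrow> coeffs" where
  "subst_upto n q \<tau> u v \<sigma> h z N G y =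
     (\<Sum>\<nu>\<in>multi_upto n v \<sigma> N. cmul n q \<tau> (taylor_sum n q \<tau> u h N (G \<nu>) y) (cmonomial n q \<tau> v z \<nu>))"

text \<open>The limit of \<open>subst_upto\<close> in the order filtration, formed without a
  convergence argument: the coefficient at \<mu> is read off from the truncation at the total degree
  of \<mu>, beyond which it no longer changes.\<close>

definition subst ::
  "nat \<Rightarrow> nat \<Rightarrow> (nat \<Rightarrow> degree) \<Rightarrow> nat \<Rightarrow> nat \<Rightarrow> (nat \<Rightarrow> degree) \<Rightarrow> (nat \<Rightarrow> coeffs) \<Rightarrow> (nat \<Rightarrow> coeffs) \<Rightarrow>
     power_series \<Rightarrow> (nat \<Rightarrow> real) \<Rightarrow> coeffs" where
  "subst n q \<tau> u v \<sigma> h z G y = (\<lambda>\<mu>. subst_upto n q \<tau> u v \<sigma> h z (total_degree q \<mu>) G y \<mu>)"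

lemma corder_eqI: "(\<And>N. a - b \<in> corder q (Suc N)) \<Longrightarrow> a = b"
  by (auto simp: corder_def fun_eq_iff)

text \<open>The situation over a single point of a chart: \<open>h j\<close> stands for a coordinate
  section minus its body and \<open>z b\<close> for an image of a formal variable. Order 1 means
  that both have vanishing body.\<close>

locale substitution =
  fixes n q :: nat and \<tau> :: "nat \<Rightarrow> degree" and u v :: nat and \<sigma> :: "nat \<Rightarrow> degree"
    and h z :: "nat \<Rightarrow> coeffs"
  assumes h_admissible: "\<And>j. j < u \<Longrightarrow> admissible n q \<tau> (h j)"
    and h_grade: "\<And>j. j < u \<Longrightarrow> h j \<in> cgrade q \<tau> deg_zero"
    and h_order: "\<And>j. j < u \<Longrightarrow> h j \<in> corder q 1"
    and z_admissible: "\<And>b. b < v \<Longrightarrow> admissible n q \<tau> (z b)"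
    and z_grade: "\<And>b. b < v \<Longrightarrow> z b \<in> cgrade q \<tau> (\<sigma> b)"
    and z_order: "\<And>b. b < v \<Longrightarrow> z b \<in> corder q 1"
begin

abbreviation "ts \<equiv> taylor_sum n q \<tau> u h"
abbreviation "cm \<equiv> cmonomial n q \<tau> v z"
abbreviation "mul \<equiv> cmul n q \<tau>"
abbreviation "Su \<equiv> subst_upto n q \<tau> u v \<sigma> h z"
abbreviation "S \<equiv> subst n q \<tau> u v \<sigma> h z"

lemma cm_order:
  assumes "k \<le> total_degree v \<nu>"
  shows "cm \<nu> \<in> corder q k"
  using corder_mono[OF corder_cmonomial assms] z_order by blast

text \<open>Raising the truncation adds monomials of order above \<open>N\<close> and changes the
  old terms by Taylor tails of order above \<open>N\<close>.\<close>

lemma subst_upto_mono: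
  assumes "N \<le> N'"
  shows "Su N' G y - Su N G y \<in> corder q (Suc N)"
proof -
  let ?M = "multi_upto n v \<sigma>"
  have sub: "?M N \<subseteq> ?M N'" using assms by (auto simp: multi_upto_def)
  have 1: "(\<Sum>\<nu>\<in>?M N' - ?M N. mul (ts N' (G \<nu>) y) (cm \<nu>)) \<in> corder q (Suc N)"
  proof (rule corder_sum)
    fix \<nu> assume "\<nu> \<in> ?M N' - ?M N"
    then have "Suc N \<le> total_degree v \<nu>" by (auto simp: multi_upto_def)
    then have "cm \<nu> \<in> corder q (Suc N)" by (rule cm_order)
    then show "mul (ts N' (G \<nu>) y) (cm \<nu>) \<in> corder q (Suc N)"
      by (rule corder_cmul_right)
  qed
  have 2: "(\<Sum>\<nu>\<in>?M N. mul (ts N' (G \<nu>) y) (cm \<nu>) - mul (ts N (G \<nu>) y) (cm \<nu>)) \<in> corder q (Suc N)"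
    by (intro corder_sum cmul_cong_corder taylor_sum_mono assms h_order) auto
  have "Su N' G y - Su N G y = (\<Sum>\<nu>\<in>?M N' - ?M N. mul (ts N' (G \<nu>) y) (cm \<nu>)) +
      (\<Sum>\<nu>\<in>?M N. mul (ts N' (G \<nu>) y) (cm \<nu>) - mul (ts N (G \<nu>) y) (cm \<nu>))"
    unfolding subst_upto_def sum_subtractf by (subst sum.subset_diff[OF sub]) auto
  then show ?thesis using corder_add[OF 1 2] by simp
qed

lemma subst_approx: "S G y - Su N G y \<in> corder q (Suc N)"
  unfolding corder_def
proof (intro CollectI allI impI)
  fix \<mu> assume "total_degree q \<mu> < Suc N"
  then have "(Su N G y - Su (total_degree q \<mu>) G y) \<mu> = 0"
    using subst_upto_mono[of "total_degree q \<mu>" N G y] by (auto simp: corder_def)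
  then show "(S G y - Su N G y) \<mu> = 0" by (simp add: subst_def)
qed

text \<open>All values of \<open>S\<close> below are computed through this lemma or coefficientwise
  from \<open>Su\<close>, so that only finite sums have to be manipulated.\<close>

lemma subst_eqI:
  assumes "\<And>N. Su N G y - a \<in> corder q (Suc N)"
  shows "S G y = a"
proof (rule corder_eqI[where q = q])
  show "S G y - a \<in> corder q (Suc N)" for N
    using corder_add[OF subst_approx[of G y N] assms[of N]] by simp
qed

lemma admissible_subst: "admissible n q \<tau> (S G y)"
proof -
  have "admissible n q \<tau> (Su N G y)" for N by (simp add: subst_upto_def admissible_sum)
  then show ?thesis by (simp add: admissible_def subst_def)
qed

lemma subst_cong:
  assumes "openin (Euclidean_space u) V" "y \<in> V" "\<And>\<nu> y. y \<in> V \<Longrightarrow> G \<nu> y = H \<nu> y"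
  shows "S G y = S H y"
proof -
  have "taylor n q \<tau> u h k (G \<nu>) y = taylor n q \<tau> u h k (H \<nu>) y" for k \<nu>
    using assms by (intro taylor_cong[OF assms(1,2)])
  then show ?thesis by (simp add: subst_def subst_upto_def taylor_sum_def)
qed

lemma subst_add:
  assumes V: "openin (Euclidean_space u) V" "y \<in> V" and "\<And>\<nu>. smooth u V (G \<nu>)" "\<And>\<nu>. smooth u V (H \<nu>)"
  shows "S (\<lambda>\<nu> y. G \<nu> y + H \<nu> y) y = S G y + S H y"
proof -
  have "Su N (\<lambda>\<nu> y. G \<nu> y + H \<nu> y) y = Su N G y + Su N H y" for N
    unfolding subst_upto_def taylor_sum_def
    by (simp add: taylor_add[OF V assms(3,4)] sum.distrib cmul_add_left)
  then show ?thesis by (simp add: subst_def fun_eq_iff)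
qed

lemma subst_scale:
  assumes V: "openin (Euclidean_space u) V" "y \<in> V" and "\<And>\<nu>. smooth u V (G \<nu>)"
  shows "S (\<lambda>\<nu> y. c * G \<nu> y) y = cscale c (S G y)"
proof -
  have "Su N (\<lambda>\<nu> y. c * G \<nu> y) y = cscale c (Su N G y)" for N
    unfolding subst_upto_def taylor_sum_def
    by (simp add: taylor_scale[OF V assms(3)] cmul_scale_left flip: cscale_sum)
  then show ?thesis by (simp add: subst_def fun_eq_iff cscale_def)
qed

lemma cgrade_subst:
  assumes "\<And>\<nu>. monomial_degree v \<sigma> \<nu> \<noteq> i \<Longrightarrow> G \<nu> = (\<lambda>_. 0)"
  shows "S G y \<in> cgrade q \<tau> i"
proof -
  have "mul (ts N (G \<nu>) y) (cm \<nu>) \<in> cgrade q \<tau> i" for N \<nu>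
  proof (cases "monomial_degree v \<sigma> \<nu> = i")
    case True
    then show ?thesis
      using cgrade_cmul[OF cgrade_taylor_sum[OF h_grade] cgrade_cmonomial[OF z_grade]] by fastforce
  next
    case False
    then show ?thesis using assms by (simp add: taylor_sum_def taylor_zero)
  qed
  then have "Su N G y \<in> cgrade q \<tau> i" for N unfolding subst_upto_def by (intro cgrade_sum)
  then show ?thesis by (auto simp: cgrade_def subst_def)
qed

lemma taylor_sum_linear:
  assumes V: "openin (Euclidean_space u) V" "y \<in> V" and "finite A" "\<And>a. a \<in> A \<Longrightarrow> smooth u V (f a)"
  shows "ts N (\<lambda>y. \<Sum>a\<in>A. c a * f a y) y = (\<Sum>a\<in>A. cscale (c a) (ts N (f a) y))"
  using assms(3,4)
proof (induction A rule: finite_induct)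
  case empty
  then show ?case by (simp add: taylor_sum_def taylor_zero)
next
  case (insert a A)
  have "taylor n q \<tau> u h k (\<lambda>y. c a * f a y + (\<Sum>a\<in>A. c a * f a y)) y =
      cscale (c a) (taylor n q \<tau> u h k (f a) y) + taylor n q \<tau> u h k (\<lambda>y. \<Sum>a\<in>A. c a * f a y) y" for k
    using insert.prems
    by (subst taylor_add[OF V]) (auto intro!: smooth_mult smooth_const smooth_sum V taylor_scale[OF V])
  then have "ts N (\<lambda>y. c a * f a y + (\<Sum>a\<in>A. c a * f a y)) y =
      cscale (c a) (ts N (f a) y) + ts N (\<lambda>y. \<Sum>a\<in>A. c a * f a y) y"
    by (simp add: taylor_sum_def sum.distrib cscale_sum)
  then show ?case using insert by simp
qed

text \<open>Both sides are compared with a finite sum over pairs of indices. Three errors occur, all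
  of order above \<open>N\<close>: products of truncated Taylor sums, pairs of indices outside
  \<open>T\<close>, and the passage from \<open>S\<close> to \<open>Su\<close>.\<close>

lemma subst_mult:
  assumes V: "openin (Euclidean_space u) V" "y \<in> V" and G: "\<And>\<nu>. smooth u V (G \<nu>)" and H: "\<And>\<nu>. smooth u V (H \<nu>)"
  shows "S (series_mult n v \<sigma> G H) y = mul (S G y) (S H y)"
proof (rule subst_eqI)
  fix N
  let ?M = "multi_upto n v \<sigma> N" and ?s = "monomial_sign n v \<sigma>"
  define t where "t = (\<lambda>(\<mu>, \<kappa>). mul (cscale (?s \<mu> \<kappa>) (mul (ts N (G \<mu>) y) (ts N (H \<kappa>) y))) (cm (\<mu> + \<kappa>)))"
  \<comment> \<open>The pairs that survive in the truncated product series: their sum is admissible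
    and of total degree at most \<open>N\<close>.\<close>
  define T where "T = {(\<mu>, \<kappa>). \<mu> + \<kappa> \<in> ?M}"
  have MI: "\<nu> \<in> multi_index n v \<sigma>" if "\<nu> \<in> ?M" for \<nu> using that by (simp add: multi_upto_def)
  have fin: "finite {\<mu>. \<mu> \<le> \<nu>}" if "\<nu> \<in> ?M" for \<nu>
    using finite_multi_index_le[OF MI[OF that]] .
  have T_sub: "T \<subseteq> ?M \<times> ?M"
  proof clarify
    fix \<mu> \<kappa> assume "(\<mu>, \<kappa>) \<in> T"
    then have *: "\<mu> + \<kappa> \<in> multi_index n v \<sigma>" "total_degree v \<mu> + total_degree v \<kappa> \<le> N"
      by (auto simp: T_def multi_upto_def total_degree_add)
    have "\<mu> \<le> \<mu> + \<kappa>" "\<kappa> \<le> \<mu> + \<kappa>" by (auto simp: le_fun_def)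
    then show "\<mu> \<in> ?M \<and> \<kappa> \<in> ?M" using *(2) multi_index_le[OF *(1)] by (auto simp: multi_upto_def)
  qed
  have "ts N (series_mult n v \<sigma> G H \<nu>) y =
      (\<Sum>\<mu> | \<mu> \<le> \<nu>. cscale (?s \<mu> (\<nu> - \<mu>)) (ts N (\<lambda>y. G \<mu> y * H (\<nu> - \<mu>) y) y))" if "\<nu> \<in> ?M" for \<nu>
  proof -
    have "series_mult n v \<sigma> G H \<nu> = (\<lambda>y. \<Sum>\<mu> | \<mu> \<le> \<nu>. ?s \<mu> (\<nu> - \<mu>) * (G \<mu> y * H (\<nu> - \<mu>) y))"
      using MI[OF that] by (auto simp: series_mult_eq cmul_def mult.assoc fun_eq_iff)
    then show ?thesis
      using taylor_sum_linear[OF V fin[OF that], of "\<lambda>\<mu> y. G \<mu> y * H (\<nu> - \<mu>) y" N "\<lambda>\<mu>. ?s \<mu> (\<nu> - \<mu>)"]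
      by (simp add: smooth_mult[OF V(1) G H])
  qed
  then have "Su N (series_mult n v \<sigma> G H) y =
      (\<Sum>\<nu>\<in>?M. \<Sum>\<mu> | \<mu> \<le> \<nu>. mul (cscale (?s \<mu> (\<nu> - \<mu>)) (ts N (\<lambda>y. G \<mu> y * H (\<nu> - \<mu>) y) y)) (cm \<nu>))"
    by (simp add: subst_upto_def cmul_sum_left)
  moreover have "(\<Sum>\<nu>\<in>?M. \<Sum>\<mu> | \<mu> \<le> \<nu>. mul (cscale (?s \<mu> (\<nu> - \<mu>)) (ts N (\<lambda>y. G \<mu> y * H (\<nu> - \<mu>) y) y)) (cm \<nu>)) -
      (\<Sum>\<nu>\<in>?M. \<Sum>\<mu> | \<mu> \<le> \<nu>. mul (cscale (?s \<mu> (\<nu> - \<mu>)) (mul (ts N (G \<mu>) y) (ts N (H (\<nu> - \<mu>)) y))) (cm \<nu>))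
      \<in> corder q (Suc N)"
    unfolding sum_subtractf[symmetric]
    by (intro corder_sum cmul_cong_corder)
      (auto simp flip: cscale_diff intro!: corder_scale taylor_sum_mult[OF V h_grade h_order G H])
  moreover have "(\<Sum>\<nu>\<in>?M. \<Sum>\<mu> | \<mu> \<le> \<nu>. mul (cscale (?s \<mu> (\<nu> - \<mu>)) (mul (ts N (G \<mu>) y) (ts N (H (\<nu> - \<mu>)) y))) (cm \<nu>)) =
      sum t T"
  proof -
    have "(\<Sum>\<nu>\<in>?M. \<Sum>\<mu> | \<mu> \<le> \<nu>. mul (cscale (?s \<mu> (\<nu> - \<mu>)) (mul (ts N (G \<mu>) y) (ts N (H (\<nu> - \<mu>)) y))) (cm \<nu>)) =
        (\<Sum>(\<nu>, \<mu>)\<in>(SIGMA \<nu>:?M. {\<mu>. \<mu> \<le> \<nu>}). mul (cscale (?s \<mu> (\<nu> - \<mu>)) (mul (ts N (G \<mu>) y) (ts N (H (\<nu> - \<mu>)) y))) (cm \<nu>))"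
      using fin by (subst sum.Sigma) auto
    also have "\<dots> = sum t T"
    proof (rule sum.reindex_bij_witness[where i = "\<lambda>(\<mu>, \<kappa>). (\<mu> + \<kappa>, \<mu>)" and j = "\<lambda>(\<nu>, \<mu>). (\<mu>, \<nu> - \<mu>)"], goal_cases)
      case (1 x)
      then show ?case by (auto simp: multi_add_diff)
    next
      case (2 x)
      then show ?case by (auto simp: T_def multi_add_diff)
    next
      case (3 x)
      then show ?case by (cases x) (auto simp: fun_eq_iff)
    next
      case (4 x)
      then show ?case by (auto simp: T_def le_fun_def)
    next
      case (5 x)
      then show ?case by (auto simp: t_def multi_add_diff)
    qed
    finally show ?thesis .
  qed
  moreover have "mul (Su N G y) (Su N H y) = sum t (?M \<times> ?M - T) + sum t T"
  proof -
    have "mul (mul (ts N (G \<mu>) y) (cm \<mu>)) (mul (ts N (H \<kappa>) y) (cm \<kappa>)) = t (\<mu>, \<kappa>)" for \<mu> \<kappa>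
    proof -
      have "mul (mul (ts N (G \<mu>) y) (cm \<mu>)) (mul (ts N (H \<kappa>) y) (cm \<kappa>)) =
          mul (ts N (G \<mu>) y) (mul (mul (cm \<mu>) (ts N (H \<kappa>) y)) (cm \<kappa>))"
        by (simp only: cmul_assoc)
      \<comment> \<open>Taylor sums have degree zero, so this exchange costs no sign; all signs come
        from the two monomials.\<close>
      also have "mul (cm \<mu>) (ts N (H \<kappa>) y) = mul (ts N (H \<kappa>) y) (cm \<mu>)"
        by (rule cmul_central[OF cgrade_taylor_sum[OF h_grade], symmetric])
      also have "mul (ts N (G \<mu>) y) (mul (mul (ts N (H \<kappa>) y) (cm \<mu>)) (cm \<kappa>)) =
          mul (mul (ts N (G \<mu>) y) (ts N (H \<kappa>) y)) (mul (cm \<mu>) (cm \<kappa>))"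
        by (simp only: cmul_assoc)
      also have "\<dots> = t (\<mu>, \<kappa>)"
        using cmonomial_mult[OF z_grade refl] by (simp add: t_def cmul_scale_left cmul_scale_right)
      finally show ?thesis .
    qed
    then have "mul (Su N G y) (Su N H y) = sum t (?M \<times> ?M)"
      by (simp add: subst_upto_def cmul_sum_left) (simp add: cmul_sum_right sum.cartesian_product)
    also have "\<dots> = sum t (?M \<times> ?M - T) + sum t T"
      by (rule sum.subset_diff[OF T_sub]) simp
    finally show ?thesis .
  qed
  moreover have "sum t (?M \<times> ?M - T) \<in> corder q (Suc N)"
  proof (rule corder_sum)
    fix x assume x: "x \<in> ?M \<times> ?M - T"
    obtain \<mu> \<kappa> where \<mu>\<kappa>: "x = (\<mu>, \<kappa>)" by (cases x)
    have "cm (\<mu> + \<kappa>) \<in> corder q (Suc N)"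
    \<comment> \<open>A pair outside \<open>T\<close> either has an admissible sum of too high
      degree, or an inadmissible sum, and then the combined monomial is 0 since some anticommuting
      factor is repeated.\<close>
    proof (cases "\<mu> + \<kappa> \<in> multi_index n v \<sigma>")
      case True
      then have "Suc N \<le> total_degree v (\<mu> + \<kappa>)" using x \<mu>\<kappa> by (auto simp: T_def multi_upto_def)
      then show ?thesis by (rule cm_order)
    next
      case False
      moreover have "\<forall>a\<ge>v. (\<mu> + \<kappa>) a = 0" using x \<mu>\<kappa> by (auto simp: multi_upto_def multi_index_def)
      ultimately have "cm (\<mu> + \<kappa>) = 0" using cmonomial_eq_0[of v z q \<tau> \<sigma> "\<mu> + \<kappa>" n] z_grade by blast
      then show ?thesis by simp
    qed
    then show "t x \<in> corder q (Suc N)"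
      unfolding \<mu>\<kappa> t_def split_conv by (rule corder_cmul_right)
  qed
  ultimately have "Su N (series_mult n v \<sigma> G H) y - mul (Su N G y) (Su N H y) \<in> corder q (Suc N)"
    using corder_diff[of "Su N (series_mult n v \<sigma> G H) y - sum t T" q "Suc N" "sum t (?M \<times> ?M - T)"]
    by (simp add: algebra_simps)
  moreover have "Su N F y - S F y \<in> corder q (Suc N)" for F
    using corder_diff[OF corder_0(2) subst_approx[of F y N]] by simp
  then have "mul (Su N G y) (Su N H y) - mul (S G y) (S H y) \<in> corder q (Suc N)"
    by (intro cmul_cong_corder)
  ultimately have "(Su N (series_mult n v \<sigma> G H) y - mul (Su N G y) (Su N H y)) +
      (mul (Su N G y) (Su N H y) - mul (S G y) (S H y)) \<in> corder q (Suc N)"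
    by (rule corder_add)
  then show "Su N (series_mult n v \<sigma> G H) y - mul (S G y) (S H y) \<in> corder q (Suc N)" by simp
qed

text \<open>Stated modulo order \<open>Suc N\<close> because for \<kappa> of degree above
  \<open>N\<close> the truncated sum is empty; the missing monomial then has order above
  \<open>N\<close> itself.\<close>

lemma subst_term_approx:
  assumes "openin (Euclidean_space u) V" "y \<in> V" "\<kappa> \<in> multi_index n v \<sigma>"
  shows "Su N (series_term V f \<kappa>) y - mul (ts N f y) (cm \<kappa>) \<in> corder q (Suc N)"
proof -
  have "ts N (series_term V f \<kappa> \<nu>) y = (if \<nu> = \<kappa> then ts N f y else 0)" for \<nu>
  proof (cases "\<nu> = \<kappa>")
    case True
    have "taylor n q \<tau> u h k (series_term V f \<kappa> \<kappa>) y = taylor n q \<tau> u h k f y" for k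
      by (rule taylor_cong[OF assms(1,2)]) (simp add: series_term_def)
    then show ?thesis using True by (simp add: taylor_sum_def)
  next
    case False
    then have "series_term V f \<kappa> \<nu> = (\<lambda>_. 0)" by (simp add: series_term_def)
    then show ?thesis using False by (simp add: taylor_sum_def taylor_zero)
  qed
  then have *: "Su N (series_term V f \<kappa>) y = (\<Sum>\<nu>\<in>multi_upto n v \<sigma> N. if \<nu> = \<kappa> then mul (ts N f y) (cm \<kappa>) else 0)"
    unfolding subst_upto_def by (intro sum.cong) auto
  show ?thesis
  proof (cases "\<kappa> \<in> multi_upto n v \<sigma> N")
    case True
    then show ?thesis unfolding * by (simp add: sum.delta)
  next
    case False
    then have "Suc N \<le> total_degree v \<kappa>" using assms(3) by (simp add: multi_upto_def)
    then have "cm \<kappa> \<in> corder q (Suc N)" by (rule cm_order)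
    then have "mul (ts N f y) (cm \<kappa>) \<in> corder q (Suc N)" by (rule corder_cmul_right)
    then have "0 - mul (ts N f y) (cm \<kappa>) \<in> corder q (Suc N)" by (rule corder_diff[OF corder_0(2)])
    moreover have "Su N (series_term V f \<kappa>) y = 0" using False unfolding * by (simp add: sum.delta)
    ultimately show ?thesis by simp
  qed
qed

lemma taylor_sum_const: "ts N (\<lambda>_. c) y = cconst c"
proof -
  have "ts N (\<lambda>_. c) y = (\<Sum>k\<in>{0}. taylor n q \<tau> u h k (\<lambda>_. c) y)"
    unfolding taylor_sum_def
  proof (rule sum.mono_neutral_right)
    show "\<forall>k\<in>{..N} - {0}. taylor n q \<tau> u h k (\<lambda>_. c) y = 0"
    proof
      fix k assume "k \<in> {..N} - {0}"
      then obtain l where "k = Suc l" by (cases k) auto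
      then show "taylor n q \<tau> u h k (\<lambda>_. c) y = 0" using taylor_const_Suc by blast
    qed
  qed auto
  then show ?thesis by simp
qed

lemma cmonomial_0: "cm 0 = cconst 1"
proof -
  have "cmonomial n q \<tau> w z 0 = cconst 1" for w by (induction w) auto
  then show ?thesis .
qed

lemma subst_const:
  assumes "openin (Euclidean_space u) V" "y \<in> V"
  shows "S (series_term V (\<lambda>_. c) 0) y = cconst c"
  using subst_term_approx[OF assms zero_multi_index, of _ "\<lambda>_. c"]
  by (intro subst_eqI) (simp add: taylor_sum_const cmonomial_0)

lemma subst_formal_var:
  assumes V: "openin (Euclidean_space u) V" "y \<in> V" and b: "b < v"
  shows "S (formal_var V b) y = z b"
proof -
  define e where "e = (\<lambda>a. if a = b then 1 else 0 :: nat)"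
  have "e \<in> multi_index n v \<sigma>" using b by (auto simp: e_def multi_index_def)
  note * = subst_term_approx[OF V this, of _ "\<lambda>_. 1"]
  have "cmonomial n q \<tau> w z e = (if b < w then z b else cconst 1)" if "w \<le> v" for w
    using that z_admissible[OF b] by (induction w) (auto simp: e_def less_Suc_eq)
  then have "cm e = z b" using b by simp
  then show ?thesis using * z_admissible[OF b]
    by (intro subst_eqI) (simp add: formal_var_def e_def taylor_sum_const)
qed

lemma subst_coord_fun:
  assumes V: "openin (Euclidean_space u) V" "y \<in> V" and j: "j < u"
  shows "S (coord_fun V j) y = cconst (y j) + h j"
proof (rule subst_eqI)
  fix N
  let ?t = "\<lambda>k. taylor n q \<tau> u h k (\<lambda>y. y j) y"
  have t1: "?t (Suc 0) = h j"
  proof -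
    have "mul (h i) (cconst (if i = j then 1 else 0)) = (if i = j then h i else 0)" if "i < u" for i
      using h_admissible[OF that] by (simp add: cmul_const_right)
    then have "?t (Suc 0) = (\<Sum>i<u. if i = j then h i else 0)"
      by (simp add: partial_deriv_coord)
    then show ?thesis using j by simp
  qed
  have t2: "?t (Suc (Suc k)) = 0" for k
    by (simp add: partial_deriv_coord partial_deriv_const taylor_zero)
  have "ts N (\<lambda>y. y j) y - (cconst (y j) + h j) \<in> corder q (Suc N)"
  proof (cases N)
    \<comment> \<open>Only the constant term is kept here, and the missing \<open>h j\<close> has
      order 1. For larger \<open>N\<close> the expansion stops after the first derivative.\<close>
    case 0
    then show ?thesis using corder_diff[OF corder_0(2) h_order[OF j]] by (simp add: taylor_sum_def)
  next
    case (Suc M)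
    have "ts N (\<lambda>y. y j) y = (\<Sum>k\<in>{0, Suc 0}. ?t k)"
      unfolding taylor_sum_def
    proof (rule sum.mono_neutral_right)
      show "\<forall>k\<in>{..N} - {0, Suc 0}. ?t k = 0"
      proof
        fix k assume "k \<in> {..N} - {0, Suc 0}"
        then obtain l where "k = Suc (Suc l)" by (metis DiffD2 insertCI not0_implies_Suc)
        then show "?t k = 0" using t2 by blast
      qed
    qed (use Suc in auto)
    also have "\<dots> = cconst (y j) + h j" using t1 by (simp del: taylor.simps(2))
    finally show ?thesis by simp
  qed
  moreover have "Su N (coord_fun V j) y - ts N (\<lambda>y. y j) y \<in> corder q (Suc N)"
    using subst_term_approx[OF V zero_multi_index, of N "\<lambda>y. y j"]
    by (simp add: cmonomial_0 coord_fun_def flip: zero_fun_def)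
  ultimately have "(Su N (coord_fun V j) y - ts N (\<lambda>y. y j) y) + (ts N (\<lambda>y. y j) y - (cconst (y j) + h j)) \<in> corder q (Suc N)"
    by (rule corder_add[rotated])
  then show "Su N (coord_fun V j) y - (cconst (y j) + h j) \<in> corder q (Suc N)"
    by (simp only: add_diff_eq diff_add_cancel)
qed

end

subsection \<open>Smooth dependence on parameters\<close>

definition csmooth :: "nat \<Rightarrow> (nat \<Rightarrow> real) set \<Rightarrow> ((nat \<Rightarrow> real) \<Rightarrow> coeffs) \<Rightarrow> bool" where
  "csmooth p U a \<longleftrightarrow> (\<forall>\<mu>. smooth p U (\<lambda>x. a x \<mu>))"

lemma csmooth_sum:
  "openin (Euclidean_space p) U \<Longrightarrow> (\<And>i. i \<in> I \<Longrightarrow> csmooth p U (a i)) \<Longrightarrow> csmooth p U (\<lambda>x. \<Sum>i\<in>I. a i x)"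
  unfolding csmooth_def by (simp add: sum_coeffs_apply smooth_sum)

lemma csmooth_cmul:
  "openin (Euclidean_space p) U \<Longrightarrow> csmooth p U a \<Longrightarrow> csmooth p U b \<Longrightarrow> csmooth p U (\<lambda>x. cmul n q \<tau> (a x) (b x))"
  unfolding csmooth_def
proof
  fix \<nu>
  assume *: "openin (Euclidean_space p) U" "\<forall>\<mu>. smooth p U (\<lambda>x. a x \<mu>)" "\<forall>\<mu>. smooth p U (\<lambda>x. b x \<mu>)"
  show "smooth p U (\<lambda>x. cmul n q \<tau> (a x) (b x) \<nu>)"
    by (cases "\<nu> \<in> multi_index n q \<tau>") (use * in \<open>auto simp: cmul_def intro!: smooth_sum smooth_mult smooth_const\<close>)
qed

lemma csmooth_scale: "openin (Euclidean_space p) U \<Longrightarrow> csmooth p U a \<Longrightarrow> csmooth p U (\<lambda>x. cscale r (a x))"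
  unfolding csmooth_def cscale_def by (auto intro!: smooth_mult smooth_const)

lemma csmooth_const: "openin (Euclidean_space p) U \<Longrightarrow> smooth p U f \<Longrightarrow> csmooth p U (\<lambda>x. cconst (f x))"
  unfolding csmooth_def cconst_def
proof
  show "openin (Euclidean_space p) U \<Longrightarrow> smooth p U f \<Longrightarrow> smooth p U (\<lambda>x. if \<mu> = 0 then f x else 0)" for \<mu> :: "nat \<Rightarrow> nat"
    by (cases "\<mu> = 0") (auto intro: smooth_const)
qed

lemma csmooth_taylor:
  assumes U: "openin (Euclidean_space p) U" and V: "openin (Euclidean_space u) V"
    and f: "\<And>x. x \<in> U \<Longrightarrow> f x \<in> V" "\<And>j. j < u \<Longrightarrow> smooth p U (\<lambda>x. f x j)"
    and h: "\<And>j. j < u \<Longrightarrow> csmooth p U (\<lambda>x. h x j)"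
  shows "smooth u V g \<Longrightarrow> csmooth p U (\<lambda>x. taylor n q \<tau> u (h x) k g (f x))"
proof (induction k arbitrary: g)
  case 0
  have "smooth p U (\<lambda>x. g (f x))" by (rule smooth_compose[OF V U f]) (use 0 in auto)
  then show ?case by (simp add: csmooth_const[OF U])
next
  case (Suc k)
  then show ?case
    using h smooth_partial_deriv by (auto intro!: csmooth_scale[OF U] csmooth_sum[OF U] csmooth_cmul[OF U])
qed

lemma csmooth_cpow: "openin (Euclidean_space p) U \<Longrightarrow> csmooth p U z \<Longrightarrow> csmooth p U (\<lambda>x. cpow n q \<tau> (z x) k)"
  by (induction k) (auto intro: csmooth_cmul csmooth_const smooth_const)

lemma csmooth_cmonomial:
  "openin (Euclidean_space p) U \<Longrightarrow> (\<And>b. b < v \<Longrightarrow> csmooth p U (\<lambda>x. z x b)) \<Longrightarrow>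
     csmooth p U (\<lambda>x. cmonomial n q \<tau> v (z x) \<nu>)"
  by (induction v) (auto intro!: csmooth_cmul csmooth_cpow csmooth_const smooth_const)

text \<open>Each coefficient is taken from one truncation, hence is a finite polynomial expression
  in the coefficients of \<open>h\<close> and \<open>z\<close> and in derivatives of
  \<open>G\<close> composed with \<open>f\<close>.\<close>

lemma csmooth_subst:
  assumes U: "openin (Euclidean_space p) U" and V: "openin (Euclidean_space u) V"
    and f: "\<And>x. x \<in> U \<Longrightarrow> f x \<in> V" "\<And>j. j < u \<Longrightarrow> smooth p U (\<lambda>x. f x j)"
    and h: "\<And>j. j < u \<Longrightarrow> csmooth p U (\<lambda>x. h x j)"
    and z: "\<And>b. b < v \<Longrightarrow> csmooth p U (\<lambda>x. z x b)"
    and G: "\<And>\<nu>. smooth u V (G \<nu>)"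
  shows "csmooth p U (\<lambda>x. subst n q \<tau> u v \<sigma> (h x) (z x) G (f x))"
proof -
  have "csmooth p U (\<lambda>x. subst_upto n q \<tau> u v \<sigma> (h x) (z x) N G (f x))" for N
    unfolding subst_upto_def taylor_sum_def
    by (intro csmooth_sum csmooth_cmul csmooth_cmonomial csmooth_taylor[OF U V f h] U z G)
  then show ?thesis by (simp add: csmooth_def subst_def)
qed

section \<open>The algebras of a superdomain\<close>

lemma series_algebra_simps [simp]:
  "carrier (series_algebra n p q \<tau> V) = series_carrier n p q \<tau> V"
  "F \<otimes>\<^bsub>series_algebra n p q \<tau> V\<^esub> G = series_mult n q \<tau> F G"
  "\<one>\<^bsub>series_algebra n p q \<tau> V\<^esub> = series_term V (\<lambda>_. 1) 0"
  "\<zero>\<^bsub>series_algebra n p q \<tau> V\<^esub> = 0"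
  "F \<oplus>\<^bsub>series_algebra n p q \<tau> V\<^esub> G = F + G"
  "r \<odot>\<^bsub>series_algebra n p q \<tau> V\<^esub> F = (\<lambda>\<mu> x. r * F \<mu> x)"
  by (simp_all add: series_algebra_def fun_eq_iff zero_fun_def)

definition coeffs_at :: "(nat \<Rightarrow> real) \<Rightarrow> power_series \<Rightarrow> coeffs" where
  "coeffs_at x F = (\<lambda>\<mu>. F \<mu> x)"

definition series_of :: "(nat \<Rightarrow> real) set \<Rightarrow> ((nat \<Rightarrow> real) \<Rightarrow> coeffs) \<Rightarrow> power_series" where
  "series_of V a = (\<lambda>\<mu> x. if x \<in> V then a x \<mu> else 0)"

definition cut :: "(nat \<Rightarrow> real) set \<Rightarrow> power_series \<Rightarrow> power_series" where
  "cut W F = (\<lambda>\<mu> x. if x \<in> W then F \<mu> x else 0)"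

lemma coeffs_at_simps [simp]:
  "coeffs_at x (F + G) = coeffs_at x F + coeffs_at x G"
  "coeffs_at x (F - G) = coeffs_at x F - coeffs_at x G"
  "coeffs_at x 0 = 0"
  "coeffs_at x (\<lambda>\<mu> x. r * F \<mu> x) = cscale r (coeffs_at x F)"
  "coeffs_at x (series_mult n q \<tau> F G) = cmul n q \<tau> (coeffs_at x F) (coeffs_at x G)"
  "coeffs_at x (series_of V a) = (if x \<in> V then a x else 0)"
  "coeffs_at x (cut W F) = (if x \<in> W then coeffs_at x F else 0)"
  "coeffs_at x (series_term V f 0) = (if x \<in> V then cconst (f x) else 0)"
  by (auto simp: coeffs_at_def series_mult_eq series_of_def cut_def series_term_def cconst_def cscale_def fun_eq_iff)

lemma series_eqI: "(\<And>x. coeffs_at x F = coeffs_at x G) \<Longrightarrow> F = G"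
  by (auto simp: coeffs_at_def fun_eq_iff)

lemma series_carrier_iff:
  assumes "openin (Euclidean_space p) V"
  shows "F \<in> series_carrier n p q \<tau> V \<longleftrightarrow>
    csmooth p V (\<lambda>x. coeffs_at x F) \<and> (\<forall>x. admissible n q \<tau> (coeffs_at x F)) \<and>
    (\<forall>x. x \<notin> V \<longrightarrow> coeffs_at x F = 0)"
  unfolding series_carrier_def csmooth_def coeffs_at_def admissible_def C_infinity_iff[OF assms]
  by (auto simp: fun_eq_iff)

lemma series_carrier_eqI:
  assumes "openin (Euclidean_space p) V" "F \<in> series_carrier n p q \<tau> V" "G \<in> series_carrier n p q \<tau> V"
    and "\<And>x. x \<in> V \<Longrightarrow> coeffs_at x F = coeffs_at x G"
  shows "F = G"
proof (rule series_eqI)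
  fix x show "coeffs_at x F = coeffs_at x G"
    using assms by (cases "x \<in> V") (auto simp: series_carrier_iff)
qed

lemma csmooth_subset: "csmooth p V a \<Longrightarrow> W \<subseteq> V \<Longrightarrow> csmooth p W a"
  by (auto simp: csmooth_def intro: smooth_subset)

lemma csmooth_add:
  "openin (Euclidean_space p) V \<Longrightarrow> csmooth p V a \<Longrightarrow> csmooth p V b \<Longrightarrow> csmooth p V (\<lambda>x. a x + b x)"
  by (auto simp: csmooth_def intro: smooth_add)

lemma csmooth_diff:
  assumes "openin (Euclidean_space p) V" "csmooth p V a" "csmooth p V b"
  shows "csmooth p V (\<lambda>x. a x - b x)"
proof -
  have *: "(\<lambda>x. a x - b x) = (\<lambda>x. a x + cscale (-1) (b x))" by (auto simp: cscale_def fun_eq_iff)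
  show ?thesis unfolding * by (intro csmooth_add csmooth_scale assms)
qed

lemma csmooth_cong:
  assumes "openin (Euclidean_space p) V" "\<And>x. x \<in> V \<Longrightarrow> a x = b x"
  shows "csmooth p V a \<longleftrightarrow> csmooth p V b"
  unfolding csmooth_def using smooth_cong[OF assms(1)] assms(2) by metis

lemma csmooth_coeffs: "csmooth p V (\<lambda>x. a x) \<Longrightarrow> smooth p V (\<lambda>x. a x \<mu>)"
  by (simp add: csmooth_def)

lemma series_of_carrier:
  assumes V: "openin (Euclidean_space p) V" and "csmooth p V a" "\<And>x. x \<in> V \<Longrightarrow> admissible n q \<tau> (a x)"
  shows "series_of V a \<in> series_carrier n p q \<tau> V"
  using assms(2,3) csmooth_cong[OF V, of "\<lambda>x. if x \<in> V then a x else 0" a]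
  by (simp add: series_carrier_iff[OF V])

lemma series_carrier_closed:
  assumes V: "openin (Euclidean_space p) V"
  shows "F \<in> series_carrier n p q \<tau> V \<Longrightarrow> G \<in> series_carrier n p q \<tau> V \<Longrightarrow> F + G \<in> series_carrier n p q \<tau> V"
    and "F \<in> series_carrier n p q \<tau> V \<Longrightarrow> G \<in> series_carrier n p q \<tau> V \<Longrightarrow> F - G \<in> series_carrier n p q \<tau> V"
    and "F \<in> series_carrier n p q \<tau> V \<Longrightarrow> (\<lambda>\<mu> x. r * F \<mu> x) \<in> series_carrier n p q \<tau> V"
    and "F \<in> series_carrier n p q \<tau> V \<Longrightarrow> G \<in> series_carrier n p q \<tau> V \<Longrightarrow> series_mult n q \<tau> F G \<in> series_carrier n p q \<tau> V"
    and "0 \<in> series_carrier n p q \<tau> V"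
    and "smooth p V f \<Longrightarrow> series_term V f 0 \<in> series_carrier n p q \<tau> V"
proof -
  show "series_term V f 0 \<in> series_carrier n p q \<tau> V" if "smooth p V f"
    using csmooth_cong[OF V, of "\<lambda>x. if x \<in> V then cconst (f x) else 0" "\<lambda>x. cconst (f x)"]
      csmooth_const[OF V that] by (auto simp: series_carrier_iff[OF V])
qed (auto simp: series_carrier_iff[OF V] csmooth_add[OF V] csmooth_diff[OF V] csmooth_scale[OF V] csmooth_cmul[OF V],
    auto simp: csmooth_def smooth_const[OF V])

lemma series_carrier_sum:
  assumes V: "openin (Euclidean_space p) V"
  shows "(\<And>i. i \<in> I \<Longrightarrow> F i \<in> series_carrier n p q \<tau> V) \<Longrightarrow> (\<Sum>i\<in>I. F i) \<in> series_carrier n p q \<tau> V"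
  by (induction I rule: infinite_finite_induct) (auto simp: series_carrier_closed[OF V])

lemma cut_carrier:
  assumes "openin (Euclidean_space p) V" "openin (Euclidean_space p) W" "W \<subseteq> V" "F \<in> series_carrier n p q \<tau> V"
  shows "cut W F \<in> series_carrier n p q \<tau> W"
  using assms csmooth_subset[of p V "\<lambda>x. coeffs_at x F" W]
    csmooth_cong[OF assms(2), of "\<lambda>x. if x \<in> W then coeffs_at x F else 0" "\<lambda>x. coeffs_at x F"]
  by (simp add: series_carrier_iff)

lemma cut_simps [simp]:
  "cut W (F + G) = cut W F + cut W G"
  "cut W (F - G) = cut W F - cut W G"
  "cut W 0 = 0"
  "cut W (\<lambda>\<mu> x. r * F \<mu> x) = (\<lambda>\<mu> x. r * cut W F \<mu> x)"
  "cut W (series_mult n q \<tau> F G) = series_mult n q \<tau> (cut W F) (cut W G)"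
  "cut W (cut V F) = cut (V \<inter> W) F"
  by (rule series_eqI; auto)+

lemma cut_term: "W \<subseteq> V \<Longrightarrow> cut W (series_term V f \<mu>) = series_term W f \<mu>"
  by (auto simp: cut_def series_term_def fun_eq_iff)

lemma cut_carrier_id:
  "openin (Euclidean_space p) V \<Longrightarrow> F \<in> series_carrier n p q \<tau> V \<Longrightarrow> cut V F = F"
  by (rule series_eqI) (auto simp: series_carrier_iff)

lemma ring_series_algebra:
  assumes V: "openin (Euclidean_space p) V"
  shows "ring (series_algebra n p q \<tau> V)"
proof (rule ringI)
  note c = series_carrier_closed[OF V]
  note adm = series_carrier_iff[OF V]
  have inv: "\<exists>G\<in>series_carrier n p q \<tau> V. F + G = 0" if "F \<in> series_carrier n p q \<tau> V" for F
    using c(2)[OF c(5) that] by (intro bexI[of _ "0 - F"]) auto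
  show "abelian_group (series_algebra n p q \<tau> V)"
    by (rule abelian_groupI) (simp_all add: c inv ac_simps)
  have assoc: "series_mult n q \<tau> (series_mult n q \<tau> F G) H = series_mult n q \<tau> F (series_mult n q \<tau> G H)" for F G H
    by (rule series_eqI) (simp add: cmul_assoc)
  have one: "series_mult n q \<tau> (series_term V (\<lambda>_. 1) 0) F = F" "series_mult n q \<tau> F (series_term V (\<lambda>_. 1) 0) = F"
    if "F \<in> series_carrier n p q \<tau> V" for F
    using that by (auto intro!: series_eqI simp: adm)
  show "Group.monoid (series_algebra n p q \<tau> V)"
    by (rule monoidI) (simp_all add: c smooth_const[OF V] assoc one)
qed (auto intro!: series_eqI simp: cmul_add_left cmul_add_right)

lemma series_grade_iff:
  "F \<in> grade (series_algebra n p q \<tau> V) i \<longleftrightarrow>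
     F \<in> series_carrier n p q \<tau> V \<and> (\<forall>x. coeffs_at x F \<in> cgrade q \<tau> i)"
  by (auto simp: series_algebra_def coeffs_at_def cgrade_def fun_eq_iff)

lemma superdomain_simps [simp]:
  "base (superdomain n p q \<tau> U) = subtopology (Euclidean_space p) U"
  "sections (superdomain n p q \<tau> U) = series_algebra n p q \<tau>"
  "rstr (superdomain n p q \<tau> U) V W = cut W"
  by (auto simp: superdomain_def cut_def fun_eq_iff)

lemma openin_superdomain_iff:
  assumes "openin (Euclidean_space p) U"
  shows "openin (subtopology (Euclidean_space p) U) W \<longleftrightarrow> openin (Euclidean_space p) W \<and> W \<subseteq> U"
  using assms openin_open_subtopology by blast

lemma cut_ring_hom:
  assumes "openin (Euclidean_space p) V" "openin (Euclidean_space p) W" "W \<subseteq> V"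
  shows "cut W \<in> ring_hom (series_algebra n p q \<tau> V) (series_algebra n p q \<tau> W)"
  by (rule ring_hom_memI) (use assms in \<open>auto simp: cut_carrier cut_term\<close>)

subsection \<open>Invertible series\<close>

text \<open>The geometric series, meant for families of positive order: a coefficient receives
  contributions only from powers up to its total degree.\<close>

definition cgeometric :: "nat \<Rightarrow> nat \<Rightarrow> (nat \<Rightarrow> degree) \<Rightarrow> coeffs \<Rightarrow> coeffs" where
  "cgeometric n q \<tau> a = (\<lambda>\<mu>. (\<Sum>k\<le>total_degree q \<mu>. cpow n q \<tau> a k) \<mu>)"

lemma cgeometric_approx:
  assumes "a \<in> corder q 1"
  shows "cgeometric n q \<tau> a - (\<Sum>k\<le>N. cpow n q \<tau> a k) \<in> corder q (Suc N)"
  unfolding corder_def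
proof (intro CollectI allI impI)
  fix \<mu> assume "total_degree q \<mu> < Suc N"
  then have "(\<Sum>k\<le>N. cpow n q \<tau> a k) =
      (\<Sum>k\<in>{..N} - {..total_degree q \<mu>}. cpow n q \<tau> a k) + (\<Sum>k\<le>total_degree q \<mu>. cpow n q \<tau> a k)"
    by (intro sum.subset_diff) auto
  moreover have "(\<Sum>k\<in>{..N} - {..total_degree q \<mu>}. cpow n q \<tau> a k) \<in> corder q (Suc (total_degree q \<mu>))"
    by (intro corder_sum corder_mono[OF corder_cpow[OF assms]]) auto
  ultimately show "(cgeometric n q \<tau> a - (\<Sum>k\<le>N. cpow n q \<tau> a k)) \<mu> = 0"
    by (simp add: cgeometric_def corder_def)
qed

lemma admissible_cgeometric [simp]: "admissible n q \<tau> (cgeometric n q \<tau> a)"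
proof -
  have "admissible n q \<tau> (\<Sum>k\<le>N. cpow n q \<tau> a k)" for N by (simp add: admissible_sum)
  then show ?thesis by (simp add: admissible_def cgeometric_def)
qed

text \<open>The partial sums telescope to 1 minus a power of order \<open>Suc N\<close>. They
  commute with \<open>a\<close>, which gives the inverse on both sides although the algebra is not
  commutative.\<close>

lemma cgeometric_inverse:
  assumes "a \<in> corder q 1" "admissible n q \<tau> a"
  shows "cmul n q \<tau> (cconst 1 - a) (cgeometric n q \<tau> a) = cconst 1" (is ?R)
    and "cmul n q \<tau> (cgeometric n q \<tau> a) (cconst 1 - a) = cconst 1" (is ?L)
proof -
  define P where "P = (\<lambda>N. \<Sum>k\<le>N. cpow n q \<tau> a k)"
  have P: "admissible n q \<tau> (P N)" for N by (simp add: P_def admissible_sum)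
  have shift: "cmul n q \<tau> (cpow n q \<tau> a k) a = cpow n q \<tau> a (Suc k)" for k
    using cpow_add[of n q \<tau> a k 1] assms(2) by simp
  have 1: "cmul n q \<tau> (cconst 1 - a) (P N) = cconst 1 - cpow n q \<tau> a (Suc N)" for N
  proof (induction N)
    case 0
    have "cmul n q \<tau> (cconst 1 - a) (cconst 1) = cconst 1 - cmul n q \<tau> a (cconst 1)"
      using assms(2) by (simp only: cmul_one admissible_simps)
    then show ?case unfolding P_def by (simp only: atMost_0 sum.insert finite.emptyI empty_iff not_False_eq_True sum.empty add_0_right cpow.simps)
  next
    case (Suc N)
    have "P (Suc N) = P N + cpow n q \<tau> a (Suc N)" by (simp add: P_def)
    then have "cmul n q \<tau> (cconst 1 - a) (P (Suc N)) =
        cmul n q \<tau> (cconst 1 - a) (P N) + cmul n q \<tau> (cconst 1 - a) (cpow n q \<tau> a (Suc N))"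
      by (simp only: cmul_add_right)
    also have "\<dots> = (cconst 1 - cpow n q \<tau> a (Suc N)) + (cpow n q \<tau> a (Suc N) - cpow n q \<tau> a (Suc (Suc N)))"
      unfolding Suc.IH by (simp add: cmul_diff_left)
    also have "\<dots> = cconst 1 - cpow n q \<tau> a (Suc (Suc N))"
      by (simp only: add_diff_eq diff_add_cancel)
    finally show ?case .
  qed
  have 2: "cmul n q \<tau> (P N) (cconst 1 - a) = cconst 1 - cpow n q \<tau> a (Suc N)" for N
  proof -
    have "cmul n q \<tau> (P N) a = cmul n q \<tau> a (P N)"
      unfolding P_def cmul_sum_left cmul_sum_right shift by simp
    then have "cmul n q \<tau> (P N) (cconst 1 - a) = cmul n q \<tau> (cconst 1 - a) (P N)"
      using P by (simp add: cmul_diff_left cmul_diff_right)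
    then show ?thesis using 1 by simp
  qed
  have pow: "0 - cpow n q \<tau> a (Suc N) \<in> corder q (Suc N)" for N
    by (intro corder_diff corder_cpow assms) simp
  have G: "cgeometric n q \<tau> a - P N \<in> corder q (Suc N)" for N
    unfolding P_def by (rule cgeometric_approx[OF assms(1)])
  have triv: "(cconst 1 - a) - (cconst 1 - a) \<in> corder q (Suc N)" for N by simp
  show ?R
  proof (rule corder_eqI[where q = q])
    fix N
    show "cmul n q \<tau> (cconst 1 - a) (cgeometric n q \<tau> a) - cconst 1 \<in> corder q (Suc N)"
      using corder_add[OF cmul_cong_corder[OF triv G, of n \<tau>] pow] 1 by (simp del: cpow.simps)
  qed
  show ?L
  proof (rule corder_eqI[where q = q])
    fix N
    show "cmul n q \<tau> (cgeometric n q \<tau> a) (cconst 1 - a) - cconst 1 \<in> corder q (Suc N)"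
      using corder_add[OF cmul_cong_corder[OF G triv, of n \<tau>] pow] 2 by (simp del: cpow.simps)
  qed
qed

text \<open>A series with nowhere vanishing body is its body times 1 - N, where N has no body; the
  geometric series in N inverts the second factor. Smoothness holds because each coefficient is a
  finite sum of products.\<close>

lemma series_Units:
  assumes V: "openin (Euclidean_space p) V" and F: "F \<in> series_carrier n p q \<tau> V"
    and nz: "\<And>x. x \<in> V \<Longrightarrow> F 0 x \<noteq> 0"
  shows "F \<in> Units (series_algebra n p q \<tau> V)"
proof -
  define c where "c = (\<lambda>x. coeffs_at x F)"
  define N where "N = (\<lambda>x. cconst 1 - cscale (inverse (F 0 x)) (c x))"
  define b where "b = (\<lambda>x. cscale (inverse (F 0 x)) (cgeometric n q \<tau> (N x)))"
  have adm: "admissible n q \<tau> (c x)" for x using F by (simp add: c_def series_carrier_iff[OF V])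
  have N: "N x \<in> corder q 1" "admissible n q \<tau> (N x)" if "x \<in> V" for x
  proof -
    show "admissible n q \<tau> (N x)" using adm by (simp add: N_def)
    then show "N x \<in> corder q 1" using nz[OF that]
      by (subst corder_one_iff) (auto simp: N_def cconst_def cscale_def c_def coeffs_at_def)
  qed
  have c_eq: "cscale (inverse (F 0 x)) (c x) = cconst 1 - N x" for x by (simp add: N_def)
  have inv: "cmul n q \<tau> (c x) (b x) = cconst 1" "cmul n q \<tau> (b x) (c x) = cconst 1" if "x \<in> V" for x
  proof -
    have "cmul n q \<tau> (c x) (b x) = cmul n q \<tau> (cscale (inverse (F 0 x)) (c x)) (cgeometric n q \<tau> (N x))"
      by (simp add: b_def cmul_scale_left cmul_scale_right)
    then show "cmul n q \<tau> (c x) (b x) = cconst 1" unfolding c_eq using cgeometric_inverse N that by simp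
    have "cmul n q \<tau> (b x) (c x) = cmul n q \<tau> (cgeometric n q \<tau> (N x)) (cscale (inverse (F 0 x)) (c x))"
      by (simp add: b_def cmul_scale_left cmul_scale_right)
    then show "cmul n q \<tau> (b x) (c x) = cconst 1" unfolding c_eq using cgeometric_inverse N that by simp
  qed
  have c_smooth: "csmooth p V c" using F by (simp add: c_def[abs_def] series_carrier_iff[OF V])
  have "smooth p V (\<lambda>x. inverse (F 0 x))"
    using csmooth_coeffs[OF c_smooth, of 0] nz by (intro smooth_inverse[OF V]) (auto simp: c_def coeffs_at_def)
  then have sc: "csmooth p V (\<lambda>x. cscale (inverse (F 0 x)) (a x))" if "csmooth p V a" for a
    using that by (auto simp: csmooth_def cscale_def intro!: smooth_mult[OF V])
  have "csmooth p V N" unfolding N_def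
    by (intro csmooth_diff[OF V] sc c_smooth csmooth_const[OF V] smooth_const[OF V])
  then have "csmooth p V (\<lambda>x. \<Sum>k\<le>l. cpow n q \<tau> (N x) k)" for l
    by (intro csmooth_sum csmooth_cpow V)
  then have "csmooth p V (\<lambda>x. cgeometric n q \<tau> (N x))"
    unfolding csmooth_def cgeometric_def by blast
  then have "csmooth p V b" unfolding b_def by (rule sc)
  then have b: "series_of V b \<in> series_carrier n p q \<tau> V"
    by (intro series_of_carrier[OF V]) (auto simp: b_def)
  have "series_mult n q \<tau> (series_of V b) F = series_term V (\<lambda>_. 1) 0"
    "series_mult n q \<tau> F (series_of V b) = series_term V (\<lambda>_. 1) 0"
    using inv by (auto intro!: series_eqI simp: c_def)
  then show ?thesis using F b by (auto simp: Units_def)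
qed

section \<open>Families of pullbacks\<close>

definition pre :: "'m set \<Rightarrow> ('m \<Rightarrow> 'k) \<Rightarrow> 'k set \<Rightarrow> 'm set" where
  "pre O' \<psi> W = {m \<in> O'. \<psi> m \<in> W}"

text \<open>
  The pullback part of a morphism from the open subset \<open>O'\<close> of \<open>X\<close> to the superdomain
  \<open>(V, C\<^sup>\<infinity>[[\<eta>]])\<close> over \<open>\<psi>\<close>, with prescribed pullbacks \<open>s\<close>, \<open>\<zeta>\<close> of the coordinates; no locality on stalks.
\<close>

definition pullback_family ::
  "nat \<Rightarrow> ('m, 'a) ringed_space \<Rightarrow> 'm set \<Rightarrow> ('m \<Rightarrow> nat \<Rightarrow> real) \<Rightarrow> nat \<Rightarrow> nat \<Rightarrow> (nat \<Rightarrow> degree) \<Rightarrow>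
     (nat \<Rightarrow> real) set \<Rightarrow> (nat \<Rightarrow> 'a) \<Rightarrow> (nat \<Rightarrow> 'a) \<Rightarrow> ((nat \<Rightarrow> real) set \<Rightarrow> power_series \<Rightarrow> 'a) \<Rightarrow> bool" where
  "pullback_family n X O' \<psi> u v \<sigma> V s \<zeta> \<alpha> \<longleftrightarrow>
     (\<forall>W. openin (Euclidean_space u) W \<and> W \<subseteq> V \<longrightarrow>
        \<alpha> W \<in> graded_alg_hom n (series_algebra n u v \<sigma> W) (sections X (pre O' \<psi> W))) \<and>
     (\<forall>W W'. openin (Euclidean_space u) W \<and> openin (Euclidean_space u) W' \<and> W' \<subseteq> W \<and> W \<subseteq> V \<longrightarrow>
        (\<forall>G\<in>series_carrier n u v \<sigma> W. \<alpha> W' (cut W' G) = rstr X (pre O' \<psi> W) (pre O' \<psi> W') (\<alpha> W G))) \<and>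
     (\<forall>j<u. \<alpha> V (coord_fun V j) = s j) \<and> (\<forall>b<v. \<alpha> V (formal_var V b) = \<zeta> b)"

lemma openin_pre:
  assumes U: "openin (Euclidean_space p) U" and W: "openin (Euclidean_space u) W"
    and cont: "\<And>j. j < u \<Longrightarrow> continuous_on U (\<lambda>x. f x j)" and f0: "\<And>x j. x \<in> U \<Longrightarrow> j \<ge> u \<Longrightarrow> f x j = 0"
  shows "openin (Euclidean_space p) (pre U f W)"
proof -
  have sub: "U \<subseteq> topspace (Euclidean_space p)" using U openin_subset by blast
  have "continuous_map (subtopology (Euclidean_space p) U) (Euclidean_space u) (\<lambda>x i. if i < u then f x i else 0)"
    using cont by (simp add: continuous_map_componentwise_Euclidean_space continuous_map_Euclidean_subspace_iff[OF sub])
  then have "openin (subtopology (Euclidean_space p) U)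
      {x \<in> topspace (subtopology (Euclidean_space p) U). (\<lambda>i. if i < u then f x i else 0) \<in> W}"
    using W by (rule openin_continuous_map_preimage)
  moreover have "(\<lambda>i. if i < u then f x i else 0) = f x" if "x \<in> U" for x
    using f0[OF that] by (auto simp: fun_eq_iff)
  then have "{x \<in> topspace (subtopology (Euclidean_space p) U). (\<lambda>i. if i < u then f x i else 0) \<in> W} = pre U f W"
    using sub by (auto simp: pre_def)
  ultimately show ?thesis using U openin_trans_full by fastforce
qed

text \<open>The morphism in coordinates. Over \<open>x\<close> the expansion is centred at
  \<open>f x\<close>, the intended body, and the increments are the coordinate sections minus this
  body.\<close>

definition pullback ::
  "nat \<Rightarrow> nat \<Rightarrow> (nat \<Rightarrow> degree) \<Rightarrow> (nat \<Rightarrow> real) set \<Rightarrow> ((nat \<Rightarrow> real) \<Rightarrow> nat \<Rightarrow> real) \<Rightarrow> nat \<Rightarrow> nat \<Rightarrow>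
     (nat \<Rightarrow> degree) \<Rightarrow> (nat \<Rightarrow> power_series) \<Rightarrow> (nat \<Rightarrow> power_series) \<Rightarrow> (nat \<Rightarrow> real) set \<Rightarrow> power_series \<Rightarrow> power_series" where
  "pullback n q \<tau> U f u v \<sigma> s \<zeta> W G = series_of (pre U f W) (\<lambda>x.
     subst n q \<tau> u v \<sigma> (\<lambda>j. coeffs_at x (s j) - cconst (f x j)) (\<lambda>b. coeffs_at x (\<zeta> b)) G (f x))"

lemma deg_zero_in_Z2n [simp]: "deg_zero \<in> Z2n n"
  by (simp add: Z2n_def deg_zero_def)

text \<open>The index 0 has degree \<open>deg_zero\<close>, so a section of another degree has no
  body. This is where nonzero degrees of the formal variables provide positive order.\<close>

lemma series_grade_nonzero:
  assumes "F \<in> grade (series_algebra n p q \<tau> V) i" "i \<noteq> deg_zero"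
  shows "F 0 x = 0"
proof (rule ccontr)
  assume "F 0 x \<noteq> 0"
  then have "monomial_degree q \<tau> 0 = i" using assms(1) unfolding series_grade_iff cgrade_def coeffs_at_def by blast
  then show False using assms(2) by simp
qed

text \<open>Each property is a property of \<open>subst\<close> over a single point, carried over by
  \<open>series_eqI\<close>; membership in the series algebra is the smooth dependence of
  \<open>subst\<close> on the point.\<close>

lemma pullback_family_pullback:
  assumes U: "openin (Euclidean_space p) U" and V: "openin (Euclidean_space u) V"
    and s: "\<And>j. j < u \<Longrightarrow> s j \<in> grade (series_algebra n p q \<tau> U) deg_zero"
    and \<zeta>: "\<And>b. b < v \<Longrightarrow> \<zeta> b \<in> grade (series_algebra n p q \<tau> U) (\<sigma> b)"
    and \<sigma>: "\<And>b. b < v \<Longrightarrow> \<sigma> b \<noteq> deg_zero"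
    and f: "\<And>x j. x \<in> U \<Longrightarrow> j < u \<Longrightarrow> f x j = s j 0 x" "\<And>x. x \<in> U \<Longrightarrow> f x \<in> V"
  shows "pullback_family n (superdomain n p q \<tau> U') U f u v \<sigma> V s \<zeta> (pullback n q \<tau> U f u v \<sigma> s \<zeta>)"
proof -
  define h where "h = (\<lambda>x j. coeffs_at x (s j) - cconst (f x j))"
  define z where "z = (\<lambda>x b. coeffs_at x (\<zeta> b))"
  let ?P = "pullback n q \<tau> U f u v \<sigma> s \<zeta>"
  have sc: "s j \<in> series_carrier n p q \<tau> U" "\<And>x. coeffs_at x (s j) \<in> cgrade q \<tau> deg_zero" if "j < u" for j
    using s[OF that] by (auto simp: series_grade_iff)
  have zc: "\<zeta> b \<in> series_carrier n p q \<tau> U" "\<And>x. coeffs_at x (\<zeta> b) \<in> cgrade q \<tau> (\<sigma> b)" if "b < v" for b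
    using \<zeta>[OF that] by (auto simp: series_grade_iff)
  have s_smooth: "csmooth p U (\<lambda>x. coeffs_at x (s j))" and s_adm: "\<And>x. admissible n q \<tau> (coeffs_at x (s j))" if "j < u" for j
    using sc[OF that] by (auto simp: series_carrier_iff[OF U])
  have z_smooth: "csmooth p U (\<lambda>x. z x b)" and z_adm: "\<And>x. admissible n q \<tau> (z x b)" if "b < v" for b
    using zc[OF that] by (auto simp: series_carrier_iff[OF U] z_def)
  have f_smooth: "smooth p U (\<lambda>x. f x j)" if "j < u" for j
    using csmooth_coeffs[OF s_smooth[OF that], of 0] smooth_cong[OF U, of "\<lambda>x. f x j" "\<lambda>x. coeffs_at x (s j) 0"] f(1)[OF _ that]
    by (simp add: coeffs_at_def)
  have h_smooth: "csmooth p U (\<lambda>x. h x j)" if "j < u" for j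
    unfolding h_def by (intro csmooth_diff[OF U] csmooth_const[OF U] s_smooth f_smooth that)
  have subs: "substitution n q \<tau> u v \<sigma> (h x) (z x)" if x: "x \<in> U" for x
  proof
    fix j assume j: "j < u"
    show adm: "admissible n q \<tau> (h x j)" using s_adm[OF j] by (simp add: h_def)
    show "h x j \<in> cgrade q \<tau> deg_zero" unfolding h_def using sc(2)[OF j] by (intro cgrade_diff) auto
    \<comment> \<open>The body cancels because \<open>f x j\<close> is by assumption the body of
      \<open>s j\<close> at \<open>x\<close>.\<close>
    show "h x j \<in> corder q 1"
      by (subst corder_one_iff[OF adm]) (simp add: h_def coeffs_at_def cconst_def f(1)[OF x j])
  next
    fix b assume b: "b < v"
    show "admissible n q \<tau> (z x b)" by (rule z_adm[OF b])
    show "z x b \<in> cgrade q \<tau> (\<sigma> b)" using zc(2)[OF b] by (simp add: z_def)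
    show "z x b \<in> corder q 1"
      by (subst corder_one_iff[OF z_adm[OF b]]) (simp add: z_def coeffs_at_def series_grade_nonzero[OF \<zeta>[OF b] \<sigma>[OF b]])
  qed
  have f0: "f x j = 0" if "x \<in> U" "j \<ge> u" for x j
    using f(2)[OF that(1)] openin_subset[OF V] that(2) by (auto simp: topspace_Euclidean_space)
  have pre_open: "openin (Euclidean_space p) (pre U f W)" if "openin (Euclidean_space u) W" for W
    by (rule openin_pre[OF U that _ f0]) (use smooth_upto_continuous[OF smooth_imp_smooth_upto[OF f_smooth]] in auto)
  have P_eq: "?P W G = series_of (pre U f W) (\<lambda>x. subst n q \<tau> u v \<sigma> (h x) (z x) G (f x))" for W G
    by (simp add: pullback_def h_def z_def)
  have P: "coeffs_at x (?P W G) = (if x \<in> pre U f W then subst n q \<tau> u v \<sigma> (h x) (z x) G (f x) else 0)" for W G x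
    by (simp add: pullback_def h_def z_def)
  have pre_sub: "pre U f W \<subseteq> U" for W by (auto simp: pre_def)
  have carrier: "?P W G \<in> series_carrier n p q \<tau> (pre U f W)"
    if W: "openin (Euclidean_space u) W" and G: "G \<in> series_carrier n u v \<sigma> W" for W G
  proof -
    have "csmooth p (pre U f W) (\<lambda>x. subst n q \<tau> u v \<sigma> (h x) (z x) G (f x))"
    proof (rule csmooth_subst[OF pre_open[OF W] W])
      show "smooth u W (G \<nu>)" for \<nu>
        using G csmooth_coeffs[of u W "\<lambda>x. coeffs_at x G" \<nu>] by (simp add: series_carrier_iff[OF W] coeffs_at_def)
    qed (use f_smooth h_smooth z_smooth smooth_subset[OF _ pre_sub] csmooth_subset[OF _ pre_sub] in \<open>auto simp: pre_def\<close>)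
    then show ?thesis
      unfolding P_eq using substitution.admissible_subst[OF subs]
      by (intro series_of_carrier[OF pre_open[OF W]]) (auto simp: pre_def)
  qed
  have G_smooth: "smooth u W (G \<nu>)" if "openin (Euclidean_space u) W" "G \<in> series_carrier n u v \<sigma> W" for W G \<nu>
    using csmooth_coeffs[of u W "\<lambda>x. coeffs_at x G" \<nu>] that by (simp add: series_carrier_iff coeffs_at_def)
  have hom: "?P W \<in> graded_alg_hom n (series_algebra n u v \<sigma> W) (series_algebra n p q \<tau> (pre U f W))"
    if W: "openin (Euclidean_space u) W" for W
  proof -
    have "?P W \<in> ring_hom (series_algebra n u v \<sigma> W) (series_algebra n p q \<tau> (pre U f W))"
    proof (rule ring_hom_memI; simp)
      fix G assume G: "G \<in> series_carrier n u v \<sigma> W"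
      then show "?P W G \<in> series_carrier n p q \<tau> (pre U f W)" by (rule carrier[OF W])
      fix H assume H: "H \<in> series_carrier n u v \<sigma> W"
      show "?P W (series_mult n v \<sigma> G H) = series_mult n q \<tau> (?P W G) (?P W H)"
        using substitution.subst_mult[OF subs W _ G_smooth[OF W G] G_smooth[OF W H]]
        by (intro series_eqI) (auto simp: P pre_def)
      have "G + H = (\<lambda>\<nu> y. G \<nu> y + H \<nu> y)" by (simp add: fun_eq_iff)
      then show "?P W (G + H) = ?P W G + ?P W H"
        using substitution.subst_add[OF subs W _ G_smooth[OF W G] G_smooth[OF W H]]
        by (intro series_eqI) (auto simp: P pre_def)
    next
      show "?P W (series_term W (\<lambda>_. 1) 0) = series_term (pre U f W) (\<lambda>_. 1) 0"
        using substitution.subst_const[OF subs W, of _ _ 1] by (intro series_eqI) (auto simp: P pre_def)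
    qed
    moreover have "?P W (\<lambda>\<mu> x. r * G \<mu> x) = (\<lambda>\<mu> x. r * ?P W G \<mu> x)" if G: "G \<in> series_carrier n u v \<sigma> W" for r G
      using substitution.subst_scale[OF subs W _ G_smooth[OF W G], of _ _ r]
      by (intro series_eqI) (auto simp: P pre_def)
    moreover have "?P W G \<in> grade (series_algebra n p q \<tau> (pre U f W)) i"
      if G: "G \<in> grade (series_algebra n u v \<sigma> W) i" for i G
    proof -
      have "G \<nu> = (\<lambda>_. 0)" if "monomial_degree v \<sigma> \<nu> \<noteq> i" for \<nu>
        using G that by (auto simp: series_algebra_def)
      then show ?thesis
        using G carrier[OF W] substitution.cgrade_subst[OF subs, of _ i G]
        by (auto simp: series_grade_iff P pre_def)
    qed
    ultimately show ?thesis by (auto simp: graded_alg_hom_def)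
  qed
  have restrict: "?P W' (cut W' G) = cut (pre U f W') (?P W G)"
    if W: "openin (Euclidean_space u) W'" "W' \<subseteq> W" for W W' G
  proof (rule series_eqI)
    fix x
    show "coeffs_at x (?P W' (cut W' G)) = coeffs_at x (cut (pre U f W') (?P W G))"
    proof (cases "x \<in> pre U f W'")
      case True
      then have x: "x \<in> U" "f x \<in> W'" "x \<in> pre U f W" using W(2) by (auto simp: pre_def)
      have "subst n q \<tau> u v \<sigma> (h x) (z x) (cut W' G) (f x) = subst n q \<tau> u v \<sigma> (h x) (z x) G (f x)"
        by (rule substitution.subst_cong[OF subs[OF x(1)] W(1) x(2)]) (simp add: cut_def)
      then show ?thesis using True x by (simp add: P)
    qed (simp add: P)
  qed
  have preV: "pre U f V = U" using f(2) by (auto simp: pre_def)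
  have coord: "?P V (coord_fun V j) = s j" if j: "j < u" for j
  proof (rule series_eqI)
    fix x
    show "coeffs_at x (?P V (coord_fun V j)) = coeffs_at x (s j)"
    proof (cases "x \<in> U")
      case True
      then show ?thesis using substitution.subst_coord_fun[OF subs[OF True] V f(2)[OF True] j]
        by (simp add: P preV h_def)
    next
      case False
      then show ?thesis using sc(1)[OF j] by (simp add: P preV series_carrier_iff[OF U])
    qed
  qed
  have var: "?P V (formal_var V b) = \<zeta> b" if b: "b < v" for b
  proof (rule series_eqI)
    fix x
    show "coeffs_at x (?P V (formal_var V b)) = coeffs_at x (\<zeta> b)"
    proof (cases "x \<in> U")
      case True
      then show ?thesis using substitution.subst_formal_var[OF subs[OF True] V f(2)[OF True] b]
        by (simp add: P preV z_def)
    next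
      case False
      then show ?thesis using zc(1)[OF b] by (simp add: P preV series_carrier_iff[OF U])
    qed
  qed
  show ?thesis
    unfolding pullback_family_def using hom restrict coord var by simp
qed

section \<open>Uniqueness of families of pullbacks\<close>

text \<open>Contact of order \<open>k\<close> with zero: all partial derivatives of order less than
  \<open>k\<close> vanish at the point, with no condition for \<open>k = 0\<close>.\<close>

primrec vanishes :: "nat \<Rightarrow> nat \<Rightarrow> ((nat \<Rightarrow> real) \<Rightarrow> real) \<Rightarrow> (nat \<Rightarrow> real) \<Rightarrow> bool" where
  "vanishes p 0 f x \<longleftrightarrow> True"
| "vanishes p (Suc k) f x \<longleftrightarrow> f x = 0 \<and> (\<forall>i<p. vanishes p k (partial_deriv i f) x)"

lemma vanishes_cong:
  assumes V: "openin (Euclidean_space p) V" "x \<in> V"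
  shows "(\<And>y. y \<in> V \<Longrightarrow> f y = g y) \<Longrightarrow> vanishes p k f x \<longleftrightarrow> vanishes p k g x"
proof (induction k arbitrary: f g)
  case (Suc k)
  have "vanishes p k (partial_deriv i f) x \<longleftrightarrow> vanishes p k (partial_deriv i g) x" if "i < p" for i
    using Suc.IH[of "partial_deriv i f" "partial_deriv i g"] partial_deriv_cong[OF V(1) _ that, of _ f g] Suc.prems
    by blast
  then show ?case using Suc.prems V by auto
qed simp

lemma vanishes_SucD: "vanishes p (Suc k) f x \<Longrightarrow> vanishes p k f x"
  by (induction k arbitrary: f) auto

lemma vanishes_mono: "vanishes p k f x \<Longrightarrow> l \<le> k \<Longrightarrow> vanishes p l f x"
  by (induction k) (auto simp: le_Suc_eq simp del: vanishes.simps(2) dest: vanishes_SucD)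

lemma vanishes_zero: "vanishes p k (\<lambda>_. 0) x"
  by (induction k) (auto simp: partial_deriv_const)

lemma vanishes_add:
  assumes V: "openin (Euclidean_space p) V" "x \<in> V"
  shows "smooth p V f \<Longrightarrow> smooth p V g \<Longrightarrow> vanishes p k f x \<Longrightarrow> vanishes p k g x \<Longrightarrow>
           vanishes p k (\<lambda>x. f x + g x) x"
proof (induction k arbitrary: f g)
  case (Suc k)
  have "vanishes p k (partial_deriv i (\<lambda>x. f x + g x)) x" if i: "i < p" for i
  proof -
    have "partial_deriv i (\<lambda>x. f x + g x) y = partial_deriv i f y + partial_deriv i g y" if "y \<in> V" for y
      by (rule has_partial_imp_eq, rule DERIV_add) (rule smooth_has_partial[OF _ i that], fact Suc.prems)+
    then have "vanishes p k (partial_deriv i (\<lambda>x. f x + g x)) x \<longleftrightarrow>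
        vanishes p k (\<lambda>x. partial_deriv i f x + partial_deriv i g x) x"
      by (rule vanishes_cong[OF V])
    then show ?thesis using Suc.IH[of "partial_deriv i f" "partial_deriv i g"] Suc.prems i
      by (simp add: smooth_partial_deriv)
  qed
  then show ?case using Suc.prems by auto
qed simp

text \<open>By the Leibniz rule a derivative lowers the order of one factor by one. If the
  differentiated factor has order 0 already, the other factor gives up one order instead. In both
  cases the orders sum to one less.\<close>

lemma vanishes_mult:
  assumes V: "openin (Euclidean_space p) V" "x \<in> V"
  shows "smooth p V f \<Longrightarrow> smooth p V g \<Longrightarrow> vanishes p k f x \<Longrightarrow> vanishes p l g x \<Longrightarrow>
           vanishes p (k + l) (\<lambda>x. f x * g x) x"
proof (induction "k + l" arbitrary: k l f g)
  case (Suc m)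
  have zero: "f x * g x = 0"
    using Suc.hyps(2) Suc.prems(3,4) by (cases k; cases l) auto
  have deriv: "vanishes p m (partial_deriv i (\<lambda>x. f x * g x)) x" if i: "i < p" for i
  proof -
    note f' = smooth_partial_deriv[OF Suc.prems(1) i] and g' = smooth_partial_deriv[OF Suc.prems(2) i]
    have "partial_deriv i (\<lambda>x. f x * g x) y = partial_deriv i f y * g y + f y * partial_deriv i g y" if "y \<in> V" for y
      by (rule has_partial_imp_eq, rule DERIV_cong[OF DERIV_mult])
        (rule smooth_has_partial[OF _ i that], fact Suc.prems, rule smooth_has_partial[OF _ i that], fact Suc.prems, simp)
    then have *: "vanishes p m (partial_deriv i (\<lambda>x. f x * g x)) x \<longleftrightarrow>
        vanishes p m (\<lambda>x. partial_deriv i f x * g x + f x * partial_deriv i g x) x"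
      by (rule vanishes_cong[OF V])
    have "vanishes p m (\<lambda>x. partial_deriv i f x * g x) x"
    proof (cases k)
      case 0
      obtain l' where l: "l = Suc l'" "m = 0 + l'" using Suc.hyps(2) 0 by (cases l) auto
      have "vanishes p (0 + l') (\<lambda>x. partial_deriv i f x * g x) x"
        using Suc.hyps(1)[of 0 l' "partial_deriv i f" g] l f' Suc.prems vanishes_SucD by auto
      then show ?thesis using l by simp
    next
      case (Suc k')
      have "vanishes p (k' + l) (\<lambda>x. partial_deriv i f x * g x) x"
        using Suc.hyps(1)[of k' l "partial_deriv i f" g] Suc f' \<open>Suc m = k + l\<close> Suc.prems i by auto
      then show ?thesis using Suc \<open>Suc m = k + l\<close> by simp
    qed
    moreover have "vanishes p m (\<lambda>x. f x * partial_deriv i g x) x"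
    proof (cases l)
      case 0
      obtain k' where k: "k = Suc k'" "m = k' + 0" using Suc.hyps(2) 0 by (cases k) auto
      have "vanishes p (k' + 0) (\<lambda>x. f x * partial_deriv i g x) x"
        using Suc.hyps(1)[of k' 0 f "partial_deriv i g"] k g' Suc.prems vanishes_SucD by auto
      then show ?thesis using k by simp
    next
      case (Suc l')
      have "vanishes p (k + l') (\<lambda>x. f x * partial_deriv i g x) x"
        using Suc.hyps(1)[of k l' f "partial_deriv i g"] Suc g' \<open>Suc m = k + l\<close> Suc.prems i by auto
      then show ?thesis using Suc \<open>Suc m = k + l\<close> by simp
    qed
    ultimately show ?thesis unfolding *
      by (intro vanishes_add[OF V] smooth_mult[OF V(1)] f' g' Suc.prems)
  qed
  show ?case unfolding Suc.hyps(2)[symmetric] using zero deriv by simp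
qed simp

lemma vanishes_sum:
  assumes V: "openin (Euclidean_space p) V" "x \<in> V"
  shows "(\<And>a. a \<in> A \<Longrightarrow> smooth p V (f a)) \<Longrightarrow> (\<And>a. a \<in> A \<Longrightarrow> vanishes p k (f a) x) \<Longrightarrow>
    vanishes p k (\<lambda>x. \<Sum>a\<in>A. f a x) x"
  by (induction A rule: infinite_finite_induct)
    (auto intro!: vanishes_zero vanishes_add[OF V] smooth_sum[OF V(1)])

text \<open>
  Membership in the \<open>k\<close>-th power of the maximal ideal at \<open>x\<close>, read off from the coefficients: a formal
  variable counts as much as a derivative.
\<close>

definition series_vanishes :: "nat \<Rightarrow> nat \<Rightarrow> nat \<Rightarrow> power_series \<Rightarrow> (nat \<Rightarrow> real) \<Rightarrow> bool" where
  "series_vanishes p q k F x \<longleftrightarrow> (\<forall>\<mu>. vanishes p (k - total_degree q \<mu>) (F \<mu>) x)"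

lemma series_smooth:
  "openin (Euclidean_space p) V \<Longrightarrow> F \<in> series_carrier n p q \<tau> V \<Longrightarrow> smooth p V (F \<mu>)"
  using csmooth_coeffs[of p V "\<lambda>x. coeffs_at x F" \<mu>] by (simp add: series_carrier_iff coeffs_at_def)

lemma series_vanishes_cong:
  assumes "openin (Euclidean_space p) V" "x \<in> V" "cut V F = cut V G"
  shows "series_vanishes p q k F x \<longleftrightarrow> series_vanishes p q k G x"
proof -
  have "F \<mu> y = G \<mu> y" if "y \<in> V" for \<mu> y
    using fun_cong[OF fun_cong[OF assms(3)], of \<mu> y] that by (simp add: cut_def)
  then have "vanishes p l (F \<mu>) x \<longleftrightarrow> vanishes p l (G \<mu>) x" for l \<mu>
    by (intro vanishes_cong[OF assms(1,2)])
  then show ?thesis by (simp add: series_vanishes_def)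
qed

lemma series_vanishes_add:
  assumes "openin (Euclidean_space p) V" "x \<in> V" "F \<in> series_carrier n p q \<tau> V" "G \<in> series_carrier n p q \<tau> V"
    and "series_vanishes p q k F x" "series_vanishes p q k G x"
  shows "series_vanishes p q k (F + G) x"
  unfolding series_vanishes_def
proof
  fix \<mu>
  have "(F + G) \<mu> = (\<lambda>x. F \<mu> x + G \<mu> x)" by (simp add: fun_eq_iff)
  then show "vanishes p (k - total_degree q \<mu>) ((F + G) \<mu>) x"
    using vanishes_add[OF assms(1,2) series_smooth[OF assms(1,3)] series_smooth[OF assms(1,4)]] assms(5,6)
    by (simp add: series_vanishes_def)
qed

lemma series_vanishes_zero: "series_vanishes p q k 0 x"
  by (simp add: series_vanishes_def zero_fun_def vanishes_zero)

lemma series_vanishes_sum: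
  assumes "openin (Euclidean_space p) V" "x \<in> V"
  shows "(\<And>i. i \<in> I \<Longrightarrow> F i \<in> series_carrier n p q \<tau> V) \<Longrightarrow> (\<And>i. i \<in> I \<Longrightarrow> series_vanishes p q k (F i) x) \<Longrightarrow>
    series_vanishes p q k (\<Sum>i\<in>I. F i) x"
  by (induction I rule: infinite_finite_induct)
    (auto intro!: series_vanishes_zero series_vanishes_add[OF assms] series_carrier_sum[OF assms(1)])

text \<open>A factor without value at the point gains one order in every term of the product: the
  body coefficient vanishes there, and any other coefficient comes with a formal variable.\<close>

lemma series_vanishes_mult:
  assumes V: "openin (Euclidean_space p) V" "x \<in> V"
    and FG: "F \<in> series_carrier n p q \<tau> V" "G \<in> series_carrier n p q \<tau> V"
    and F0: "F 0 x = 0" and G: "series_vanishes p q k G x"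
  shows "series_vanishes p q (Suc k) (series_mult n q \<tau> F G) x"
  unfolding series_vanishes_def
proof
  fix \<nu>
  show "vanishes p (Suc k - total_degree q \<nu>) (series_mult n q \<tau> F G \<nu>) x"
  proof (cases "\<nu> \<in> multi_index n q \<tau>")
    case True
    have eq: "series_mult n q \<tau> F G \<nu> =
        (\<lambda>x. \<Sum>\<mu> | \<mu> \<le> \<nu>. monomial_sign n q \<tau> \<mu> (\<nu> - \<mu>) * (F \<mu> x * G (\<nu> - \<mu>) x))"
      using True by (simp add: series_mult_eq cmul_def fun_eq_iff mult.assoc)
    have van: "vanishes p (Suc k - total_degree q \<nu>) (\<lambda>x. monomial_sign n q \<tau> \<mu> (\<nu> - \<mu>) * (F \<mu> x * G (\<nu> - \<mu>) x)) x"
      if \<mu>: "\<mu> \<le> \<nu>" for \<mu>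
    proof -
      \<comment> \<open>The subtraction is truncated: the order claimed is 1 for \<mu> = 0 and 0 for
        all other indices.\<close>
      have "vanishes p (1 - total_degree q \<mu>) (F \<mu>) x"
      proof (cases "\<mu> = 0")
        case True
        then show ?thesis using F0 by (simp add: total_degree_def)
      next
        case False
        then have "total_degree q \<mu> \<noteq> 0"
          using total_degree_zero_iff[OF multi_index_le[OF True \<mu>]] by simp
        then have "1 - total_degree q \<mu> = 0" by simp
        then show ?thesis by simp
      qed
      moreover have "vanishes p (k - total_degree q (\<nu> - \<mu>)) (G (\<nu> - \<mu>)) x"
        using G by (simp add: series_vanishes_def)
      ultimately have "vanishes p (1 - total_degree q \<mu> + (k - total_degree q (\<nu> - \<mu>))) (\<lambda>x. F \<mu> x * G (\<nu> - \<mu>) x) x"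
        by (rule vanishes_mult[OF V series_smooth[OF V(1) FG(1)] series_smooth[OF V(1) FG(2)]])
      moreover have "total_degree q \<nu> = total_degree q \<mu> + total_degree q (\<nu> - \<mu>)"
        using total_degree_add[of q \<mu> "\<nu> - \<mu>"] unfolding multi_add_diff[OF \<mu>] .
      ultimately have "vanishes p (Suc k - total_degree q \<nu>) (\<lambda>x. F \<mu> x * G (\<nu> - \<mu>) x) x"
        by (elim vanishes_mono) linarith
      \<comment> \<open>The constant sign enters as a smooth factor of order 0.\<close>
      then have "vanishes p (0 + (Suc k - total_degree q \<nu>)) (\<lambda>x. monomial_sign n q \<tau> \<mu> (\<nu> - \<mu>) * (F \<mu> x * G (\<nu> - \<mu>) x)) x"
        by (rule vanishes_mult[OF V smooth_const[OF V(1)] smooth_mult[OF V(1) series_smooth[OF V(1) FG(1)] series_smooth[OF V(1) FG(2)]], rotated]) simp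
      then show ?thesis by simp
    qed
    show ?thesis unfolding eq
    proof (rule vanishes_sum[OF V])
      fix \<mu> assume "\<mu> \<in> {\<mu>. \<mu> \<le> \<nu>}"
      then show "vanishes p (Suc k - total_degree q \<nu>) (\<lambda>x. monomial_sign n q \<tau> \<mu> (\<nu> - \<mu>) * (F \<mu> x * G (\<nu> - \<mu>) x)) x"
        by (simp add: van)
      show "smooth p V (\<lambda>x. monomial_sign n q \<tau> \<mu> (\<nu> - \<mu>) * (F \<mu> x * G (\<nu> - \<mu>) x))"
        by (rule smooth_mult[OF V(1) smooth_const[OF V(1)] smooth_mult[OF V(1) series_smooth[OF V(1) FG(1)] series_smooth[OF V(1) FG(2)]]])
    qed
  next
    case False
    then have "series_mult n q \<tau> F G \<nu> = (\<lambda>_. 0)" by (simp add: series_mult_eq cmul_def fun_eq_iff)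
    then show ?thesis by (simp add: vanishes_zero)
  qed
qed

text \<open>Order one above the total degree of \<mu> already gives the value of that coefficient at
  the point. Nothing follows at other points, because flat functions have all orders.\<close>

lemma series_vanishes_all:
  assumes "\<And>k. series_vanishes p q k F x"
  shows "coeffs_at x F = 0"
proof
  fix \<mu>
  have "vanishes p (Suc (total_degree q \<mu>) - total_degree q \<mu>) (F \<mu>) x"
    using assms unfolding series_vanishes_def by blast
  then show "coeffs_at x F \<mu> = 0 \<mu>" by (simp add: coeffs_at_def)
qed

section \<open>Expansion of a series around a point with finitely many quotients\<close>

definition unit_index :: "nat \<Rightarrow> nat \<Rightarrow> nat" where
  "unit_index b = (\<lambda>a. if a = b then 1 else 0)"

lemma formal_var_mult:
  assumes "\<nu> \<in> multi_index n q \<tau>"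
  shows "series_mult n q \<tau> (formal_var V b) K \<nu> x =
    (if x \<in> V \<and> \<nu> b \<ge> 1 then monomial_sign n q \<tau> (unit_index b) (\<nu> - unit_index b) * K (\<nu> - unit_index b) x else 0)"
proof -
  have "series_mult n q \<tau> (formal_var V b) K \<nu> x = (\<Sum>\<mu> | \<mu> \<le> \<nu>. if \<mu> = unit_index b then
      (if x \<in> V then monomial_sign n q \<tau> \<mu> (\<nu> - \<mu>) * K (\<nu> - \<mu>) x else 0) else 0)"
    using assms by (auto simp: series_mult_eq cmul_def formal_var_def series_term_def unit_index_def intro!: sum.cong)
  also have "\<dots> = (if unit_index b \<le> \<nu> then
      (if x \<in> V then monomial_sign n q \<tau> (unit_index b) (\<nu> - unit_index b) * K (\<nu> - unit_index b) x else 0) else 0)"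
    using finite_multi_index_le[OF assms] by (subst sum.delta) auto
  also have "unit_index b \<le> \<nu> \<longleftrightarrow> \<nu> b \<ge> 1"
    by (auto simp: le_fun_def unit_index_def)
  finally show ?thesis by auto
qed

text \<open>
  Only the body coefficient needs Hadamard's lemma. Every other monomial is divided by its
  first formal variable, which costs no sign.
\<close>

lemma series_Hadamard:
  assumes W: "openin (Euclidean_space u) W" and c: "c \<in> W" and G: "G \<in> series_carrier n u v \<sigma> W"
  shows "\<exists>B H K. openin (Euclidean_space u) B \<and> c \<in> B \<and> B \<subseteq> W \<and>
    (\<forall>j<u. H j \<in> series_carrier n u v \<sigma> B) \<and> (\<forall>b<v. K b \<in> series_carrier n u v \<sigma> B) \<and>
    cut B G = series_term B (\<lambda>_. G 0 c) 0 +
      (\<Sum>j<u. series_mult n v \<sigma> (coord_fun B j - series_term B (\<lambda>_. c j) 0) (H j)) +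
      (\<Sum>b<v. series_mult n v \<sigma> (formal_var B b) (K b))"
proof -
  obtain B h where B: "openin (Euclidean_space u) B" "c \<in> B" "B \<subseteq> W"
    and h: "\<And>j. j < u \<Longrightarrow> smooth u B (h j)" "\<And>y. y \<in> B \<Longrightarrow> G 0 y = G 0 c + (\<Sum>j<u. (y j - c j) * h j y)"
    using Hadamard[OF W series_smooth[OF W G] c, of 0] by blast
  define H where "H = (\<lambda>j. series_term B (h j) 0)"
  \<comment> \<open>\<open>K b\<close> collects the monomials whose first variable is
    \<open>b\<close>, with one factor of it removed. The admissibility condition makes the quotient
    0 where putting the factor back is forbidden.\<close>
  define K where "K = (\<lambda>b \<nu> y. if (\<forall>a<b. \<nu> a = 0) \<and> \<nu> + unit_index b \<in> multi_index n v \<sigma> \<and> y \<in> B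
    then G (\<nu> + unit_index b) y else 0)"
  have GB: "cut B G \<in> series_carrier n u v \<sigma> B" by (rule cut_carrier[OF W B(1,3) G])
  have H: "H j \<in> series_carrier n u v \<sigma> B" if "j < u" for j
    unfolding H_def using h(1)[OF that] by (rule series_carrier_closed(6)[OF B(1)])
  have K: "K b \<in> series_carrier n u v \<sigma> B" if "b < v" for b
  proof -
    have "smooth u B (K b \<nu>)" for \<nu>
    proof (cases "(\<forall>a<b. \<nu> a = 0) \<and> \<nu> + unit_index b \<in> multi_index n v \<sigma>")
      case True
      then have "smooth u B (K b \<nu>) \<longleftrightarrow> smooth u B (G (\<nu> + unit_index b))"
        by (intro smooth_cong[OF B(1)]) (simp add: K_def)
      then show ?thesis using smooth_subset[OF series_smooth[OF W G] B(3)] by simp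
    next
      case False
      then have "K b \<nu> = (\<lambda>_. 0)" unfolding K_def by (intro ext) auto
      then show ?thesis by (simp add: smooth_const[OF B(1)])
    qed
    moreover have "K b \<nu> y = 0" if "\<nu> \<notin> multi_index n v \<sigma>" for \<nu> y
    proof -
      have "\<nu> \<le> \<nu> + unit_index b" by (auto simp: le_fun_def)
      then show ?thesis using that multi_index_le unfolding K_def by fastforce
    qed
    ultimately show ?thesis
      by (auto simp: series_carrier_iff[OF B(1)] csmooth_def coeffs_at_def admissible_def K_def fun_eq_iff)
  qed
  have "cut B G = series_term B (\<lambda>_. G 0 c) 0 +
      (\<Sum>j<u. series_mult n v \<sigma> (coord_fun B j - series_term B (\<lambda>_. c j) 0) (H j)) +
      (\<Sum>b<v. series_mult n v \<sigma> (formal_var B b) (K b))" (is "_ = ?R")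
  proof (intro ext)
    fix \<nu> y
    have coordH: "series_mult n v \<sigma> (coord_fun B j - series_term B (\<lambda>_. c j) 0) (H j) \<nu> y =
        (if \<nu> = 0 \<and> y \<in> B then (y j - c j) * h j y else 0)" for j
    proof -
      have "coeffs_at y (coord_fun B j - series_term B (\<lambda>_. c j) 0) = (if y \<in> B then cconst (y j - c j) else 0)"
        by (auto simp: coord_fun_def coeffs_at_def series_term_def cconst_def fun_eq_iff)
      moreover have "coeffs_at y (H j) = (if y \<in> B then cconst (h j y) else 0)"
        by (simp add: H_def)
      ultimately have "coeffs_at y (series_mult n v \<sigma> (coord_fun B j - series_term B (\<lambda>_. c j) 0) (H j)) =
          (if y \<in> B then cconst ((y j - c j) * h j y) else 0)"
        by (simp add: cmul_const_left) (simp add: cscale_def cconst_def fun_eq_iff)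
      from fun_cong[OF this, of \<nu>] show ?thesis by (auto simp: coeffs_at_def cconst_def)
    qed
    have R: "?R \<nu> y = (if \<nu> = 0 \<and> y \<in> B then G 0 c else 0) +
        (\<Sum>j<u. if \<nu> = 0 \<and> y \<in> B then (y j - c j) * h j y else 0) +
        (\<Sum>b<v. series_mult n v \<sigma> (formal_var B b) (K b) \<nu> y)"
      by (simp add: sum_coeffs_apply coordH) (simp add: series_term_def)
    show "cut B G \<nu> y = ?R \<nu> y"
    proof (cases "\<nu> \<in> multi_index n v \<sigma> \<and> y \<in> B")
      case False
      then have "series_mult n v \<sigma> (formal_var B b) (K b) \<nu> y = 0" for b
        using formal_var_mult[of \<nu> n v \<sigma> B b "K b" y] by (cases "y \<in> B") (auto simp: series_mult_def)
      moreover have neg: "\<not> (\<nu> = 0 \<and> y \<in> B)" using False by auto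
      moreover have "cut B G \<nu> y = 0"
        using False GB by (cases "y \<in> B") (auto simp: series_carrier_iff[OF B(1)] admissible_def coeffs_at_def cut_def)
      ultimately show ?thesis unfolding R if_not_P[OF neg] by simp
    next
      case True
      then have \<nu>: "\<nu> \<in> multi_index n v \<sigma>" and y: "y \<in> B" by auto
      have var: "series_mult n v \<sigma> (formal_var B b) (K b) \<nu> y =
          (if \<nu> b \<ge> 1 \<and> (\<forall>a<b. \<nu> a = 0) then G \<nu> y else 0)" for b
      proof (cases "\<nu> b \<ge> 1")
        case True
        then have sub: "\<nu> - unit_index b + unit_index b = \<nu>"
          by (auto simp: fun_eq_iff unit_index_def)
        have below: "(\<forall>a<b. (\<nu> - unit_index b) a = 0) \<longleftrightarrow> (\<forall>a<b. \<nu> a = 0)"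
          by (auto simp: unit_index_def)
        \<comment> \<open>A factor of the sign could differ from 1 only for \<open>b' = b\<close>
          together with a smaller index that occurs in \<nu>, and there is none.\<close>
        have "monomial_sign n v \<sigma> (unit_index b) (\<nu> - unit_index b) = 1" if "\<forall>a<b. \<nu> a = 0"
          unfolding monomial_sign_def
        proof (intro prod.neutral ballI)
          fix b' a :: nat assume "a \<in> {..<b'}"
          then have "unit_index b b' * (\<nu> - unit_index b) a = 0"
            using that by (auto simp: unit_index_def)
          then show "comm_sign n (\<sigma> b') (\<sigma> a) ^ (unit_index b b' * (\<nu> - unit_index b) a) = 1" by (simp only: power_0)
        qed
        then show ?thesis using True y \<nu> unfolding formal_var_mult[OF \<nu>] K_def sub below by auto
      qed (simp add: formal_var_mult[OF \<nu>])
      show ?thesis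
      proof (cases "\<nu> = 0")
        case True
        then show ?thesis using y h(2)[OF y] unfolding R var by (simp add: cut_def)
      next
        case False
        then obtain b where "\<nu> b \<noteq> 0" by (auto simp: fun_eq_iff)
        \<comment> \<open>The first variable that occurs in \<nu>; it is the only \<open>b\<close>
          whose quotient contributes to this coefficient, so nothing is counted twice.\<close>
        define b0 where "b0 = (LEAST b. \<nu> b \<noteq> 0)"
        have b0: "\<nu> b0 \<noteq> 0" "\<And>a. a < b0 \<Longrightarrow> \<nu> a = 0"
          unfolding b0_def using LeastI[of "\<lambda>b. \<nu> b \<noteq> 0", OF \<open>\<nu> b \<noteq> 0\<close>] not_less_Least by blast+
        have "b0 < v" 
        proof (rule ccontr)
          assume "\<not> b0 < v"
          then have "\<nu> b0 = 0" using \<nu> by (simp add: multi_index_def)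
          then show False using b0(1) by simp
        qed
        have "\<nu> b \<ge> 1 \<and> (\<forall>a<b. \<nu> a = 0) \<longleftrightarrow> b = b0" for b
          using b0 by (metis One_nat_def Suc_leI linorder_neqE_nat not_one_le_zero gr0I)
        then have "(\<Sum>b<v. series_mult n v \<sigma> (formal_var B b) (K b) \<nu> y) = (\<Sum>b<v. if b = b0 then G \<nu> y else 0)"
          unfolding var by simp
        also have "\<dots> = G \<nu> y" using \<open>b0 < v\<close> by simp
        finally show ?thesis using y False unfolding R by (simp add: cut_def)
      qed
    qed
  qed
  then show ?thesis using B H K by blast
qed

lemma series_hom_facts:
  assumes V: "openin (Euclidean_space u) V"
    and a: "a \<in> graded_alg_hom n (series_algebra n u v \<sigma> V) (series_algebra n p q \<tau> U)"
  shows "F \<in> series_carrier n u v \<sigma> V \<Longrightarrow> a F \<in> series_carrier n p q \<tau> U"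
    and "F \<in> series_carrier n u v \<sigma> V \<Longrightarrow> G \<in> series_carrier n u v \<sigma> V \<Longrightarrow> a (F + G) = a F + a G"
    and "F \<in> series_carrier n u v \<sigma> V \<Longrightarrow> G \<in> series_carrier n u v \<sigma> V \<Longrightarrow> a (F - G) = a F - a G"
    and "F \<in> series_carrier n u v \<sigma> V \<Longrightarrow> G \<in> series_carrier n u v \<sigma> V \<Longrightarrow>
           a (series_mult n v \<sigma> F G) = series_mult n q \<tau> (a F) (a G)"
    and "a (series_term V (\<lambda>_. r) 0) = series_term U (\<lambda>_. r) 0"
    and "(\<And>i. i \<in> I \<Longrightarrow> H i \<in> series_carrier n u v \<sigma> V) \<Longrightarrow> a (\<Sum>i\<in>I. H i) = (\<Sum>i\<in>I. a (H i))"
proof -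
  note c = series_carrier_closed[OF V]
  show closed: "a F \<in> series_carrier n p q \<tau> U" if "F \<in> series_carrier n u v \<sigma> V" for F
    using a that by (auto simp: graded_alg_hom_def ring_hom_def)
  show add: "a (F + G) = a F + a G" if "F \<in> series_carrier n u v \<sigma> V" "G \<in> series_carrier n u v \<sigma> V" for F G
    using a that by (auto simp: graded_alg_hom_def ring_hom_def)
  show "a (F - G) = a F - a G" if "F \<in> series_carrier n u v \<sigma> V" "G \<in> series_carrier n u v \<sigma> V" for F G
    using add[OF c(2)[OF that] that(2)] by (simp add: algebra_simps)
  show "a (series_mult n v \<sigma> F G) = series_mult n q \<tau> (a F) (a G)"
    if "F \<in> series_carrier n u v \<sigma> V" "G \<in> series_carrier n u v \<sigma> V" for F G
    using a that by (auto simp: graded_alg_hom_def ring_hom_def)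
  have one: "a (series_term V (\<lambda>_. 1) 0) = series_term U (\<lambda>_. 1) 0"
    using a by (auto simp: graded_alg_hom_def ring_hom_def)
  have "a (\<lambda>\<mu> x. r * series_term V (\<lambda>_. 1) 0 \<mu> x) = (\<lambda>\<mu> x. r * a (series_term V (\<lambda>_. 1) 0) \<mu> x)"
    using a c(6)[OF smooth_const[OF V, of 1]] by (auto simp: graded_alg_hom_def)
  moreover have "(\<lambda>\<mu> x. r * series_term V' (\<lambda>_. 1) 0 \<mu> x) = series_term V' (\<lambda>_. r) 0" for V'
    by (auto simp: series_term_def fun_eq_iff)
  ultimately show "a (series_term V (\<lambda>_. r) 0) = series_term U (\<lambda>_. r) 0" by (simp add: one)
  have zero: "a 0 = 0" using add[OF c(5) c(5)] by simp
  show "a (\<Sum>i\<in>I. H i) = (\<Sum>i\<in>I. a (H i))" if "\<And>i. i \<in> I \<Longrightarrow> H i \<in> series_carrier n u v \<sigma> V"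
    using that
  proof (induction I rule: infinite_finite_induct)
    case (insert i I)
    then have "(\<Sum>i\<in>I. H i) \<in> series_carrier n u v \<sigma> V" by (intro series_carrier_sum[OF V]) auto
    then have "a (H i + (\<Sum>i\<in>I. H i)) = a (H i) + a (\<Sum>i\<in>I. H i)" using insert.prems by (intro add) auto
    moreover have "a (\<Sum>i\<in>I. H i) = (\<Sum>i\<in>I. a (H i))" using insert by auto
    ultimately show ?case unfolding sum.insert[OF insert.hyps(1,2)] by (simp only:)
  qed (simp_all add: zero)
qed

lemma coord_fun_carrier:
  "openin (Euclidean_space p) V \<Longrightarrow> coord_fun V j \<in> series_carrier n p q \<tau> V"
  using series_carrier_closed(6)[of p V "\<lambda>x. x j"] smooth_coord by (simp add: coord_fun_def flip: zero_fun_def)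

lemma formal_var_carrier:
  assumes V: "openin (Euclidean_space p) V" and b: "b < q"
  shows "formal_var V b \<in> series_carrier n p q \<tau> V"
proof -
  have "unit_index b \<in> multi_index n q \<tau>" using b by (auto simp: unit_index_def multi_index_def)
  then have "admissible n q \<tau> (coeffs_at x (formal_var V b))" for x
    by (auto simp: admissible_def coeffs_at_def formal_var_def series_term_def unit_index_def)
  moreover have "smooth p V (formal_var V b \<mu>)" for \<mu>
    using smooth_cong[OF V, of "formal_var V b \<mu>" "\<lambda>_. if \<mu> = unit_index b then 1 else 0"] smooth_const[OF V]
    by (simp add: formal_var_def series_term_def unit_index_def)
  ultimately show ?thesis
    by (auto simp: series_carrier_iff[OF V] csmooth_def coeffs_at_def formal_var_def series_term_def fun_eq_iff)
qed

text \<open>In the difference of the two pullbacks of a Hadamard expansion the constants cancel and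
  the coordinate factors are common. What remains is a sum of factors without value at
  \<open>x\<close> times differences of pullbacks of the quotients, so one order is gained at each
  step.\<close>

lemma pullback_family_unique:
  assumes U: "openin (Euclidean_space p) U" and V: "openin (Euclidean_space u) V"
    and s: "\<And>j. j < u \<Longrightarrow> s j \<in> series_carrier n p q \<tau> U"
    and \<zeta>: "\<And>b. b < v \<Longrightarrow> \<zeta> b \<in> series_carrier n p q \<tau> U" "\<And>b x. b < v \<Longrightarrow> \<zeta> b 0 x = 0"
    and f: "\<And>x j. x \<in> U \<Longrightarrow> j < u \<Longrightarrow> f x j = s j 0 x" "\<And>x. x \<in> U \<Longrightarrow> f x \<in> V"
    and a: "pullback_family n (superdomain n p q \<tau> U') U f u v \<sigma> V s \<zeta> a"
    and b: "pullback_family n (superdomain n p q \<tau> U') U f u v \<sigma> V s \<zeta> b"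
    and W: "openin (Euclidean_space u) W" "W \<subseteq> V" and G: "G \<in> series_carrier n u v \<sigma> W"
  shows "a W G = b W G"
proof -
  let ?P = "pre U f"
  have f0: "f x j = 0" if "x \<in> U" "j \<ge> u" for x j
    using f(2)[OF that(1)] openin_subset[OF V] that(2) by (auto simp: topspace_Euclidean_space)
  have "smooth p U (\<lambda>x. f x j)" if "j < u" for j
    using series_smooth[OF U s[OF that], of 0] smooth_cong[OF U, of "\<lambda>x. f x j" "s j 0"] f(1)[OF _ that] by simp
  then have pre_open: "openin (Euclidean_space p) (?P W)" if "openin (Euclidean_space u) W" for W
    using smooth_upto_continuous[OF smooth_imp_smooth_upto] by (intro openin_pre[OF U that _ f0]) auto
  have preV: "?P V = U" using f(2) by (auto simp: pre_def)
  have hom: "\<alpha> W \<in> graded_alg_hom n (series_algebra n u v \<sigma> W) (series_algebra n p q \<tau> (?P W))"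
    and restr: "\<And>W' G. openin (Euclidean_space u) W' \<Longrightarrow> W' \<subseteq> W \<Longrightarrow> G \<in> series_carrier n u v \<sigma> W \<Longrightarrow>
        \<alpha> W' (cut W' G) = cut (?P W') (\<alpha> W G)"
    if "pullback_family n (superdomain n p q \<tau> U') U f u v \<sigma> V s \<zeta> \<alpha>" "openin (Euclidean_space u) W" "W \<subseteq> V" for \<alpha> W
    using that by (auto simp: pullback_family_def)
  have coord: "\<alpha> B (coord_fun B j) = cut (?P B) (s j)"
    if "pullback_family n (superdomain n p q \<tau> U') U f u v \<sigma> V s \<zeta> \<alpha>" "openin (Euclidean_space u) B" "B \<subseteq> V" "j < u" for \<alpha> B j
    using restr[OF that(1) V subset_refl that(2,3) coord_fun_carrier[OF V]] that
    by (simp add: pullback_family_def coord_fun_def cut_term)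
  have var: "\<alpha> B (formal_var B k) = cut (?P B) (\<zeta> k)"
    if "pullback_family n (superdomain n p q \<tau> U') U f u v \<sigma> V s \<zeta> \<alpha>" "openin (Euclidean_space u) B" "B \<subseteq> V" "k < v" for \<alpha> B k
    using restr[OF that(1) V subset_refl that(2,3) formal_var_carrier[OF V]] that
    by (simp add: pullback_family_def formal_var_def cut_term)
  \<comment> \<open>The claim covers all \<open>W\<close> and \<open>G\<close> because in the
    induction step the quotients, on a smaller open set, take the place of \<open>G\<close>.\<close>
  have "\<forall>W G. openin (Euclidean_space u) W \<longrightarrow> W \<subseteq> V \<longrightarrow> G \<in> series_carrier n u v \<sigma> W \<longrightarrow> x \<in> ?P W \<longrightarrow>
      series_vanishes p q k (a W G - b W G) x" for k x
  proof (induction k)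
    case 0
    show ?case by (simp add: series_vanishes_def)
  next
    case (Suc k)
    show ?case
    proof (intro allI impI)
      fix W G assume W: "openin (Euclidean_space u) W" "W \<subseteq> V" and G: "G \<in> series_carrier n u v \<sigma> W"
        and x: "x \<in> ?P W"
      then have xU: "x \<in> U" "f x \<in> W" by (auto simp: pre_def)
      obtain B H K where B: "openin (Euclidean_space u) B" "f x \<in> B" "B \<subseteq> W"
        and H: "\<And>j. j < u \<Longrightarrow> H j \<in> series_carrier n u v \<sigma> B"
        and K: "\<And>b. b < v \<Longrightarrow> K b \<in> series_carrier n u v \<sigma> B"
        and eq: "cut B G = series_term B (\<lambda>_. G 0 (f x)) 0 +
          (\<Sum>j<u. series_mult n v \<sigma> (coord_fun B j - series_term B (\<lambda>_. f x j) 0) (H j)) +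
          (\<Sum>b<v. series_mult n v \<sigma> (formal_var B b) (K b))"
        using series_Hadamard[OF W(1) xU(2) G] by blast
      have BV: "B \<subseteq> V" using B(3) W(2) by blast
      have xB: "x \<in> ?P B" using xU(1) B(2) by (simp add: pre_def)
      have PB: "openin (Euclidean_space p) (?P B)" by (rule pre_open[OF B(1)])
      have PBU: "?P B \<subseteq> U" by (auto simp: pre_def)
      \<comment> \<open>The common pullback of the coordinate minus its value at \<open>f x\<close>.
        Its body vanishes at \<open>x\<close> since \<open>f\<close> is the body of
        \<open>s\<close>.\<close>
      define S' where "S' = (\<lambda>j. cut (?P B) (s j) - series_term (?P B) (\<lambda>_. f x j) 0)"
      note c = series_carrier_closed[OF B(1)]
      have const: "series_term B (\<lambda>_. r) 0 \<in> series_carrier n u v \<sigma> B" for r by (intro c smooth_const B(1))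
      have cj: "coord_fun B j - series_term B (\<lambda>_. f x j) 0 \<in> series_carrier n u v \<sigma> B" for j
        by (intro c const coord_fun_carrier B(1))
      have expand: "\<alpha> B (cut B G) = series_term (?P B) (\<lambda>_. G 0 (f x)) 0 +
          (\<Sum>j<u. series_mult n q \<tau> (S' j) (\<alpha> B (H j))) + (\<Sum>b<v. series_mult n q \<tau> (cut (?P B) (\<zeta> b)) (\<alpha> B (K b)))"
        if \<alpha>: "pullback_family n (superdomain n p q \<tau> U') U f u v \<sigma> V s \<zeta> \<alpha>" for \<alpha>
      proof -
        note h = series_hom_facts[OF B(1) hom[OF \<alpha> B(1) BV]]
        have 1: "(\<Sum>j<u. series_mult n v \<sigma> (coord_fun B j - series_term B (\<lambda>_. f x j) 0) (H j)) \<in> series_carrier n u v \<sigma> B"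
          by (intro series_carrier_sum[OF B(1)] c cj H) auto
        have 2: "(\<Sum>b<v. series_mult n v \<sigma> (formal_var B b) (K b)) \<in> series_carrier n u v \<sigma> B"
          by (intro series_carrier_sum[OF B(1)] c formal_var_carrier K B(1)) auto
        have 3: "\<alpha> B (coord_fun B j - series_term B (\<lambda>_. f x j) 0) = S' j" if "j < u" for j
          unfolding S'_def h(3)[OF coord_fun_carrier[OF B(1)] const] h(5) coord[OF \<alpha> B(1) BV that] ..
        have 4: "\<alpha> B (\<Sum>j<u. series_mult n v \<sigma> (coord_fun B j - series_term B (\<lambda>_. f x j) 0) (H j)) =
            (\<Sum>j<u. series_mult n q \<tau> (S' j) (\<alpha> B (H j)))"
          using cj H by (subst h(6)) (auto intro!: c(4) sum.cong simp: h(4) 3)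
        have 5: "\<alpha> B (\<Sum>b<v. series_mult n v \<sigma> (formal_var B b) (K b)) =
            (\<Sum>b<v. series_mult n q \<tau> (cut (?P B) (\<zeta> b)) (\<alpha> B (K b)))"
        proof -
          have "\<alpha> B (series_mult n v \<sigma> (formal_var B b) (K b)) = series_mult n q \<tau> (cut (?P B) (\<zeta> b)) (\<alpha> B (K b))"
            if "b < v" for b
            unfolding h(4)[OF formal_var_carrier[OF B(1) that] K[OF that]] var[OF \<alpha> B(1) BV that] ..
          then show ?thesis
            using K by (subst h(6)) (auto intro!: c(4) sum.cong formal_var_carrier B(1))
        qed
        show ?thesis unfolding eq h(2)[OF c(1)[OF const 1] 2] h(2)[OF const 1] h(5) 4 5 ..
      qed
      note ca = series_hom_facts(1)[OF B(1) hom[OF a B(1) BV]] and cb = series_hom_facts(1)[OF B(1) hom[OF b B(1) BV]]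
      have mult_diff: "series_mult n q \<tau> F A - series_mult n q \<tau> F A' = series_mult n q \<tau> F (A - A')" for F A A'
        by (rule series_eqI) (simp add: cmul_diff_right)
      have "a B (cut B G) - b B (cut B G) =
          (\<Sum>j<u. series_mult n q \<tau> (S' j) (a B (H j)) - series_mult n q \<tau> (S' j) (b B (H j))) +
          (\<Sum>k<v. series_mult n q \<tau> (cut (?P B) (\<zeta> k)) (a B (K k)) - series_mult n q \<tau> (cut (?P B) (\<zeta> k)) (b B (K k)))"
        unfolding expand[OF a] expand[OF b] sum_subtractf by (simp add: algebra_simps)
      then have diff: "a B (cut B G) - b B (cut B G) =
          (\<Sum>j<u. series_mult n q \<tau> (S' j) (a B (H j) - b B (H j))) +
          (\<Sum>k<v. series_mult n q \<tau> (cut (?P B) (\<zeta> k)) (a B (K k) - b B (K k)))"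
        unfolding mult_diff .
      note c' = series_carrier_closed[OF PB]
      have S'c: "S' j \<in> series_carrier n p q \<tau> (?P B)" if "j < u" for j
        unfolding S'_def by (intro c' smooth_const PB cut_carrier[OF U PB PBU] s that)
      have \<zeta>c: "cut (?P B) (\<zeta> k) \<in> series_carrier n p q \<tau> (?P B)" if "k < v" for k
        by (intro cut_carrier[OF U PB PBU] \<zeta> that)
      have S'0: "S' j 0 x = 0" if "j < u" for j
        using xB f(1)[OF xU(1) that] by (simp add: S'_def cut_def series_term_def)
      have \<zeta>0: "cut (?P B) (\<zeta> k) 0 x = 0" if "k < v" for k using \<zeta>(2)[OF that] by (simp add: cut_def)
      have "series_vanishes p q (Suc k) (a B (cut B G) - b B (cut B G)) x"
        unfolding diff
      proof (rule series_vanishes_add[OF PB xB])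
        show "(\<Sum>j<u. series_mult n q \<tau> (S' j) (a B (H j) - b B (H j))) \<in> series_carrier n p q \<tau> (?P B)"
          by (intro series_carrier_sum[OF PB] c' S'c ca cb H) auto
        show "(\<Sum>k<v. series_mult n q \<tau> (cut (?P B) (\<zeta> k)) (a B (K k) - b B (K k))) \<in> series_carrier n p q \<tau> (?P B)"
          by (intro series_carrier_sum[OF PB] c' \<zeta>c ca cb K) auto
        show "series_vanishes p q (Suc k) (\<Sum>j<u. series_mult n q \<tau> (S' j) (a B (H j) - b B (H j))) x"
        proof (rule series_vanishes_sum[OF PB xB])
          fix j assume "j \<in> {..<u}"
          then have j: "j < u" by simp
          show "series_mult n q \<tau> (S' j) (a B (H j) - b B (H j)) \<in> series_carrier n p q \<tau> (?P B)"
            by (intro c' S'c ca cb H j)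
          show "series_vanishes p q (Suc k) (series_mult n q \<tau> (S' j) (a B (H j) - b B (H j))) x"
            using Suc.IH B(1) BV H[OF j] xB
            by (intro series_vanishes_mult[OF PB xB S'c[OF j] c'(2)[OF ca[OF H[OF j]] cb[OF H[OF j]]] S'0[OF j]]) blast
        qed
        show "series_vanishes p q (Suc k) (\<Sum>k<v. series_mult n q \<tau> (cut (?P B) (\<zeta> k)) (a B (K k) - b B (K k))) x"
        proof (rule series_vanishes_sum[OF PB xB])
          fix j assume "j \<in> {..<v}"
          then have j: "j < v" by simp
          show "series_mult n q \<tau> (cut (?P B) (\<zeta> j)) (a B (K j) - b B (K j)) \<in> series_carrier n p q \<tau> (?P B)"
            by (intro c' \<zeta>c ca cb K j)
          show "series_vanishes p q (Suc k) (series_mult n q \<tau> (cut (?P B) (\<zeta> j)) (a B (K j) - b B (K j))) x"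
            using Suc.IH B(1) BV K[OF j] xB
            by (intro series_vanishes_mult[OF PB xB \<zeta>c[OF j] c'(2)[OF ca[OF K[OF j]] cb[OF K[OF j]]] \<zeta>0[OF j]]) blast
        qed
      qed
      \<comment> \<open>Vanishing at \<open>x\<close> depends only on the germ, so the result over
        \<open>B\<close> carries over to \<open>W\<close>.\<close>
      moreover have "cut (?P B) (a B (cut B G) - b B (cut B G)) = cut (?P B) (a W G - b W G)"
        unfolding restr[OF a W B(1,3) G] restr[OF b W B(1,3) G] by simp
      ultimately show "series_vanishes p q (Suc k) (a W G - b W G) x"
        using series_vanishes_cong[OF PB xB] by blast
    qed
  qed
  note van = this
  have "coeffs_at x (a W G - b W G) = 0" if "x \<in> ?P W" for x
    by (rule series_vanishes_all[where p = p and q = q]) (use van W G that in blast)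
  then show ?thesis
    using series_hom_facts(1)[OF W(1) hom[OF a W] G] series_hom_facts(1)[OF W(1) hom[OF b W] G]
    by (intro series_carrier_eqI[OF pre_open[OF W(1)]]) auto
qed

section \<open>Stalks and their maximal ideals\<close>

lemma finite_Z2n [simp]: "finite (Z2n n)"
proof (rule finite_subset)
  show "Z2n n \<subseteq> {i. \<forall>k. (k \<in> {..<n} \<longrightarrow> i k \<in> {0, 1}) \<and> (k \<notin> {..<n} \<longrightarrow> i k = 0)}"
    by (auto simp: Z2n_def)
qed (rule finite_set_of_finite_funs; simp)

section \<open>Germs and the ring of the stalk\<close>

text \<open>The part of the presheaf axioms from which the stalk is a ring. In this form it applies
  to \<open>M\<close> and can be verified directly for a superdomain.\<close>

locale presheaf_point =
  fixes n :: nat and X :: "('m, 'a) ringed_space" and m :: 'm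
  assumes m_in: "m \<in> topspace (base X)"
    and ring_sections: "openin (base X) U \<Longrightarrow> ring (sections X U)"
    and rstr_hom: "openin (base X) U \<Longrightarrow> openin (base X) W \<Longrightarrow> W \<subseteq> U \<Longrightarrow>
          rstr X U W \<in> ring_hom (sections X U) (sections X W)"
    and rstr_id: "openin (base X) U \<Longrightarrow> s \<in> carrier (sections X U) \<Longrightarrow> rstr X U U s = s"
    and rstr_rstr: "openin (base X) U \<Longrightarrow> openin (base X) W \<Longrightarrow> openin (base X) N \<Longrightarrow> N \<subseteq> W \<Longrightarrow> W \<subseteq> U \<Longrightarrow>
          s \<in> carrier (sections X U) \<Longrightarrow> rstr X W N (rstr X U W s) = rstr X U N s"
begin

definition nbhd :: "'m set \<Rightarrow> bool" where
  "nbhd U \<longleftrightarrow> openin (base X) U \<and> m \<in> U"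

lemma nbhd_Int: "nbhd U \<Longrightarrow> nbhd W \<Longrightarrow> nbhd (U \<inter> W)"
  by (auto simp: nbhd_def)

lemma nbhd_topspace: "nbhd (topspace (base X))"
  using m_in by (simp add: nbhd_def)

lemma nbhd_ring: "nbhd U \<Longrightarrow> ring (sections X U)"
  by (simp add: nbhd_def ring_sections)

lemma sections_closed:
  assumes "nbhd U" "s \<in> carrier (sections X U)" "t \<in> carrier (sections X U)"
  shows "s \<otimes>\<^bsub>sections X U\<^esub> t \<in> carrier (sections X U)" "s \<oplus>\<^bsub>sections X U\<^esub> t \<in> carrier (sections X U)"
    and "\<zero>\<^bsub>sections X U\<^esub> \<in> carrier (sections X U)" "\<one>\<^bsub>sections X U\<^esub> \<in> carrier (sections X U)"
proof -
  interpret ring "sections X U" using nbhd_ring[OF assms(1)] .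
  show "s \<otimes>\<^bsub>sections X U\<^esub> t \<in> carrier (sections X U)" "s \<oplus>\<^bsub>sections X U\<^esub> t \<in> carrier (sections X U)"
    "\<zero>\<^bsub>sections X U\<^esub> \<in> carrier (sections X U)" "\<one>\<^bsub>sections X U\<^esub> \<in> carrier (sections X U)"
    using assms by auto
qed

lemma rstr_closed:
  "openin (base X) U \<Longrightarrow> openin (base X) W \<Longrightarrow> W \<subseteq> U \<Longrightarrow> s \<in> carrier (sections X U) \<Longrightarrow>
     rstr X U W s \<in> carrier (sections X W)"
  using rstr_hom ring_hom_closed by metis

lemma rstr_ops:
  assumes "openin (base X) U" "openin (base X) W" "W \<subseteq> U" "s \<in> carrier (sections X U)" "t \<in> carrier (sections X U)"
  shows "rstr X U W (s \<otimes>\<^bsub>sections X U\<^esub> t) = rstr X U W s \<otimes>\<^bsub>sections X W\<^esub> rstr X U W t"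
    and "rstr X U W (s \<oplus>\<^bsub>sections X U\<^esub> t) = rstr X U W s \<oplus>\<^bsub>sections X W\<^esub> rstr X U W t"
  using ring_hom_mult[OF rstr_hom] ring_hom_add[OF rstr_hom] assms by auto

text \<open>A section represents its own germ, which gives one direction. For the other, agreement
  near \<open>m\<close> is transitive, as seen on the intersection of the two
  neighbourhoods.\<close>

lemma germ_eq_iff:
  assumes U: "nbhd U" "s \<in> carrier (sections X U)" and W: "nbhd W" "t \<in> carrier (sections X W)"
  shows "germ X m U s = germ X m W t \<longleftrightarrow> (\<exists>N. nbhd N \<and> N \<subseteq> U \<inter> W \<and> rstr X U N s = rstr X W N t)"
proof
  assume "germ X m U s = germ X m W t"
  moreover have "(W, t) \<in> germ X m W t"
    using W by (auto simp: germ_def nbhd_def)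
  ultimately have "(W, t) \<in> germ X m U s" by simp
  then show "\<exists>N. nbhd N \<and> N \<subseteq> U \<inter> W \<and> rstr X U N s = rstr X W N t"
    by (auto simp: germ_def nbhd_def)
next
  assume "\<exists>N. nbhd N \<and> N \<subseteq> U \<inter> W \<and> rstr X U N s = rstr X W N t"
  then obtain N where N: "nbhd N" "N \<subseteq> U \<inter> W" "rstr X U N s = rstr X W N t" by blast
  have sub: "germ X m W2 t2 \<subseteq> germ X m W1 t1"
    if W1: "nbhd W1" "t1 \<in> carrier (sections X W1)" and W2: "nbhd W2" "t2 \<in> carrier (sections X W2)"
      and N: "nbhd N" "N \<subseteq> W1 \<inter> W2" "rstr X W1 N t1 = rstr X W2 N t2" for W1 W2 t1 t2
  proof clarify
    fix W' t' assume "(W', t') \<in> germ X m W2 t2"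
    then obtain N' where W': "nbhd W'" "t' \<in> carrier (sections X W')"
      and N': "nbhd N'" "N' \<subseteq> W2 \<inter> W'" "rstr X W2 N' t2 = rstr X W' N' t'"
      by (auto simp: germ_def nbhd_def)
    let ?N = "N \<inter> N'"
    have "rstr X W1 ?N t1 = rstr X N ?N (rstr X W1 N t1)"
      using rstr_rstr[of W1 N ?N t1] W1 N nbhd_Int[OF N(1) N'(1)] by (simp add: nbhd_def)
    also have "\<dots> = rstr X W2 ?N t2"
      unfolding N(3) using rstr_rstr[of W2 N ?N t2] W2 N nbhd_Int[OF N(1) N'(1)] by (simp add: nbhd_def)
    also have "\<dots> = rstr X N' ?N (rstr X W2 N' t2)"
      using rstr_rstr[of W2 N' ?N t2] W2 N' nbhd_Int[OF N(1) N'(1)] by (simp add: nbhd_def)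
    also have "\<dots> = rstr X W' ?N t'"
      unfolding N'(3) using rstr_rstr[of W' N' ?N t'] W' N' nbhd_Int[OF N(1) N'(1)] by (simp add: nbhd_def)
    finally show "(W', t') \<in> germ X m W1 t1"
      using W' nbhd_Int[OF N(1) N'(1)] N(2) N'(2) unfolding germ_def nbhd_def by blast
  qed
  show "germ X m U s = germ X m W t"
    using sub[OF U W N] sub[OF W U N(1) _ N(3)[symmetric]] N(2) by blast
qed

lemma germ_restrict:
  assumes "nbhd U" "nbhd W" "W \<subseteq> U" "s \<in> carrier (sections X U)"
  shows "germ X m W (rstr X U W s) = germ X m U s"
proof -
  have "rstr X U W s \<in> carrier (sections X W)" using assms rstr_closed by (simp add: nbhd_def)
  moreover have "rstr X W W (rstr X U W s) = rstr X U W s"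
    using assms rstr_rstr by (simp add: nbhd_def)
  ultimately show ?thesis using assms by (subst germ_eq_iff) (auto intro!: exI[of _ W])
qed

lemma stalk_carrier_iff:
  "x \<in> carrier (stalk X m) \<longleftrightarrow> (\<exists>U s. nbhd U \<and> s \<in> carrier (sections X U) \<and> x = germ X m U s)"
  by (auto simp: stalk_def nbhd_def)

lemma germ_in_stalk: "nbhd U \<Longrightarrow> s \<in> carrier (sections X U) \<Longrightarrow> germ X m U s \<in> carrier (stalk X m)"
  by (auto simp: stalk_carrier_iff)

lemma stalk_common_nbhd:
  assumes "x \<in> carrier (stalk X m)" "y \<in> carrier (stalk X m)"
  obtains U s t where "nbhd U" "s \<in> carrier (sections X U)" "t \<in> carrier (sections X U)"
    "x = germ X m U s" "y = germ X m U t"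
proof -
  obtain U s W t where *: "nbhd U" "s \<in> carrier (sections X U)" "x = germ X m U s"
    "nbhd W" "t \<in> carrier (sections X W)" "y = germ X m W t"
    using assms by (auto simp: stalk_carrier_iff)
  show ?thesis
    by (rule that[of "U \<inter> W" "rstr X U (U \<inter> W) s" "rstr X W (U \<inter> W) t"])
      (use * nbhd_Int[OF *(1,4)] germ_restrict[of U "U \<inter> W" s] germ_restrict[of W "U \<inter> W" t]
        rstr_closed[of U "U \<inter> W" s] rstr_closed[of W "U \<inter> W" t] in \<open>auto simp: nbhd_def\<close>)
qed

lemma stalk_common_nbhd3:
  assumes "x \<in> carrier (stalk X m)" "y \<in> carrier (stalk X m)" "z \<in> carrier (stalk X m)"
  obtains U s t r where "nbhd U" "s \<in> carrier (sections X U)" "t \<in> carrier (sections X U)" "r \<in> carrier (sections X U)"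
    "x = germ X m U s" "y = germ X m U t" "z = germ X m U r"
proof -
  obtain U s t where 1: "nbhd U" "s \<in> carrier (sections X U)" "t \<in> carrier (sections X U)"
    "x = germ X m U s" "y = germ X m U t"
    using stalk_common_nbhd[OF assms(1,2)] by blast
  obtain W r where 2: "nbhd W" "r \<in> carrier (sections X W)" "z = germ X m W r"
    using assms(3) by (auto simp: stalk_carrier_iff)
  show ?thesis
    by (rule that[of "U \<inter> W" "rstr X U (U \<inter> W) s" "rstr X U (U \<inter> W) t" "rstr X W (U \<inter> W) r"])
      (use 1 2 nbhd_Int[OF 1(1) 2(1)] germ_restrict[of U "U \<inter> W" s] germ_restrict[of U "U \<inter> W" t]
        germ_restrict[of W "U \<inter> W" r] rstr_closed[of U "U \<inter> W" s] rstr_closed[of U "U \<inter> W" t]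
        rstr_closed[of W "U \<inter> W" r] in \<open>auto simp: nbhd_def\<close>)
qed

text \<open>An operation on sections that commutes with restriction gives the same germ for all
  representatives over common neighbourhoods. Hence the description operator in \<open>stalk\<close>
  is determined; both product and sum are instances.\<close>

lemma stalk_binop:
  assumes closed: "\<And>U s t. nbhd U \<Longrightarrow> s \<in> carrier (sections X U) \<Longrightarrow> t \<in> carrier (sections X U) \<Longrightarrow>
      f U s t \<in> carrier (sections X U)"
    and restr: "\<And>U W s t. nbhd U \<Longrightarrow> nbhd W \<Longrightarrow> W \<subseteq> U \<Longrightarrow> s \<in> carrier (sections X U) \<Longrightarrow> t \<in> carrier (sections X U) \<Longrightarrow>
      rstr X U W (f U s t) = f W (rstr X U W s) (rstr X U W t)"
    and U: "nbhd U" "s \<in> carrier (sections X U)" "t \<in> carrier (sections X U)"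
  shows "(THE z. \<exists>U' s' t'. openin (base X) U' \<and> m \<in> U' \<and> s' \<in> carrier (sections X U') \<and> t' \<in> carrier (sections X U') \<and>
      germ X m U s = germ X m U' s' \<and> germ X m U t = germ X m U' t' \<and> z = germ X m U' (f U' s' t')) =
    germ X m U (f U s t)"
proof (rule the_equality)
  show "\<exists>U' s' t'. openin (base X) U' \<and> m \<in> U' \<and> s' \<in> carrier (sections X U') \<and> t' \<in> carrier (sections X U') \<and>
      germ X m U s = germ X m U' s' \<and> germ X m U t = germ X m U' t' \<and> germ X m U (f U s t) = germ X m U' (f U' s' t')"
    using U by (auto simp: nbhd_def)
next
  fix z
  assume "\<exists>U' s' t'. openin (base X) U' \<and> m \<in> U' \<and> s' \<in> carrier (sections X U') \<and> t' \<in> carrier (sections X U') \<and>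
      germ X m U s = germ X m U' s' \<and> germ X m U t = germ X m U' t' \<and> z = germ X m U' (f U' s' t')"
  then obtain U' s' t' where U': "nbhd U'" "s' \<in> carrier (sections X U')" "t' \<in> carrier (sections X U')"
    and eq: "germ X m U s = germ X m U' s'" "germ X m U t = germ X m U' t'" and z: "z = germ X m U' (f U' s' t')"
    by (auto simp: nbhd_def)
  obtain N1 N2 where N1: "nbhd N1" "N1 \<subseteq> U \<inter> U'" "rstr X U N1 s = rstr X U' N1 s'"
    and N2: "nbhd N2" "N2 \<subseteq> U \<inter> U'" "rstr X U N2 t = rstr X U' N2 t'"
    using eq germ_eq_iff U U' by meson
  define N where "N = N1 \<inter> N2"
  have N: "nbhd N" "N \<subseteq> U" "N \<subseteq> U'" "N \<subseteq> N1" "N \<subseteq> N2"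
    using N1 N2 nbhd_Int by (auto simp: N_def)
  have op: "openin (base X) U" "openin (base X) U'" "openin (base X) N" "openin (base X) N1" "openin (base X) N2"
    using U(1) U'(1) N(1) N1(1) N2(1) by (auto simp: nbhd_def)
  have s: "rstr X U N s = rstr X U' N s'"
    using rstr_rstr[OF op(1,4,3), of s] rstr_rstr[OF op(2,4,3), of s'] N1 N U U' by auto
  have t: "rstr X U N t = rstr X U' N t'"
    using rstr_rstr[OF op(1,5,3), of t] rstr_rstr[OF op(2,5,3), of t'] N2 N U U' by auto
  have "rstr X U N (f U s t) = rstr X U' N (f U' s' t')"
    using restr[OF U(1) N(1,2) U(2,3)] restr[OF U'(1) N(1,3) U'(2,3)] s t by simp
  then show "z = germ X m U (f U s t)"
  proof -
    assume eq: "rstr X U N (f U s t) = rstr X U' N (f U' s' t')"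
    have "N \<subseteq> U' \<inter> U" using N by blast
    then show ?thesis unfolding z
      by (subst germ_eq_iff[OF U'(1) closed[OF U'] U(1) closed[OF U]]) (use N(1) eq[symmetric] in blast)
  qed
qed

lemma stalk_mult:
  assumes "nbhd U" "s \<in> carrier (sections X U)" "t \<in> carrier (sections X U)"
  shows "germ X m U s \<otimes>\<^bsub>stalk X m\<^esub> germ X m U t = germ X m U (s \<otimes>\<^bsub>sections X U\<^esub> t)"
proof -
  have restr: "rstr X U W (s \<otimes>\<^bsub>sections X U\<^esub> t) = rstr X U W s \<otimes>\<^bsub>sections X W\<^esub> rstr X U W t"
    if "nbhd U" "nbhd W" "W \<subseteq> U" "s \<in> carrier (sections X U)" "t \<in> carrier (sections X U)" for U W s t
    using that by (simp add: rstr_ops nbhd_def)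
  show ?thesis
    using stalk_binop[of "\<lambda>U s t. s \<otimes>\<^bsub>sections X U\<^esub> t", OF sections_closed(1) restr assms] by (simp add: stalk_def)
qed

lemma stalk_add:
  assumes "nbhd U" "s \<in> carrier (sections X U)" "t \<in> carrier (sections X U)"
  shows "germ X m U s \<oplus>\<^bsub>stalk X m\<^esub> germ X m U t = germ X m U (s \<oplus>\<^bsub>sections X U\<^esub> t)"
proof -
  have restr: "rstr X U W (s \<oplus>\<^bsub>sections X U\<^esub> t) = rstr X U W s \<oplus>\<^bsub>sections X W\<^esub> rstr X U W t"
    if "nbhd U" "nbhd W" "W \<subseteq> U" "s \<in> carrier (sections X U)" "t \<in> carrier (sections X U)" for U W s t
    using that by (simp add: rstr_ops nbhd_def)
  show ?thesis
    using stalk_binop[of "\<lambda>U s t. s \<oplus>\<^bsub>sections X U\<^esub> t", OF sections_closed(2) restr assms] by (simp add: stalk_def)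
qed

lemma stalk_one: "nbhd U \<Longrightarrow> \<one>\<^bsub>stalk X m\<^esub> = germ X m U \<one>\<^bsub>sections X U\<^esub>"
  and stalk_zero: "nbhd U \<Longrightarrow> \<zero>\<^bsub>stalk X m\<^esub> = germ X m U \<zero>\<^bsub>sections X U\<^esub>"
proof -
  assume U: "nbhd U"
  have op: "openin (base X) U" "U \<subseteq> topspace (base X)" using U openin_subset by (auto simp: nbhd_def)
  have r: "ring (sections X (topspace (base X)))" "ring (sections X U)" using ring_sections op(1) by auto
  note h = rstr_hom[OF openin_topspace op]
  interpret T: ring "sections X (topspace (base X))" by (rule r)
  note g = germ_restrict[OF nbhd_topspace U op(2)]
  show "\<one>\<^bsub>stalk X m\<^esub> = germ X m U \<one>\<^bsub>sections X U\<^esub>"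
    using g[OF T.one_closed] ring_hom_one[OF h] by (simp add: stalk_def)
  show "\<zero>\<^bsub>stalk X m\<^esub> = germ X m U \<zero>\<^bsub>sections X U\<^esub>"
    using g[OF T.zero_closed] ring_hom_zero[OF h r] by (simp add: stalk_def)
qed

lemma ring_stalk: "ring (stalk X m)"
proof -
  show ?thesis
  proof (rule ringI)
    show "abelian_group (stalk X m)"
    proof (rule abelian_groupI)
      fix x y assume "x \<in> carrier (stalk X m)" "y \<in> carrier (stalk X m)"
      then obtain U s t where U: "nbhd U" "s \<in> carrier (sections X U)" "t \<in> carrier (sections X U)"
        "x = germ X m U s" "y = germ X m U t"
        by (rule stalk_common_nbhd)
      interpret R: ring "sections X U" using nbhd_ring[OF U(1)] .
      from U show "x \<oplus>\<^bsub>stalk X m\<^esub> y \<in> carrier (stalk X m)" "x \<oplus>\<^bsub>stalk X m\<^esub> y = y \<oplus>\<^bsub>stalk X m\<^esub> x"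
        by (simp_all add: stalk_add germ_in_stalk R.a_comm)
    next
      show "\<zero>\<^bsub>stalk X m\<^esub> \<in> carrier (stalk X m)"
        using germ_in_stalk[OF nbhd_topspace abelian_monoid.zero_closed[OF abelian_group.axioms(1)[OF ring.is_abelian_group[OF nbhd_ring[OF nbhd_topspace]]]]]
        by (simp add: stalk_zero[OF nbhd_topspace])
    next
      fix x y z assume "x \<in> carrier (stalk X m)" "y \<in> carrier (stalk X m)" "z \<in> carrier (stalk X m)"
      then obtain U s t r where U: "nbhd U" "s \<in> carrier (sections X U)" "t \<in> carrier (sections X U)" "r \<in> carrier (sections X U)"
        "x = germ X m U s" "y = germ X m U t" "z = germ X m U r"
        by (rule stalk_common_nbhd3)
      interpret R: ring "sections X U" using nbhd_ring[OF U(1)] .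
      from U show "x \<oplus>\<^bsub>stalk X m\<^esub> y \<oplus>\<^bsub>stalk X m\<^esub> z = x \<oplus>\<^bsub>stalk X m\<^esub> (y \<oplus>\<^bsub>stalk X m\<^esub> z)"
        by (simp add: stalk_add R.a_assoc)
    next
      fix x assume "x \<in> carrier (stalk X m)"
      then obtain U s where U: "nbhd U" "s \<in> carrier (sections X U)" "x = germ X m U s"
        by (auto simp: stalk_carrier_iff)
      interpret R: ring "sections X U" using nbhd_ring[OF U(1)] .
      from U show "\<zero>\<^bsub>stalk X m\<^esub> \<oplus>\<^bsub>stalk X m\<^esub> x = x"
        by (simp add: stalk_zero[OF U(1)] stalk_add)
      show "\<exists>y\<in>carrier (stalk X m). y \<oplus>\<^bsub>stalk X m\<^esub> x = \<zero>\<^bsub>stalk X m\<^esub>"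
        using U by (intro bexI[of _ "germ X m U (\<ominus>\<^bsub>sections X U\<^esub> s)"])
          (simp_all add: stalk_zero[OF U(1)] stalk_add germ_in_stalk R.l_neg)
    qed
    show "Group.monoid (stalk X m)"
    proof (rule monoidI)
      fix x y assume "x \<in> carrier (stalk X m)" "y \<in> carrier (stalk X m)"
      then obtain U s t where U: "nbhd U" "s \<in> carrier (sections X U)" "t \<in> carrier (sections X U)"
        "x = germ X m U s" "y = germ X m U t"
        by (rule stalk_common_nbhd)
      interpret R: ring "sections X U" using nbhd_ring[OF U(1)] .
      from U show "x \<otimes>\<^bsub>stalk X m\<^esub> y \<in> carrier (stalk X m)"
        by (simp add: stalk_mult germ_in_stalk)
    next
      show "\<one>\<^bsub>stalk X m\<^esub> \<in> carrier (stalk X m)"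
        using germ_in_stalk[OF nbhd_topspace monoid.one_closed[OF ring.is_monoid[OF nbhd_ring[OF nbhd_topspace]]]]
        by (simp add: stalk_one[OF nbhd_topspace])
    next
      fix x y z assume "x \<in> carrier (stalk X m)" "y \<in> carrier (stalk X m)" "z \<in> carrier (stalk X m)"
      then obtain U s t r where U: "nbhd U" "s \<in> carrier (sections X U)" "t \<in> carrier (sections X U)" "r \<in> carrier (sections X U)"
        "x = germ X m U s" "y = germ X m U t" "z = germ X m U r"
        by (rule stalk_common_nbhd3)
      interpret R: ring "sections X U" using nbhd_ring[OF U(1)] .
      from U show "x \<otimes>\<^bsub>stalk X m\<^esub> y \<otimes>\<^bsub>stalk X m\<^esub> z = x \<otimes>\<^bsub>stalk X m\<^esub> (y \<otimes>\<^bsub>stalk X m\<^esub> z)"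
        by (simp add: stalk_mult R.m_assoc)
    next
      fix x assume "x \<in> carrier (stalk X m)"
      then obtain U s where U: "nbhd U" "s \<in> carrier (sections X U)" "x = germ X m U s"
        by (auto simp: stalk_carrier_iff)
      interpret R: ring "sections X U" using nbhd_ring[OF U(1)] .
      from U show "\<one>\<^bsub>stalk X m\<^esub> \<otimes>\<^bsub>stalk X m\<^esub> x = x"
        by (simp add: stalk_one[OF U(1)] stalk_mult R.l_one)
      show "x \<otimes>\<^bsub>stalk X m\<^esub> \<one>\<^bsub>stalk X m\<^esub> = x"
        using U by (simp add: stalk_one[OF U(1)] stalk_mult)
    qed
  next
    fix x y z assume "x \<in> carrier (stalk X m)" "y \<in> carrier (stalk X m)" "z \<in> carrier (stalk X m)"
    then obtain U s t r where U: "nbhd U" "s \<in> carrier (sections X U)" "t \<in> carrier (sections X U)" "r \<in> carrier (sections X U)"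
      "x = germ X m U s" "y = germ X m U t" "z = germ X m U r"
      by (rule stalk_common_nbhd3)
    interpret R: ring "sections X U" using nbhd_ring[OF U(1)] .
    from U show "(x \<oplus>\<^bsub>stalk X m\<^esub> y) \<otimes>\<^bsub>stalk X m\<^esub> z = x \<otimes>\<^bsub>stalk X m\<^esub> z \<oplus>\<^bsub>stalk X m\<^esub> y \<otimes>\<^bsub>stalk X m\<^esub> z"
      by (simp add: stalk_mult stalk_add R.l_distr)
    show "z \<otimes>\<^bsub>stalk X m\<^esub> (x \<oplus>\<^bsub>stalk X m\<^esub> y) = z \<otimes>\<^bsub>stalk X m\<^esub> x \<oplus>\<^bsub>stalk X m\<^esub> z \<otimes>\<^bsub>stalk X m\<^esub> y"
      using U by (simp add: stalk_mult stalk_add R.r_distr)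
  qed
qed

lemma stalk_finsum:
  assumes U: "nbhd U"
  shows "finite A \<Longrightarrow> (\<And>i. i \<in> A \<Longrightarrow> c i \<in> carrier (sections X U)) \<Longrightarrow>
    germ X m U (finsum (sections X U) c A) = finsum (stalk X m) (\<lambda>i. germ X m U (c i)) A"
proof (induction A rule: finite_induct)
  have R: "abelian_monoid (sections X U)" "abelian_monoid (stalk X m)"
    using ring_sections U ring_stalk by (simp_all add: nbhd_def abelian_group.axioms ring.is_abelian_group)
  case empty
  show ?case using R by (simp add: abelian_monoid.finsum_empty stalk_zero[OF U])
next
  have R: "abelian_monoid (sections X U)" "abelian_monoid (stalk X m)"
    using ring_sections U ring_stalk by (simp_all add: nbhd_def abelian_group.axioms ring.is_abelian_group)
  case (insert i A)
  have "finsum (sections X U) c A \<in> carrier (sections X U)"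
    using insert.prems by (intro abelian_monoid.finsum_closed[OF R(1)]) auto
  then show ?case
    using insert U by (simp add: abelian_monoid.finsum_insert[OF R(1)] abelian_monoid.finsum_insert[OF R(2)]
        germ_in_stalk Pi_iff flip: stalk_add)
qed

end

text \<open>
  \<open>val U s\<close> is the value at \<open>m\<close> of the body of \<open>s\<close>. The existence of such an evaluation for which every
  section with nonzero value is locally invertible is what makes the stalk local.
\<close>

locale valued_point = presheaf_point +
  fixes val :: "'a set \<Rightarrow> 'b \<Rightarrow> real"
  assumes val_rstr: "nbhd U \<Longrightarrow> nbhd W \<Longrightarrow> W \<subseteq> U \<Longrightarrow> s \<in> carrier (sections X U) \<Longrightarrow> val W (rstr X U W s) = val U s"
    and val_add: "nbhd U \<Longrightarrow> s \<in> carrier (sections X U) \<Longrightarrow> t \<in> carrier (sections X U) \<Longrightarrow>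
          val U (s \<oplus>\<^bsub>sections X U\<^esub> t) = val U s + val U t"
    and val_mult: "nbhd U \<Longrightarrow> s \<in> carrier (sections X U) \<Longrightarrow> t \<in> carrier (sections X U) \<Longrightarrow>
          val U (s \<otimes>\<^bsub>sections X U\<^esub> t) = val U s * val U t"
    and val_one: "nbhd U \<Longrightarrow> val U \<one>\<^bsub>sections X U\<^esub> = 1"
    and val_grade: "nbhd U \<Longrightarrow> i \<in> Z2n n \<Longrightarrow> i \<noteq> deg_zero \<Longrightarrow> s \<in> grade (sections X U) i \<Longrightarrow> val U s = 0"
    and decompose: "nbhd U \<Longrightarrow> s \<in> carrier (sections X U) \<Longrightarrow>
          \<exists>c. (\<forall>i\<in>Z2n n. c i \<in> grade (sections X U) i) \<and> s = finsum (sections X U) c (Z2n n)"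
    and grade_carrier: "nbhd U \<Longrightarrow> i \<in> Z2n n \<Longrightarrow> grade (sections X U) i \<subseteq> carrier (sections X U)"
    and val_unit: "nbhd U \<Longrightarrow> s \<in> carrier (sections X U) \<Longrightarrow> val U s \<noteq> 0 \<Longrightarrow>
          \<exists>W. nbhd W \<and> W \<subseteq> U \<and> rstr X U W s \<in> Units (sections X W)"
begin

lemma val_zero:
  assumes U: "nbhd U"
  shows "val U \<zero>\<^bsub>sections X U\<^esub> = 0"
proof -
  interpret ring "sections X U" using nbhd_ring[OF U] .
  show ?thesis using val_add[OF U zero_closed zero_closed] by simp
qed

lemma val_germ_cong:
  assumes "nbhd U" "s \<in> carrier (sections X U)" "nbhd W" "t \<in> carrier (sections X W)" "germ X m U s = germ X m W t"
  shows "val U s = val W t"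
proof -
  obtain N where "nbhd N" "N \<subseteq> U \<inter> W" "rstr X U N s = rstr X W N t"
    using assms germ_eq_iff by metis
  then show ?thesis using val_rstr[of U N s] val_rstr[of W N t] assms by simp
qed

lemma val_finsum:
  assumes U: "nbhd U"
  shows "finite A \<Longrightarrow> (\<And>i. i \<in> A \<Longrightarrow> c i \<in> carrier (sections X U)) \<Longrightarrow>
    val U (finsum (sections X U) c A) = (\<Sum>i\<in>A. val U (c i))"
proof (induction A rule: finite_induct)
  have R: "abelian_monoid (sections X U)"
    using nbhd_ring[OF U] by (simp add: abelian_group.axioms ring.is_abelian_group)
  case empty
  show ?case using R U by (simp add: abelian_monoid.finsum_empty val_zero)
next
  have R: "abelian_monoid (sections X U)"
    using nbhd_ring[OF U] by (simp add: abelian_group.axioms ring.is_abelian_group)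
  case (insert i A)
  have "finsum (sections X U) c A \<in> carrier (sections X U)"
    using insert.prems by (intro abelian_monoid.finsum_closed[OF R]) auto
  then show ?case
    using insert U by (simp add: abelian_monoid.finsum_insert[OF R] Pi_iff val_add)
qed

section \<open>The ideal of germs with vanishing value\<close>

definition max_ideal :: "('a set \<times> 'b) set set" where
  "max_ideal = {germ X m U s | U s. nbhd U \<and> s \<in> carrier (sections X U) \<and> val U s = 0}"

lemma germ_in_max_ideal_iff:
  assumes "nbhd U" "s \<in> carrier (sections X U)"
  shows "germ X m U s \<in> max_ideal \<longleftrightarrow> val U s = 0"
proof
  assume "germ X m U s \<in> max_ideal"
  then obtain W t where "germ X m U s = germ X m W t" "nbhd W" "t \<in> carrier (sections X W)" "val W t = 0"
    unfolding max_ideal_def by blast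
  then show "val U s = 0" using val_germ_cong[OF assms] by metis
next
  show "val U s = 0 \<Longrightarrow> germ X m U s \<in> max_ideal" unfolding max_ideal_def using assms by blast
qed

lemma zero_in_max_ideal: "\<zero>\<^bsub>stalk X m\<^esub> \<in> max_ideal"
proof -
  interpret ring "sections X (topspace (base X))" using nbhd_ring[OF nbhd_topspace] .
  show ?thesis
    unfolding stalk_zero[OF nbhd_topspace]
    by (subst germ_in_max_ideal_iff[OF nbhd_topspace zero_closed]) (rule val_zero[OF nbhd_topspace])
qed

lemma max_ideal_sub: "max_ideal \<subseteq> carrier (stalk X m)"
  unfolding max_ideal_def using germ_in_stalk by blast

lemma ideal_max_ideal: "ideal max_ideal (stalk X m)"
proof (rule idealI[OF ring_stalk])
  interpret S: ring "stalk X m" by (rule ring_stalk)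
  show "subgroup max_ideal (add_monoid (stalk X m))"
  proof (rule S.add.subgroupI)
    show "max_ideal \<subseteq> carrier (stalk X m)" by (rule max_ideal_sub)
    show "max_ideal \<noteq> {}"
      using zero_in_max_ideal by blast
  next
    fix x assume x: "x \<in> max_ideal"
    then have xc: "x \<in> carrier (stalk X m)" using max_ideal_sub by blast
    then have "\<ominus>\<^bsub>stalk X m\<^esub> x \<in> carrier (stalk X m)" by simp
    with xc obtain U s t where U: "nbhd U" "s \<in> carrier (sections X U)" "t \<in> carrier (sections X U)"
      "x = germ X m U s" "\<ominus>\<^bsub>stalk X m\<^esub> x = germ X m U t"
      by (rule stalk_common_nbhd)
    have "x \<oplus>\<^bsub>stalk X m\<^esub> \<ominus>\<^bsub>stalk X m\<^esub> x = \<zero>\<^bsub>stalk X m\<^esub>" using xc by (rule S.r_neg)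
    then have "germ X m U (s \<oplus>\<^bsub>sections X U\<^esub> t) = germ X m U \<zero>\<^bsub>sections X U\<^esub>"
      unfolding U(5) unfolding U(4) using U by (simp add: stalk_add stalk_zero[OF U(1)])
    then have "val U s + val U t = 0"
      using val_germ_cong[of U "s \<oplus>\<^bsub>sections X U\<^esub> t" U "\<zero>\<^bsub>sections X U\<^esub>"] U sections_closed[OF U(1-3)]
      by (simp add: val_add val_zero)
    moreover have "val U s = 0" using x U germ_in_max_ideal_iff by simp
    ultimately show "\<ominus>\<^bsub>stalk X m\<^esub> x \<in> max_ideal" unfolding U(5) using U germ_in_max_ideal_iff by simp
  next
    fix x y assume xy: "x \<in> max_ideal" "y \<in> max_ideal"
    then have "x \<in> carrier (stalk X m)" "y \<in> carrier (stalk X m)" using max_ideal_sub by auto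
    then obtain U s t where U: "nbhd U" "s \<in> carrier (sections X U)" "t \<in> carrier (sections X U)"
      "x = germ X m U s" "y = germ X m U t"
      by (rule stalk_common_nbhd)
    then show "x \<oplus>\<^bsub>stalk X m\<^esub> y \<in> max_ideal"
      using xy sections_closed[OF U(1-3)] by (simp add: stalk_add germ_in_max_ideal_iff val_add)
  qed
next
  fix x y assume xy: "x \<in> max_ideal" "y \<in> carrier (stalk X m)"
  then have "x \<in> carrier (stalk X m)" "y \<in> carrier (stalk X m)" using max_ideal_sub by auto
  then obtain U s t where U: "nbhd U" "s \<in> carrier (sections X U)" "t \<in> carrier (sections X U)"
    "x = germ X m U s" "y = germ X m U t"
    by (rule stalk_common_nbhd)
  have s0: "val U s = 0" using xy(1) germ_in_max_ideal_iff[OF U(1,2)] U(4) by simp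
  show "y \<otimes>\<^bsub>stalk X m\<^esub> x \<in> max_ideal"
    unfolding U(4,5) stalk_mult[OF U(1,3,2)] germ_in_max_ideal_iff[OF U(1) sections_closed(1)[OF U(1,3,2)]] val_mult[OF U(1,3,2)]
    by (simp add: s0)
  show "x \<otimes>\<^bsub>stalk X m\<^esub> y \<in> max_ideal"
    unfolding U(4,5) stalk_mult[OF U(1-3)] germ_in_max_ideal_iff[OF U(1) sections_closed(1)[OF U(1-3)]] val_mult[OF U(1-3)]
    by (simp add: s0)
qed

text \<open>A germ with nonzero value is invertible on a smaller neighbourhood, so an ideal
  containing it contains 1. This holds for all ideals, homogeneous or not, and makes
  \<open>max_ideal\<close> the largest proper one.\<close>

lemma ideal_outside_max_ideal:
  assumes J: "ideal J (stalk X m)" and "\<not> J \<subseteq> max_ideal"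
  shows "J = carrier (stalk X m)"
proof -
  interpret J: ideal J "stalk X m" by (rule J)
  obtain x where x: "x \<in> J" "x \<notin> max_ideal" using assms(2) by blast
  then have "x \<in> carrier (stalk X m)" using J.a_subset by blast
  then obtain U s where U: "nbhd U" "s \<in> carrier (sections X U)" "x = germ X m U s"
    by (auto simp: stalk_carrier_iff)
  then have "val U s \<noteq> 0" using x germ_in_max_ideal_iff by simp
  then obtain W where W: "nbhd W" "W \<subseteq> U" "rstr X U W s \<in> Units (sections X W)"
    using val_unit U by blast
  then obtain t where t: "t \<in> carrier (sections X W)" "rstr X U W s \<otimes>\<^bsub>sections X W\<^esub> t = \<one>\<^bsub>sections X W\<^esub>"
    by (auto simp: Units_def)
  have xW: "x = germ X m W (rstr X U W s)" using germ_restrict[OF U(1) W(1,2) U(2)] U(3) by simp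
  have "rstr X U W s \<in> carrier (sections X W)" using W(3) by (simp add: Units_def)
  then have "x \<otimes>\<^bsub>stalk X m\<^esub> germ X m W t = \<one>\<^bsub>stalk X m\<^esub>"
    unfolding xW using t W(1) by (simp add: stalk_mult stalk_one[OF W(1)])
  moreover have "x \<otimes>\<^bsub>stalk X m\<^esub> germ X m W t \<in> J"
    using J.I_r_closed[OF x(1) germ_in_stalk[OF W(1) t(1)]] .
  ultimately show ?thesis using J.one_imp_carrier by simp
qed

text \<open>Components of nonzero degree have value 0, so the degree zero component carries the
  whole value of the section; if that is 0, all components lie in the ideal.\<close>

lemma homogeneous_max_ideal: "homogeneous_ideal n (stalk X m) max_ideal"
  unfolding homogeneous_ideal_def
proof (intro conjI ballI ideal_max_ideal)
  fix x assume "x \<in> max_ideal"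
  then obtain U s where U: "nbhd U" "s \<in> carrier (sections X U)" "x = germ X m U s" "val U s = 0"
    by (auto simp: max_ideal_def)
  obtain c where c: "\<And>i. i \<in> Z2n n \<Longrightarrow> c i \<in> grade (sections X U) i" "s = finsum (sections X U) c (Z2n n)"
    using decompose[OF U(1,2)] by blast
  have cc: "c i \<in> carrier (sections X U)" if "i \<in> Z2n n" for i
    using c(1)[OF that] grade_carrier[OF U(1) that] by blast
  have v: "val U (c i) = 0" if "i \<in> Z2n n" "i \<noteq> deg_zero" for i
    using val_grade[OF U(1) that c(1)[OF that(1)]] .
  have "0 = (\<Sum>i\<in>Z2n n. val U (c i))"
    using val_finsum[OF U(1) finite_Z2n cc] U(4) c(2) by simp
  also have "\<dots> = val U (c deg_zero)"
    using v by (subst sum.remove[of _ deg_zero]) auto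
  finally have "val U (c i) = 0" if "i \<in> Z2n n" for i using v that by (cases "i = deg_zero") auto
  then have "germ X m U (c i) \<in> max_ideal" if "i \<in> Z2n n" for i
    using germ_in_max_ideal_iff[OF U(1) cc[OF that]] that by simp
  moreover have "germ X m U (c i) \<in> grade (stalk X m) i" if "i \<in> Z2n n" for i
    using U(1) c(1)[OF that] unfolding stalk_def nbhd_def by auto
  ultimately have "germ X m U (c i) \<in> max_ideal \<inter> grade (stalk X m) i" if "i \<in> Z2n n" for i
    using that by blast
  moreover have "x = finsum (stalk X m) (\<lambda>i. germ X m U (c i)) (Z2n n)"
    unfolding U(3) c(2) by (rule stalk_finsum[OF U(1) finite_Z2n cc])
  ultimately show "\<exists>c. (\<forall>i\<in>Z2n n. c i \<in> max_ideal \<inter> grade (stalk X m) i) \<and> x = finsum (stalk X m) c (Z2n n)"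
    by (intro exI[of _ "\<lambda>i. germ X m U (c i)"] conjI ballI)
qed

lemma max_ideal_proper: "max_ideal \<noteq> carrier (stalk X m)"
proof -
  interpret R: ring "sections X (topspace (base X))" using nbhd_ring[OF nbhd_topspace] .
  interpret S: ring "stalk X m" by (rule ring_stalk)
  have "\<one>\<^bsub>stalk X m\<^esub> \<notin> max_ideal"
    unfolding stalk_one[OF nbhd_topspace]
    by (subst germ_in_max_ideal_iff[OF nbhd_topspace R.one_closed]) (simp add: val_one[OF nbhd_topspace])
  then show ?thesis using S.one_closed by blast
qed

lemma the_max_ideal_eq: "the_max_ideal n (stalk X m) = max_ideal"
  unfolding the_max_ideal_def
proof (rule the_equality)
  show "maximal_homogeneous_ideal n (stalk X m) max_ideal"
    unfolding maximal_homogeneous_ideal_def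
    using homogeneous_max_ideal max_ideal_proper ideal_outside_max_ideal
    by (auto simp: homogeneous_ideal_def)
next
  fix I assume "maximal_homogeneous_ideal n (stalk X m) I"
  then have I: "ideal I (stalk X m)" "I \<noteq> carrier (stalk X m)"
    "\<And>J. homogeneous_ideal n (stalk X m) J \<Longrightarrow> I \<subseteq> J \<Longrightarrow> J = I \<or> J = carrier (stalk X m)"
    by (auto simp: maximal_homogeneous_ideal_def homogeneous_ideal_def)
  then have "I \<subseteq> max_ideal" using ideal_outside_max_ideal by blast
  then show "I = max_ideal" using I(3)[OF homogeneous_max_ideal] max_ideal_proper by blast
qed

lemma val_minus:
  assumes "nbhd U" "s \<in> carrier (sections X U)" "t \<in> carrier (sections X U)"
  shows "val U (s \<ominus>\<^bsub>sections X U\<^esub> t) = val U s - val U t"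
proof -
  interpret R: ring "sections X U" using nbhd_ring[OF assms(1)] .
  have "val U (\<ominus>\<^bsub>sections X U\<^esub> t) + val U t = 0"
    using val_add[OF assms(1) R.a_inv_closed[OF assms(3)] assms(3)] assms by (simp add: R.l_neg val_zero)
  then show ?thesis using val_add[OF assms(1,2) R.a_inv_closed[OF assms(3)]] by (simp add: a_minus_def)
qed

text \<open>If the value of f - k is nonzero, f - k is invertible near \<open>m\<close>; if it is
  zero, multiplicativity of the value excludes an inverse on any neighbourhood. So exactly one k
  satisfies the description.\<close>

lemma base_proj_eq_val:
  assumes U: "nbhd U" "f \<in> carrier (sections X U)"
    and smult: "\<And>k. k \<odot>\<^bsub>sections X U\<^esub> \<one>\<^bsub>sections X U\<^esub> \<in> carrier (sections X U)"
      "\<And>k. val U (k \<odot>\<^bsub>sections X U\<^esub> \<one>\<^bsub>sections X U\<^esub>) = k"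
  shows "base_proj X U f m = val U f"
proof -
  let ?d = "\<lambda>k. f \<ominus>\<^bsub>sections X U\<^esub> k \<odot>\<^bsub>sections X U\<^esub> \<one>\<^bsub>sections X U\<^esub>"
  interpret R: ring "sections X U" using nbhd_ring[OF U(1)] .
  have d: "?d k \<in> carrier (sections X U)" "val U (?d k) = val U f - k" for k
    using smult U val_minus R.minus_closed by simp_all
  have "(\<forall>W. openin (base X) W \<and> m \<in> W \<and> W \<subseteq> U \<longrightarrow> rstr X U W (?d k) \<notin> Units (sections X W)) \<longleftrightarrow> k = val U f" for k
  proof
    assume "\<forall>W. openin (base X) W \<and> m \<in> W \<and> W \<subseteq> U \<longrightarrow> rstr X U W (?d k) \<notin> Units (sections X W)"
    then have "val U (?d k) = 0" using val_unit[OF U(1) d(1)] by (auto simp: nbhd_def)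
    then show "k = val U f" using d(2) by simp
  next
    assume k: "k = val U f"
    show "\<forall>W. openin (base X) W \<and> m \<in> W \<and> W \<subseteq> U \<longrightarrow> rstr X U W (?d k) \<notin> Units (sections X W)"
    proof (intro allI impI notI)
      fix W assume W: "openin (base X) W \<and> m \<in> W \<and> W \<subseteq> U" and unit: "rstr X U W (?d k) \<in> Units (sections X W)"
      then have nW: "nbhd W" by (simp add: nbhd_def)
      obtain t where t: "t \<in> carrier (sections X W)" "rstr X U W (?d k) \<otimes>\<^bsub>sections X W\<^esub> t = \<one>\<^bsub>sections X W\<^esub>"
        using unit by (auto simp: Units_def)
      have "rstr X U W (?d k) \<in> carrier (sections X W)" using unit by (simp add: Units_def)
      then have "1 = val W (rstr X U W (?d k)) * val W t"
        using val_mult[OF nW _ t(1)] val_one[OF nW] t(2) by metis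
      also have "val W (rstr X U W (?d k)) = 0"
        using val_rstr[OF U(1) nW _ d(1)] W d(2) k by simp
      finally show False by simp
    qed
  qed
  then show ?thesis by (simp add: base_proj_def)
qed

end

section \<open>Points of a superdomain\<close>

lemma finsum_series_algebra:
  assumes V: "openin (Euclidean_space p) V"
  shows "finite A \<Longrightarrow> (\<And>i. i \<in> A \<Longrightarrow> F i \<in> series_carrier n p q \<tau> V) \<Longrightarrow>
    finsum (series_algebra n p q \<tau> V) F A = (\<Sum>i\<in>A. F i)"
proof (induction A rule: finite_induct)
  case empty
  show ?case
    using ring_series_algebra[OF V] by (simp add: abelian_monoid.finsum_empty abelian_group.axioms ring.is_abelian_group)
next
  case (insert i A)
  have R: "abelian_monoid (series_algebra n p q \<tau> V)"
    using ring_series_algebra[OF V] by (simp add: abelian_group.axioms ring.is_abelian_group)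
  have "finsum (series_algebra n p q \<tau> V) F (insert i A) = F i + finsum (series_algebra n p q \<tau> V) F A"
    using insert by (subst abelian_monoid.finsum_insert[OF R]) auto
  moreover have "finsum (series_algebra n p q \<tau> V) F A = (\<Sum>i\<in>A. F i)" using insert by auto
  ultimately show ?case unfolding sum.insert[OF insert.hyps(1,2)] by (simp only:)
qed

lemma monomial_degree_in_Z2n:
  assumes "\<And>a. a < q \<Longrightarrow> \<tau> a \<in> Z2n n"
  shows "monomial_degree q \<tau> \<mu> \<in> Z2n n"
  using assms by (auto simp: Z2n_def monomial_degree_def)

lemma series_decompose:
  assumes V: "openin (Euclidean_space p) V" and \<tau>: "\<And>a. a < q \<Longrightarrow> \<tau> a \<in> Z2n n"
    and F: "F \<in> series_carrier n p q \<tau> V"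
  shows "\<exists>c. (\<forall>i\<in>Z2n n. c i \<in> grade (series_algebra n p q \<tau> V) i) \<and>
    F = finsum (series_algebra n p q \<tau> V) c (Z2n n)"
proof -
  define c where "c = (\<lambda>i \<mu>. if monomial_degree q \<tau> \<mu> = i then F \<mu> else (\<lambda>_. 0))"
  have c: "c i \<in> grade (series_algebra n p q \<tau> V) i" for i
  proof -
    have "c i \<mu> \<in> C_infinity p V" for \<mu>
      using F smooth_const[OF V, of 0] by (auto simp: c_def series_carrier_def C_infinity_iff[OF V])
    then have "c i \<in> series_carrier n p q \<tau> V"
      using F by (auto simp: series_carrier_def c_def)
    then show ?thesis by (simp add: series_algebra_def c_def)
  qed
  then have cc: "c i \<in> series_carrier n p q \<tau> V" for i by (simp add: series_grade_iff)
  have "F \<mu> = (\<Sum>i\<in>Z2n n. c i) \<mu>" for \<mu>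
  proof -
    have "(\<Sum>i\<in>Z2n n. c i) \<mu> = (\<Sum>i\<in>Z2n n. if i = monomial_degree q \<tau> \<mu> then F \<mu> else 0)"
      by (rule trans[OF sum_coeffs_apply sum.cong[OF refl]]) (auto simp: c_def zero_fun_def)
    then show ?thesis using monomial_degree_in_Z2n[of q \<tau> n \<mu>, OF \<tau>] by (simp add: sum.delta)
  qed
  then have "F = (\<Sum>i\<in>Z2n n. c i)" by blast
  moreover have "finsum (series_algebra n p q \<tau> V) c (Z2n n) = (\<Sum>i\<in>Z2n n. c i)"
    by (rule finsum_series_algebra[OF V finite_Z2n cc])
  ultimately have "F = finsum (series_algebra n p q \<tau> V) c (Z2n n)" by (simp only:)
  then show ?thesis using c by blast
qed

text \<open>The value of a section is its body at \<open>y\<close>: body and evaluation are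
  multiplicative, and monomials of nonzero degree do not contribute.\<close>

lemma superdomain_valued_point:
  assumes V: "openin (Euclidean_space p) V" and y: "y \<in> V" and \<tau>: "\<And>a. a < q \<Longrightarrow> \<tau> a \<in> Z2n n"
  shows "valued_point n (superdomain n p q \<tau> V) y (\<lambda>U F. F 0 y)"
proof -
  let ?X = "superdomain n p q \<tau> V"
  note op = openin_superdomain_iff[OF V]
  have pp: "presheaf_point ?X y"
  proof (rule presheaf_point.intro)
    show "y \<in> topspace (base ?X)" using y openin_subset[OF V] by auto
    show "ring (sections ?X U)" if "openin (base ?X) U" for U
      using that ring_series_algebra by (simp add: op)
    show "rstr ?X U W \<in> ring_hom (sections ?X U) (sections ?X W)"
      if "openin (base ?X) U" "openin (base ?X) W" "W \<subseteq> U" for U W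
      using that cut_ring_hom by (simp add: op)
    show "rstr ?X U U s = s" if "openin (base ?X) U" "s \<in> carrier (sections ?X U)" for U s
      using that cut_carrier_id[of p U s n q \<tau>] by (simp add: op)
    show "rstr ?X W N (rstr ?X U W s) = rstr ?X U N s" if "N \<subseteq> W" for U W N s
      using that by (simp add: Int_absorb1)
  qed
  interpret presheaf_point n ?X y by (rule pp)
  have nb: "nbhd U \<longleftrightarrow> openin (Euclidean_space p) U \<and> U \<subseteq> V \<and> y \<in> U" for U
    by (auto simp: nbhd_def op)
  have adm: "admissible n q \<tau> (coeffs_at y F)" if "nbhd U" "F \<in> series_carrier n p q \<tau> U" for U F
    using that series_carrier_iff by (simp add: nb)
  show ?thesis
  proof (rule valued_point.intro[OF pp valued_point_axioms.intro])
    show "rstr ?X U W s 0 y = s 0 y" if "nbhd W" for U W s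
      using that by (simp add: nb cut_def)
    show "(s \<oplus>\<^bsub>sections ?X U\<^esub> t) 0 y = s 0 y + t 0 y" for U s t by simp
    show "(s \<otimes>\<^bsub>sections ?X U\<^esub> t) 0 y = s 0 y * t 0 y" for U s t
      by (simp add: series_mult_eq cmul_at_zero)
    show "\<one>\<^bsub>sections ?X U\<^esub> 0 y = 1" if "nbhd U" for U
      using that by (simp add: nb series_term_def)
    show "s 0 y = 0" if "i \<noteq> deg_zero" "s \<in> grade (sections ?X U) i" for U i s
      using series_grade_nonzero[of s n p q \<tau> U i] that by simp
    show "grade (sections ?X U) i \<subseteq> carrier (sections ?X U)" for U i
      by (auto simp: series_grade_iff)
    show "\<exists>W. nbhd W \<and> W \<subseteq> U \<and> rstr ?X U W s \<in> Units (sections ?X W)"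
      if U: "nbhd U" and s: "s \<in> carrier (sections ?X U)" and nz: "s 0 y \<noteq> 0" for U s
    proof -
      have Uo: "openin (Euclidean_space p) U" "U \<subseteq> V" "y \<in> U" using U by (auto simp: nb)
      have sc: "s \<in> series_carrier n p q \<tau> U" using s by simp
      have cont: "continuous_on U (s 0)"
        using smooth_upto_continuous[OF smooth_imp_smooth_upto[OF series_smooth[OF Uo(1) sc]]] .
      \<comment> \<open>The body is continuous, so it stays nonzero on this open set, over which the
        series is invertible by \<open>series_Units\<close>.\<close>
      define W where "W = {x \<in> U. s 0 x \<noteq> 0}"
      have "openin (subtopology (Euclidean_space p) U)
          {x \<in> topspace (subtopology (Euclidean_space p) U). s 0 x \<in> - {0}}"
        using cont openin_subset[OF Uo(1)]
        by (intro openin_continuous_map_preimage[where Y = euclideanreal]) (auto simp: continuous_map_Euclidean_subspace_iff)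
      moreover have "{x \<in> topspace (subtopology (Euclidean_space p) U). s 0 x \<in> - {0}} = W"
        using openin_subset[OF Uo(1)] by (auto simp: W_def)
      ultimately have W: "openin (Euclidean_space p) W" using Uo(1) openin_trans_full by fastforce
      have WU: "W \<subseteq> U" by (auto simp: W_def)
      have "cut W s \<in> Units (series_algebra n p q \<tau> W)"
        by (rule series_Units[OF W cut_carrier[OF Uo(1) W WU sc]]) (simp add: cut_def W_def)
      then show ?thesis using W WU Uo nz by (intro exI[of _ W]) (auto simp: nb W_def)
    qed
    show "\<exists>c. (\<forall>i\<in>Z2n n. c i \<in> grade (sections ?X U) i) \<and> s = finsum (sections ?X U) c (Z2n n)"
      if U: "nbhd U" and s: "s \<in> carrier (sections ?X U)" for U s
      using U s series_decompose[OF _ \<tau>] by (simp add: nb)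
  qed
qed

section \<open>Charts\<close>

lemma comm_algebraD:
  assumes "z2n_comm_algebra n A"
  shows "ring A" "i \<in> Z2n n \<Longrightarrow> grade A i \<subseteq> carrier A"
    and "a \<in> carrier A \<Longrightarrow> r \<odot>\<^bsub>A\<^esub> a \<in> carrier A"
    and "a \<in> carrier A \<Longrightarrow> \<exists>!c. c \<in> (\<Pi>\<^sub>E i\<in>Z2n n. grade A i) \<and> a = finsum A c (Z2n n)"
    and "i \<in> Z2n n \<Longrightarrow> \<zero>\<^bsub>A\<^esub> \<in> grade A i"
proof -
  show "ring A" using assms by (simp add: z2n_comm_algebra_def real_algebra_def)
  have m: "Module.module real_ring A" using assms by (simp add: z2n_comm_algebra_def real_algebra_def)
  show "a \<in> carrier A \<Longrightarrow> r \<odot>\<^bsub>A\<^esub> a \<in> carrier A"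
    using module.smult_closed[OF m, of r a] by (simp add: real_ring_def)
  show "a \<in> carrier A \<Longrightarrow> \<exists>!c. c \<in> (\<Pi>\<^sub>E i\<in>Z2n n. grade A i) \<and> a = finsum A c (Z2n n)"
    using assms by (simp add: z2n_comm_algebra_def z2n_graded_def)
  have "subgroup (grade A i) (add_monoid A)" if "i \<in> Z2n n"
    using assms that by (auto simp: z2n_comm_algebra_def z2n_graded_def submodule_def)
  from subgroup.subset[OF this] subgroup.one_closed[OF this]
  show "i \<in> Z2n n \<Longrightarrow> grade A i \<subseteq> carrier A" "i \<in> Z2n n \<Longrightarrow> \<zero>\<^bsub>A\<^esub> \<in> grade A i" by simp_all
qed

lemma presheafD:
  assumes "z2n_presheaf n M"
  shows "openin (base M) U \<Longrightarrow> z2n_comm_algebra n (sections M U)"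
    and "openin (base M) U \<Longrightarrow> openin (base M) W \<Longrightarrow> W \<subseteq> U \<Longrightarrow>
      rstr M U W \<in> graded_alg_hom n (sections M U) (sections M W)"
    and "openin (base M) U \<Longrightarrow> s \<in> carrier (sections M U) \<Longrightarrow> rstr M U U s = s"
    and "openin (base M) U \<Longrightarrow> openin (base M) W \<Longrightarrow> openin (base M) N \<Longrightarrow> N \<subseteq> W \<Longrightarrow> W \<subseteq> U \<Longrightarrow>
      s \<in> carrier (sections M U) \<Longrightarrow> rstr M W N (rstr M U W s) = rstr M U N s"
proof -
  note P = assms[unfolded z2n_presheaf_def]
  show "openin (base M) U \<Longrightarrow> z2n_comm_algebra n (sections M U)"
    using P[THEN conjunct1] by simp
  show "openin (base M) U \<Longrightarrow> openin (base M) W \<Longrightarrow> W \<subseteq> U \<Longrightarrow>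
      rstr M U W \<in> graded_alg_hom n (sections M U) (sections M W)"
    using P[THEN conjunct2, THEN conjunct1] by simp
  show "openin (base M) U \<Longrightarrow> s \<in> carrier (sections M U) \<Longrightarrow> rstr M U U s = s"
    using P[THEN conjunct2, THEN conjunct2, THEN conjunct1] by simp
  show "openin (base M) U \<Longrightarrow> openin (base M) W \<Longrightarrow> openin (base M) N \<Longrightarrow> N \<subseteq> W \<Longrightarrow> W \<subseteq> U \<Longrightarrow>
      s \<in> carrier (sections M U) \<Longrightarrow> rstr M W N (rstr M U W s) = rstr M U N s"
    using P[THEN conjunct2, THEN conjunct2, THEN conjunct2] by simp
qed

lemma graded_alg_homD:
  assumes "h \<in> graded_alg_hom n A B"
  shows "h \<in> ring_hom A B" "a \<in> carrier A \<Longrightarrow> h (r \<odot>\<^bsub>A\<^esub> a) = r \<odot>\<^bsub>B\<^esub> h a"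
    and "i \<in> Z2n n \<Longrightarrow> a \<in> grade A i \<Longrightarrow> h a \<in> grade B i" "a \<in> carrier A \<Longrightarrow> h a \<in> carrier B"
    and "h \<one>\<^bsub>A\<^esub> = \<one>\<^bsub>B\<^esub>"
    and "a \<in> carrier A \<Longrightarrow> b \<in> carrier A \<Longrightarrow> h (a \<otimes>\<^bsub>A\<^esub> b) = h a \<otimes>\<^bsub>B\<^esub> h b"
    and "a \<in> carrier A \<Longrightarrow> b \<in> carrier A \<Longrightarrow> h (a \<oplus>\<^bsub>A\<^esub> b) = h a \<oplus>\<^bsub>B\<^esub> h b"
proof -
  show h: "h \<in> ring_hom A B" using assms by (simp add: graded_alg_hom_def)
  show "a \<in> carrier A \<Longrightarrow> h (r \<odot>\<^bsub>A\<^esub> a) = r \<odot>\<^bsub>B\<^esub> h a"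
    using assms by (simp add: graded_alg_hom_def)
  show "i \<in> Z2n n \<Longrightarrow> a \<in> grade A i \<Longrightarrow> h a \<in> grade B i"
    using assms unfolding graded_alg_hom_def by blast
  show "a \<in> carrier A \<Longrightarrow> h a \<in> carrier B" "h \<one>\<^bsub>A\<^esub> = \<one>\<^bsub>B\<^esub>"
    "a \<in> carrier A \<Longrightarrow> b \<in> carrier A \<Longrightarrow> h (a \<otimes>\<^bsub>A\<^esub> b) = h a \<otimes>\<^bsub>B\<^esub> h b"
    "a \<in> carrier A \<Longrightarrow> b \<in> carrier A \<Longrightarrow> h (a \<oplus>\<^bsub>A\<^esub> b) = h a \<oplus>\<^bsub>B\<^esub> h b"
    using ring_hom_closed[OF h] ring_hom_one[OF h] ring_hom_mult[OF h] ring_hom_add[OF h] by simp_all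
qed

lemma graded_alg_hom_compose:
  assumes "g \<in> graded_alg_hom n A B" "h \<in> graded_alg_hom n B C"
  shows "(\<lambda>x. h (g x)) \<in> graded_alg_hom n A C"
proof -
  note g = graded_alg_homD[OF assms(1)] and h = graded_alg_homD[OF assms(2)]
  have "(\<lambda>x. h (g x)) \<in> ring_hom A C"
    by (rule ring_hom_memI) (simp_all add: g h)
  then show ?thesis using g(2,3,4) h(2,3) by (auto simp: graded_alg_hom_def)
qed

lemma ring_hom_Units:
  assumes h: "h \<in> ring_hom R S" and x: "x \<in> Units R"
  shows "h x \<in> Units S"
proof -
  obtain y where "x \<in> carrier R" "y \<in> carrier R" "y \<otimes>\<^bsub>R\<^esub> x = \<one>\<^bsub>R\<^esub>" "x \<otimes>\<^bsub>R\<^esub> y = \<one>\<^bsub>R\<^esub>"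
    using x unfolding Units_def by blast
  then have "h x \<in> carrier S" "h y \<in> carrier S" "h y \<otimes>\<^bsub>S\<^esub> h x = \<one>\<^bsub>S\<^esub>" "h x \<otimes>\<^bsub>S\<^esub> h y = \<one>\<^bsub>S\<^esub>"
    using h by (auto simp: ring_hom_closed simp flip: ring_hom_mult[OF h] ring_hom_one[OF h])
  then show ?thesis unfolding Units_def by blast
qed

lemma presheaf_point_presheaf:
  assumes "z2n_presheaf n M" "m \<in> topspace (base M)"
  shows "presheaf_point M m"
proof (rule presheaf_point.intro)
  show "rstr M W N (rstr M U W s) = rstr M U N s"
    if "openin (base M) U" "openin (base M) W" "openin (base M) N" "N \<subseteq> W" "W \<subseteq> U" "s \<in> carrier (sections M U)" for U W N s
    by (rule presheafD(4)[OF assms(1) that])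
qed (use assms(2) comm_algebraD(1)[OF presheafD(1)[OF assms(1)]] graded_alg_homD(1)[OF presheafD(2)[OF assms(1)]]
    presheafD(3)[OF assms(1)] in blast)+

lemma pre_subset: "pre O' \<psi> W \<subseteq> O'" "W \<subseteq> W' \<Longrightarrow> pre O' \<psi> W \<subseteq> pre O' \<psi> W'" "O'' \<subseteq> O' \<Longrightarrow> pre O'' \<psi> W \<subseteq> pre O' \<psi> W"
  by (auto simp: pre_def)

text \<open>At truncation 0 only the constant monomial and the zeroth Taylor term remain. The body
  of a pullback is thus composition with \<open>f\<close>, which yields locality on stalks
  later.\<close>

lemma pullback_value:
  assumes "x \<in> pre U f W"
  shows "pullback n q \<tau> U f u v \<sigma> s \<zeta> W G 0 x = G 0 (f x)"
proof -
  have "multi_upto n v \<sigma> 0 = {0}"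
    using total_degree_zero_iff[of _ n v \<sigma>] by (auto simp: multi_upto_def)
  moreover have "cmonomial n q \<tau> v z 0 0 = 1" for z
    using cmul_at_zero by (induction v) (auto simp: cconst_def)
  moreover have "total_degree q 0 = 0" by (simp add: total_degree_def)
  ultimately show ?thesis
    using assms cmul_at_zero by (simp add: pullback_def series_of_def subst_def subst_upto_def taylor_sum_def cconst_def)
qed

lemma pullback_familyD:
  assumes "pullback_family n X O' \<psi> u v \<sigma> V s \<zeta> \<alpha>"
  shows "openin (Euclidean_space u) W \<Longrightarrow> W \<subseteq> V \<Longrightarrow>
      \<alpha> W \<in> graded_alg_hom n (series_algebra n u v \<sigma> W) (sections X (pre O' \<psi> W))"
    and "openin (Euclidean_space u) W \<Longrightarrow> openin (Euclidean_space u) W' \<Longrightarrow> W' \<subseteq> W \<Longrightarrow> W \<subseteq> V \<Longrightarrow>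
      G \<in> series_carrier n u v \<sigma> W \<Longrightarrow> \<alpha> W' (cut W' G) = rstr X (pre O' \<psi> W) (pre O' \<psi> W') (\<alpha> W G)"
    and "j < u \<Longrightarrow> \<alpha> V (coord_fun V j) = s j" "b < v \<Longrightarrow> \<alpha> V (formal_var V b) = \<zeta> b"
    and "openin (Euclidean_space u) W \<Longrightarrow> W \<subseteq> V \<Longrightarrow> G \<in> series_carrier n u v \<sigma> W \<Longrightarrow>
      \<alpha> W G \<in> carrier (sections X (pre O' \<psi> W))"
proof -
  show hom: "\<alpha> W \<in> graded_alg_hom n (series_algebra n u v \<sigma> W) (sections X (pre O' \<psi> W))"
    if "openin (Euclidean_space u) W" "W \<subseteq> V" for W
    using assms that unfolding pullback_family_def by blast
  show "openin (Euclidean_space u) W \<Longrightarrow> W \<subseteq> V \<Longrightarrow> G \<in> series_carrier n u v \<sigma> W \<Longrightarrow>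
      \<alpha> W G \<in> carrier (sections X (pre O' \<psi> W))"
    using graded_alg_homD(4)[OF hom] by simp
qed (use assms in \<open>unfold pullback_family_def, blast+\<close>)

text \<open>Serves to compare two families, given over different charts, on the overlap of the
  charts.\<close>

lemma pullback_family_restrict:
  assumes P: "z2n_presheaf n M" and fam: "pullback_family n M O' \<psi> u v \<sigma> V s \<zeta> \<alpha>"
    and O'': "O'' \<subseteq> O'" and \<psi>: "\<And>m. m \<in> O' \<Longrightarrow> \<psi> m \<in> V"
    and op: "\<And>W. openin (Euclidean_space u) W \<Longrightarrow> openin (base M) (pre O' \<psi> W)"
      "\<And>W. openin (Euclidean_space u) W \<Longrightarrow> openin (base M) (pre O'' \<psi> W)"
  shows "pullback_family n M O'' \<psi> u v \<sigma> V (\<lambda>j. rstr M O' O'' (s j)) (\<lambda>b. rstr M O' O'' (\<zeta> b))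
    (\<lambda>W G. rstr M (pre O' \<psi> W) (pre O'' \<psi> W) (\<alpha> W G))"
  unfolding pullback_family_def
proof (intro conjI allI impI ballI)
  fix W assume W: "openin (Euclidean_space u) W \<and> W \<subseteq> V"
  show "(\<lambda>G. rstr M (pre O' \<psi> W) (pre O'' \<psi> W) (\<alpha> W G))
      \<in> graded_alg_hom n (series_algebra n u v \<sigma> W) (sections M (pre O'' \<psi> W))"
    using W op O'' by (intro graded_alg_hom_compose[OF pullback_familyD(1)[OF fam]] presheafD(2)[OF P] pre_subset(3)) auto
next
  fix W W' G
  assume W: "openin (Euclidean_space u) W \<and> openin (Euclidean_space u) W' \<and> W' \<subseteq> W \<and> W \<subseteq> V"
    and G: "G \<in> series_carrier n u v \<sigma> W"
  have c: "\<alpha> W G \<in> carrier (sections M (pre O' \<psi> W))" using pullback_familyD(5)[OF fam] W G by blast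
  have "\<alpha> W' (cut W' G) = rstr M (pre O' \<psi> W) (pre O' \<psi> W') (\<alpha> W G)"
    using W G by (intro pullback_familyD(2)[OF fam]) auto
  then have "rstr M (pre O' \<psi> W') (pre O'' \<psi> W') (\<alpha> W' (cut W' G)) =
      rstr M (pre O' \<psi> W') (pre O'' \<psi> W') (rstr M (pre O' \<psi> W) (pre O' \<psi> W') (\<alpha> W G))"
    by (rule arg_cong)
  also have "\<dots> = rstr M (pre O' \<psi> W) (pre O'' \<psi> W') (\<alpha> W G)"
    using W c op O'' by (intro presheafD(4)[OF P] pre_subset) auto
  also have "\<dots> = rstr M (pre O'' \<psi> W) (pre O'' \<psi> W') (rstr M (pre O' \<psi> W) (pre O'' \<psi> W) (\<alpha> W G))"
    using W c op O'' by (intro presheafD(4)[OF P, symmetric] pre_subset) auto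
  finally show "rstr M (pre O' \<psi> W') (pre O'' \<psi> W') (\<alpha> W' (cut W' G)) =
      rstr M (pre O'' \<psi> W) (pre O'' \<psi> W') (rstr M (pre O' \<psi> W) (pre O'' \<psi> W) (\<alpha> W G))" .
next
  have V: "pre O' \<psi> V = O'" "pre O'' \<psi> V = O''" using \<psi> O'' by (auto simp: pre_def)
  show "rstr M (pre O' \<psi> V) (pre O'' \<psi> V) (\<alpha> V (coord_fun V j)) = rstr M O' O'' (s j)" if "j < u" for j
    using pullback_familyD(3)[OF fam that] by (simp add: V)
  show "rstr M (pre O' \<psi> V) (pre O'' \<psi> V) (\<alpha> V (formal_var V b)) = rstr M O' O'' (\<zeta> b)" if "b < v" for b
    using pullback_familyD(4)[OF fam that] by (simp add: V)
qed

text \<open>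
  A chart is a homeomorphism \<open>\<phi>\<close> of the open set \<open>W\<close> onto an open subset of \<open>\<real>\<^sup>p\<close> together with mutually inverse
  isomorphisms \<open>\<theta>\<close>, \<open>\<kappa>\<close> of sheaves of algebras. Locality on stalks plays no role.
\<close>

locale sd_chart =
  fixes n p r :: nat and \<tau> :: "nat \<Rightarrow> degree" and M :: "('m, 'a) ringed_space" and W :: "'m set"
    and \<phi> :: "'m \<Rightarrow> nat \<Rightarrow> real" and \<theta> :: "'m set \<Rightarrow> 'a \<Rightarrow> power_series" and \<kappa> :: "'m set \<Rightarrow> power_series \<Rightarrow> 'a"
  assumes presheaf: "z2n_presheaf n M" and W_open: "openin (base M) W" and \<phi>_inj: "inj_on \<phi> W"
    and \<phi>_open: "openin (base M) O' \<Longrightarrow> O' \<subseteq> W \<Longrightarrow> openin (Euclidean_space p) (\<phi> ` O')"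
    and \<phi>_cont: "openin (Euclidean_space p) U' \<Longrightarrow> openin (base M) (pre W \<phi> U')"
    and \<tau>_Z2n: "a < r \<Longrightarrow> \<tau> a \<in> Z2n n"
    and \<theta>_hom: "openin (base M) O' \<Longrightarrow> O' \<subseteq> W \<Longrightarrow>
          \<theta> O' \<in> graded_alg_hom n (sections M O') (series_algebra n p r \<tau> (\<phi> ` O'))"
    and \<kappa>_hom: "openin (base M) O' \<Longrightarrow> O' \<subseteq> W \<Longrightarrow>
          \<kappa> O' \<in> graded_alg_hom n (series_algebra n p r \<tau> (\<phi> ` O')) (sections M O')"
    and \<theta>\<kappa>: "openin (base M) O' \<Longrightarrow> O' \<subseteq> W \<Longrightarrow> F \<in> series_carrier n p r \<tau> (\<phi> ` O') \<Longrightarrow> \<theta> O' (\<kappa> O' F) = F"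
    and \<kappa>\<theta>: "openin (base M) O' \<Longrightarrow> O' \<subseteq> W \<Longrightarrow> s \<in> carrier (sections M O') \<Longrightarrow> \<kappa> O' (\<theta> O' s) = s"
    and \<theta>_rstr: "openin (base M) O' \<Longrightarrow> O' \<subseteq> W \<Longrightarrow> openin (base M) O'' \<Longrightarrow> O'' \<subseteq> O' \<Longrightarrow> s \<in> carrier (sections M O') \<Longrightarrow>
          \<theta> O'' (rstr M O' O'' s) = cut (\<phi> ` O'') (\<theta> O' s)"

lemma z2n_morphismD:
  assumes "z2n_morphism n M N \<Phi>"
  shows "continuous_map (base M) (base N) (fst \<Phi>)"
    and "openin (base N) V \<Longrightarrow> snd \<Phi> V \<in> graded_alg_hom n (sections N V) (sections M (preimage M (fst \<Phi>) V))"
    and "openin (base N) V \<Longrightarrow> openin (base N) W \<Longrightarrow> W \<subseteq> V \<Longrightarrow> s \<in> carrier (sections N V) \<Longrightarrow>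
      snd \<Phi> W (rstr N V W s) = rstr M (preimage M (fst \<Phi>) V) (preimage M (fst \<Phi>) W) (snd \<Phi> V s)"
    and "m \<in> topspace (base M) \<Longrightarrow>
      stalk_map M N \<Phi> m ` the_max_ideal n (stalk N (fst \<Phi> m)) \<subseteq> the_max_ideal n (stalk M m)"
    and "fst \<Phi> \<in> extensional (topspace (base M))" "snd \<Phi> \<in> extensional {V. openin (base N) V}"
    and "openin (base N) V \<Longrightarrow> snd \<Phi> V \<in> extensional (carrier (sections N V))"
  using assms unfolding z2n_morphism_def by simp_all

text \<open>The two composites being identity maps makes the base maps mutually inverse, so
  preimages under one are images under the other. The pullbacks of the two morphisms are then
  inverse to each other over corresponding open sets.\<close>

lemma chart_of_isomorphic:
  fixes M :: "('m, 'a) ringed_space"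
  assumes P: "z2n_presheaf n M" and W: "openin (base M) W" and U: "openin (Euclidean_space p) U"
    and \<tau>: "\<And>a. a < r \<Longrightarrow> \<tau> a \<in> Z2n n"
    and iso: "z2n_isomorphic n (open_subspace M W) (superdomain n p r \<tau> U)"
  shows "\<exists>\<phi> \<theta> \<kappa>. sd_chart n p r \<tau> M W \<phi> \<theta> \<kappa>"
proof -
  let ?X = "open_subspace M W" and ?D = "superdomain n p r \<tau> U"
  obtain \<Phi> \<Psi> where \<Phi>: "z2n_morphism n ?X ?D \<Phi>" and \<Psi>: "z2n_morphism n ?D ?X \<Psi>"
    and id1: "comp_map ?X ?D ?X \<Psi> \<Phi> = id_map ?X" and id2: "comp_map ?D ?X ?D \<Phi> \<Psi> = id_map ?D"
    using iso unfolding z2n_isomorphic_def by blast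
  define \<phi> where "\<phi> = fst \<Phi>"
  define \<psi> where "\<psi> = fst \<Psi>"
  define \<theta> where "\<theta> = snd \<Psi>"
  \<comment> \<open>Indexed by the open subset of \<open>M\<close> rather than by its image, so that
    \<theta> and \<kappa> are inverse for the same index.\<close>
  define \<kappa> where "\<kappa> = (\<lambda>O'. snd \<Phi> (\<phi> ` O'))"
  have X [simp]: "sections ?X = sections M" "rstr ?X = rstr M" "base ?X = subtopology (base M) W"
    by (simp_all add: open_subspace_def)
  have opX: "openin (base ?X) O' \<longleftrightarrow> openin (base M) O' \<and> O' \<subseteq> W" for O'
    using W by (simp add: openin_open_subtopology)
  have opD: "openin (base ?D) U' \<longleftrightarrow> openin (Euclidean_space p) U' \<and> U' \<subseteq> U" for U'
    using openin_superdomain_iff[OF U] by simp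
  have tX: "topspace (base ?X) = W" using openin_subset[OF W] by auto
  have tD: "topspace (base ?D) = U" using openin_subset[OF U] by auto
  have \<psi>\<phi>: "\<psi> (\<phi> m) = m" if "m \<in> W" for m
    using fun_cong[OF arg_cong[OF id1, of fst], of m] that unfolding comp_map_def id_map_def tX
    by (simp add: \<psi>_def \<phi>_def)
  have \<phi>\<psi>: "\<phi> (\<psi> x) = x" if "x \<in> U" for x
    using fun_cong[OF arg_cong[OF id2, of fst], of x] that unfolding comp_map_def id_map_def tD
    by (simp add: \<psi>_def \<phi>_def)
  have \<phi>_map: "\<phi> m \<in> U" if "m \<in> W" for m
    using z2n_morphismD(1)[OF \<Phi>] that unfolding continuous_map_def tX tD \<phi>_def by blast
  have \<psi>_map: "\<psi> x \<in> W" if "x \<in> U" for x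
    using z2n_morphismD(1)[OF \<Psi>] that unfolding continuous_map_def tX tD \<psi>_def by blast
  have preD: "preimage ?D \<psi> O' = \<phi> ` O'" if "O' \<subseteq> W" for O'
  proof -
    have "x \<in> \<phi> ` O'" if "x \<in> U" "\<psi> x \<in> O'" for x using \<phi>\<psi>[OF that(1)] that(2) by (metis imageI)
    then show ?thesis unfolding preimage_def tD using \<psi>\<phi> \<phi>_map that by (auto simp: subset_iff)
  qed
  have preX: "preimage ?X \<phi> (\<phi> ` O') = O'" if "O' \<subseteq> W" for O'
    unfolding preimage_def tX using that \<psi>\<phi> by (auto simp: subset_iff) metis
  have op_img: "openin (Euclidean_space p) (\<phi> ` O')" "\<phi> ` O' \<subseteq> U" if "openin (base M) O'" "O' \<subseteq> W" for O'
  proof -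
    have "openin (base ?D) {x \<in> topspace (base ?D). \<psi> x \<in> O'}"
      using z2n_morphismD(1)[OF \<Psi>] that opX unfolding continuous_map_def \<psi>_def by blast
    then show "openin (Euclidean_space p) (\<phi> ` O')" "\<phi> ` O' \<subseteq> U"
      using preD[OF that(2)] opD unfolding preimage_def by metis+
  qed
  have \<theta>_hom: "\<theta> O' \<in> graded_alg_hom n (sections M O') (series_algebra n p r \<tau> (\<phi> ` O'))"
    if "openin (base M) O'" "O' \<subseteq> W" for O'
    using z2n_morphismD(2)[OF \<Psi>, of O'] that opX preD[OF that(2)] by (simp add: \<theta>_def \<psi>_def)
  have \<kappa>_hom: "\<kappa> O' \<in> graded_alg_hom n (series_algebra n p r \<tau> (\<phi> ` O')) (sections M O')"
    if "openin (base M) O'" "O' \<subseteq> W" for O'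
    using z2n_morphismD(2)[OF \<Phi>, of "\<phi> ` O'"] op_img[OF that] opD preX[OF that(2)] by (simp add: \<kappa>_def \<phi>_def)
  have "sd_chart n p r \<tau> M W \<phi> \<theta> \<kappa>"
  proof (rule sd_chart.intro[OF P W])
    show "inj_on \<phi> W" using \<psi>\<phi> by (metis inj_onI)
    show "openin (base M) (pre W \<phi> U')" if "openin (Euclidean_space p) U'" for U'
    proof -
      have "openin (base ?D) (U \<inter> U')" using that U opD by blast
      then have "openin (base ?X) {m \<in> topspace (base ?X). \<phi> m \<in> U \<inter> U'}"
        using z2n_morphismD(1)[OF \<Phi>] unfolding continuous_map_def \<phi>_def by blast
      moreover have "{m \<in> topspace (base ?X). \<phi> m \<in> U \<inter> U'} = pre W \<phi> U'"
        unfolding tX pre_def using \<phi>_map by blast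
      ultimately show ?thesis using opX by simp
    qed
    show "\<theta> O' (\<kappa> O' F) = F" if O': "openin (base M) O'" "O' \<subseteq> W" and F: "F \<in> series_carrier n p r \<tau> (\<phi> ` O')" for O' F
    proof -
      have "snd (comp_map ?D ?X ?D \<Phi> \<Psi>) (\<phi> ` O') F = snd (id_map ?D) (\<phi> ` O') F" by (simp only: id2)
      moreover have "openin (base ?D) (\<phi> ` O')" using op_img[OF O'] opD by blast
      ultimately show ?thesis using F preX[OF O'(2)]
        unfolding comp_map_def id_map_def \<theta>_def \<kappa>_def \<phi>_def by simp
    qed
    show "\<kappa> O' (\<theta> O' s) = s" if O': "openin (base M) O'" "O' \<subseteq> W" and s: "s \<in> carrier (sections M O')" for O' s
    proof -
      have "snd (comp_map ?X ?D ?X \<Psi> \<Phi>) O' s = snd (id_map ?X) O' s" by (simp only: id1)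
      moreover have "openin (base ?X) O'" using O' opX by blast
      ultimately show ?thesis using s preD[OF O'(2)]
        unfolding comp_map_def id_map_def \<theta>_def \<kappa>_def \<psi>_def by simp
    qed
    show "\<theta> O'' (rstr M O' O'' s) = cut (\<phi> ` O'') (\<theta> O' s)"
      if O': "openin (base M) O'" "O' \<subseteq> W" "openin (base M) O''" "O'' \<subseteq> O'" and s: "s \<in> carrier (sections M O')" for O' O'' s
    proof -
      have op: "openin (base ?X) O'" "openin (base ?X) O''" using O' opX by blast+
      have "snd \<Psi> O'' (rstr ?X O' O'' s) = rstr ?D (preimage ?D \<psi> O') (preimage ?D \<psi> O'') (snd \<Psi> O' s)"
        using z2n_morphismD(3)[OF \<Psi> op O'(4)] s by (simp add: \<psi>_def)
      then show ?thesis using preD[of O''] O' by (simp add: \<theta>_def)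
    qed
  qed (use op_img \<theta>_hom \<kappa>_hom \<tau> in auto)
  then show ?thesis by blast
qed

context sd_chart
begin

text \<open>The intersection with the chart domain allows evaluation of sections over any open set,
  in particular of global ones.\<close>

definition val :: "'m \<Rightarrow> 'm set \<Rightarrow> 'a \<Rightarrow> real" where
  "val m O' s = \<theta> (O' \<inter> W) (rstr M O' (O' \<inter> W) s) 0 (\<phi> m)"

lemma Int_W_open: "openin (base M) O' \<Longrightarrow> openin (base M) (O' \<inter> W)"
  using W_open by blast

lemma rstr_carrier:
  "openin (base M) O' \<Longrightarrow> openin (base M) O'' \<Longrightarrow> O'' \<subseteq> O' \<Longrightarrow> s \<in> carrier (sections M O') \<Longrightarrow>
     rstr M O' O'' s \<in> carrier (sections M O'')"
  using graded_alg_homD(4)[OF presheafD(2)[OF presheaf]] by blast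

lemma \<theta>_carrier:
  "openin (base M) O' \<Longrightarrow> O' \<subseteq> W \<Longrightarrow> s \<in> carrier (sections M O') \<Longrightarrow> \<theta> O' s \<in> series_carrier n p r \<tau> (\<phi> ` O')"
  using graded_alg_homD(4)[OF \<theta>_hom] by simp

text \<open>Since \<theta> turns restriction into \<open>cut\<close>, the value at \<open>m\<close>
  can be computed on any open part of the chart around \<open>m\<close>.\<close>

lemma \<theta>_value:
  assumes "openin (base M) O'" "openin (base M) O''" "O'' \<subseteq> O'" "O'' \<subseteq> W" "m \<in> O''" "s \<in> carrier (sections M O')"
  shows "\<theta> O'' (rstr M O' O'' s) 0 (\<phi> m) = val m O' s"
proof -
  have "rstr M O' O'' s = rstr M (O' \<inter> W) O'' (rstr M O' (O' \<inter> W) s)"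
    using assms Int_W_open by (intro presheafD(4)[OF presheaf, symmetric]) auto
  then have "\<theta> O'' (rstr M O' O'' s) = cut (\<phi> ` O'') (\<theta> (O' \<inter> W) (rstr M O' (O' \<inter> W) s))"
    using \<theta>_rstr[of "O' \<inter> W" O'' "rstr M O' (O' \<inter> W) s"] assms Int_W_open[OF assms(1)]
      rstr_carrier[OF assms(1) Int_W_open[OF assms(1)] _ assms(6)] by auto
  then show ?thesis using assms(5) by (simp add: val_def cut_def)
qed

lemma val_rstr:
  assumes "openin (base M) O'" "openin (base M) O''" "O'' \<subseteq> O'" "m \<in> O'' \<inter> W" "s \<in> carrier (sections M O')"
  shows "val m O'' (rstr M O' O'' s) = val m O' s"
proof -
  have "val m O'' (rstr M O' O'' s) = \<theta> (O'' \<inter> W) (rstr M O' (O'' \<inter> W) s) 0 (\<phi> m)"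
    unfolding val_def using assms Int_W_open by (subst presheafD(4)[OF presheaf]) auto
  also have "\<dots> = val m O' s"
    using assms Int_W_open by (intro \<theta>_value) auto
  finally show ?thesis .
qed

lemma \<theta>_rstr_hom:
  assumes "openin (base M) O'"
  shows "(\<lambda>s. \<theta> (O' \<inter> W) (rstr M O' (O' \<inter> W) s)) \<in>
    graded_alg_hom n (sections M O') (series_algebra n p r \<tau> (\<phi> ` (O' \<inter> W)))"
  using assms Int_W_open by (intro graded_alg_hom_compose[OF presheafD(2)[OF presheaf] \<theta>_hom]) auto

text \<open>Everything is transported from the superdomain through \<theta> after restriction to the
  chart; invertibility travels back through \<kappa>.\<close>

lemma valued_point: 
  assumes m: "m \<in> W"
  shows "valued_point n M m (val m)"
proof -
  have mt: "m \<in> topspace (base M)" using m openin_subset[OF W_open] by blast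
  have pp: "presheaf_point M m" by (rule presheaf_point_presheaf[OF presheaf mt])
  interpret presheaf_point n M m by (rule pp)
  let ?D = "superdomain n p r \<tau> (\<phi> ` W)"
  have \<phi>W: "openin (Euclidean_space p) (\<phi> ` W)" by (rule \<phi>_open[OF W_open subset_refl])
  interpret D: valued_point n ?D "\<phi> m" "\<lambda>U F. F 0 (\<phi> m)"
    by (rule superdomain_valued_point[OF \<phi>W]) (use m \<tau>_Z2n in simp_all)
  have Dn: "D.nbhd (\<phi> ` (O' \<inter> W))" if "nbhd O'" for O'
  proof -
    have O': "openin (base M) O'" "m \<in> O'" using that by (simp_all add: nbhd_def)
    have "openin (Euclidean_space p) (\<phi> ` (O' \<inter> W))" by (rule \<phi>_open[OF Int_W_open[OF O'(1)]]) simp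
    moreover have "\<phi> m \<in> \<phi> ` (O' \<inter> W)" using O'(2) m by blast
    moreover have "\<phi> ` (O' \<inter> W) \<subseteq> \<phi> ` W" by blast
    ultimately show ?thesis unfolding D.nbhd_def by (simp add: openin_superdomain_iff[OF \<phi>W])
  qed
  note h = graded_alg_homD[OF \<theta>_rstr_hom]
  have op: "openin (base M) O'" "m \<in> O'" if "nbhd O'" for O' using that by (auto simp: nbhd_def)
  show ?thesis
  proof (rule valued_point.intro[OF pp valued_point_axioms.intro])
    fix O' O'' s assume "nbhd O'" "nbhd O''" "O'' \<subseteq> O'" "s \<in> carrier (sections M O')"
    then show "val m O'' (rstr M O' O'' s) = val m O' s" using m by (intro val_rstr) (auto simp: nbhd_def)
  next
    fix O' s t assume O': "nbhd O'" and st: "s \<in> carrier (sections M O')" "t \<in> carrier (sections M O')"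
    show "val m O' (s \<oplus>\<^bsub>sections M O'\<^esub> t) = val m O' s + val m O' t"
      unfolding val_def using h(7)[OF op(1)[OF O'] st] by simp
    show "val m O' (s \<otimes>\<^bsub>sections M O'\<^esub> t) = val m O' s * val m O' t"
      unfolding val_def
      using h(6)[OF op(1)[OF O'] st] D.val_mult[OF Dn[OF O']] h(4)[OF op(1)[OF O'] st(1)] h(4)[OF op(1)[OF O'] st(2)] by simp
  next
    fix O' assume O': "nbhd O'"
    show "val m O' \<one>\<^bsub>sections M O'\<^esub> = 1"
      unfolding val_def h(5)[OF op(1)[OF O']] using D.val_one[OF Dn[OF O']] by simp
  next
    fix O' i s assume O': "nbhd O'" and i: "i \<in> Z2n n" "i \<noteq> deg_zero" and s: "s \<in> grade (sections M O') i"
    show "val m O' s = 0"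
      unfolding val_def using D.val_grade[OF Dn[OF O'] i] h(3)[OF op(1)[OF O'] i(1) s] by simp
  next
    fix O' s assume O': "nbhd O'" and s: "s \<in> carrier (sections M O')"
    have "\<exists>!c. c \<in> (\<Pi>\<^sub>E i\<in>Z2n n. grade (sections M O') i) \<and> s = finsum (sections M O') c (Z2n n)"
      by (rule comm_algebraD(4)[OF presheafD(1)[OF presheaf op(1)[OF O']] s])
    then show "\<exists>c. (\<forall>i\<in>Z2n n. c i \<in> grade (sections M O') i) \<and> s = finsum (sections M O') c (Z2n n)"
      by (auto simp: PiE_iff)
  next
    fix O' i assume "nbhd O'" "i \<in> Z2n n"
    then show "grade (sections M O') i \<subseteq> carrier (sections M O')"
      using comm_algebraD(2)[OF presheafD(1)[OF presheaf]] op by blast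
  next
    fix O' s assume O': "nbhd O'" and s: "s \<in> carrier (sections M O')" and nz: "val m O' s \<noteq> 0"
    let ?s' = "rstr M O' (O' \<inter> W) s"
    define F where "F = \<theta> (O' \<inter> W) ?s'"
    have OW: "openin (base M) (O' \<inter> W)" by (rule Int_W_open[OF op(1)[OF O']])
    have s': "?s' \<in> carrier (sections M (O' \<inter> W))" by (rule rstr_carrier[OF op(1)[OF O'] OW _ s]) simp
    have Fc: "F \<in> series_carrier n p r \<tau> (\<phi> ` (O' \<inter> W))" unfolding F_def by (rule \<theta>_carrier[OF OW _ s']) simp
    obtain U' where U': "D.nbhd U'" "U' \<subseteq> \<phi> ` (O' \<inter> W)" "cut U' F \<in> Units (series_algebra n p r \<tau> U')"
    proof -
      have "\<exists>U'. D.nbhd U' \<and> U' \<subseteq> \<phi> ` (O' \<inter> W) \<and> rstr ?D (\<phi> ` (O' \<inter> W)) U' F \<in> Units (sections ?D U')"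
        using Fc nz by (intro D.val_unit[OF Dn[OF O']]) (simp_all add: val_def F_def)
      then show ?thesis using that by auto
    qed
    have U'o: "openin (Euclidean_space p) U'" "\<phi> m \<in> U'"
      using U'(1) unfolding D.nbhd_def by (simp_all add: openin_superdomain_iff[OF \<phi>W])
    \<comment> \<open>The part of the chart that lies over the neighbourhood on which the coordinate
      expression is invertible. Injectivity of \<phi> places it inside
      \<open>O' \<inter> W\<close>.\<close>
    define N where "N = pre W \<phi> U'"
    have N: "openin (base M) N" "m \<in> N" "N \<subseteq> W" using \<phi>_cont[OF U'o(1)] U'o(2) m by (auto simp: N_def pre_def)
    have NO: "N \<subseteq> O' \<inter> W"
    proof
      fix x assume "x \<in> N"
      then have x: "x \<in> W" "\<phi> x \<in> \<phi> ` (O' \<inter> W)" using U'(2) by (auto simp: N_def pre_def)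
      then obtain y where "y \<in> O' \<inter> W" "\<phi> x = \<phi> y" by blast
      then show "x \<in> O' \<inter> W" using \<phi>_inj x(1) by (metis IntD2 inj_onD)
    qed
    have \<phi>N: "\<phi> ` N = U'" using U'(2) by (auto simp: N_def pre_def)
    have "rstr M O' N s = rstr M (O' \<inter> W) N ?s'"
      using presheafD(4)[OF presheaf op(1)[OF O'] OW N(1) NO _ s] by simp
    also have "\<dots> = \<kappa> N (\<theta> N (rstr M (O' \<inter> W) N ?s'))"
      using \<kappa>\<theta>[OF N(1,3) rstr_carrier[OF OW N(1) NO s']] by simp
    also have "\<theta> N (rstr M (O' \<inter> W) N ?s') = cut U' F"
      using \<theta>_rstr[OF OW _ N(1) NO s'] by (simp add: F_def \<phi>N)
    finally have "rstr M O' N s = \<kappa> N (cut U' F)" .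
    moreover have "\<kappa> N (cut U' F) \<in> Units (sections M N)"
      using graded_alg_homD(1)[OF \<kappa>_hom[OF N(1,3)]] U'(3) unfolding \<phi>N by (rule ring_hom_Units)
    ultimately show "\<exists>N. nbhd N \<and> N \<subseteq> O' \<and> rstr M O' N s \<in> Units (sections M N)"
      using N NO by (intro exI[of _ N]) (auto simp: nbhd_def)
  qed
qed

lemma val_smult:
  assumes "openin (base M) O'" "m \<in> O' \<inter> W" "s \<in> carrier (sections M O')"
  shows "val m O' (k \<odot>\<^bsub>sections M O'\<^esub> s) = k * val m O' s"
  unfolding val_def using graded_alg_homD(2)[OF \<theta>_rstr_hom[OF assms(1)] assms(3)] by simp

lemma base_proj_eq:
  assumes "openin (base M) O'" "m \<in> O' \<inter> W" "s \<in> carrier (sections M O')"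
  shows "base_proj M O' s m = val m O' s"
proof -
  interpret valued_point n M m "val m" using valued_point assms(2) by blast
  have nb: "nbhd O'" using assms by (simp add: nbhd_def)
  have one: "\<one>\<^bsub>sections M O'\<^esub> \<in> carrier (sections M O')" using sections_closed(4)[OF nb assms(3,3)] .
  show ?thesis
    using comm_algebraD(3)[OF presheafD(1)[OF presheaf assms(1)] one] val_smult[OF assms(1,2) one] val_one[OF nb]
    by (intro base_proj_eq_val[OF nb assms(3)]) auto
qed

end

section \<open>Existence and uniqueness of pullbacks over a chart\<close>

context sd_chart
begin

lemma image_pre:
  "O' \<subseteq> W \<Longrightarrow> \<phi> ` pre O' \<psi> W' = pre (\<phi> ` O') (\<lambda>x. \<psi> (inv_into W \<phi> x)) W'"
  by (auto simp: pre_def inv_into_f_f[OF \<phi>_inj] subset_iff)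

lemma \<theta>_value_self:
  assumes "openin (base M) O'" "O' \<subseteq> W" "m \<in> O'" "s \<in> carrier (sections M O')"
  shows "\<theta> O' s 0 (\<phi> m) = val m O' s"
  using \<theta>_value[OF assms(1,1) subset_refl assms(2-4)] presheafD(3)[OF presheaf assms(1,4)] by simp

text \<open>Replaces the open set of \<open>M\<close> by its image in coordinates, so that families
  over a chart fall under \<open>pullback_family_unique\<close>.\<close>

lemma pullback_transport:
  assumes O': "openin (base M) O'" "O' \<subseteq> W" and fam: "pullback_family n M O' \<psi> u v \<sigma> V s \<zeta> \<alpha>"
    and \<psi>: "\<And>m. m \<in> O' \<Longrightarrow> \<psi> m \<in> V"
    and op: "\<And>W'. openin (Euclidean_space u) W' \<Longrightarrow> openin (base M) (pre O' \<psi> W')"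
  shows "pullback_family n (superdomain n p r \<tau> U') (\<phi> ` O') (\<lambda>x. \<psi> (inv_into W \<phi> x)) u v \<sigma> V
    (\<lambda>j. \<theta> O' (s j)) (\<lambda>b. \<theta> O' (\<zeta> b)) (\<lambda>W' G. \<theta> (pre O' \<psi> W') (\<alpha> W' G))"
proof -
  have preW: "pre O' \<psi> W' \<subseteq> W" for W' using O'(2) by (auto simp: pre_def)
  have preV: "pre O' \<psi> V = O'" using \<psi> by (auto simp: pre_def)
  show ?thesis
    unfolding pullback_family_def superdomain_simps
  proof (intro conjI allI impI ballI)
    fix W' assume W': "openin (Euclidean_space u) W' \<and> W' \<subseteq> V"
    show "(\<lambda>G. \<theta> (pre O' \<psi> W') (\<alpha> W' G)) \<in> graded_alg_hom n (series_algebra n u v \<sigma> W')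
        (series_algebra n p r \<tau> (pre (\<phi> ` O') (\<lambda>x. \<psi> (inv_into W \<phi> x)) W'))"
      unfolding image_pre[OF O'(2), symmetric]
      using W' op preW by (intro graded_alg_hom_compose[OF pullback_familyD(1)[OF fam] \<theta>_hom]) auto
  next
    fix W1 W2 G assume W12: "openin (Euclidean_space u) W1 \<and> openin (Euclidean_space u) W2 \<and> W2 \<subseteq> W1 \<and> W1 \<subseteq> V"
      and G: "G \<in> series_carrier n u v \<sigma> W1"
    have "\<alpha> W2 (cut W2 G) = rstr M (pre O' \<psi> W1) (pre O' \<psi> W2) (\<alpha> W1 G)"
      using W12 G by (intro pullback_familyD(2)[OF fam]) auto
    moreover have "\<theta> (pre O' \<psi> W2) (rstr M (pre O' \<psi> W1) (pre O' \<psi> W2) (\<alpha> W1 G)) =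
        cut (\<phi> ` pre O' \<psi> W2) (\<theta> (pre O' \<psi> W1) (\<alpha> W1 G))"
      using W12 op preW G by (intro \<theta>_rstr pullback_familyD(5)[OF fam] pre_subset) auto
    ultimately show "\<theta> (pre O' \<psi> W2) (\<alpha> W2 (cut W2 G)) =
        cut (pre (\<phi> ` O') (\<lambda>x. \<psi> (inv_into W \<phi> x)) W2) (\<theta> (pre O' \<psi> W1) (\<alpha> W1 G))"
      by (simp only: image_pre[OF O'(2)])
  qed (simp_all add: preV pullback_familyD(3,4)[OF fam])
qed

text \<open>Carried to coordinates by \<theta>, both families have the same coordinate data, whose
  bodies are the components of \<psi>, and agree; \<kappa> brings the equality back.\<close>

lemma local_unique:
  assumes O': "openin (base M) O'" "O' \<subseteq> W" and V: "openin (Euclidean_space u) V"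
    and s: "\<And>j. j < u \<Longrightarrow> s j \<in> carrier (sections M O')"
    and \<zeta>: "\<And>b. b < v \<Longrightarrow> \<zeta> b \<in> grade (sections M O') (\<sigma> b)"
    and \<sigma>: "\<And>b. b < v \<Longrightarrow> \<sigma> b \<in> Z2n n" "\<And>b. b < v \<Longrightarrow> \<sigma> b \<noteq> deg_zero"
    and \<psi>: "\<And>m j. m \<in> O' \<Longrightarrow> j < u \<Longrightarrow> \<psi> m j = val m O' (s j)" "\<And>m. m \<in> O' \<Longrightarrow> \<psi> m \<in> V"
    and op: "\<And>W'. openin (Euclidean_space u) W' \<Longrightarrow> openin (base M) (pre O' \<psi> W')"
    and a: "pullback_family n M O' \<psi> u v \<sigma> V s \<zeta> a" and b: "pullback_family n M O' \<psi> u v \<sigma> V s \<zeta> b"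
    and W': "openin (Euclidean_space u) W'" "W' \<subseteq> V" and G: "G \<in> series_carrier n u v \<sigma> W'"
  shows "a W' G = b W' G"
proof -
  have z: "\<theta> O' (\<zeta> b) \<in> grade (series_algebra n p r \<tau> (\<phi> ` O')) (\<sigma> b)" if "b < v" for b
    using graded_alg_homD(3)[OF \<theta>_hom[OF O']] \<sigma> \<zeta> that by blast
  have "\<theta> (pre O' \<psi> W') (a W' G) = \<theta> (pre O' \<psi> W') (b W' G)"
  proof (rule pullback_family_unique[OF \<phi>_open[OF O'] V _ _ _ _ _
      pullback_transport[OF O' a \<psi>(2) op] pullback_transport[OF O' b \<psi>(2) op] W' G])
    show "\<theta> O' (s j) \<in> series_carrier n p r \<tau> (\<phi> ` O')" if "j < u" for j
      by (rule \<theta>_carrier[OF O' s[OF that]])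
    show "\<theta> O' (\<zeta> b) \<in> series_carrier n p r \<tau> (\<phi> ` O')" if "b < v" for b
      using z[OF that] by (simp add: series_grade_iff)
    show "\<theta> O' (\<zeta> b) 0 x = 0" if "b < v" for b x
      by (rule series_grade_nonzero[OF z[OF that] \<sigma>(2)[OF that]])
    show "\<psi> (inv_into W \<phi> x) j = \<theta> O' (s j) 0 x" if "x \<in> \<phi> ` O'" "j < u" for x j
    proof -
      obtain m where m: "m \<in> O'" "x = \<phi> m" using \<open>x \<in> \<phi> ` O'\<close> by blast
      then have "inv_into W \<phi> x = m" using O'(2) \<phi>_inj by auto
      then show ?thesis using \<theta>_value_self[OF O' m(1) s[OF that(2)]] \<psi>(1)[OF m(1) that(2)] m(2) by simp
    qed
    show "\<psi> (inv_into W \<phi> x) \<in> V" if "x \<in> \<phi> ` O'" for x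
    proof -
      obtain m where m: "m \<in> O'" "x = \<phi> m" using \<open>x \<in> \<phi> ` O'\<close> by blast
      then have "inv_into W \<phi> x = m" using O'(2) \<phi>_inj by auto
      then show ?thesis using \<psi>(2) m(1) by simp
    qed
  qed auto
  then have "\<kappa> (pre O' \<psi> W') (\<theta> (pre O' \<psi> W') (a W' G)) = \<kappa> (pre O' \<psi> W') (\<theta> (pre O' \<psi> W') (b W' G))"
    by simp
  moreover have "pre O' \<psi> W' \<subseteq> W" using O'(2) by (auto simp: pre_def)
  ultimately show ?thesis
    using \<kappa>\<theta>[OF op[OF W'(1)]] pullback_familyD(5)[OF a W' G] pullback_familyD(5)[OF b W' G] by simp
qed

text \<open>Read in the chart, the components of \<psi> are bodies of smooth series and hence
  continuous. This is how continuity of the base map arises from sections.\<close>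

lemma chart_pre_open:
  assumes V: "openin (Euclidean_space u) V" and W': "openin (Euclidean_space u) W'"
    and s: "\<And>j. j < u \<Longrightarrow> s j \<in> carrier (sections M W)"
    and \<psi>: "\<And>m j. m \<in> W \<Longrightarrow> j < u \<Longrightarrow> \<psi> m j = val m W (s j)" "\<And>m. m \<in> W \<Longrightarrow> \<psi> m \<in> V"
  shows "openin (base M) (pre W \<psi> W')"
proof -
  define f where "f = (\<lambda>x. \<psi> (inv_into W \<phi> x))"
  have f: "f (\<phi> m) = \<psi> m" if "m \<in> W" for m using that \<phi>_inj by (simp add: f_def)
  have \<phi>W: "openin (Euclidean_space p) (\<phi> ` W)" by (rule \<phi>_open[OF W_open subset_refl])
  have "openin (Euclidean_space p) (pre (\<phi> ` W) f W')"
  proof (rule openin_pre[OF \<phi>W W'])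
    fix j assume j: "j < u"
    have "f x j = \<theta> W (s j) 0 x" if "x \<in> \<phi> ` W" for x
      using that f \<psi>(1)[OF _ j] \<theta>_value_self[OF W_open subset_refl _ s[OF j]] by auto
    moreover have "continuous_on (\<phi> ` W) (\<theta> W (s j) 0)"
      using series_smooth[OF \<phi>W \<theta>_carrier[OF W_open subset_refl s[OF j]]] smooth_upto_continuous[OF smooth_imp_smooth_upto] by blast
    ultimately show "continuous_on (\<phi> ` W) (\<lambda>x. f x j)" by (subst continuous_on_cong[OF refl]) auto
  next
    fix x j assume "x \<in> \<phi> ` W" "j \<ge> u"
    then obtain m where "m \<in> W" "x = \<phi> m" by blast
    then have "f x \<in> topspace (Euclidean_space u)" using f \<psi>(2) openin_subset[OF V] by auto
    then show "f x j = 0" using \<open>j \<ge> u\<close> by (simp add: topspace_Euclidean_space)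
  qed
  then have "openin (base M) (pre W \<phi> (pre (\<phi> ` W) f W'))" by (rule \<phi>_cont)
  moreover have "pre W \<phi> (pre (\<phi> ` W) f W') = pre W \<psi> W'" unfolding pre_def
  proof (intro Collect_cong conj_cong refl)
    fix m assume "m \<in> W"
    then show "\<phi> m \<in> {x \<in> \<phi> ` W. f x \<in> W'} \<longleftrightarrow> \<psi> m \<in> W'" using f[of m] by simp
  qed
  ultimately show ?thesis by simp
qed

text \<open>The explicit pullback in coordinates, brought back to \<open>M\<close> by \<kappa>. The
  second conjunct records that the body of the pullback of \<open>G\<close> is the body of
  \<open>G\<close> composed with \<psi>; locality on stalks rests on it.\<close>

lemma local_exist:
  assumes V: "openin (Euclidean_space u) V"
    and s: "\<And>j. j < u \<Longrightarrow> s j \<in> grade (sections M W) deg_zero"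
    and \<zeta>: "\<And>b. b < v \<Longrightarrow> \<zeta> b \<in> grade (sections M W) (\<sigma> b)"
    and \<sigma>: "\<And>b. b < v \<Longrightarrow> \<sigma> b \<in> Z2n n" "\<And>b. b < v \<Longrightarrow> \<sigma> b \<noteq> deg_zero"
    and \<psi>: "\<And>m j. m \<in> W \<Longrightarrow> j < u \<Longrightarrow> \<psi> m j = val m W (s j)" "\<And>m. m \<in> W \<Longrightarrow> \<psi> m \<in> V"
  shows "\<exists>\<alpha>. pullback_family n M W \<psi> u v \<sigma> V s \<zeta> \<alpha> \<and>
    (\<forall>W' G m. openin (Euclidean_space u) W' \<longrightarrow> W' \<subseteq> V \<longrightarrow> G \<in> series_carrier n u v \<sigma> W' \<longrightarrow> m \<in> pre W \<psi> W' \<longrightarrow>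
       val m (pre W \<psi> W') (\<alpha> W' G) = G 0 (\<psi> m))"
proof -
  have A: "z2n_comm_algebra n (sections M W)" by (rule presheafD(1)[OF presheaf W_open])
  have sc: "s j \<in> carrier (sections M W)" if "j < u" for j
    using s[OF that] comm_algebraD(2)[OF A deg_zero_in_Z2n] by blast
  have zc: "\<zeta> b \<in> carrier (sections M W)" if "b < v" for b
    using \<zeta>[OF that] comm_algebraD(2)[OF A \<sigma>(1)[OF that]] by blast
  have op: "openin (base M) (pre W \<psi> W')" if "openin (Euclidean_space u) W'" for W'
    using sc \<psi> by (intro chart_pre_open[OF V that]) auto
  define f where "f = (\<lambda>x. \<psi> (inv_into W \<phi> x))"
  have f: "f (\<phi> m) = \<psi> m" if "m \<in> W" for m using that \<phi>_inj by (simp add: f_def)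
  have \<phi>W: "openin (Euclidean_space p) (\<phi> ` W)" by (rule \<phi>_open[OF W_open subset_refl])
  note \<theta>W = \<theta>_hom[OF W_open subset_refl]
  define P where "P = pullback n r \<tau> (\<phi> ` W) f u v \<sigma> (\<lambda>j. \<theta> W (s j)) (\<lambda>b. \<theta> W (\<zeta> b))"
  have fam: "pullback_family n (superdomain n p r \<tau> (\<phi> ` W)) (\<phi> ` W) f u v \<sigma> V (\<lambda>j. \<theta> W (s j)) (\<lambda>b. \<theta> W (\<zeta> b)) P"
    unfolding P_def
  proof (rule pullback_family_pullback[OF \<phi>W V])
    show "\<theta> W (s j) \<in> grade (series_algebra n p r \<tau> (\<phi> ` W)) deg_zero" if "j < u" for j
      by (rule graded_alg_homD(3)[OF \<theta>W deg_zero_in_Z2n s[OF that]])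
    show "\<theta> W (\<zeta> b) \<in> grade (series_algebra n p r \<tau> (\<phi> ` W)) (\<sigma> b)" if "b < v" for b
      by (rule graded_alg_homD(3)[OF \<theta>W \<sigma>(1)[OF that] \<zeta>[OF that]])
    show "f x j = \<theta> W (s j) 0 x" if "x \<in> \<phi> ` W" "j < u" for x j
      using that f \<psi>(1)[OF _ that(2)] \<theta>_value_self[OF W_open subset_refl _ sc[OF that(2)]] by auto
    show "f x \<in> V" if "x \<in> \<phi> ` W" for x using that f \<psi>(2) by auto
  qed (use \<sigma> in auto)
  define \<alpha> where "\<alpha> = (\<lambda>W' G. \<kappa> (pre W \<psi> W') (P W' G))"
  have img: "\<phi> ` pre W \<psi> W' = pre (\<phi> ` W) f W'" for W' unfolding f_def by (rule image_pre) simp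
  have Pc: "P W' G \<in> series_carrier n p r \<tau> (\<phi> ` pre W \<psi> W')"
    if "openin (Euclidean_space u) W'" "W' \<subseteq> V" "G \<in> series_carrier n u v \<sigma> W'" for W' G
    using pullback_familyD(5)[OF fam that] by (simp add: img)
  have \<alpha>c: "\<alpha> W' G \<in> carrier (sections M (pre W \<psi> W'))"
    if "openin (Euclidean_space u) W'" "W' \<subseteq> V" "G \<in> series_carrier n u v \<sigma> W'" for W' G
    unfolding \<alpha>_def using graded_alg_homD(4)[OF \<kappa>_hom[OF op[OF that(1)] pre_subset(1)]] Pc[OF that] by simp
  have \<theta>\<alpha>: "\<theta> (pre W \<psi> W') (\<alpha> W' G) = P W' G"
    if "openin (Euclidean_space u) W'" "W' \<subseteq> V" "G \<in> series_carrier n u v \<sigma> W'" for W' G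
    unfolding \<alpha>_def by (rule \<theta>\<kappa>[OF op[OF that(1)] pre_subset(1) Pc[OF that]])
  have "pullback_family n M W \<psi> u v \<sigma> V s \<zeta> \<alpha>"
    unfolding pullback_family_def
  proof (intro conjI allI impI ballI)
    fix W' assume W': "openin (Euclidean_space u) W' \<and> W' \<subseteq> V"
    have "P W' \<in> graded_alg_hom n (series_algebra n u v \<sigma> W') (series_algebra n p r \<tau> (\<phi> ` pre W \<psi> W'))"
      using pullback_familyD(1)[OF fam] W' by (simp add: img)
    from graded_alg_hom_compose[OF this \<kappa>_hom[OF op pre_subset(1)]] W'
    show "\<alpha> W' \<in> graded_alg_hom n (series_algebra n u v \<sigma> W') (sections M (pre W \<psi> W'))"
      by (simp add: \<alpha>_def)
  next
    fix W1 W2 G assume W12: "openin (Euclidean_space u) W1 \<and> openin (Euclidean_space u) W2 \<and> W2 \<subseteq> W1 \<and> W1 \<subseteq> V"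
      and G: "G \<in> series_carrier n u v \<sigma> W1"
    have o1: "openin (base M) (pre W \<psi> W1)" and o2: "openin (base M) (pre W \<psi> W2)"
      and ac: "\<alpha> W1 G \<in> carrier (sections M (pre W \<psi> W1))"
      using W12 G op \<alpha>c by auto
    have sub: "pre W \<psi> W2 \<subseteq> pre W \<psi> W1" using W12 by (intro pre_subset(2)) simp
    have "\<theta> (pre W \<psi> W2) (rstr M (pre W \<psi> W1) (pre W \<psi> W2) (\<alpha> W1 G)) = cut (\<phi> ` pre W \<psi> W2) (P W1 G)"
      using \<theta>_rstr[OF o1 pre_subset(1) o2 sub ac] \<theta>\<alpha>[of W1 G] W12 G by simp
    also have "\<dots> = P W2 (cut W2 G)"
      using pullback_familyD(2)[OF fam, of W1 W2 G] W12 G by (simp add: img)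
    finally have "\<kappa> (pre W \<psi> W2) (\<theta> (pre W \<psi> W2) (rstr M (pre W \<psi> W1) (pre W \<psi> W2) (\<alpha> W1 G))) = \<alpha> W2 (cut W2 G)"
      by (simp add: \<alpha>_def)
    then show "\<alpha> W2 (cut W2 G) = rstr M (pre W \<psi> W1) (pre W \<psi> W2) (\<alpha> W1 G)"
      using \<kappa>\<theta>[OF o2 pre_subset(1) rstr_carrier[OF o1 o2 sub ac]] by simp
  next
    have preV: "pre W \<psi> V = W" using \<psi>(2) by (auto simp: pre_def)
    show "\<alpha> V (coord_fun V j) = s j" if "j < u" for j
      using pullback_familyD(3)[OF fam that] \<kappa>\<theta>[OF W_open subset_refl sc[OF that]] by (simp add: \<alpha>_def preV)
    show "\<alpha> V (formal_var V b) = \<zeta> b" if "b < v" for b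
      using pullback_familyD(4)[OF fam that] \<kappa>\<theta>[OF W_open subset_refl zc[OF that]] by (simp add: \<alpha>_def preV)
  qed
  moreover have "val m (pre W \<psi> W') (\<alpha> W' G) = G 0 (\<psi> m)"
    if W': "openin (Euclidean_space u) W'" "W' \<subseteq> V" "G \<in> series_carrier n u v \<sigma> W'" and m: "m \<in> pre W \<psi> W'" for W' G m
  proof -
    have "val m (pre W \<psi> W') (\<alpha> W' G) = P W' G 0 (\<phi> m)"
      using \<theta>_value_self[OF op[OF W'(1)] pre_subset(1) m \<alpha>c[OF W']] \<theta>\<alpha>[OF W'] by simp
    also have "\<dots> = G 0 (f (\<phi> m))"
      unfolding P_def using m img by (intro pullback_value) blast
    finally show ?thesis using f m by (simp add: pre_def)
  qed
  ultimately show ?thesis by blast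
qed

end

section \<open>Gluing\<close>

lemma sheaf_presheaf: "z2n_sheaf n M \<Longrightarrow> z2n_presheaf n M"
  by (simp add: z2n_sheaf_def)

lemma sheaf_eqI:
  assumes S: "z2n_sheaf n M" and D: "\<And>i. i \<in> I \<Longrightarrow> openin (base M) (D i)" "O' = (\<Union>i\<in>I. D i)"
    and st: "s \<in> carrier (sections M O')" "t \<in> carrier (sections M O')"
    and eq: "\<And>i. i \<in> I \<Longrightarrow> rstr M O' (D i) s = rstr M O' (D i) t"
  shows "s = t"
proof -
  note sep = S[unfolded z2n_sheaf_def, THEN conjunct2, THEN spec, of "D ` I", THEN mp, THEN conjunct1]
  show ?thesis using sep D st eq by auto
qed

text \<open>The sheaf axiom speaks of a set of open sets, while different indices here may share the
  same open set. Compatibility on \<open>D i \<inter> D j\<close> forces such sections to be equal,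
  so one index can be chosen for each set.\<close>

lemma sheaf_glue:
  assumes S: "z2n_sheaf n M" and D: "\<And>i. i \<in> I \<Longrightarrow> openin (base M) (D i)" "O' = (\<Union>i\<in>I. D i)"
    and a: "\<And>i. i \<in> I \<Longrightarrow> a i \<in> carrier (sections M (D i))"
    and compat: "\<And>i j. i \<in> I \<Longrightarrow> j \<in> I \<Longrightarrow> rstr M (D i) (D i \<inter> D j) (a i) = rstr M (D j) (D i \<inter> D j) (a j)"
  shows "\<exists>s\<in>carrier (sections M O'). \<forall>i\<in>I. rstr M O' (D i) s = a i"
proof -
  note P = sheaf_presheaf[OF S]
  define c where "c = (\<lambda>U. SOME i. i \<in> I \<and> D i = U)"
  have c: "c (D i) \<in> I" "D (c (D i)) = D i" if "i \<in> I" for i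
    using someI[of "\<lambda>k. k \<in> I \<and> D k = D i" i] that by (auto simp: c_def)
  define f where "f = (\<lambda>U. a (c U))"
  have f: "f (D i) = a i" if i: "i \<in> I" for i
  proof -
    have "rstr M (D i) (D i) (a (c (D i))) = rstr M (D i) (D i) (a i)"
      using compat[OF c(1)[OF i] i] c(2)[OF i] by simp
    then show ?thesis
      using presheafD(3)[OF P D(1)[OF i]] a[OF i] a[OF c(1)[OF i]] c(2)[OF i] by (simp add: f_def)
  qed
  note glue = S[unfolded z2n_sheaf_def, THEN conjunct2, THEN spec, of "D ` I", THEN mp, THEN conjunct2, THEN spec, of f, THEN mp]
  have "\<exists>s\<in>carrier (sections M (\<Union>(D ` I))). \<forall>U\<in>D ` I. rstr M (\<Union>(D ` I)) U s = f U"
    by (rule glue) (use D(1) f a compat in auto)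
  then show ?thesis using f D(2) by auto
qed

lemma ring_hom_finsum:
  assumes h: "h \<in> ring_hom R S" and R: "ring R" "ring S"
  shows "finite A \<Longrightarrow> (\<And>i. i \<in> A \<Longrightarrow> c i \<in> carrier R) \<Longrightarrow> h (finsum R c A) = finsum S (\<lambda>i. h (c i)) A"
proof (induction A rule: finite_induct)
  have m: "abelian_monoid R" "abelian_monoid S" using R by (simp_all add: abelian_group.axioms ring.is_abelian_group)
  case empty
  show ?case using m ring_hom_zero[OF h R] by (simp add: abelian_monoid.finsum_empty)
next
  have m: "abelian_monoid R" "abelian_monoid S" using R by (simp_all add: abelian_group.axioms ring.is_abelian_group)
  case (insert i A)
  have c: "finsum R c A \<in> carrier R" using insert.prems by (intro abelian_monoid.finsum_closed[OF m(1)]) auto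
  have "h (finsum R c (insert i A)) = h (c i \<oplus>\<^bsub>R\<^esub> finsum R c A)"
    using insert by (subst abelian_monoid.finsum_insert[OF m(1)]) auto
  also have "\<dots> = h (c i) \<oplus>\<^bsub>S\<^esub> finsum S (\<lambda>i. h (c i)) A"
    using insert c by (subst ring_hom_add[OF h]) auto
  also have "\<dots> = finsum S (\<lambda>i. h (c i)) (insert i A)"
    using insert ring_hom_closed[OF h] by (subst abelian_monoid.finsum_insert[OF m(2)]) auto
  finally show ?case .
qed

text \<open>The homogeneous element also has the decomposition concentrated in degree
  \<open>k\<close>; uniqueness of decompositions makes the two coincide.\<close>

lemma graded_component_unique:
  assumes A: "z2n_comm_algebra n A" and c: "\<And>l. l \<in> Z2n n \<Longrightarrow> c l \<in> grade A l"
    and k: "k \<in> Z2n n" "finsum A c (Z2n n) \<in> grade A k" and l: "l \<in> Z2n n" "l \<noteq> k"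
  shows "c l = \<zero>\<^bsub>A\<^esub>"
proof -
  let ?t = "finsum A c (Z2n n)"
  have m: "abelian_monoid A" using comm_algebraD(1)[OF A] by (simp add: abelian_group.axioms ring.is_abelian_group)
  have cc: "c \<in> Z2n n \<rightarrow> carrier A" using c comm_algebraD(2)[OF A] by blast
  have tc: "?t \<in> carrier A" using k comm_algebraD(2)[OF A] by blast
  define c1 where "c1 = restrict c (Z2n n)"
  define c2 where "c2 = (\<lambda>l\<in>Z2n n. if k = l then ?t else \<zero>\<^bsub>A\<^esub>)"
  have "c1 \<in> (\<Pi>\<^sub>E i\<in>Z2n n. grade A i)" using c by (auto simp: c1_def)
  moreover have "?t = finsum A c1 (Z2n n)"
    unfolding c1_def using cc by (intro abelian_monoid.finsum_cong'[OF m]) auto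
  moreover have "c2 \<in> (\<Pi>\<^sub>E i\<in>Z2n n. grade A i)" using k comm_algebraD(5)[OF A] by (auto simp: c2_def)
  moreover have "?t = finsum A c2 (Z2n n)"
  proof -
    have "finsum A c2 (Z2n n) = finsum A (\<lambda>l. if k = l then ?t else \<zero>\<^bsub>A\<^esub>) (Z2n n)"
      unfolding c2_def using tc abelian_monoid.zero_closed[OF m] by (intro abelian_monoid.finsum_cong'[OF m]) auto
    also have "\<dots> = ?t" using abelian_monoid.finsum_singleton[OF m k(1) finite_Z2n, of "\<lambda>_. ?t"] tc by simp
    finally show ?thesis by simp
  qed
  ultimately have "c1 = c2" using comm_algebraD(4)[OF A tc] by blast
  then have "c1 l = c2 l" by simp
  then show ?thesis using l by (simp add: c1_def c2_def)
qed

text \<open>Homogeneity is a local property: the components of degree other than \<open>k\<close>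
  restrict to 0 on every member of the cover, hence are 0.\<close>

lemma sheaf_grade:
  assumes S: "z2n_sheaf n M" and D: "\<And>i. i \<in> I \<Longrightarrow> openin (base M) (D i)" "O' = (\<Union>i\<in>I. D i)"
    and t: "t \<in> carrier (sections M O')" and k: "k \<in> Z2n n"
    and loc: "\<And>i. i \<in> I \<Longrightarrow> rstr M O' (D i) t \<in> grade (sections M (D i)) k"
  shows "t \<in> grade (sections M O') k"
proof -
  note P = sheaf_presheaf[OF S]
  have O': "openin (base M) O'" using D by auto
  have A: "z2n_comm_algebra n (sections M O')" by (rule presheafD(1)[OF P O'])
  have m: "abelian_monoid (sections M O')"
    using comm_algebraD(1)[OF A] by (simp add: abelian_group.axioms ring.is_abelian_group)
  obtain c where c: "\<And>l. l \<in> Z2n n \<Longrightarrow> c l \<in> grade (sections M O') l" "t = finsum (sections M O') c (Z2n n)"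
    using comm_algebraD(4)[OF A t] by (auto simp: PiE_iff)
  have cc: "c l \<in> carrier (sections M O')" if "l \<in> Z2n n" for l
    using c(1)[OF that] comm_algebraD(2)[OF A that] by blast
  have zero: "c l = \<zero>\<^bsub>sections M O'\<^esub>" if l: "l \<in> Z2n n" "l \<noteq> k" for l
  proof (rule sheaf_eqI[OF S D cc[OF l(1)] abelian_monoid.zero_closed[OF m]])
    fix i assume i: "i \<in> I"
    have sub: "D i \<subseteq> O'" using i D(2) by blast
    note h = presheafD(2)[OF P O' D(1)[OF i] sub]
    have Ai: "z2n_comm_algebra n (sections M (D i))" by (rule presheafD(1)[OF P D(1)[OF i]])
    have "rstr M O' (D i) t = finsum (sections M (D i)) (\<lambda>l. rstr M O' (D i) (c l)) (Z2n n)"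
      unfolding c(2) by (rule ring_hom_finsum[OF graded_alg_homD(1)[OF h] comm_algebraD(1)[OF A] comm_algebraD(1)[OF Ai] finite_Z2n cc])
    then have "rstr M O' (D i) (c l) = \<zero>\<^bsub>sections M (D i)\<^esub>"
      using graded_component_unique[OF Ai, of "\<lambda>l. rstr M O' (D i) (c l)" k l] graded_alg_homD(3)[OF h] c(1) loc[OF i] k l by simp
    then show "rstr M O' (D i) (c l) = rstr M O' (D i) \<zero>\<^bsub>sections M O'\<^esub>"
      using ring_hom_zero[OF graded_alg_homD(1)[OF h] comm_algebraD(1)[OF A] comm_algebraD(1)[OF Ai]] by simp
  qed
  have "t = finsum (sections M O') (\<lambda>l. if k = l then c l else \<zero>\<^bsub>sections M O'\<^esub>) (Z2n n)"
    unfolding c(2) using zero cc abelian_monoid.zero_closed[OF m] by (intro abelian_monoid.finsum_cong'[OF m]) auto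
  also have "\<dots> = c k" using abelian_monoid.finsum_singleton[OF m k finite_Z2n, of c] cc by auto
  finally show ?thesis using c(1)[OF k] by simp
qed

lemma pullback_family_cong:
  assumes "\<And>j. j < u \<Longrightarrow> s j = s' j" "\<And>b. b < v \<Longrightarrow> \<zeta> b = \<zeta>' b"
  shows "pullback_family n X O' \<psi> u v \<sigma> V s \<zeta> \<alpha> \<longleftrightarrow> pullback_family n X O' \<psi> u v \<sigma> V s' \<zeta>' \<alpha>"
  using assms by (simp add: pullback_family_def)

section \<open>Morphisms into a superdomain\<close>

text \<open>Two representatives of a germ agree on a smaller neighbourhood, and pullback commutes
  with restriction, so the description in \<open>stalk_map\<close> has one solution.\<close>

lemma stalk_map_germ:
  assumes M: "presheaf_point M m" and N: "presheaf_point N (fst \<Phi> m)"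
    and cont: "\<And>V. openin (base N) V \<Longrightarrow> openin (base M) (preimage M (fst \<Phi>) V)"
    and closed: "\<And>V s. openin (base N) V \<Longrightarrow> s \<in> carrier (sections N V) \<Longrightarrow>
      snd \<Phi> V s \<in> carrier (sections M (preimage M (fst \<Phi>) V))"
    and restr: "\<And>V W s. openin (base N) V \<Longrightarrow> openin (base N) W \<Longrightarrow> W \<subseteq> V \<Longrightarrow> s \<in> carrier (sections N V) \<Longrightarrow>
      snd \<Phi> W (rstr N V W s) = rstr M (preimage M (fst \<Phi>) V) (preimage M (fst \<Phi>) W) (snd \<Phi> V s)"
    and V: "openin (base N) V" "fst \<Phi> m \<in> V" "s \<in> carrier (sections N V)"
  shows "stalk_map M N \<Phi> m (germ N (fst \<Phi> m) V s) = germ M m (preimage M (fst \<Phi>) V) (snd \<Phi> V s)"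
  unfolding stalk_map_def
proof (rule the_equality)
  show "\<exists>V' s'. openin (base N) V' \<and> fst \<Phi> m \<in> V' \<and> s' \<in> carrier (sections N V') \<and>
      germ N (fst \<Phi> m) V s = germ N (fst \<Phi> m) V' s' \<and>
      germ M m (preimage M (fst \<Phi>) V) (snd \<Phi> V s) = germ M m (preimage M (fst \<Phi>) V') (snd \<Phi> V' s')"
    using V by blast
next
  interpret M: presheaf_point n M m for n by (rule M)
  interpret N: presheaf_point n N "fst \<Phi> m" for n by (rule N)
  let ?p = "preimage M (fst \<Phi>)"
  have nb: "M.nbhd (?p V)" if "N.nbhd V" for V
    using that cont M.m_in by (simp add: M.nbhd_def N.nbhd_def preimage_def)
  fix y
  assume "\<exists>V' s'. openin (base N) V' \<and> fst \<Phi> m \<in> V' \<and> s' \<in> carrier (sections N V') \<and>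
      germ N (fst \<Phi> m) V s = germ N (fst \<Phi> m) V' s' \<and> y = germ M m (?p V') (snd \<Phi> V' s')"
  then obtain V' s' where V': "openin (base N) V'" "fst \<Phi> m \<in> V'" "s' \<in> carrier (sections N V')"
    and eq: "germ N (fst \<Phi> m) V s = germ N (fst \<Phi> m) V' s'" and y: "y = germ M m (?p V') (snd \<Phi> V' s')"
    by blast
  have nV: "N.nbhd V" "N.nbhd V'" using V V' by (simp_all add: N.nbhd_def)
  obtain N' where N': "N.nbhd N'" "N' \<subseteq> V \<inter> V'" "rstr N V N' s = rstr N V' N' s'"
    using eq N.germ_eq_iff[OF nV(1) V(3) nV(2) V'(3)] by blast
  have oN': "openin (base N) N'" using N'(1) by (simp add: N.nbhd_def)
  have sub: "?p N' \<subseteq> ?p V" "?p N' \<subseteq> ?p V'" using N'(2) by (auto simp: preimage_def)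
  have "germ M m (?p V) (snd \<Phi> V s) = germ M m (?p N') (rstr M (?p V) (?p N') (snd \<Phi> V s))"
    by (rule M.germ_restrict[OF nb[OF nV(1)] nb[OF N'(1)] sub(1) closed[OF V(1,3)], symmetric])
  also have "rstr M (?p V) (?p N') (snd \<Phi> V s) = rstr M (?p V') (?p N') (snd \<Phi> V' s')"
    using restr[OF V(1) oN' _ V(3)] restr[OF V'(1) oN' _ V'(3)] N'(2,3) by simp
  also have "germ M m (?p N') \<dots> = y"
    unfolding y by (rule M.germ_restrict[OF nb[OF nV(2)] nb[OF N'(1)] sub(2) closed[OF V'(1,3)]])
  finally show "y = germ M m (?p V) (snd \<Phi> V s)" by simp
qed

text \<open>One chart is fixed around each point and indexed by that point, so the points themselves
  index the cover. The degrees of the chart variables may vary with the chart; their number does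
  not.\<close>

locale coordinate_data =
  fixes n p r u v :: nat and M :: "('m, 'a) ringed_space" and V :: "(nat \<Rightarrow> real) set" and \<sigma> :: "nat \<Rightarrow> degree"
    and s \<zeta> :: "nat \<Rightarrow> 'a"
    and T :: "'m \<Rightarrow> nat \<Rightarrow> degree" and C :: "'m \<Rightarrow> 'm set" and \<phi> :: "'m \<Rightarrow> 'm \<Rightarrow> nat \<Rightarrow> real"
    and \<theta> :: "'m \<Rightarrow> 'm set \<Rightarrow> 'a \<Rightarrow> power_series" and \<kappa> :: "'m \<Rightarrow> 'm set \<Rightarrow> power_series \<Rightarrow> 'a"
  assumes sheaf: "z2n_sheaf n M"
    and chart: "i \<in> topspace (base M) \<Longrightarrow> sd_chart n p r (T i) M (C i) (\<phi> i) (\<theta> i) (\<kappa> i)"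
    and in_C: "i \<in> topspace (base M) \<Longrightarrow> i \<in> C i"
    and V: "openin (Euclidean_space u) V"
    and \<sigma>: "b < v \<Longrightarrow> \<sigma> b \<in> Z2n n" "b < v \<Longrightarrow> \<sigma> b \<noteq> deg_zero"
    and s_grade: "j < u \<Longrightarrow> s j \<in> grade (sections M (topspace (base M))) deg_zero"
    and \<zeta>_grade: "b < v \<Longrightarrow> \<zeta> b \<in> grade (sections M (topspace (base M))) (\<sigma> b)"
    and base_in: "m \<in> topspace (base M) \<Longrightarrow>
      (\<lambda>j. if j < u then base_proj M (topspace (base M)) (s j) m else 0) \<in> V"
begin

abbreviation "X \<equiv> topspace (base M)"
abbreviation "D \<equiv> superdomain n u v \<sigma> V"

definition \<psi> :: "'m \<Rightarrow> nat \<Rightarrow> real" where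
  "\<psi> m = (\<lambda>j. if j < u then base_proj M X (s j) m else 0)"

abbreviation "val m \<equiv> sd_chart.val M (C m) (\<phi> m) (\<theta> m) m"

lemma presheaf: "z2n_presheaf n M"
  using sheaf by (rule sheaf_presheaf)

lemma alg: "openin (base M) U \<Longrightarrow> z2n_comm_algebra n (sections M U)"
  by (rule presheafD(1)[OF presheaf])

lemma s_carrier: "j < u \<Longrightarrow> s j \<in> carrier (sections M X)"
  using s_grade comm_algebraD(2)[OF alg[OF openin_topspace] deg_zero_in_Z2n] by blast

lemma \<zeta>_carrier: "b < v \<Longrightarrow> \<zeta> b \<in> carrier (sections M X)"
  using \<zeta>_grade \<sigma>(1) comm_algebraD(2)[OF alg[OF openin_topspace]] by blast

lemma C_open: "i \<in> X \<Longrightarrow> openin (base M) (C i)"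
  using sd_chart.W_open[OF chart] .

lemma C_sub: "i \<in> X \<Longrightarrow> C i \<subseteq> X"
  using C_open openin_subset by blast

lemma \<psi>_in: "m \<in> X \<Longrightarrow> \<psi> m \<in> V"
  using base_in by (simp add: \<psi>_def)

text \<open>\<open>base_proj\<close> is defined without charts, so every chart containing
  \<open>m\<close> computes the same value. This is what allows local constructions over one common
  base map \<psi>.\<close>

lemma \<psi>_val: "i \<in> X \<Longrightarrow> m \<in> C i \<Longrightarrow> j < u \<Longrightarrow> \<psi> m j = sd_chart.val M (C i) (\<phi> i) (\<theta> i) m X (s j)"
  using sd_chart.base_proj_eq[OF chart openin_topspace _ s_carrier, of i m j] C_sub[of i] by (auto simp: \<psi>_def)

lemma \<psi>_val_rstr:
  assumes "i \<in> X" "openin (base M) O'" "m \<in> O'" "O' \<subseteq> C i" "j < u"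
  shows "\<psi> m j = sd_chart.val M (C i) (\<phi> i) (\<theta> i) m O' (rstr M X O' (s j))"
proof -
  have m: "m \<in> C i" "O' \<subseteq> X" "m \<in> O' \<inter> C i" using assms C_sub by auto
  show ?thesis
    using sd_chart.val_rstr[OF chart[OF assms(1)] openin_topspace assms(2) m(2,3) s_carrier[OF assms(5)]]
      \<psi>_val[OF assms(1) m(1) assms(5)] by simp
qed

lemma rstr_X_carrier:
  "j < u \<Longrightarrow> openin (base M) O' \<Longrightarrow> rstr M X O' (s j) \<in> carrier (sections M O')"
  "b < v \<Longrightarrow> openin (base M) O' \<Longrightarrow> rstr M X O' (\<zeta> b) \<in> grade (sections M O') (\<sigma> b)"
  "j < u \<Longrightarrow> openin (base M) O' \<Longrightarrow> rstr M X O' (s j) \<in> grade (sections M O') deg_zero"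
  using graded_alg_homD(3,4)[OF presheafD(2)[OF presheaf openin_topspace _ openin_subset]] s_carrier s_grade \<zeta>_grade \<sigma>(1)
  by auto

lemma pre_C_open:
  assumes "i \<in> X" "openin (Euclidean_space u) W"
  shows "openin (base M) (pre (C i) \<psi> W)"
  using assms \<psi>_val_rstr[OF assms(1) C_open[OF assms(1)]] rstr_X_carrier(1) C_open \<psi>_in C_sub
  by (intro sd_chart.chart_pre_open[OF chart V, of i W "\<lambda>j. rstr M X (C i) (s j)"]) blast+

lemma pre_cover: "O' \<subseteq> X \<Longrightarrow> pre O' \<psi> W = (\<Union>i\<in>X. O' \<inter> pre (C i) \<psi> W)"
  using in_C by (auto simp: pre_def)

lemma pre_open:
  assumes "openin (base M) O'" "openin (Euclidean_space u) W"
  shows "openin (base M) (pre O' \<psi> W)"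
  using assms pre_C_open openin_subset[OF assms(1)] by (subst pre_cover) auto

lemma pre_X_cover: "pre X \<psi> W = (\<Union>i\<in>X. pre (C i) \<psi> W)"
  using in_C C_sub by (auto simp: pre_def)

lemma pre_X_V: "pre X \<psi> V = X"
  using \<psi>_in by (auto simp: pre_def)

lemma \<psi>_continuous: "continuous_map (base M) (subtopology (Euclidean_space u) V) (restrict \<psi> X)"
  unfolding continuous_map_def
proof (intro conjI allI impI)
  show "restrict \<psi> X \<in> X \<rightarrow> topspace (subtopology (Euclidean_space u) V)"
    using \<psi>_in openin_subset[OF V] by auto
  fix U assume "openin (subtopology (Euclidean_space u) V) U"
  then have "openin (Euclidean_space u) U" by (simp add: openin_superdomain_iff[OF V])
  then have "openin (base M) (pre X \<psi> U)" by (rule pre_open[OF openin_topspace])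
  moreover have "{x \<in> X. restrict \<psi> X x \<in> U} = pre X \<psi> U" by (auto simp: pre_def)
  ultimately show "openin (base M) {x \<in> X. restrict \<psi> X x \<in> U}" by simp
qed

section \<open>Gluing the pullback families of the charts\<close>

abbreviation "family O' \<equiv> pullback_family n M O' \<psi> u v \<sigma> V (\<lambda>j. rstr M X O' (s j)) (\<lambda>b. rstr M X O' (\<zeta> b))"

lemma family_restrict:
  assumes O': "openin (base M) O'" and O'': "openin (base M) O''" "O'' \<subseteq> O'" and fam: "family O' \<alpha>"
  shows "family O'' (\<lambda>W G. rstr M (pre O' \<psi> W) (pre O'' \<psi> W) (\<alpha> W G))"
proof -
  have sub: "O' \<subseteq> X" using openin_subset[OF O'] .
  have "pullback_family n M O'' \<psi> u v \<sigma> V (\<lambda>j. rstr M O' O'' (rstr M X O' (s j))) (\<lambda>b. rstr M O' O'' (rstr M X O' (\<zeta> b)))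
      (\<lambda>W G. rstr M (pre O' \<psi> W) (pre O'' \<psi> W) (\<alpha> W G))"
    using pre_open[OF O'] pre_open[OF O''(1)] \<psi>_in sub by (intro pullback_family_restrict[OF presheaf fam O''(2)]) auto
  then show ?thesis
    using presheafD(4)[OF presheaf openin_topspace O' O''(1) O''(2) sub] s_carrier \<zeta>_carrier
    by (subst pullback_family_cong) auto
qed

lemma family_unique_chart:
  assumes i: "i \<in> X" and O': "openin (base M) O'" "O' \<subseteq> C i" and a: "family O' a" and b: "family O' b"
    and W: "openin (Euclidean_space u) W" "W \<subseteq> V" and G: "G \<in> series_carrier n u v \<sigma> W"
  shows "a W G = b W G"
  by (rule sd_chart.local_unique[OF chart[OF i] O' V _ _ _ _ _ _ _ a b W G])
    (use \<sigma> rstr_X_carrier(1,2)[OF _ O'(1)] \<psi>_val_rstr[OF i O'(1) _ O'(2)] pre_open[OF O'(1)] \<psi>_in C_sub[OF i] O'(2) in blast)+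

text \<open>Two sections are equal if they agree on the charts, where uniqueness is known.\<close>

lemma family_unique:
  assumes a: "family X a" and b: "family X b"
    and W: "openin (Euclidean_space u) W" "W \<subseteq> V" and G: "G \<in> series_carrier n u v \<sigma> W"
  shows "a W G = b W G"
proof (rule sheaf_eqI[OF sheaf pre_C_open[OF _ W(1)] pre_X_cover pullback_familyD(5)[OF a W G] pullback_familyD(5)[OF b W G]])
  fix i assume i: "i \<in> X"
  show "rstr M (pre X \<psi> W) (pre (C i) \<psi> W) (a W G) = rstr M (pre X \<psi> W) (pre (C i) \<psi> W) (b W G)"
    using family_unique_chart[OF i C_open[OF i] subset_refl family_restrict[OF openin_topspace C_open[OF i] C_sub[OF i] a]
        family_restrict[OF openin_topspace C_open[OF i] C_sub[OF i] b] W G] .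
qed

definition local_pullback :: "'m \<Rightarrow> (nat \<Rightarrow> real) set \<Rightarrow> power_series \<Rightarrow> 'a" where
  "local_pullback i = (SOME \<alpha>. family (C i) \<alpha> \<and>
     (\<forall>W G m. openin (Euclidean_space u) W \<longrightarrow> W \<subseteq> V \<longrightarrow> G \<in> series_carrier n u v \<sigma> W \<longrightarrow> m \<in> pre (C i) \<psi> W \<longrightarrow>
       sd_chart.val M (C i) (\<phi> i) (\<theta> i) m (pre (C i) \<psi> W) (\<alpha> W G) = G 0 (\<psi> m)))"

lemma local_pullback:
  assumes i: "i \<in> X"
  shows "family (C i) (local_pullback i)"
    and "openin (Euclidean_space u) W \<Longrightarrow> W \<subseteq> V \<Longrightarrow> G \<in> series_carrier n u v \<sigma> W \<Longrightarrow> m \<in> pre (C i) \<psi> W \<Longrightarrow>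
       sd_chart.val M (C i) (\<phi> i) (\<theta> i) m (pre (C i) \<psi> W) (local_pullback i W G) = G 0 (\<psi> m)"
proof -
  have "\<exists>\<alpha>. family (C i) \<alpha> \<and>
     (\<forall>W G m. openin (Euclidean_space u) W \<longrightarrow> W \<subseteq> V \<longrightarrow> G \<in> series_carrier n u v \<sigma> W \<longrightarrow> m \<in> pre (C i) \<psi> W \<longrightarrow>
       sd_chart.val M (C i) (\<phi> i) (\<theta> i) m (pre (C i) \<psi> W) (\<alpha> W G) = G 0 (\<psi> m))"
    by (rule sd_chart.local_exist[OF chart[OF i] V])
      (use \<sigma> rstr_X_carrier(2,3)[OF _ C_open[OF i]] \<psi>_val_rstr[OF i C_open[OF i] _ subset_refl] \<psi>_in C_sub[OF i] in blast)+
  from someI_ex[OF this] show "family (C i) (local_pullback i)"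
    and "openin (Euclidean_space u) W \<Longrightarrow> W \<subseteq> V \<Longrightarrow> G \<in> series_carrier n u v \<sigma> W \<Longrightarrow> m \<in> pre (C i) \<psi> W \<Longrightarrow>
       sd_chart.val M (C i) (\<phi> i) (\<theta> i) m (pre (C i) \<psi> W) (local_pullback i W G) = G 0 (\<psi> m)"
    unfolding local_pullback_def by blast+
qed

definition global_pullback :: "(nat \<Rightarrow> real) set \<Rightarrow> power_series \<Rightarrow> 'a" where
  "global_pullback W G = (SOME t. t \<in> carrier (sections M (pre X \<psi> W)) \<and>
     (\<forall>i\<in>X. rstr M (pre X \<psi> W) (pre (C i) \<psi> W) t = local_pullback i W G))"

text \<open>On an overlap both local families restrict to families with the same coordinate
  sections. The overlap lies in a single chart, so they coincide there and can be glued.\<close>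

lemma global_pullback:
  assumes W: "openin (Euclidean_space u) W" "W \<subseteq> V" and G: "G \<in> series_carrier n u v \<sigma> W"
  shows "global_pullback W G \<in> carrier (sections M (pre X \<psi> W))"
    and "i \<in> X \<Longrightarrow> rstr M (pre X \<psi> W) (pre (C i) \<psi> W) (global_pullback W G) = local_pullback i W G"
proof -
  have Int: "pre (C i) \<psi> W \<inter> pre (C j) \<psi> W = pre (C i \<inter> C j) \<psi> W" for i j by (auto simp: pre_def)
  have "\<exists>t\<in>carrier (sections M (pre X \<psi> W)). \<forall>i\<in>X. rstr M (pre X \<psi> W) (pre (C i) \<psi> W) t = local_pullback i W G"
  proof (rule sheaf_glue[OF sheaf pre_C_open[OF _ W(1)] pre_X_cover])
    show "local_pullback i W G \<in> carrier (sections M (pre (C i) \<psi> W))" if "i \<in> X" for i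
      by (rule pullback_familyD(5)[OF local_pullback(1)[OF that] W G])
    fix i j assume ij: "i \<in> X" "j \<in> X"
    have O': "openin (base M) (C i \<inter> C j)" using C_open ij by blast
    show "rstr M (pre (C i) \<psi> W) (pre (C i) \<psi> W \<inter> pre (C j) \<psi> W) (local_pullback i W G) =
        rstr M (pre (C j) \<psi> W) (pre (C i) \<psi> W \<inter> pre (C j) \<psi> W) (local_pullback j W G)"
      unfolding Int
      using family_unique_chart[OF ij(1) O' Int_lower1
          family_restrict[OF C_open[OF ij(1)] O' Int_lower1 local_pullback(1)[OF ij(1)]]
          family_restrict[OF C_open[OF ij(2)] O' Int_lower2 local_pullback(1)[OF ij(2)]] W G] .
  qed
  then have "\<exists>t. t \<in> carrier (sections M (pre X \<psi> W)) \<and>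
     (\<forall>i\<in>X. rstr M (pre X \<psi> W) (pre (C i) \<psi> W) t = local_pullback i W G)" by blast
  from someI_ex[OF this] show "global_pullback W G \<in> carrier (sections M (pre X \<psi> W))"
    and "i \<in> X \<Longrightarrow> rstr M (pre X \<psi> W) (pre (C i) \<psi> W) (global_pullback W G) = local_pullback i W G"
    unfolding global_pullback_def by blast+
qed

text \<open>Each law holds for the local families and restriction is a morphism, so both sides agree
  on every chart; separatedness of the sheaf gives equality, and \<open>sheaf_grade\<close> the
  degrees.\<close>

lemma family_global_pullback: "family X global_pullback"
  unfolding pullback_family_def
proof (intro conjI allI impI ballI)
  fix W assume WV: "openin (Euclidean_space u) W \<and> W \<subseteq> V"
  then have W: "openin (Euclidean_space u) W" "W \<subseteq> V" by auto
  let ?P = "pre X \<psi> W" and ?A = "series_algebra n u v \<sigma> W"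
  have P: "openin (base M) ?P" by (rule pre_open[OF openin_topspace W(1)])
  note eqI = sheaf_eqI[OF sheaf pre_C_open[OF _ W(1)] pre_X_cover]
  have r: "rstr M ?P (pre (C i) \<psi> W) \<in> graded_alg_hom n (sections M ?P) (sections M (pre (C i) \<psi> W))" if "i \<in> X" for i
    by (rule presheafD(2)[OF presheaf P pre_C_open[OF that W(1)] pre_subset(3)[OF C_sub[OF that]]])
  have l: "local_pullback i W \<in> graded_alg_hom n ?A (sections M (pre (C i) \<psi> W))" if "i \<in> X" for i
    by (rule pullback_familyD(1)[OF local_pullback(1)[OF that] W])
  note c = series_carrier_closed[OF W(1)]
  note gc = global_pullback(1)[OF W] and gr = global_pullback(2)[OF W]
  interpret R: ring "sections M ?P" by (rule comm_algebraD(1)[OF alg[OF P]])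
  have "global_pullback W \<in> ring_hom ?A (sections M ?P)"
  proof (rule ring_hom_memI)
    fix F G assume "F \<in> carrier ?A" "G \<in> carrier ?A"
    then have FG: "F \<in> series_carrier n u v \<sigma> W" "G \<in> series_carrier n u v \<sigma> W" by auto
    show "global_pullback W (F \<otimes>\<^bsub>?A\<^esub> G) = global_pullback W F \<otimes>\<^bsub>sections M ?P\<^esub> global_pullback W G"
    proof (rule eqI)
      fix i assume i: "i \<in> X"
      show "rstr M ?P (pre (C i) \<psi> W) (global_pullback W (F \<otimes>\<^bsub>?A\<^esub> G)) =
          rstr M ?P (pre (C i) \<psi> W) (global_pullback W F \<otimes>\<^bsub>sections M ?P\<^esub> global_pullback W G)"
        using graded_alg_homD(6)[OF r[OF i] gc[OF FG(1)] gc[OF FG(2)]] graded_alg_homD(6)[OF l[OF i], of F G] FG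
          gr[OF FG(1) i] gr[OF FG(2) i] gr[OF c(4)[OF FG] i] by simp
    qed (use gc[OF FG(1)] gc[OF FG(2)] gc[OF c(4)[OF FG]] in simp_all)
    show "global_pullback W (F \<oplus>\<^bsub>?A\<^esub> G) = global_pullback W F \<oplus>\<^bsub>sections M ?P\<^esub> global_pullback W G"
    proof (rule eqI)
      fix i assume i: "i \<in> X"
      show "rstr M ?P (pre (C i) \<psi> W) (global_pullback W (F \<oplus>\<^bsub>?A\<^esub> G)) =
          rstr M ?P (pre (C i) \<psi> W) (global_pullback W F \<oplus>\<^bsub>sections M ?P\<^esub> global_pullback W G)"
        using graded_alg_homD(7)[OF r[OF i] gc[OF FG(1)] gc[OF FG(2)]] graded_alg_homD(7)[OF l[OF i], of F G] FG
          gr[OF FG(1) i] gr[OF FG(2) i] gr[OF c(1)[OF FG] i] by simp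
    qed (use gc[OF FG(1)] gc[OF FG(2)] gc[OF c(1)[OF FG]] in simp_all)
  next
    have one: "\<one>\<^bsub>?A\<^esub> \<in> series_carrier n u v \<sigma> W" using c(6)[OF smooth_const[OF W(1)]] by simp
    show "global_pullback W \<one>\<^bsub>?A\<^esub> = \<one>\<^bsub>sections M ?P\<^esub>"
    proof (rule eqI)
      fix i assume i: "i \<in> X"
      show "rstr M ?P (pre (C i) \<psi> W) (global_pullback W \<one>\<^bsub>?A\<^esub>) = rstr M ?P (pre (C i) \<psi> W) \<one>\<^bsub>sections M ?P\<^esub>"
        unfolding gr[OF one i] graded_alg_homD(5)[OF r[OF i]] graded_alg_homD(5)[OF l[OF i]] ..
    qed (use gc[OF one] in simp_all)
  qed (use gc in simp)
  moreover have "global_pullback W (k \<odot>\<^bsub>?A\<^esub> F) = k \<odot>\<^bsub>sections M ?P\<^esub> global_pullback W F" if "F \<in> carrier ?A" for k F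
  proof -
    have F: "F \<in> series_carrier n u v \<sigma> W" "k \<odot>\<^bsub>?A\<^esub> F \<in> series_carrier n u v \<sigma> W" using that c(3) by simp_all
    show ?thesis
    proof (rule eqI)
      fix i assume i: "i \<in> X"
      show "rstr M ?P (pre (C i) \<psi> W) (global_pullback W (k \<odot>\<^bsub>?A\<^esub> F)) =
          rstr M ?P (pre (C i) \<psi> W) (k \<odot>\<^bsub>sections M ?P\<^esub> global_pullback W F)"
        unfolding gr[OF F(2) i] graded_alg_homD(2)[OF r[OF i] gc[OF F(1)]] gr[OF F(1) i] graded_alg_homD(2)[OF l[OF i] that] ..
    qed (use gc[OF F(1)] gc[OF F(2)] comm_algebraD(3)[OF alg[OF P]] in simp_all)
  qed
  moreover have "global_pullback W F \<in> grade (sections M ?P) k" if k: "k \<in> Z2n n" and F: "F \<in> grade ?A k" for k F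
  proof -
    have Fc: "F \<in> series_carrier n u v \<sigma> W" using F by (simp add: series_grade_iff)
    show ?thesis
    proof (rule sheaf_grade[OF sheaf pre_C_open[OF _ W(1)] pre_X_cover gc[OF Fc] k])
      fix i assume i: "i \<in> X"
      show "rstr M ?P (pre (C i) \<psi> W) (global_pullback W F) \<in> grade (sections M (pre (C i) \<psi> W)) k"
        unfolding gr[OF Fc i] by (rule graded_alg_homD(3)[OF l[OF i] k F])
    qed
  qed
  ultimately show "global_pullback W \<in> graded_alg_hom n ?A (sections M ?P)"
    by (auto simp: graded_alg_hom_def)
next
  fix W W' G assume "openin (Euclidean_space u) W \<and> openin (Euclidean_space u) W' \<and> W' \<subseteq> W \<and> W \<subseteq> V"
    and G: "G \<in> series_carrier n u v \<sigma> W"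
  then have W: "openin (Euclidean_space u) W" "W \<subseteq> V" and W': "openin (Euclidean_space u) W'" "W' \<subseteq> V" and sub: "W' \<subseteq> W"
    by auto
  have G': "cut W' G \<in> series_carrier n u v \<sigma> W'" by (rule cut_carrier[OF W(1) W'(1) sub G])
  note P = pre_open[OF openin_topspace W(1)] and P' = pre_open[OF openin_topspace W'(1)]
  have sP: "pre X \<psi> W' \<subseteq> pre X \<psi> W" by (rule pre_subset(2)[OF sub])
  note g = global_pullback(1)[OF W G]
  show "global_pullback W' (cut W' G) = rstr M (pre X \<psi> W) (pre X \<psi> W') (global_pullback W G)"
  proof (rule sheaf_eqI[OF sheaf pre_C_open[OF _ W'(1)] pre_X_cover global_pullback(1)[OF W' G']])
    show "rstr M (pre X \<psi> W) (pre X \<psi> W') (global_pullback W G) \<in> carrier (sections M (pre X \<psi> W'))"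
      by (rule graded_alg_homD(4)[OF presheafD(2)[OF presheaf P P' sP] g])
    fix i assume i: "i \<in> X"
    note Ci = pre_C_open[OF i W(1)] and Ci' = pre_C_open[OF i W'(1)]
    have "rstr M (pre X \<psi> W') (pre (C i) \<psi> W') (global_pullback W' (cut W' G)) = local_pullback i W' (cut W' G)"
      by (rule global_pullback(2)[OF W' G' i])
    also have "\<dots> = rstr M (pre (C i) \<psi> W) (pre (C i) \<psi> W') (local_pullback i W G)"
      by (rule pullback_familyD(2)[OF local_pullback(1)[OF i] W(1) W'(1) sub W(2) G])
    also have "\<dots> = rstr M (pre (C i) \<psi> W) (pre (C i) \<psi> W') (rstr M (pre X \<psi> W) (pre (C i) \<psi> W) (global_pullback W G))"
      by (simp only: global_pullback(2)[OF W G i])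
    also have "\<dots> = rstr M (pre X \<psi> W) (pre (C i) \<psi> W') (global_pullback W G)"
      by (rule presheafD(4)[OF presheaf P Ci Ci' pre_subset(2)[OF sub] pre_subset(3)[OF C_sub[OF i]] g])
    also have "\<dots> = rstr M (pre X \<psi> W') (pre (C i) \<psi> W') (rstr M (pre X \<psi> W) (pre X \<psi> W') (global_pullback W G))"
      by (rule presheafD(4)[OF presheaf P P' Ci' pre_subset(3)[OF C_sub[OF i]] sP g, symmetric])
    finally show "rstr M (pre X \<psi> W') (pre (C i) \<psi> W') (global_pullback W' (cut W' G)) =
        rstr M (pre X \<psi> W') (pre (C i) \<psi> W') (rstr M (pre X \<psi> W) (pre X \<psi> W') (global_pullback W G))" .
  qed
next
  have preV: "pre (C i) \<psi> V = C i" if "i \<in> X" for i using \<psi>_in C_sub[OF that] by (auto simp: pre_def)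
  have eq: "global_pullback V F = rstr M X X t"
    if F: "F \<in> series_carrier n u v \<sigma> V" and t: "t \<in> carrier (sections M X)"
      and loc: "\<And>i. i \<in> X \<Longrightarrow> local_pullback i V F = rstr M X (C i) t" for F t
  proof -
    have "global_pullback V F = t"
    proof (rule sheaf_eqI[OF sheaf pre_C_open[OF _ V] pre_X_cover global_pullback(1)[OF V subset_refl F]])
      show "t \<in> carrier (sections M (pre X \<psi> V))" using t by (simp add: pre_X_V)
      show "rstr M (pre X \<psi> V) (pre (C i) \<psi> V) (global_pullback V F) = rstr M (pre X \<psi> V) (pre (C i) \<psi> V) t" if "i \<in> X" for i
        unfolding global_pullback(2)[OF V subset_refl F that] using loc[OF that] by (simp add: preV[OF that] pre_X_V)
    qed
    then show ?thesis using presheafD(3)[OF presheaf openin_topspace t] by simp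
  qed
  show "global_pullback V (coord_fun V j) = rstr M X X (s j)" if "j < u" for j
    by (rule eq[OF coord_fun_carrier[OF V] s_carrier[OF that] pullback_familyD(3)[OF local_pullback(1) that]])
  show "global_pullback V (formal_var V b) = rstr M X X (\<zeta> b)" if b: "b < v" for b
    by (rule eq[OF formal_var_carrier[OF V b] \<zeta>_carrier[OF b] pullback_familyD(4)[OF local_pullback(1) b]])
qed

lemma val_global_pullback:
  assumes W: "openin (Euclidean_space u) W" "W \<subseteq> V" and G: "G \<in> series_carrier n u v \<sigma> W" and m: "m \<in> pre X \<psi> W"
  shows "val m (pre X \<psi> W) (global_pullback W G) = G 0 (\<psi> m)"
proof -
  have mX: "m \<in> X" and mC: "m \<in> pre (C m) \<psi> W" using m in_C by (auto simp: pre_def)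
  then have "m \<in> pre (C m) \<psi> W \<inter> C m" by (simp add: pre_def)
  from sd_chart.val_rstr[OF chart[OF mX] pre_open[OF openin_topspace W(1)] pre_C_open[OF mX W(1)]
      pre_subset(3)[OF C_sub[OF mX]] this global_pullback(1)[OF W G]]
  show ?thesis using global_pullback(2)[OF W G mX] local_pullback(2)[OF mX W G mC] by simp
qed

section \<open>The glued morphism and its uniqueness\<close>

definition \<Psi> :: "('m, 'a, nat \<Rightarrow> real, power_series) space_map" where
  "\<Psi> = (restrict \<psi> X, \<lambda>W\<in>{W. openin (base D) W}. \<lambda>G\<in>series_carrier n u v \<sigma> W. global_pullback W G)"

lemma open_D: "openin (base D) W \<longleftrightarrow> openin (Euclidean_space u) W \<and> W \<subseteq> V"
  by (simp add: openin_superdomain_iff[OF V])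

lemma preimage_\<psi>: "preimage M (restrict \<psi> X) W = pre X \<psi> W"
  by (auto simp: preimage_def pre_def)

lemma snd_\<Psi>: "openin (base D) W \<Longrightarrow> G \<in> series_carrier n u v \<sigma> W \<Longrightarrow> snd \<Psi> W G = global_pullback W G"
  by (simp add: \<Psi>_def)

lemma fst_\<Psi>: "fst \<Psi> = restrict \<psi> X"
  by (simp add: \<Psi>_def)

lemma \<Psi>_rstr:
  assumes W: "openin (base D) W" and W': "openin (base D) W'" and sub: "W' \<subseteq> W" and G: "G \<in> carrier (sections D W)"
  shows "snd \<Psi> W' (rstr D W W' G) = rstr M (preimage M (fst \<Psi>) W) (preimage M (fst \<Psi>) W') (snd \<Psi> W G)"
proof -
  have Wo: "openin (Euclidean_space u) W" "W \<subseteq> V" and Wo': "openin (Euclidean_space u) W'" "W' \<subseteq> V"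
    using W W' unfolding open_D by blast+
  have Gc: "G \<in> series_carrier n u v \<sigma> W" using G by simp
  show ?thesis
    using pullback_familyD(2)[OF family_global_pullback Wo(1) Wo'(1) sub Wo(2) Gc]
      snd_\<Psi>[OF W Gc] snd_\<Psi>[OF W' cut_carrier[OF Wo(1) Wo'(1) sub Gc]] by (simp add: fst_\<Psi> preimage_\<psi>)
qed

text \<open>On stalks, the pullback of a germ has the value at \<open>m\<close> that the germ has at
  \<open>\<psi> m\<close>, so the maximal ideal is respected once both ideals are known to consist
  of germs of value 0.\<close>

lemma morphism_\<Psi>: "z2n_morphism n M D \<Psi>"
  unfolding z2n_morphism_def
proof (intro conjI allI impI ballI)
  show "fst \<Psi> \<in> extensional X" "snd \<Psi> \<in> extensional {V'. openin (base D) V'}" by (simp_all add: \<Psi>_def)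
  show "snd \<Psi> W \<in> extensional (carrier (sections D W))" if "openin (base D) W" for W
    using that by (simp add: \<Psi>_def)
  show "continuous_map (base M) (base D) (fst \<Psi>)" using \<psi>_continuous by (simp add: fst_\<Psi>)
next
  fix W assume W: "openin (base D) W"
  then have Wo: "openin (Euclidean_space u) W" "W \<subseteq> V" by (simp_all only: open_D)
  note g = graded_alg_homD[OF pullback_familyD(1)[OF family_global_pullback Wo]]
  note c = series_carrier_closed[OF Wo(1)] and S = snd_\<Psi>[OF W]
  have "snd \<Psi> W \<in> ring_hom (series_algebra n u v \<sigma> W) (sections M (pre X \<psi> W))"
    by (rule ring_hom_memI) (use g(4-7) c smooth_const[OF Wo(1)] in \<open>simp_all add: S\<close>)
  then show "snd \<Psi> W \<in> graded_alg_hom n (sections D W) (sections M (preimage M (fst \<Psi>) W))"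
    using g(2,3) c by (auto simp: graded_alg_hom_def fst_\<Psi> preimage_\<psi> S series_grade_iff)
next
  fix W W' G assume "openin (base D) W \<and> openin (base D) W' \<and> W' \<subseteq> W" and "G \<in> carrier (sections D W)"
  then show "snd \<Psi> W' (rstr D W W' G) = rstr M (preimage M (fst \<Psi>) W) (preimage M (fst \<Psi>) W') (snd \<Psi> W G)"
    using \<Psi>_rstr by blast
next
  fix m assume m: "m \<in> X"
  have y: "fst \<Psi> m = \<psi> m" using m by (simp add: fst_\<Psi>)
  interpret M: valued_point n M m "val m" by (rule sd_chart.valued_point[OF chart[OF m] in_C[OF m]])
  interpret D: valued_point n D "\<psi> m" "\<lambda>U F. F 0 (\<psi> m)"
    by (rule superdomain_valued_point[OF V \<psi>_in[OF m] \<sigma>(1)])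
  show "stalk_map M D \<Psi> m ` the_max_ideal n (stalk D (fst \<Psi> m)) \<subseteq> the_max_ideal n (stalk M m)"
    unfolding y M.the_max_ideal_eq D.the_max_ideal_eq
  proof clarify
    fix x assume "x \<in> D.max_ideal"
    then obtain W F where W: "D.nbhd W" and F: "F \<in> carrier (sections D W)" "F 0 (\<psi> m) = 0" and x: "x = germ D (\<psi> m) W F"
      unfolding D.max_ideal_def by blast
    have Wo: "openin (base D) W" "\<psi> m \<in> W" using W unfolding D.nbhd_def by blast+
    then have Wu: "openin (Euclidean_space u) W" "W \<subseteq> V" unfolding open_D by blast+
    have Fc: "F \<in> series_carrier n u v \<sigma> W" using F(1) by simp
    have mW: "m \<in> pre X \<psi> W" using m Wo(2) by (simp add: pre_def)
    have "stalk_map M D \<Psi> m (germ D (fst \<Psi> m) W F) = germ M m (preimage M (fst \<Psi>) W) (snd \<Psi> W F)"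
    proof (rule stalk_map_germ)
      show "presheaf_point M m" by (rule presheaf_point_presheaf[OF presheaf m])
      show "presheaf_point D (fst \<Psi> m)" unfolding y using D.presheaf_point_axioms .
      show "openin (base M) (preimage M (fst \<Psi>) W)" if "openin (base D) W" for W
        using that pre_open[OF openin_topspace] unfolding open_D fst_\<Psi> preimage_\<psi> by blast
      show "snd \<Psi> W G \<in> carrier (sections M (preimage M (fst \<Psi>) W))"
        if "openin (base D) W" "G \<in> carrier (sections D W)" for W G
      proof -
        have "openin (Euclidean_space u) W" "W \<subseteq> V" "G \<in> series_carrier n u v \<sigma> W"
          using that unfolding open_D by simp_all
        then show ?thesis unfolding fst_\<Psi> preimage_\<psi> using snd_\<Psi>[OF that(1)] global_pullback(1) by simp
      qed
    qed (use Wo F y \<Psi>_rstr in simp_all)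
    then have eq: "stalk_map M D \<Psi> m x = germ M m (pre X \<psi> W) (global_pullback W F)"
      unfolding x y[symmetric] unfolding fst_\<Psi> preimage_\<psi> snd_\<Psi>[OF Wo(1) Fc] .
    have nb: "M.nbhd (pre X \<psi> W)" unfolding M.nbhd_def using pre_open[OF openin_topspace Wu(1)] mW by blast
    show "stalk_map M D \<Psi> m x \<in> M.max_ideal"
      unfolding eq M.germ_in_max_ideal_iff[OF nb global_pullback(1)[OF Wu Fc]] val_global_pullback[OF Wu Fc mW] by (rule F(2))
  qed
qed

lemma \<Psi>_coordinates:
  "j < u \<Longrightarrow> s j = snd \<Psi> V (coord_fun V j)" "b < v \<Longrightarrow> \<zeta> b = snd \<Psi> V (formal_var V b)"
proof -
  have VD: "openin (base D) V" using V unfolding open_D by blast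
  note id = presheafD(3)[OF presheaf openin_topspace]
  show "s j = snd \<Psi> V (coord_fun V j)" if "j < u"
    using snd_\<Psi>[OF VD coord_fun_carrier[OF V]] pullback_familyD(3)[OF family_global_pullback that] id[OF s_carrier[OF that]] by simp
  show "\<zeta> b = snd \<Psi> V (formal_var V b)" if b: "b < v"
    using snd_\<Psi>[OF VD formal_var_carrier[OF V b]] pullback_familyD(4)[OF family_global_pullback b] id[OF \<zeta>_carrier[OF b]] by simp
qed

text \<open>
  Locality on stalks forces the underlying map: \<open>y\<^sup>j - y\<^sup>j(\<psi> m)\<close> lies in the maximal ideal at \<open>\<psi> m\<close>,
  so its pullback \<open>s\<^sup>j - y\<^sup>j(\<psi> m)\<close> has value 0 at \<open>m\<close>.
\<close>

lemma base_map_unique: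
  assumes \<Phi>: "z2n_morphism n M D \<Phi>" and coord: "\<And>j. j < u \<Longrightarrow> s j = snd \<Phi> V (coord_fun V j)" and m: "m \<in> X"
  shows "fst \<Phi> m = \<psi> m"
proof
  fix j
  let ?y = "fst \<Phi> m"
  have yV: "?y \<in> V" using z2n_morphismD(1)[OF \<Phi>] m unfolding continuous_map_def by auto
  show "?y j = \<psi> m j"
  proof (cases "j < u")
    case False
    then show ?thesis using yV openin_subset[OF V] by (auto simp: \<psi>_def topspace_Euclidean_space)
  next
    case True
    have VD: "openin (base D) V" using V unfolding open_D by blast
    have preV: "preimage M (fst \<Phi>) V = X"
      using z2n_morphismD(1)[OF \<Phi>] unfolding continuous_map_def preimage_def by auto
    interpret M: valued_point n M m "val m" by (rule sd_chart.valued_point[OF chart[OF m] in_C[OF m]])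
    interpret D: valued_point n D ?y "\<lambda>U F. F 0 ?y"
      by (rule superdomain_valued_point[OF V yV \<sigma>(1)])
    note c = series_carrier_closed[OF V]
    \<comment> \<open>The unit series: writing the constant as a scalar multiple of it lets
      linearity carry the constant through the morphism.\<close>
    define e where "e = series_term V (\<lambda>_. 1) 0"
    define F where "F = coord_fun V j - (\<lambda>\<mu> x. ?y j * e \<mu> x)"
    have e: "e \<in> series_carrier n u v \<sigma> V" unfolding e_def by (intro c smooth_const V)
    have F: "F \<in> series_carrier n u v \<sigma> V" unfolding F_def by (intro c e coord_fun_carrier V)
    have sum: "coord_fun V j = F + (\<lambda>\<mu> x. ?y j * e \<mu> x)" by (simp add: F_def)
    note h = graded_alg_homD[OF z2n_morphismD(2)[OF \<Phi> VD]]
    have hF: "snd \<Phi> V F \<in> carrier (sections M X)" using h(4)[of F] F preV by simp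
    have one: "snd \<Phi> V e = \<one>\<^bsub>sections M X\<^esub>" using h(5) by (simp add: e_def preV)
    have nb: "M.nbhd X" using m by (simp add: M.nbhd_def)
    interpret R: ring "sections M X" by (rule comm_algebraD(1)[OF alg[OF openin_topspace]])
    have "D.nbhd V" using VD yV unfolding D.nbhd_def by blast
    moreover have "F 0 ?y = 0" using yV by (simp add: F_def e_def coord_fun_def series_term_def zero_fun_def)
    ultimately have "germ D ?y V F \<in> the_max_ideal n (stalk D ?y)"
      unfolding D.the_max_ideal_eq using D.germ_in_max_ideal_iff[of V F] F by simp
    then have "stalk_map M D \<Phi> m (germ D ?y V F) \<in> the_max_ideal n (stalk M m)"
      using z2n_morphismD(4)[OF \<Phi> m] by blast
    moreover have "stalk_map M D \<Phi> m (germ D ?y V F) = germ M m (preimage M (fst \<Phi>) V) (snd \<Phi> V F)"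
    proof (rule stalk_map_germ[OF presheaf_point_presheaf[OF presheaf m] D.presheaf_point_axioms])
      show "openin (base M) (preimage M (fst \<Phi>) W)" if "openin (base D) W" for W
        using z2n_morphismD(1)[OF \<Phi>] that unfolding continuous_map_def preimage_def by blast
      show "snd \<Phi> W G \<in> carrier (sections M (preimage M (fst \<Phi>) W))" if "openin (base D) W" "G \<in> carrier (sections D W)" for W G
        by (rule graded_alg_homD(4)[OF z2n_morphismD(2)[OF \<Phi> that(1)] that(2)])
    qed (use z2n_morphismD(3)[OF \<Phi>] VD yV F in simp_all)
    ultimately have "val m X (snd \<Phi> V F) = 0"
      unfolding M.the_max_ideal_eq preV using M.germ_in_max_ideal_iff[OF nb hF] by simp
    moreover have "s j = snd \<Phi> V F \<oplus>\<^bsub>sections M X\<^esub> ?y j \<odot>\<^bsub>sections M X\<^esub> \<one>\<^bsub>sections M X\<^esub>"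
      unfolding coord[OF True] sum one[symmetric]
      using h(7)[of F "\<lambda>\<mu> x. ?y j * e \<mu> x"] h(2)[of e "?y j"] F e c(3)[OF e] by (simp add: preV)
    moreover have "val m X (?y j \<odot>\<^bsub>sections M X\<^esub> \<one>\<^bsub>sections M X\<^esub>) = ?y j"
      using sd_chart.val_smult[OF chart[OF m] openin_topspace _ R.one_closed, of m] m in_C[OF m] M.val_one[OF nb] by simp
    moreover have "?y j \<odot>\<^bsub>sections M X\<^esub> \<one>\<^bsub>sections M X\<^esub> \<in> carrier (sections M X)"
      by (rule comm_algebraD(3)[OF alg[OF openin_topspace] R.one_closed])
    ultimately have "val m X (s j) = ?y j" using M.val_add[OF nb hF] by simp
    then show ?thesis using \<psi>_val[OF m in_C[OF m] True] by simp
  qed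
qed

text \<open>Once the base maps agree, the pullbacks of \<Phi> form a family over the same \<psi>
  with the same coordinate sections, and \<open>family_unique\<close> applies.\<close>

lemma morphism_unique:
  assumes \<Phi>: "z2n_morphism n M D \<Phi>" and coord: "\<And>j. j < u \<Longrightarrow> s j = snd \<Phi> V (coord_fun V j)"
    and var: "\<And>b. b < v \<Longrightarrow> \<zeta> b = snd \<Phi> V (formal_var V b)"
  shows "\<Phi> = \<Psi>"
proof (rule prod_eqI)
  show fst_eq: "fst \<Phi> = fst \<Psi>"
  proof
    fix m show "fst \<Phi> m = fst \<Psi> m"
      using base_map_unique[OF \<Phi> coord, of m] z2n_morphismD(5)[OF \<Phi>]
      by (cases "m \<in> X") (auto simp: fst_\<Psi> extensional_def)
  qed
  have pre: "preimage M (fst \<Phi>) W = pre X \<psi> W" for W unfolding fst_eq fst_\<Psi> by (rule preimage_\<psi>)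
  have "family X (snd \<Phi>)"
    unfolding pullback_family_def
  proof (intro conjI allI impI ballI)
    fix W assume "openin (Euclidean_space u) W \<and> W \<subseteq> V"
    then have "openin (base D) W" unfolding open_D .
    from z2n_morphismD(2)[OF \<Phi> this]
    show "snd \<Phi> W \<in> graded_alg_hom n (series_algebra n u v \<sigma> W) (sections M (pre X \<psi> W))" by (simp add: pre)
  next
    fix W W' G assume W: "openin (Euclidean_space u) W \<and> openin (Euclidean_space u) W' \<and> W' \<subseteq> W \<and> W \<subseteq> V"
      and G: "G \<in> series_carrier n u v \<sigma> W"
    have "openin (base D) W" "openin (base D) W'" "W' \<subseteq> W" using W unfolding open_D by blast+
    from z2n_morphismD(3)[OF \<Phi> this, of G] G
    show "snd \<Phi> W' (cut W' G) = rstr M (pre X \<psi> W) (pre X \<psi> W') (snd \<Phi> W G)" by (simp add: pre)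
  next
    note id = presheafD(3)[OF presheaf openin_topspace]
    show "snd \<Phi> V (coord_fun V j) = rstr M X X (s j)" if "j < u" for j
      using coord[OF that] id[OF s_carrier[OF that]] by simp
    show "snd \<Phi> V (formal_var V b) = rstr M X X (\<zeta> b)" if b: "b < v" for b
      using var[OF b] id[OF \<zeta>_carrier[OF b]] by simp
  qed
  note eq = family_unique[OF this family_global_pullback]
  show "snd \<Phi> = snd \<Psi>"
  proof (intro ext)
    fix W G
    show "snd \<Phi> W G = snd \<Psi> W G"
    \<comment> \<open>Off the open sets, and off the carriers below, both sides take the default
      value of extensional functions.\<close>
    proof (cases "openin (base D) W")
      case False
      then show ?thesis using z2n_morphismD(6)[OF \<Phi>] z2n_morphismD(6)[OF morphism_\<Psi>] by (metis (no_types, lifting) extensional_arb mem_Collect_eq)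
    next
      case True
      then have Wo: "openin (Euclidean_space u) W" "W \<subseteq> V" unfolding open_D by blast+
      show ?thesis
      proof (cases "G \<in> series_carrier n u v \<sigma> W")
        case G: True
        show ?thesis using eq[OF Wo G] snd_\<Psi>[OF True G] by simp
      next
        case False
        then show ?thesis using z2n_morphismD(7)[OF \<Phi> True] z2n_morphismD(7)[OF morphism_\<Psi> True]
          by (simp add: extensional_def)
      qed
    qed
  qed
qed

end

theorem theorem6p8:
  fixes n p u :: nat
    and q vs :: "nat list"
    and M :: "('m, 'a) ringed_space"
    and V :: "(nat \<Rightarrow> real) set"
    and \<tau> :: "nat \<Rightarrow> degree"
    and s \<zeta> :: "nat \<Rightarrow> 'a"
  assumes "z2n_supermanifold n p q M"
    and "superdomain_data n u vs V \<tau>"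
    and "\<forall>j<u. s j \<in> grade (sections M (topspace (base M))) deg_zero"
    and "\<forall>b<sum_list vs. \<zeta> b \<in> grade (sections M (topspace (base M))) (\<tau> b)"
    and "\<forall>m\<in>topspace (base M).
           (\<lambda>j. if j < u then base_proj M (topspace (base M)) (s j) m else 0) \<in> V"
  shows "\<exists>!\<Psi>. z2n_morphism n M (superdomain n u (sum_list vs) \<tau> V) \<Psi> \<and>
           (\<forall>j<u. s j = snd \<Psi> V (coord_fun V j)) \<and>
           (\<forall>b<sum_list vs. \<zeta> b = snd \<Psi> V (formal_var V b))"
proof -
  have S: "z2n_sheaf n M" using assms(1) by (simp add: z2n_supermanifold_def locally_z2n_ringed_space_def)
  have "\<exists>T W \<phi> \<theta> \<kappa>. sd_chart n p (sum_list q) T M W \<phi> \<theta> \<kappa> \<and> m \<in> W" if "m \<in> topspace (base M)" for m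
  proof -
    from assms(1) that have "\<exists>W U T. openin (base M) W \<and> m \<in> W \<and> superdomain_data n p q U T \<and>
        z2n_isomorphic n (open_subspace M W) (superdomain n p (sum_list q) T U)"
      unfolding z2n_supermanifold_def by (elim conjE bspec)
    then obtain W U T where W: "openin (base M) W" "m \<in> W" and U: "superdomain_data n p q U T"
      and iso: "z2n_isomorphic n (open_subspace M W) (superdomain n p (sum_list q) T U)"
      by (elim exE conjE)
    have "\<exists>\<phi> \<theta> \<kappa>. sd_chart n p (sum_list q) T M W \<phi> \<theta> \<kappa>"
      using U by (intro chart_of_isomorphic[OF sheaf_presheaf[OF S] W(1) _ _ iso]) (auto simp: superdomain_data_def)
    then show ?thesis using W(2) by blast
  qed
  \<comment> \<open>A choice of one chart for every point at once, as \<open>coordinate_data\<close>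
    requires.\<close>
  then obtain T C \<phi> \<theta> \<kappa> where charts: "\<And>m. m \<in> topspace (base M) \<Longrightarrow>
      sd_chart n p (sum_list q) (T m) M (C m) (\<phi> m) (\<theta> m) (\<kappa> m) \<and> m \<in> C m"
    by metis
  interpret coordinate_data n p "sum_list q" u "sum_list vs" M V \<tau> s \<zeta> T C \<phi> \<theta> \<kappa>
    by (rule coordinate_data.intro[OF S]) (use charts assms(2-5) in \<open>auto simp: superdomain_data_def\<close>)
  show ?thesis
  proof (rule ex1I[of _ \<Psi>])
    show "z2n_morphism n M D \<Psi> \<and> (\<forall>j<u. s j = snd \<Psi> V (coord_fun V j)) \<and>
        (\<forall>b<sum_list vs. \<zeta> b = snd \<Psi> V (formal_var V b))"
      by (intro conjI allI impI morphism_\<Psi> \<Psi>_coordinates)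
    fix \<Phi> assume \<Phi>: "z2n_morphism n M D \<Phi> \<and> (\<forall>j<u. s j = snd \<Phi> V (coord_fun V j)) \<and>
        (\<forall>b<sum_list vs. \<zeta> b = snd \<Phi> V (formal_var V b))"
    show "\<Phi> = \<Psi>"
      by (rule morphism_unique[OF conjunct1[OF \<Phi>]]) (use conjunct2[OF \<Phi>] in blast)+
  qed
qed

end
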